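(* For any plabic graph there is a unique geometric signature up to gauge equivalence. More precisely, let $(\mathcal N,\mathcal O,\mathfrak l)$ and $(\hat{\mathcal N},\hat{\mathcal O},\hat{\mathfrak l})$ be plabic networks representing the same point of $Gr^{\mathrm{TNN}}(k,n)$, where $\hat{\mathcal N}$ is obtained from $\mathcal N$ by a composition of changes of the perfect orientation, of the gauge ray direction and of the positions of the internal vertices (respecting the topology of the graph), and let $\epsilon,\hat\epsilon$ be their geometric signatures. Then $\epsilon$ and $\hat\epsilon$ are gauge equivalent: there is $\eta$ on the internal vertices with values in $\{0,1\}$ such that $\hat\epsilon_{U,V}\equiv\epsilon_{U,V}+\eta(U)+\eta(V)\pmod 2$ for internal edges and $\hat\epsilon_{U,V}\equiv\epsilon_{U,V}+\eta(U)\pmod 2$ for edges joining an internal vertex $U$ to a boundary vertex $V$. The gauge function is obtained by composing the following elementary cases: (1) If $\hat{\mathcal O}$ is obtained from $\mathcal O$ by reversing the orientation along a non-self-intersecting directed path $\mathcal P$ from a boundary source $b_{i_0}$ to a boundary sink $b_{j_0}$, or along a simple directed cycle $\mathcal Q$, and $\hat{\mathfrak l}=\mathfrak l$, then $\eta(U)=0$ if $U\notin\mathcal P$ (resp. $\mathcal Q$) lies in a $+$ region; $\eta(U)=1$ if $U\notin\mathcal P$ (resp. $\mathcal Q$) lies in a $-$ region; $\eta(U)=\mathrm{wind}(e_1,e_2)+\gamma_1(e_1)+\gamma_2(e_2)+1$ if $U$ is a white vertex on the path (cycle); $\eta(U)=\mathrm{wind}(e_1,e_2)+\gamma_1(e_1)+\gamma_2(e_1)$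 if $U$ is a black vertex on the path (cycle); here $e_1,e_2$ are the two edges at $U$ changing orientation, $e_1$ incoming at $U$ in the initial orientation. (2) If only the gauge ray direction changes from $\mathfrak l$ to $\hat{\mathfrak l}$, then $\eta(U)=\mathrm{cr}(U)+\mathrm{par}(e_m)$ if $U$ is white, $e_m$ its unique incoming edge, and $\eta(U)=\mathrm{cr}(U)+\mathrm{par}(e_1)$ if $U$ is black, $e_1$ its unique outgoing edge. (3) If only one internal vertex $U$ is moved (all others fixed), then: $\eta(V)=0$ for internal vertices $V$ not joined to $U$ by an edge; $\eta(U)$ is given by the formula of case (2); for an edge $e_i$ directed from $U$ to $V_i$ ($i=1$ if $U$ is black, $i\in[m-1]$ if $U$ is white of valency $m$), $\eta(V_i)=\mathrm{par}(e_i)$ if $V_i$ is white and $0$ if $V_i$ is black; for an edge $e_j$ directed from $W_j$ to $U$ ($j\in[2,m]$ if $U$ is black, $j=m$ if $U$ is white), $\eta(W_j)=\mathrm{par}(e_j)$ if $W_j$ is black and $0$ if $W_j$ is white.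
   Context: A plabic graph is a finite planar directed graph in a closed disc, no component disjoint from the boundary, with $n$ degree-one boundary vertices $b_1,\dots,b_n$ labelled clockwise on a common arc of the boundary circle, internal vertices of degree $2$ or $3$ in the open disc, edges straight segments, and a perfect orientation: each internal vertex has exactly one incoming edge (white) or exactly one outgoing edge (black), bivalent vertices being assigned a colour. Sources/sinks are boundary vertices with outgoing/incoming edge; $I$ = set of source indices. A plabic network carries positive edge weights (when an edge is reversed its weight is replaced by its reciprocal, so the represented point is unchanged). Gauge ray direction: a direction $\mathfrak l$ such that rays from boundary vertices in direction $\mathfrak l$ enter the disc, no edge is parallel to $\mathfrak l$, and no such ray passes through an internal vertex. $s(f,g)=1,0,-1$ according as $\det(f,g)>0,=0,<0$. For oriented edges $(e,f)$: $\mathrm{wind}(e,f)=1$ if $s(e,f)=s(e,\mathfrak l)=s(\mathfrak l,f)=1$, $-1$ if all are $-1$, else $0$. For $i\in I$, $\mathfrak l_i$ is the ray from $b_i$ in direction $\mathfrak l$ (the gauge rays); $\mathrm{int}(e)$ = number of intersections of $e$ with the $\mathfrak l_i$, $i\in I$, times $s(\mathfrak l,e)$. Geometric signature of $(\mathcal G,\mathcal O,\mathfrak l)$ (mod 2): for $e$ from internal $V$ to a sink: $\mathrm{int}(e)$ if $V$ black, $1+\mathrm{int}(e)+\mathrm{wind}(e_1,e)$ if $V$ white with incoming $e_1$; for $e$ from a source to internal $V$: $1+\mathrm{int}(e)+\mathrm{wind}(e,e')$ if $V$ black with outgoing $e'$, $1+\mathrm{int}(e)$ if $V$ white; for internal $e=(U,V)$: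 $\mathrm{int}(e)$ ($U$ black, $V$ white); $1+\mathrm{int}(e)+\mathrm{wind}(e_1,e)$ ($U,V$ white, $e_1$ incoming at $U$); $1+\mathrm{int}(e)+\mathrm{wind}(e_1,e)+\mathrm{wind}(e,e_5)$ ($U$ white, $V$ black, $e_1$ incoming at $U$, $e_5$ outgoing at $V$); $\mathrm{int}(e)+\mathrm{wind}(e,e_5)$ ($U,V$ black, $e_5$ outgoing at $V$). A geometric signature is any signature gauge equivalent to this one. Region marking for case (1): for a path $\mathcal P$ from $b_{i_0}$ to $b_{j_0}$, the interior of the disc is divided into finitely many regions by the gauge ray from $b_{i_0}$ (oriented into the disc), the ray from $b_{j_0}$ in direction $\mathfrak l$ (oriented towards $b_{j_0}$), the path $\mathcal P$ in its initial orientation, and the two boundary arcs, each oriented from $b_{j_0}$ to $b_{i_0}$; a region is marked $+$ if its boundary is coherently oriented and $-$ otherwise. For a cycle $\mathcal Q$, the exterior region is marked $+$ and the interior $-$. For an edge $e$ on $\mathcal P$ (resp. $\mathcal Q$), with its initial orientation: $\gamma_1(e)=0$ or $1$ according as the region to the left of $e$ near its ending point is marked $+$ or $-$; $\gamma_2(e)=(1-s(e,\mathfrak l))/2$. Indices for cases (2),(3): $\mathrm{par}(e)=1$ if, during the deformation (rotation of the gauge direction from $\mathfrak l$ to $\hat{\mathfrak l}$ in case (2), i.e. the direction of $e$ lies in the angle swept from $\mathfrak l$ to $\hat{\mathfrak l}$; motion of $U$ in case (3)), the direction of $e$ becomes parallel to the gauge direction an odd number of times, and $0$ otherwise; $\mathrm{cr}(U)$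 is the number of gauge rays passing through the vertex $U$ during the deformation.
   Formalization: In case (3) the motion of U is assumed to be in general position: whenever an edge at U becomes parallel to the gauge direction, or U meets a gauge ray, it passes through and does not merely touch; with touchings counted in par or cr the stated formula fails. *)

theory Defs
  imports "HOL-Analysis.Analysis" "HOL-Number_Theory.Cong"
begin

datatype 'v vertex = Boundary nat | Internal 'v

text \<open>
  The plane is \<^typ>\<open>complex\<close>. The arcs carry the perfect orientation. Edges are straight segments, so
  there are no multiple edges and an arc is determined by its two ends. Internal vertices outside
  \<^term>\<open>white\<close> are black.
\<close>

record 'v network =
  center :: complex
  radius :: real
  bdcount :: nat
  internals :: "'v set"
  white :: "'v set"
  arcs :: "('v vertex \<times> 'v vertex) set"
  pos :: "'v vertex \<Rightarrow> complex"
  weight :: "'v vertex \<times> 'v vertex \<Rightarrow> real"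

definition vertices :: "'v network \<Rightarrow> 'v vertex set" where
  "vertices N = Boundary ` {1..bdcount N} \<union> Internal ` internals N"

definition disc :: "'v network \<Rightarrow> complex set" where
  "disc N = ball (center N) (radius N)"

abbreviation bpos :: "'v network \<Rightarrow> nat \<Rightarrow> complex" where
  "bpos N j \<equiv> pos N (Boundary j)"

abbreviation ipos :: "'v network \<Rightarrow> 'v \<Rightarrow> complex" where
  "ipos N v \<equiv> pos N (Internal v)"

definition ends :: "'v vertex \<times> 'v vertex \<Rightarrow> 'v vertex set" where
  "ends e = {fst e, snd e}"

definition edges :: "'v network \<Rightarrow> 'v vertex set set" where
  "edges N = ends ` arcs N"

definition in_arcs :: "'v network \<Rightarrow> 'v vertex \<Rightarrow> ('v vertex \<times> 'v vertex) set" where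
  "in_arcs N v = {e \<in> arcs N. snd e = v}"

definition out_arcs :: "'v network \<Rightarrow> 'v vertex \<Rightarrow> ('v vertex \<times> 'v vertex) set" where
  "out_arcs N v = {e \<in> arcs N. fst e = v}"

definition valency :: "'v network \<Rightarrow> 'v vertex \<Rightarrow> nat" where
  "valency N v = card (in_arcs N v) + card (out_arcs N v)"

definition sources :: "'v network \<Rightarrow> nat set" where
  "sources N = {j \<in> {1..bdcount N}. out_arcs N (Boundary j) \<noteq> {}}"

definition sinks :: "'v network \<Rightarrow> nat set" where
  "sinks N = {j \<in> {1..bdcount N}. in_arcs N (Boundary j) \<noteq> {}}"

definition edge_vec :: "'v network \<Rightarrow> 'v vertex \<times> 'v vertex \<Rightarrow> complex" where
  "edge_vec N e = pos N (snd e) - pos N (fst e)"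

definition edge_seg :: "'v network \<Rightarrow> 'v vertex \<times> 'v vertex \<Rightarrow> complex set" where
  "edge_seg N e = closed_segment (pos N (fst e)) (pos N (snd e))"

definition clockwise_boundary :: "'v network \<Rightarrow> bool" where
  "clockwise_boundary N \<longleftrightarrow>
     (\<exists>\<theta> :: nat \<Rightarrow> real.
        (\<forall>j\<in>{1..bdcount N}. bpos N j = center N + of_real (radius N) * cis (\<theta> j)) \<and>
        (\<forall>i\<in>{1..bdcount N}. \<forall>j\<in>{1..bdcount N}. i < j \<longrightarrow> \<theta> j < \<theta> i \<and> \<theta> i < \<theta> j + 2 * pi))"

definition plane_drawing :: "'v network \<Rightarrow> bool" where
  "plane_drawing N \<longleftrightarrow>
     radius N > 0 \<and> clockwise_boundary N \<and>
     (\<forall>v\<in>internals N. ipos N v \<in> disc N) \<and>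
     inj_on (pos N) (vertices N) \<and>
     (\<forall>e\<in>arcs N. \<forall>f\<in>arcs N. e \<noteq> f \<longrightarrow>
        edge_seg N e \<inter> edge_seg N f \<subseteq> pos N ` (ends e \<inter> ends f))"

definition perfect_orientation :: "'v network \<Rightarrow> bool" where
  "perfect_orientation N \<longleftrightarrow>
     (\<forall>v\<in>internals N. if v \<in> white N then card (in_arcs N (Internal v)) = 1
                                      else card (out_arcs N (Internal v)) = 1)"

definition plabic_network :: "'v network \<Rightarrow> bool" where
  "plabic_network N \<longleftrightarrow>
     finite (internals N) \<and> white N \<subseteq> internals N \<and>
     arcs N \<subseteq> vertices N \<times> vertices N \<and> (\<forall>e\<in>arcs N. fst e \<noteq> snd e) \<and>
     (\<forall>j\<in>{1..bdcount N}. valency N (Boundary j) = 1) \<and>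
     (\<forall>v\<in>internals N. valency N (Internal v) \<in> {2, 3}) \<and>
     (\<forall>v\<in>internals N. \<exists>j\<in>{1..bdcount N}. (Internal v, Boundary j) \<in> (arcs N \<union> (arcs N)\<inverse>)\<^sup>*) \<and>
     plane_drawing N \<and> perfect_orientation N \<and>
     (\<forall>e\<in>arcs N. weight N e > 0)"

text \<open>
  The point is given by its Pluecker coordinates, up to the common denominator in Talaska's flow
  formula for Postnikov's boundary measurement map. A flow from the source set \<open>I\<close> to \<open>J\<close> is a
  vertex-disjoint family of self-avoiding walks from \<open>I - J\<close> to \<open>J - I\<close> and of cycles; in a perfectly
  oriented network this is the same as a set of arcs balanced at every internal vertex that uses
  exactly the boundary vertices in the symmetric difference of \<open>I\<close> and \<open>J\<close>.
\<close>

definition flows :: "'v network \<Rightarrow> nat set \<Rightarrow> ('v vertex \<times> 'v vertex) set set" where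
  "flows N J = {F. F \<subseteq> arcs N \<and>
     (\<forall>v\<in>internals N. card (F \<inter> in_arcs N (Internal v)) = card (F \<inter> out_arcs N (Internal v))) \<and>
     (\<forall>j\<in>{1..bdcount N}. (\<exists>e\<in>F. Boundary j \<in> ends e) \<longleftrightarrow> (j \<in> sources N) \<noteq> (j \<in> J))}"

definition pluecker :: "'v network \<Rightarrow> nat set \<Rightarrow> real" where
  "pluecker N J = (\<Sum>F\<in>flows N J. \<Prod>e\<in>F. weight N e)"

definition same_point :: "'v network \<Rightarrow> 'v network \<Rightarrow> bool" where
  "same_point N N' \<longleftrightarrow>
     bdcount N' = bdcount N \<and> card (sources N') = card (sources N) \<and>
     (\<exists>c>0. \<forall>J. J \<subseteq> {1..bdcount N} \<and> card J = card (sources N) \<longrightarrow>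
        pluecker N' J = c * pluecker N J)"

definition turn :: "complex \<Rightarrow> complex \<Rightarrow> int" where
  "turn f g = (let d = Re f * Im g - Im f * Re g in if d > 0 then 1 else if d = 0 then 0 else -1)"

text \<open>The starting point is not part of the ray, so the edge at a source \<open>b\<^sub>i\<close> does not meet the gauge
  ray from \<open>b\<^sub>i\<close>.\<close>

definition ray :: "complex \<Rightarrow> complex \<Rightarrow> complex set" where
  "ray b l = {b + of_real t * l | t. t > 0}"

definition gauge_direction :: "'v network \<Rightarrow> complex \<Rightarrow> bool" where
  "gauge_direction N l \<longleftrightarrow>
     l \<noteq> 0 \<and>
     (\<forall>j\<in>{1..bdcount N}. ray (bpos N j) l \<inter> disc N \<noteq> {}) \<and>
     (\<forall>e\<in>arcs N. turn (edge_vec N e) l \<noteq> 0) \<and>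
     (\<forall>j\<in>{1..bdcount N}. \<forall>v\<in>internals N. ipos N v \<notin> ray (bpos N j) l)"

definition wind :: "complex \<Rightarrow> complex \<Rightarrow> complex \<Rightarrow> int" where
  "wind l e f =
     (if turn e f = 1 \<and> turn e l = 1 \<and> turn l f = 1 then 1
      else if turn e f = -1 \<and> turn e l = -1 \<and> turn l f = -1 then -1 else 0)"

definition edge_wind ::
  "'v network \<Rightarrow> complex \<Rightarrow> 'v vertex \<times> 'v vertex \<Rightarrow> 'v vertex \<times> 'v vertex \<Rightarrow> int" where
  "edge_wind N l e f = wind l (edge_vec N e) (edge_vec N f)"

definition edge_int :: "'v network \<Rightarrow> complex \<Rightarrow> 'v vertex \<times> 'v vertex \<Rightarrow> int" where
  "edge_int N l e =
     int (\<Sum>j\<in>sources N. card (edge_seg N e \<inter> ray (bpos N j) l)) * turn l (edge_vec N e)"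

text \<open>Meaningful for the incoming arc of a white vertex and the outgoing arc of a black one.\<close>

definition in_arc :: "'v network \<Rightarrow> 'v \<Rightarrow> 'v vertex \<times> 'v vertex" where
  "in_arc N v = (THE e. e \<in> in_arcs N (Internal v))"

definition out_arc :: "'v network \<Rightarrow> 'v \<Rightarrow> 'v vertex \<times> 'v vertex" where
  "out_arc N v = (THE e. e \<in> out_arcs N (Internal v))"

definition arc_sign :: "'v network \<Rightarrow> complex \<Rightarrow> 'v vertex \<times> 'v vertex \<Rightarrow> int" where
  "arc_sign N l e =
     (case e of
        (Internal u, Boundary _) \<Rightarrow>
          if u \<in> white N then 1 + edge_int N l e + edge_wind N l (in_arc N u) e
          else edge_int N l e
      | (Boundary _, Internal v) \<Rightarrow>
          if v \<in> white N then 1 + edge_int N l e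
          else 1 + edge_int N l e + edge_wind N l e (out_arc N v)
      | (Internal u, Internal v) \<Rightarrow>
          if u \<in> white N
          then if v \<in> white N
               then 1 + edge_int N l e + edge_wind N l (in_arc N u) e
               else 1 + edge_int N l e + edge_wind N l (in_arc N u) e + edge_wind N l e (out_arc N v)
          else if v \<in> white N
               then edge_int N l e
               else edge_int N l e + edge_wind N l e (out_arc N v)
      | (Boundary _, Boundary _) \<Rightarrow> 0) mod 2"

text \<open>Signatures are functions on unoriented edges, so that they can be compared for different
  orientations. An edge joining two boundary vertices carries no condition.\<close>

type_synonym 'v signature = "'v vertex set \<Rightarrow> int"

definition geom_signature :: "'v network \<Rightarrow> complex \<Rightarrow> 'v signature" where
  "geom_signature N l d = arc_sign N l (THE e. e \<in> arcs N \<and> ends e = d)"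

definition gauge_transforms ::
  "'v network \<Rightarrow> ('v \<Rightarrow> int) \<Rightarrow> 'v signature \<Rightarrow> 'v signature \<Rightarrow> bool" where
  "gauge_transforms N \<eta> \<epsilon> \<epsilon>' \<longleftrightarrow>
     (\<forall>u\<in>internals N. \<eta> u \<in> {0, 1}) \<and>
     (\<forall>u v. {Internal u, Internal v} \<in> edges N \<longrightarrow>
        [\<epsilon>' {Internal u, Internal v} = \<epsilon> {Internal u, Internal v} + \<eta> u + \<eta> v] (mod 2)) \<and>
     (\<forall>u j. {Internal u, Boundary j} \<in> edges N \<longrightarrow>
        [\<epsilon>' {Internal u, Boundary j} = \<epsilon> {Internal u, Boundary j} + \<eta> u] (mod 2))"

definition gauge_equivalent :: "'v network \<Rightarrow> 'v signature \<Rightarrow> 'v signature \<Rightarrow> bool" where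
  "gauge_equivalent N \<epsilon> \<epsilon>' \<longleftrightarrow> (\<exists>\<eta>. gauge_transforms N \<eta> \<epsilon> \<epsilon>')"

definition is_geometric_signature :: "'v network \<Rightarrow> complex \<Rightarrow> 'v signature \<Rightarrow> bool" where
  "is_geometric_signature N l \<epsilon> \<longleftrightarrow> gauge_equivalent N (geom_signature N l) \<epsilon>"

definition valid_gauged :: "'v network \<Rightarrow> complex \<Rightarrow> bool" where
  "valid_gauged N l \<longleftrightarrow> plabic_network N \<and> gauge_direction N l"

definition reverse_arcs :: "('v vertex \<times> 'v vertex) set \<Rightarrow> 'v network \<Rightarrow> 'v network" where
  "reverse_arcs D N = N\<lparr>
     arcs := (arcs N - D) \<union> D\<inverse>,
     weight := (\<lambda>(u, v). if (v, u) \<in> D then 1 / weight N (v, u) else weight N (u, v))\<rparr>"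

definition orientation_change :: "'v network \<Rightarrow> 'v network \<Rightarrow> bool" where
  "orientation_change N N' \<longleftrightarrow> (\<exists>D \<subseteq> arcs N. N' = reverse_arcs D N)"

text \<open>Respecting the topology: the vertices move simultaneously through plane drawings.\<close>

definition position_change :: "'v network \<Rightarrow> 'v network \<Rightarrow> bool" where
  "position_change N N' \<longleftrightarrow>
     (\<exists>p :: real \<Rightarrow> 'v vertex \<Rightarrow> complex.
        p 0 = pos N \<and> N' = N\<lparr>pos := p 1\<rparr> \<and>
        (\<forall>v. continuous_on {0..1} (\<lambda>t. p t v)) \<and>
        (\<forall>t\<in>{0..1}. \<forall>v. v \<notin> Internal ` internals N \<longrightarrow> p t v = pos N v) \<and>
        (\<forall>t\<in>{0..1}. plane_drawing (N\<lparr>pos := p t\<rparr>)))"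

fun change :: "'v network \<times> complex \<Rightarrow> 'v network \<times> complex \<Rightarrow> bool" where
  "change (N, l) (N', l') \<longleftrightarrow> valid_gauged N l \<and> valid_gauged N' l' \<and>
     (orientation_change N N' \<and> l' = l \<or> N' = N \<or> position_change N N' \<and> l' = l)"

definition path_arcs :: "'v vertex list \<Rightarrow> ('v vertex \<times> 'v vertex) set" where
  "path_arcs p = set (zip p (tl p))"

definition cycle_arcs :: "'v vertex list \<Rightarrow> ('v vertex \<times> 'v vertex) set" where
  "cycle_arcs q = set (zip q (rotate1 q))"

definition source_sink_path :: "'v network \<Rightarrow> nat \<Rightarrow> nat \<Rightarrow> 'v vertex list \<Rightarrow> bool" where
  "source_sink_path N i j p \<longleftrightarrow>
     i \<in> sources N \<and> j \<in> sinks N \<and> p \<noteq> [] \<and> hd p = Boundary i \<and> last p = Boundary j \<and>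
     distinct p \<and> path_arcs p \<subseteq> arcs N"

definition simple_cycle :: "'v network \<Rightarrow> 'v vertex list \<Rightarrow> bool" where
  "simple_cycle N q \<longleftrightarrow> q \<noteq> [] \<and> distinct q \<and> cycle_arcs q \<subseteq> arcs N"

definition trace_of :: "'v network \<Rightarrow> ('v vertex \<times> 'v vertex) set \<Rightarrow> complex set" where
  "trace_of N D = (\<Union>e\<in>D. edge_seg N e)"

definition regions ::
  "'v network \<Rightarrow> complex \<Rightarrow> nat \<Rightarrow> nat \<Rightarrow> ('v vertex \<times> 'v vertex) set \<Rightarrow> complex set set" where
  "regions N l i j D =
     components (disc N - (ray (bpos N i) l \<union> ray (bpos N j) l \<union> trace_of N D))"

text \<open>
  The curves bounding the regions, as pairs of a point and a tangent vector giving the orientation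
  there. On the boundary circle, \<^term>\<open>turn (x - bpos N j) (bpos N i - x)\<close> is \<open>1\<close> if \<open>x\<close> lies on the
  counterclockwise arc from \<open>b\<^sub>j\<close> to \<open>b\<^sub>i\<close> and \<open>-1\<close> if it lies on the clockwise one.
\<close>

definition oriented_curves ::
  "'v network \<Rightarrow> complex \<Rightarrow> nat \<Rightarrow> nat \<Rightarrow> ('v vertex \<times> 'v vertex) set \<Rightarrow> (complex \<times> complex) set" where
  "oriented_curves N l i j D =
     {(x, l) | x. x \<in> ray (bpos N i) l \<inter> disc N} \<union>
     {(x, - l) | x. x \<in> ray (bpos N j) l \<inter> disc N} \<union>
     {(x, edge_vec N e) | x e. e \<in> D \<and> x \<in> open_segment (pos N (fst e)) (pos N (snd e))} \<union>
     {(x, of_int (turn (x - bpos N j) (bpos N i - x)) * (\<i> * (x - center N))) | x.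
        x \<in> sphere (center N) (radius N) - {bpos N i, bpos N j}}"

definition lies_left :: "complex set \<Rightarrow> complex \<Rightarrow> complex \<Rightarrow> bool" where
  "lies_left R x d \<longleftrightarrow> (\<forall>\<^sub>F \<delta> in at_right 0. x + of_real \<delta> * \<i> * d \<in> R)"

definition lies_right :: "complex set \<Rightarrow> complex \<Rightarrow> complex \<Rightarrow> bool" where
  "lies_right R x d \<longleftrightarrow> (\<forall>\<^sub>F \<delta> in at_right 0. x - of_real \<delta> * \<i> * d \<in> R)"

text \<open>The boundary of a region is coherently oriented iff the region lies on the same side, always
  left or always right, of the oriented curves bounding it.\<close>

definition coherent :: "(complex \<times> complex) set \<Rightarrow> complex set \<Rightarrow> bool" where
  "coherent K R \<longleftrightarrow> (\<forall>(x, d)\<in>K. \<not> lies_right R x d) \<or> (\<forall>(x, d)\<in>K. \<not> lies_left R x d)"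

text \<open>The union of the regions marked \<open>+\<close>.\<close>

definition path_plus ::
  "'v network \<Rightarrow> complex \<Rightarrow> nat \<Rightarrow> nat \<Rightarrow> ('v vertex \<times> 'v vertex) set \<Rightarrow> complex set" where
  "path_plus N l i j D = \<Union> {R \<in> regions N l i j D. coherent (oriented_curves N l i j D) R}"

definition cycle_plus :: "'v network \<Rightarrow> ('v vertex \<times> 'v vertex) set \<Rightarrow> complex set" where
  "cycle_plus N D = outside (trace_of N D)"

definition gamma1 :: "complex set \<Rightarrow> 'v network \<Rightarrow> 'v vertex \<times> 'v vertex \<Rightarrow> int" where
  "gamma1 A N e =
     (if \<forall>\<^sub>F t in at_left 1. lies_left A (pos N (fst e) + of_real t * edge_vec N e) (edge_vec N e)
      then 0 else 1)"

definition gamma2 :: "'v network \<Rightarrow> complex \<Rightarrow> 'v vertex \<times> 'v vertex \<Rightarrow> int" where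
  "gamma2 N l e = (1 - turn (edge_vec N e) l) div 2"

text \<open>Here \<open>A\<close> is the union of the regions marked \<open>+\<close>.\<close>

definition reversal_gauge ::
  "complex set \<Rightarrow> 'v network \<Rightarrow> complex \<Rightarrow> ('v vertex \<times> 'v vertex) set \<Rightarrow> 'v \<Rightarrow> int" where
  "reversal_gauge A N l D u =
     (if Internal u \<notin> \<Union> (ends ` D) then (if ipos N u \<in> A then 0 else 1)
      else let e1 = (THE e. e \<in> D \<and> snd e = Internal u);
               e2 = (THE e. e \<in> D \<and> fst e = Internal u)
           in (if u \<in> white N
               then edge_wind N l e1 e2 + gamma1 A N e1 + gamma2 N l e2 + 1
               else edge_wind N l e1 e2 + gamma1 A N e1 + gamma2 N l e1) mod 2)"

text \<open>A deformation is a family of networks \<open>M t\<close> and gauge directions \<open>m t\<close> for \<open>t\<close> between 0 and 1.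
  An edge counts as parallel to the gauge direction only if it points the same way.\<close>

definition aligned :: "complex \<Rightarrow> complex \<Rightarrow> bool" where
  "aligned d l \<longleftrightarrow> (\<exists>c>0. d = of_real c * l)"

definition par ::
  "(real \<Rightarrow> 'v network) \<Rightarrow> (real \<Rightarrow> complex) \<Rightarrow> 'v vertex \<times> 'v vertex \<Rightarrow> int" where
  "par M m e = (if odd (card {t \<in> {0..1}. aligned (edge_vec (M t) e) (m t)}) then 1 else 0)"

definition cr :: "(real \<Rightarrow> 'v network) \<Rightarrow> (real \<Rightarrow> complex) \<Rightarrow> 'v \<Rightarrow> int" where
  "cr M m u = int (\<Sum>j\<in>sources (M 0). card {t \<in> {0..1}. ipos (M t) u \<in> ray (bpos (M t) j) (m t)})"

definition deformation_gauge ::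
  "(real \<Rightarrow> 'v network) \<Rightarrow> (real \<Rightarrow> complex) \<Rightarrow> 'v \<Rightarrow> int" where
  "deformation_gauge M m u =
     (if u \<in> white (M 0) then cr M m u + par M m (in_arc (M 0) u)
      else cr M m u + par M m (out_arc (M 0) u)) mod 2"

text \<open>The directions for which all rays from boundary vertices enter the disc form a convex cone, so
  the admissible rotation is the one through the angle less than \<open>pi\<close>, here parametrised by the
  segment from \<open>l\<close> to \<open>l'\<close>.\<close>

definition rotation :: "complex \<Rightarrow> complex \<Rightarrow> real \<Rightarrow> complex" where
  "rotation l l' t = of_real (1 - t) * l + of_real t * l'"

definition rotation_gauge :: "'v network \<Rightarrow> complex \<Rightarrow> complex \<Rightarrow> 'v \<Rightarrow> int" where
  "rotation_gauge N l l' = deformation_gauge (\<lambda>_. N) (rotation l l')"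

definition move :: "'v network \<Rightarrow> 'v \<Rightarrow> complex \<Rightarrow> 'v network" where
  "move N u z = N\<lparr>pos := (pos N)(Internal u := z)\<rparr>"

definition changes_sign_at :: "(real \<Rightarrow> int) \<Rightarrow> real \<Rightarrow> bool" where
  "changes_sign_at f t \<longleftrightarrow>
     (\<exists>\<sigma>. \<sigma> \<noteq> 0 \<and> (\<forall>\<^sub>F s in at_left t. f s = \<sigma>) \<and> (\<forall>\<^sub>F s in at_right t. f s = - \<sigma>))"

text \<open>The last two clauses are general position: the edges at \<open>u\<close> pass through the gauge direction, and
  \<open>u\<close> passes through the gauge rays, without mere touching. Otherwise the numbers of times counted by
  \<^const>\<open>par\<close> and \<^const>\<open>cr\<close> have no meaning modulo 2.\<close>

definition vertex_motion :: "'v network \<Rightarrow> complex \<Rightarrow> 'v \<Rightarrow> (real \<Rightarrow> complex) \<Rightarrow> bool" where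
  "vertex_motion N l u p \<longleftrightarrow>
     u \<in> internals N \<and> continuous_on {0..1} p \<and> p 0 = ipos N u \<and>
     (\<forall>t\<in>{0..1}. plane_drawing (move N u (p t))) \<and>
     (\<forall>t\<in>{0..1}. \<forall>e\<in>arcs N. Internal u \<in> ends e \<and> aligned (edge_vec (move N u (p t)) e) l \<longrightarrow>
        changes_sign_at (\<lambda>s. turn l (edge_vec (move N u (p s)) e)) t) \<and>
     (\<forall>t\<in>{0..1}. \<forall>j\<in>sources N. p t \<in> ray (bpos N j) l \<longrightarrow>
        changes_sign_at (\<lambda>s. turn l (p s - bpos N j)) t)"

definition motion_gauge :: "'v network \<Rightarrow> complex \<Rightarrow> 'v \<Rightarrow> (real \<Rightarrow> complex) \<Rightarrow> 'v \<Rightarrow> int" where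
  "motion_gauge N l u p v =
     (let M = (\<lambda>t. move N u (p t)); m = (\<lambda>_. l) in
      if v = u then deformation_gauge M m u
      else if (Internal u, Internal v) \<in> arcs N \<and> v \<in> white N
        then par M m (Internal u, Internal v)
      else if (Internal v, Internal u) \<in> arcs N \<and> v \<notin> white N
        then par M m (Internal v, Internal u)
      else 0)"

inductive elementary ::
  "'v network \<times> complex \<Rightarrow> ('v \<Rightarrow> int) \<Rightarrow> 'v network \<times> complex \<Rightarrow> bool" where
  path_reversal:
    "\<lbrakk>valid_gauged N l; source_sink_path N i j p; D = path_arcs p; valid_gauged (reverse_arcs D N) l\<rbrakk>
     \<Longrightarrow> elementary (N, l) (reversal_gauge (path_plus N l i j D) N l D) (reverse_arcs D N, l)"
| cycle_reversal:
    "\<lbrakk>valid_gauged N l; simple_cycle N q; D = cycle_arcs q; valid_gauged (reverse_arcs D N) l\<rbrakk>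
     \<Longrightarrow> elementary (N, l) (reversal_gauge (cycle_plus N D) N l D) (reverse_arcs D N, l)"
| ray_rotation:
    "\<lbrakk>valid_gauged N l; valid_gauged N l'\<rbrakk> \<Longrightarrow> elementary (N, l) (rotation_gauge N l l') (N, l')"
| vertex_move:
    "\<lbrakk>valid_gauged N l; vertex_motion N l u p; valid_gauged (move N u (p 1)) l\<rbrakk>
     \<Longrightarrow> elementary (N, l) (motion_gauge N l u p) (move N u (p 1), l)"

inductive composed ::
  "'v network \<times> complex \<Rightarrow> ('v \<Rightarrow> int) \<Rightarrow> 'v network \<times> complex \<Rightarrow> bool" where
  refl: "composed S (\<lambda>_. 0) S"
| step: "\<lbrakk>composed S \<eta> T; elementary T \<zeta> R\<rbrakk> \<Longrightarrow> composed S (\<lambda>u. (\<eta> u + \<zeta> u) mod 2) R"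

end

theory Submission
  imports Defs
begin

text \<open>
  Let the gauge direction point upwards. Modulo two, the winding of two consecutive edges says whether
  one of them lies below the other as seen from their common vertex, and the intersection index of an
  edge counts the gauge rays separating its two ends. Hence the geometric signature is
  determined by left-right and above-below relations between edges and vertices.

  Under a deformation such a relation changes only when an edge becomes parallel to the gauge direction
  or a vertex crosses a gauge ray, and each change alters the signature by the stated gauge function.
  Under a reversal the gauge function is, up to a local term at the reversed arcs, the parity of
  the number of reversed edges below a vertex. For a cycle, the Jordan curve theorem identifies this parity
  with lying inside. For a path, one closes the path up outside the disc to a simple polygon; a region is
  then coherently oriented iff lying inside the polygon is equivalent to lying in the strip between the
  two rays, iff an even number of edges of the path lies below its points.

  Any change of orientation is a disjoint union of source-sink paths and cycles, which can be
  reversed one after the other. A change of positions is subdivided into small ones, each of which is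
  replaced by moves of single vertices along segments, through a placement with pairwise different
  horizontal coordinates.
\<close>

text \<open>Everything on crossings rests on one identity for disjoint segments,
  \<open>down_segment_disjoint\<close>: how the passage of \<open>PQ\<close> below a point changes
  from \<open>a\<close> to \<open>b\<close> equals how the passage of \<open>ab\<close> above a
  point changes from \<open>Q\<close> to \<open>P\<close>. Over a closed polygon the right side
  telescopes, so crossing numbers are constant off the polygon. Over the reversed arcs it cancels
  modulo two at internal vertices, and the boundary remainder is the change in the set of gauge
  rays. Segments sharing a vertex violate the identity by a winding parity.

  \<open>wind\<close> records only turns through the gauge direction, not through its opposite,
  which is why \<open>par\<close> counts only edges that point with it.

  Coherence of a region speaks about its bounding curves. For two of the four kinds of region
  (inside the polygon or not, in the strip or not) it follows curve by curve; for the other two a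
  bounding piece on each side must be exhibited.

  A motion of all vertices can keep an edge parallel to the gauge direction for a whole time
  interval, so it cannot itself be cut into admissible moves; only placements near it are
  used.\<close>

section \<open>Horizontal and vertical order of points and segments\<close>

definition det2 :: "complex \<Rightarrow> complex \<Rightarrow> real" where
  "det2 f g = Re f * Im g - Im f * Re g"

lemma det2_simps [simp]:
  "det2 0 g = 0" "det2 f 0 = 0" "det2 f f = 0"
  by (simp_all add: det2_def)

lemma det2_linear:
  "det2 (a + b) g = det2 a g + det2 b g" "det2 g (a + b) = det2 g a + det2 g b"
  "det2 (a - b) g = det2 a g - det2 b g" "det2 g (a - b) = det2 g a - det2 g b"
  "det2 (- a) g = - det2 a g" "det2 g (- a) = - det2 g a"
  "det2 (of_real t * a) g = t * det2 a g" "det2 g (of_real t * a) = t * det2 g a"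
  by (simp_all add: det2_def algebra_simps)

lemma det2_commute: "det2 f g = - det2 g f"
  by (simp add: det2_def)

lemma turn_det2: "turn f g = (if det2 f g > 0 then 1 else if det2 f g = 0 then 0 else -1)"
  by (simp add: turn_def det2_def Let_def)

lemma det2_zero_imp:
  assumes "det2 v l = 0" "l \<noteq> 0"
  obtains a where "v = of_real a * l"
proof
  have n: "(Re l)\<^sup>2 + (Im l)\<^sup>2 \<noteq> 0"
    using assms(2) by (simp add: complex_eq_iff sum_power2_eq_zero_iff)
  have "Re v * Im l = Im v * Re l"
    using assms(1) by (simp add: det2_def)
  then show "v = of_real ((Re v * Re l + Im v * Im l) / ((Re l)\<^sup>2 + (Im l)\<^sup>2)) * l"
    using n by (auto simp: complex_eq_iff field_simps power2_eq_square)
qed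

lemma continuous_on_det2 [continuous_intros]:
  "continuous_on S f \<Longrightarrow> continuous_on S g \<Longrightarrow> continuous_on S (\<lambda>x. det2 (f x) (g x))"
  unfolding det2_def by (intro continuous_intros)

lemma tendsto_det2 [tendsto_intros]:
  "(f \<longlongrightarrow> a) F \<Longrightarrow> (g \<longlongrightarrow> b) F \<Longrightarrow> ((\<lambda>x. det2 (f x) (g x)) \<longlongrightarrow> det2 a b) F"
  unfolding det2_def by (intro tendsto_intros)

text \<open>The gauge direction \<open>l\<close> is thought of as pointing upwards, and \<^term>\<open>det2 z l\<close> is then the
  horizontal coordinate of \<open>z\<close>.\<close>

definition lefter :: "complex \<Rightarrow> complex \<Rightarrow> complex \<Rightarrow> bool" where
  "lefter l a b \<longleftrightarrow> det2 a l < det2 b l"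

text \<open>The second factor makes the test independent of the direction of \<open>g\<close>:
  \<open>z\<close> and the gauge direction lie on the same side of the line through
  \<open>g\<close>. That \<open>z\<close> is horizontally between the ends is a separate condition,
  supplied in \<open>down\<close> and \<open>upw\<close>.\<close>

definition above :: "complex \<Rightarrow> complex \<Rightarrow> complex \<times> complex \<Rightarrow> bool" where
  "above l z g \<longleftrightarrow> det2 (snd g - fst g) (z - fst g) * det2 (snd g - fst g) l > 0"

definition below :: "complex \<Rightarrow> complex \<Rightarrow> complex \<times> complex \<Rightarrow> bool" where
  "below l z g \<longleftrightarrow> det2 (snd g - fst g) (z - fst g) * det2 (snd g - fst g) l < 0"

text \<open>Signed number of crossings of the segment \<open>g\<close> with the downward, respectively upward, ray from
  a point. With the half-open convention on the ends the identities for sums over closed polygons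
  need no general position assumption.\<close>

definition down :: "complex \<Rightarrow> complex \<Rightarrow> complex \<times> complex \<Rightarrow> int" where
  "down l z g = (of_bool (lefter l (fst g) z) - of_bool (lefter l (snd g) z)) * of_bool (above l z g)"

definition upw :: "complex \<Rightarrow> complex \<Rightarrow> complex \<times> complex \<Rightarrow> int" where
  "upw l p g = (of_bool (lefter l p (snd g)) - of_bool (lefter l p (fst g))) * of_bool (below l p g)"

definition seg :: "complex \<times> complex \<Rightarrow> complex set" where
  "seg g = closed_segment (fst g) (snd g)"

lemma above_iff:
  assumes "det2 (Q - P) l \<noteq> 0" "z - (P + of_real s * (Q - P)) = of_real a * l"
  shows "above l z (P, Q) \<longleftrightarrow> a > 0" "below l z (P, Q) \<longleftrightarrow> a < 0"
proof -
  have "z - P = of_real a * l + of_real s * (Q - P)"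
    using assms(2) by (simp add: algebra_simps)
  then have "det2 (Q - P) (z - P) = a * det2 (Q - P) l"
    by (simp only: det2_linear(2,8) det2_simps)
  then have "det2 (Q - P) (z - P) * det2 (Q - P) l = a * (det2 (Q - P) l)\<^sup>2"
    by (simp add: power2_eq_square)
  then show "above l z (P, Q) \<longleftrightarrow> a > 0" "below l z (P, Q) \<longleftrightarrow> a < 0"
    using assms(1) by (simp_all add: above_def below_def zero_less_mult_iff mult_less_0_iff)
qed

lemma vertical_projection:
  assumes "l \<noteq> 0" "lefter l P z \<noteq> lefter l Q z"
  obtains s a where "0 \<le> s" "s \<le> 1" "z - (P + of_real s * (Q - P)) = of_real a * l"
    "det2 (Q - P) l \<noteq> 0" "P + of_real s * (Q - P) \<in> seg (P, Q)"
proof -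
  have ne: "det2 (Q - P) l \<noteq> 0"
    using assms(2) by (auto simp: lefter_def det2_linear)
  define s where "s = det2 (z - P) l / det2 (Q - P) l"
  have s: "0 \<le> s" "s \<le> 1"
    using assms(2) ne unfolding s_def lefter_def
    by (auto simp: det2_linear divide_simps split: if_splits)
  have "det2 (z - (P + of_real s * (Q - P))) l = det2 (z - P) l - s * det2 (Q - P) l"
    by (simp only: det2_linear)
  then have "det2 (z - (P + of_real s * (Q - P))) l = 0"
    using ne by (simp add: s_def)
  then obtain a where a: "z - (P + of_real s * (Q - P)) = of_real a * l"
    using det2_zero_imp assms(1) by metis
  have "P + of_real s * (Q - P) \<in> seg (P, Q)"
    using s unfolding seg_def in_segment
    by (intro exI[of _ s]) (auto simp: scaleR_conv_of_real algebra_simps)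
  with s a ne show ?thesis using that by blast
qed

text \<open>If the vertical order of \<open>S\<close> and \<open>T\<close> were different on two
  vertical lines, an interpolation between the two lines would make the vertical distance vanish and
  give a common point.\<close>

lemma convex_disjoint_sides:
  fixes S T :: "complex set"
  assumes "convex S" "convex T" "S \<inter> T = {}"
    and "E1 \<in> S" "E2 \<in> S" "G1 \<in> T" "G2 \<in> T"
    and "E1 - G1 = of_real a * l" "E2 - G2 = of_real b * l" "a > 0"
  shows "b > 0"
proof (rule ccontr)
  assume "\<not> b > 0"
  then have b: "b \<le> 0" by simp
  define s where "s = a / (a - b)"
  have s: "0 \<le> s" "s \<le> 1" "(1 - s) * a + s * b = 0"
    using b \<open>a > 0\<close> by (auto simp: s_def field_simps)
  have "(1 - s) *\<^sub>R E1 + s *\<^sub>R E2 \<in> S" "(1 - s) *\<^sub>R G1 + s *\<^sub>R G2 \<in> T"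
    using s convexD[OF assms(1,4,5), of "1 - s" s] convexD[OF assms(2,6,7), of "1 - s" s] by auto
  moreover have "(1 - s) *\<^sub>R E1 + s *\<^sub>R E2 - ((1 - s) *\<^sub>R G1 + s *\<^sub>R G2)
      = (1 - s) *\<^sub>R (E1 - G1) + s *\<^sub>R (E2 - G2)"
    by (simp add: algebra_simps)
  moreover have "\<dots> = of_real ((1 - s) * a + s * b) * l"
    using assms by (simp add: scaleR_conv_of_real algebra_simps)
  ultimately show False
    using s assms(3) by auto
qed

text \<open>Disjoint segments have one vertical order throughout. If \<open>ab\<close> runs above
  \<open>PQ\<close>, both sides are the same alternating sum of the four comparisons of
  \<open>P\<close>, \<open>Q\<close> with \<open>a\<close>, \<open>b\<close>; otherwise all terms
  vanish.\<close>

lemma down_segment_disjoint: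
  assumes "l \<noteq> 0" "seg (a, b) \<inter> seg (P, Q) = {}"
  shows "down l b (P, Q) - down l a (P, Q) = upw l P (a, b) - upw l Q (a, b)"
proof -
  \<comment> \<open>The vertical order of the two segments, tested on any vertical line that meets
    both; by \<open>up_iff\<close> the choice of the line does not matter.\<close>
  define up where "up \<longleftrightarrow> (\<exists>E\<in>seg (a,b). \<exists>G\<in>seg (P,Q). \<exists>c>0. E - G = of_real c * l)"
  have cv: "convex (seg g)" for g by (simp add: seg_def)
  have up_iff: "up \<longleftrightarrow> c > 0"
    if "E \<in> seg (a,b)" "G \<in> seg (P,Q)" "E - G = of_real c * l" for E G c
    using that convex_disjoint_sides[OF cv cv assms(2)] unfolding up_def by blast
  have down: "down l z (P, Q) = (of_bool (lefter l P z) - of_bool (lefter l Q z)) * of_bool up"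
    if z: "z \<in> seg (a, b)" for z
  proof (cases "lefter l P z = lefter l Q z")
    case False
    then obtain s c where sc: "z - (P + of_real s * (Q - P)) = of_real c * l"
      "det2 (Q - P) l \<noteq> 0" "P + of_real s * (Q - P) \<in> seg (P, Q)"
      by (metis vertical_projection[OF assms(1)])
    show ?thesis
      using above_iff(1)[OF sc(2,1)] up_iff[OF z sc(3,1)] by (simp add: down_def)
  qed (simp add: down_def)
  have upw: "upw l z (a, b) = (of_bool (lefter l z b) - of_bool (lefter l z a)) * of_bool up"
    if z: "z \<in> seg (P, Q)" and ne: "lefter l z a \<noteq> lefter l z b" for z
  proof -
    have ne': "det2 (b - a) l \<noteq> 0" using ne by (auto simp: lefter_def det2_linear)
    define s where "s = det2 (z - a) l / det2 (b - a) l"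
    have s: "0 \<le> s" "s \<le> 1"
      using ne ne' unfolding s_def lefter_def by (auto simp: det2_linear divide_simps split: if_splits)
    have "det2 (z - (a + of_real s * (b - a))) l = det2 (z - a) l - s * det2 (b - a) l"
      by (simp only: det2_linear)
    then have "det2 (z - (a + of_real s * (b - a))) l = 0"
      using ne' by (simp add: s_def)
    then obtain c where c: "z - (a + of_real s * (b - a)) = of_real c * l"
      using det2_zero_imp assms(1) by metis
    have in_seg: "a + of_real s * (b - a) \<in> seg (a, b)"
      using s unfolding seg_def in_segment
      by (intro exI[of _ s]) (auto simp: scaleR_conv_of_real algebra_simps)
    have "a + of_real s * (b - a) - z = of_real (- c) * l"
      using c by (simp add: algebra_simps)
    then have "up \<longleftrightarrow> c < 0"
      using up_iff[OF in_seg z] by fastforce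
    then show ?thesis
      using above_iff(2)[OF ne' c] by (simp add: upw_def)
  qed
  have ends: "a \<in> seg (a,b)" "b \<in> seg (a,b)" "P \<in> seg (P,Q)" "Q \<in> seg (P,Q)"
    by (simp_all add: seg_def)
  have upw': "upw l z (a, b) = (of_bool (lefter l z b) - of_bool (lefter l z a)) * of_bool up"
    if z: "z \<in> seg (P, Q)" for z
    using upw[OF z] by (cases "lefter l z a = lefter l z b") (auto simp: upw_def)
  show ?thesis
    unfolding down[OF ends(1)] down[OF ends(2)] upw'[OF ends(3)] upw'[OF ends(4)]
    by (auto simp: of_bool_def)
qed

text \<open>For two edges with directions \<open>v\<close> and \<open>q\<close> at a common vertex:
  they leave to the same horizontal side, and \<open>q\<close> starts below
  \<open>v\<close>.\<close>

definition under :: "complex \<Rightarrow> complex \<Rightarrow> complex \<Rightarrow> bool" where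
  "under l v q \<longleftrightarrow> det2 v l * det2 q l > 0 \<and> det2 q v * det2 q l > 0"

lemma down_swap: "down l z (Q, P) = - down l z (P, Q)"
proof -
  have "det2 (P - Q) (z - Q) * det2 (P - Q) l = det2 (Q - P) (z - P) * det2 (Q - P) l"
    by (simp add: det2_def algebra_simps)
  then show ?thesis by (simp add: down_def above_def)
qed

text \<open>Only edges leaving \<open>a\<close> to the same side matter. Then exactly one of the two
  far ends projects vertically onto the other edge, with ties decided by the half-open convention,
  and it is counted iff \<open>aQ\<close> runs below \<open>ab\<close>.\<close>

lemma down_segment_shared:
  assumes "det2 (b - a) l \<noteq> 0" "det2 (Q - a) l \<noteq> 0"
  shows "even (down l b (a, Q) + upw l Q (a, b) + of_bool (under l (b - a) (Q - a)))"
proof -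
  define v q where "v = b - a" and "q = Q - a"
  have eq: "det2 v q = - det2 q v"
    by (rule det2_commute)
  have le: "lefter l a b \<longleftrightarrow> det2 v l > 0" "lefter l Q b \<longleftrightarrow> det2 q l < det2 v l"
    "lefter l Q a \<longleftrightarrow> det2 q l < 0"
    by (auto simp: lefter_def v_def q_def det2_linear)
  have nz: "det2 v l \<noteq> 0" "det2 q l \<noteq> 0"
    using assms by (auto simp: v_def q_def)
  have pos: "det2 q v * det2 q l > 0 \<longleftrightarrow> (if det2 q l > 0 then det2 q v > 0 else det2 q v < 0)"
    "det2 v l * det2 q l > 0 \<longleftrightarrow> (det2 v l > 0 \<longleftrightarrow> det2 q l > 0)"
    "- det2 q v * det2 v l < 0 \<longleftrightarrow> (if det2 v l > 0 then det2 q v > 0 else det2 q v < 0)"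
    using nz by (auto simp: zero_less_mult_iff mult_less_0_iff)
  have sgn: "det2 q l < 0 \<longleftrightarrow> \<not> det2 q l > 0"
    "det2 v l > 0 \<Longrightarrow> \<not> det2 q l > 0 \<Longrightarrow> det2 q l < det2 v l"
    "\<not> det2 v l > 0 \<Longrightarrow> det2 q l > 0 \<Longrightarrow> \<not> det2 q l < det2 v l"
    using nz by linarith+
  show ?thesis
    unfolding down_def upw_def under_def above_def below_def fst_conv snd_conv le
      v_def[symmetric] q_def[symmetric] eq pos
    using sgn
    by (cases "det2 v l > 0"; cases "det2 q l > 0"; cases "det2 q l < det2 v l")
       (auto simp: of_bool_def)
qed

text \<open>\<open>wind\<close> is nonzero iff the path turns back horizontally through the gauge
  direction. Seen from the common vertex, \<open>f\<close> and the way back along \<open>e\<close>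
  are then on the same side, with the way back below.\<close>

lemma odd_wind:
  assumes "det2 e l \<noteq> 0" "det2 f l \<noteq> 0"
  shows "odd (wind l e f) \<longleftrightarrow> under l f (- e)"
proof -
  have "det2 l f = - det2 f l" by (rule det2_commute)
  then show ?thesis
    using assms
    by (auto simp: wind_def turn_det2 under_def det2_linear zero_less_mult_iff mult_less_0_iff
        split: if_splits)
qed

lemma under_antisym:
  assumes "det2 v l * det2 q l > 0" "det2 q v \<noteq> 0"
  shows "under l v q \<longleftrightarrow> \<not> under l q v"
proof -
  have "det2 v q = - det2 q v" by (rule det2_commute)
  then show ?thesis
    using assms unfolding under_def zero_less_mult_iff by (smt (verit))
qed

lemma under_same_side: "under l v q \<Longrightarrow> det2 v l * det2 q l > 0"
  by (simp add: under_def)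

lemma upw_swap: "upw l z (Q, P) = - upw l z (P, Q)"
proof -
  have "det2 (P - Q) (z - Q) * det2 (P - Q) l = det2 (Q - P) (z - P) * det2 (Q - P) l"
    by (simp add: det2_def algebra_simps)
  then show ?thesis by (simp add: upw_def below_def)
qed

section \<open>Parity of the number of edges below a vertex\<close>

definition is_end :: "complex \<Rightarrow> complex \<times> complex \<Rightarrow> bool" where
  "is_end a g \<longleftrightarrow> fst g = a \<or> snd g = a"

definition opposite :: "complex \<Rightarrow> complex \<times> complex \<Rightarrow> complex" where
  "opposite a g = (if fst g = a then snd g else fst g)"

definition count_below :: "complex \<Rightarrow> (complex \<times> complex) set \<Rightarrow> complex \<Rightarrow> int" where
  "count_below l E a = (\<Sum>g\<in>E. if is_end a g then 0 else down l a g)"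

text \<open>Excluding the edges that end at \<open>b\<close> keeps the edge \<open>ab\<close> itself
  out of the count.\<close>

definition count_under ::
  "complex \<Rightarrow> (complex \<times> complex) set \<Rightarrow> complex \<Rightarrow> complex \<Rightarrow> int" where
  "count_under l E a b =
     (\<Sum>g\<in>E. if is_end a g \<and> \<not> is_end b g then of_bool (under l (b - a) (opposite a g - a)) else 0)"

definition upw_proper :: "complex \<Rightarrow> complex \<Rightarrow> complex \<Rightarrow> complex \<Rightarrow> int" where
  "upw_proper l a b p = (if p = a \<or> p = b then 0 else upw l p (a, b))"

text \<open>The contribution of a single edge \<open>g\<close> to \<open>count_parity\<close>; the
  cases are the ends it shares with \<open>ab\<close>.\<close>

lemma segment_parity:
  assumes "l \<noteq> 0" and ab: "det2 (b - a) l \<noteq> 0"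
    and g: "det2 (snd g - fst g) l \<noteq> 0"
    and seg: "seg (a, b) \<inter> seg g \<subseteq> {a, b} \<inter> {fst g, snd g} \<or> {fst g, snd g} = {a, b}"
  shows "even ((if is_end a g then 0 else down l a g) + (if is_end b g then 0 else down l b g)
    + (upw_proper l a b (fst g) + upw_proper l a b (snd g))
    + (if is_end a g \<and> \<not> is_end b g then of_bool (under l (b - a) (opposite a g - a)) else 0)
    + (if is_end b g \<and> \<not> is_end a g then of_bool (under l (a - b) (opposite b g - b)) else 0))"
proof -
  obtain P Q where gPQ: "g = (P, Q)" by (cases g)
  have "P \<noteq> Q" "a \<noteq> b" using g ab gPQ by auto
  have Q: "det2 (Q - P) l \<noteq> 0" using g gPQ by simp
  have P: "det2 (P - Q) l \<noteq> 0" using Q by (simp add: det2_linear)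
  have ba: "det2 (a - b) l \<noteq> 0" using ab by (simp add: det2_linear)
  consider "is_end a g" "is_end b g" | "is_end a g" "\<not> is_end b g"
    | "\<not> is_end a g" "is_end b g" | "\<not> is_end a g" "\<not> is_end b g" by blast
  then show ?thesis
  proof cases
    case 1
    then show ?thesis using \<open>a \<noteq> b\<close> by (auto simp: gPQ is_end_def upw_proper_def)
  next
    case 2
    have "P = a \<or> Q = a" using 2 by (auto simp: gPQ is_end_def)
    then show ?thesis
    proof
      assume "P = a"
      then show ?thesis
        using 2 down_segment_shared[of b a l Q] ab Q \<open>P \<noteq> Q\<close>
        by (auto simp: gPQ is_end_def upw_proper_def opposite_def)
    next
      assume "Q = a"
      then show ?thesis
        using 2 down_segment_shared[of b a l P] ab P \<open>P \<noteq> Q\<close>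
        by (auto simp: gPQ is_end_def upw_proper_def opposite_def down_swap[of l b P a])
    qed
  next
    case 3
    have "P = b \<or> Q = b" using 3 by (auto simp: gPQ is_end_def)
    then show ?thesis
    proof
      assume "P = b"
      then show ?thesis
        using 3 down_segment_shared[of a b l Q] ba Q \<open>P \<noteq> Q\<close>
        by (auto simp: gPQ is_end_def upw_proper_def opposite_def upw_swap[of l Q a b])
    next
      assume "Q = b"
      then show ?thesis
        using 3 down_segment_shared[of a b l P] ba P \<open>P \<noteq> Q\<close>
        by (auto simp: gPQ is_end_def upw_proper_def opposite_def upw_swap[of l P a b]
            down_swap[of l a P b])
    qed
  next
    case 4
    then have "seg (a, b) \<inter> seg (P, Q) = {}"
      using seg by (auto simp: gPQ is_end_def doubleton_eq_iff)
    from down_segment_disjoint[OF \<open>l \<noteq> 0\<close> this]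
    have d: "down l b (P, Q) = down l a (P, Q) + upw l P (a, b) - upw l Q (a, b)" by simp
    show ?thesis using 4 by (auto simp: gPQ is_end_def upw_proper_def d)
  qed
qed

text \<open>Walking from \<open>a\<close> to \<open>b\<close>, the number of edges below changes at
  each edge end that lies below \<open>ab\<close>, and is corrected by the edges at \<open>a\<close>
  and at \<open>b\<close> that start out below \<open>ab\<close>. All dependence on the shape of
  \<open>E\<close> is in the ends, so in a closed curve the middle sum cancels.\<close>

lemma count_parity:
  assumes "finite E" "l \<noteq> 0" "det2 (b - a) l \<noteq> 0"
    and "\<And>g. g \<in> E \<Longrightarrow> det2 (snd g - fst g) l \<noteq> 0"
    and "\<And>g. g \<in> E \<Longrightarrow>
      seg (a, b) \<inter> seg g \<subseteq> {a, b} \<inter> {fst g, snd g} \<or> {fst g, snd g} = {a, b}"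
  shows "even (count_below l E a + count_below l E b
    + (\<Sum>g\<in>E. upw_proper l a b (fst g) + upw_proper l a b (snd g))
    + count_under l E a b + count_under l E b a)"
proof -
  let ?t = "\<lambda>g. (if is_end a g then 0 else down l a g) + (if is_end b g then 0 else down l b g)
    + (upw_proper l a b (fst g) + upw_proper l a b (snd g))
    + (if is_end a g \<and> \<not> is_end b g then of_bool (under l (b - a) (opposite a g - a)) else 0)
    + (if is_end b g \<and> \<not> is_end a g then of_bool (under l (a - b) (opposite b g - b)) else 0)"
  have "even (\<Sum>g\<in>E. ?t g)"
    by (rule dvd_sum, rule segment_parity[OF assms(2,3)]) (rule assms(4,5), assumption)+
  then show ?thesis
    by (simp only: count_below_def count_under_def sum.distrib)
qed

section \<open>Closed polygons\<close>

definition crossings :: "complex \<Rightarrow> (complex \<times> complex) set \<Rightarrow> complex \<Rightarrow> int" where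
  "crossings l E z = (\<Sum>g\<in>E. down l z g)"

text \<open>Several disjoint closed polygons are allowed; only the telescoping of sums over the ends
  is needed from this notion.\<close>

definition closed_chain :: "(complex \<times> complex) set \<Rightarrow> bool" where
  "closed_chain E \<longleftrightarrow> finite E \<and> inj_on fst E \<and> inj_on snd E \<and> fst ` E = snd ` E"

lemma closed_chain_sum:
  fixes f :: "complex \<Rightarrow> int"
  assumes "closed_chain E"
  shows "(\<Sum>g\<in>E. f (fst g) - f (snd g)) = 0"
proof -
  have inj: "inj_on fst E" "inj_on snd E"
    using assms by (simp_all add: closed_chain_def)
  have "(\<Sum>g\<in>E. f (fst g)) = sum f (fst ` E)" "(\<Sum>g\<in>E. f (snd g)) = sum f (snd ` E)"
    using sum.reindex[OF inj(1), of f] sum.reindex[OF inj(2), of f] by (simp_all add: o_def)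
  then show ?thesis using assms by (simp add: sum_subtractf closed_chain_def)
qed

text \<open>By \<open>down_segment_disjoint\<close> the difference is a sum of terms
  \<open>upw\<close> at starts minus ends of the edges, which cancels around the chain.\<close>

lemma crossings_segment:
  assumes "closed_chain E" "l \<noteq> 0" "\<And>g. g \<in> E \<Longrightarrow> seg (a, b) \<inter> seg g = {}"
  shows "crossings l E a = crossings l E b"
proof -
  have "crossings l E b - crossings l E a = (\<Sum>g\<in>E. upw l (fst g) (a, b) - upw l (snd g) (a, b))"
    unfolding crossings_def sum_subtractf[symmetric]
    using down_segment_disjoint[OF assms(2), of a b "fst g" "snd g" for g] assms(3)
    by (intro sum.cong[OF HOL.refl]) simp
  then show ?thesis using closed_chain_sum[OF assms(1), of "\<lambda>p. upw l p (a, b)"] by simp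
qed

definition trace :: "(complex \<times> complex) set \<Rightarrow> complex set" where
  "trace E = (\<Union>g\<in>E. seg g)"

lemma compact_trace: "finite E \<Longrightarrow> compact (trace E)"
  by (auto simp: trace_def seg_def intro!: compact_UN)

lemma crossings_constant:
  assumes "closed_chain E" "l \<noteq> 0" "connected S" "open S" "S \<inter> trace E = {}" "a \<in> S" "b \<in> S"
  shows "crossings l E a = crossings l E b"
proof (rule connected_local_const[where f = "crossings l E", OF assms(3,6,7)], rule ballI)
  fix x assume "x \<in> S"
  then obtain r where r: "r > 0" "ball x r \<subseteq> S" using \<open>open S\<close> openE by blast
  have "crossings l E x = crossings l E y" if "y \<in> ball x r" for y
  proof (rule crossings_segment[OF assms(1,2)])
    fix g assume "g \<in> E"
    have "seg (x, y) \<subseteq> ball x r"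
      unfolding seg_def by (intro closed_segment_subset) (use that r in auto)
    then show "seg (x, y) \<inter> seg g = {}"
      using r assms(5) \<open>g \<in> E\<close> unfolding trace_def by blast
  qed
  then show "\<forall>\<^sub>F y in at x within S. crossings l E x = crossings l E y"
    unfolding eventually_at using r(1) by (metis dist_commute mem_ball)
qed

text \<open>For each edge the quantity tested by \<open>above\<close> is affine in \<open>T\<close>,
  with slope minus a square, so it is eventually not positive.\<close>

lemma crossings_far_below:
  assumes "finite E"
  shows "\<forall>\<^sub>F T in at_top. crossings l E (z - of_real T * l) = 0"
proof -
  have "\<forall>\<^sub>F T in at_top. \<forall>g\<in>E. \<not> above l (z - of_real T * l) g"
  proof (intro eventually_ball_finite[OF assms] ballI)
    fix g assume "g \<in> E"
    define d where "d = det2 (snd g - fst g) l"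
    define c where "c = det2 (snd g - fst g) (z - fst g)"
    have "z - of_real T * l - fst g = (z - fst g) - of_real T * l" for T
      by simp
    then have *: "det2 (snd g - fst g) (z - of_real T * l - fst g) * d = (c - T * d) * d" for T
      unfolding d_def c_def by (simp only: det2_linear(4,8))
    have "(c - T * d) * d \<le> 0" if "T \<ge> \<bar>c / d\<bar>" for T
    proof (cases "d = 0")
      case False
      then have "c / d - T \<le> 0" using that by linarith
      moreover have "(c - T * d) * d = (c / d - T) * d\<^sup>2"
        using False by (simp add: field_simps power2_eq_square)
      ultimately show ?thesis by (simp add: mult_nonpos_nonneg)
    qed simp
    then show "\<forall>\<^sub>F T in at_top. \<not> above l (z - of_real T * l) g"
      unfolding above_def d_def[symmetric] * eventually_at_top_linorder by (meson not_less)
  qed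
  then show ?thesis
    by eventually_elim (simp add: crossings_def down_def)
qed

lemma eventually_left_right_in:
  assumes "open U" "x \<in> U"
  shows "\<forall>\<^sub>F \<delta> in at_right 0. seg (x - of_real \<delta> * \<i> * d, x + of_real \<delta> * \<i> * d) \<subseteq> U"
proof -
  obtain r where r: "r > 0" "ball x r \<subseteq> U" using assms openE by blast
  have "((\<lambda>\<delta>. \<delta> * cmod d) \<longlongrightarrow> 0 * cmod d) (at_right 0)"
    by (intro tendsto_intros)
  then have "\<forall>\<^sub>F \<delta> in at_right 0. \<delta> * cmod d < r"
    using r by (intro order_tendstoD) auto
  moreover have "\<forall>\<^sub>F \<delta>::real in at_right 0. \<delta> > 0"
    by (simp add: eventually_at_right_less)
  ultimately show ?thesis
  proof eventually_elim
    case (elim \<delta>)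
    then have "x - of_real \<delta> * \<i> * d \<in> ball x r" "x + of_real \<delta> * \<i> * d \<in> ball x r"
      by (auto simp: dist_norm norm_mult)
    then have "seg (x - of_real \<delta> * \<i> * d, x + of_real \<delta> * \<i> * d) \<subseteq> ball x r"
      unfolding seg_def by (intro closed_segment_subset) auto
    then show ?case using r by blast
  qed
qed

lemma det2_left: "det2 d (x + of_real \<delta> * \<i> * d - P) = det2 d (x - P) + \<delta> * (cmod d)\<^sup>2"
  "det2 d (x - of_real \<delta> * \<i> * d - P) = det2 d (x - P) - \<delta> * (cmod d)\<^sup>2"
  unfolding cmod_power2 by (simp_all add: det2_def algebra_simps power2_eq_square)

lemma det2_on_segment:
  assumes "x \<in> closed_segment P Q" shows "det2 (Q - P) (x - P) = 0"
proof -
  obtain u where x: "x = (1 - u) *\<^sub>R P + u *\<^sub>R Q"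
    using assms by (auto simp: in_segment)
  show ?thesis unfolding x by (simp add: det2_def algebra_simps)
qed

lemma open_segment_strictly_between:
  assumes "x \<in> open_segment P Q" "lefter l P Q" shows "lefter l P x" "lefter l x Q"
proof -
  obtain u where u: "0 < u" "u < 1" "x = (1 - u) *\<^sub>R P + u *\<^sub>R Q"
    using assms(1) by (auto simp: in_segment)
  have eq: "det2 x l - det2 P l = u * (det2 Q l - det2 P l)"
    "det2 Q l - det2 x l = (1 - u) * (det2 Q l - det2 P l)"
    by (simp_all add: u(3) det2_def algebra_simps)
  have "0 < det2 x l - det2 P l" "0 < det2 Q l - det2 x l"
    unfolding eq using assms(2) u(1,2) by (simp_all add: lefter_def)
  then show "lefter l P x" "lefter l x Q"
    by (simp_all add: lefter_def)
qed

text \<open>Passing an edge from its right to its left raises the signed count by one. This fixes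
  the orientation conventions for everything below.\<close>

lemma crossings_jump:
  assumes ch: "closed_chain E" and l: "l \<noteq> 0" and e: "e \<in> E"
    and ne: "det2 (snd e - fst e) l \<noteq> 0"
    and x: "x \<in> open_segment (fst e) (snd e)"
    and others: "\<And>g. g \<in> E \<Longrightarrow> g \<noteq> e \<Longrightarrow> x \<notin> seg g"
  defines "d \<equiv> snd e - fst e"
  shows "\<forall>\<^sub>F \<delta> in at_right 0. crossings l E (x + of_real \<delta> * \<i> * d)
             = crossings l E (x - of_real \<delta> * \<i> * d) + 1 \<and>
           x + of_real \<delta> * \<i> * d \<notin> trace E \<and> x - of_real \<delta> * \<i> * d \<notin> trace E"
proof -
  obtain P Q where ePQ: "e = (P, Q)" by (cases e)
  have fin: "finite E" using ch by (simp add: closed_chain_def)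
  define U where "U = - trace (E - {e}) \<inter> {z. lefter l P z = lefter l P Q} \<inter> {z. lefter l z Q = lefter l P Q}
     \<inter> {z. lefter l Q z = lefter l Q P} \<inter> {z. lefter l z P = lefter l Q P}"
  \<comment> \<open>In \<open>V\<close> only the edge \<open>e\<close> can be met, and the
    horizontal position relative to both ends of \<open>e\<close> never changes.\<close>
  define V where "V = - trace (E - {e}) \<inter>
     (if lefter l P Q then {z. lefter l P z} \<inter> {z. lefter l z Q}
      else {z. lefter l Q z} \<inter> {z. lefter l z P})"
  have dl: "det2 d l = det2 Q l - det2 P l" by (simp add: d_def ePQ det2_linear)
  have "open {z. lefter l A z}" "open {z. lefter l z A}" for A
    unfolding lefter_def by (auto intro!: open_Collect_less continuous_intros)
  moreover have "closed (trace (E - {e}))"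
    using fin by (intro compact_imp_closed compact_trace) simp
  ultimately have "open V"
    unfolding V_def by (auto intro!: open_Int)
  have QP: "lefter l Q P" if "\<not> lefter l P Q"
    using that ne by (auto simp: lefter_def ePQ det2_linear)
  have "x \<in> V"
    using others open_segment_strictly_between[of x P Q l] open_segment_strictly_between[of x Q P l]
      x QP by (auto simp: V_def trace_def ePQ open_segment_commute)
  have V: "lefter l P z \<longleftrightarrow> lefter l P Q" "lefter l Q z \<longleftrightarrow> \<not> lefter l P Q" if "z \<in> V" for z
    using that unfolding V_def lefter_def by (auto split: if_splits)
  have dx: "det2 d (x - P) = 0"
    using x unfolding d_def ePQ fst_conv snd_conv
    by (intro det2_on_segment) (auto simp: open_segment_def)
  have dpos: "cmod d > 0" using ne by (auto simp: d_def)
  have "\<forall>\<^sub>F \<delta>::real in at_right 0. \<delta> > 0"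
    by (simp add: eventually_at_right_less)
  with eventually_left_right_in[OF \<open>open V\<close> \<open>x \<in> V\<close>, of d]
  show ?thesis
  proof eventually_elim
    case (elim \<delta>)
    define a b where "a = x - of_real \<delta> * \<i> * d" and "b = x + of_real \<delta> * \<i> * d"
    have ab: "seg (a, b) \<subseteq> V" "a \<in> V" "b \<in> V"
      using elim by (auto simp: a_def b_def seg_def)
    have det: "det2 d (b - P) = \<delta> * (cmod d)\<^sup>2" "det2 d (a - P) = - (\<delta> * (cmod d)\<^sup>2)"
      using dx by (simp_all add: a_def b_def det2_left)
    have pos: "\<delta> * (cmod d)\<^sup>2 > 0" using elim dpos by simp
    have above: "above l b (P, Q) \<longleftrightarrow> det2 d l > 0" "above l a (P, Q) \<longleftrightarrow> det2 d l < 0"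
      using pos by (simp_all add: above_def d_def[unfolded ePQ fst_conv snd_conv, symmetric] det
          zero_less_mult_iff mult_less_0_iff)
    have e1: "down l b e - down l a e = 1"
      using V[OF ab(2)] V[OF ab(3)] ne unfolding ePQ down_def fst_conv snd_conv above dl
      by (auto simp: lefter_def ePQ det2_linear)
    have "(\<Sum>g\<in>E - {e}. down l b g) - (\<Sum>g\<in>E - {e}. down l a g)
        = (\<Sum>g\<in>E - {e}. upw l (fst g) (a, b) - upw l (snd g) (a, b))"
      unfolding sum_subtractf[symmetric]
    proof (rule sum.cong[OF HOL.refl])
      fix g assume "g \<in> E - {e}"
      then have "seg (a, b) \<inter> seg g = {}"
        using ab(1) by (auto simp: V_def trace_def)
      then show "down l b g - down l a g = upw l (fst g) (a, b) - upw l (snd g) (a, b)"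
        by (metis l down_segment_disjoint prod.collapse)
    qed
    \<comment> \<open>The chain closes only with \<open>e\<close>, so the other edges sum to minus
      the term of \<open>e\<close>. That term vanishes because \<open>a\<close> and \<open>b\<close>
      are horizontally on the same side of either end.\<close>
    also have "\<dots> = - (upw l (fst e) (a, b) - upw l (snd e) (a, b))"
      using closed_chain_sum[OF ch, of "\<lambda>p. upw l p (a, b)"] fin e by (simp add: sum_diff1)
    also have "\<dots> = 0"
      using V[OF ab(2)] V[OF ab(3)] by (simp add: upw_def ePQ)
    finally have "crossings l E b = crossings l E a + 1"
      using e1 fin e by (simp add: crossings_def sum.remove)
    moreover have "a \<notin> seg e" "b \<notin> seg e"
      using det pos det2_on_segment[of _ P Q] by (auto simp: seg_def ePQ d_def)
    moreover have "a \<notin> trace (E - {e})" "b \<notin> trace (E - {e})"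
      using ab by (auto simp: V_def)
    ultimately show ?case
      unfolding a_def[symmetric] b_def[symmetric] by (auto simp: trace_def)
  qed
qed

section \<open>Simple polygons and the Jordan curve theorem\<close>

definition simple_chain :: "(complex \<times> complex) set \<Rightarrow> bool" where
  "simple_chain E \<longleftrightarrow>
     (\<forall>e\<in>E. \<forall>g\<in>E. e \<noteq> g \<longrightarrow> seg e \<inter> seg g \<subseteq> {fst e, snd e} \<inter> {fst g, snd g})"

text \<open>The parametrised form of a polygonal path, needed to apply the Jordan curve theorem. The
  last equation is a default value for lists with fewer than two points.\<close>

fun polypath :: "complex list \<Rightarrow> real \<Rightarrow> complex" where
  "polypath (a # b # c # xs) = linepath a b +++ polypath (b # c # xs)"
| "polypath [a, b] = linepath a b"
| "polypath xs = linepath 0 0"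

lemma polypath_arc:
  assumes "distinct xs" "length xs \<ge> 2" "simple_chain (set (zip xs (tl xs)))"
  shows "arc (polypath xs) \<and> pathstart (polypath xs) = hd xs \<and> pathfinish (polypath xs) = last xs \<and>
    path_image (polypath xs) = trace (set (zip xs (tl xs)))"
  using assms
proof (induction xs rule: polypath.induct)
  case (1 a b c xs)
  let ?E = "set (zip (b # c # xs) (c # xs))"
  have "simple_chain ?E"
    using 1(4) by (auto simp: simple_chain_def)
  then have IH: "arc (polypath (b # c # xs))" "pathstart (polypath (b # c # xs)) = b"
    "pathfinish (polypath (b # c # xs)) = last (b # c # xs)"
    "path_image (polypath (b # c # xs)) = trace ?E"
    using 1(1,2) by auto
  have "seg (a, b) \<inter> seg g \<subseteq> {b}" if "g \<in> ?E" for g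
  proof -
    have ends: "fst g \<noteq> a" "snd g \<noteq> a"
      using that 1(2) set_zip_leftD[of "fst g" "snd g" "b # c # xs" "c # xs"]
        set_zip_rightD[of "fst g" "snd g" "b # c # xs" "c # xs"] by auto
    then have "(a, b) \<noteq> g" by auto
    moreover have "(a, b) \<in> set (zip (a # b # c # xs) (tl (a # b # c # xs)))"
      "g \<in> set (zip (a # b # c # xs) (tl (a # b # c # xs)))"
      using that by auto
    ultimately have "seg (a, b) \<inter> seg g \<subseteq> {a, b} \<inter> {fst g, snd g}"
      using 1(4) unfolding simple_chain_def by (metis fst_conv snd_conv)
    then show ?thesis using ends by auto
  qed
  then have int: "path_image (linepath a b) \<inter> path_image (polypath (b # c # xs))
      \<subseteq> {pathstart (polypath (b # c # xs))}"
    unfolding IH trace_def by (fastforce simp: seg_def)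
  have "arc (linepath a b +++ polypath (b # c # xs))"
    using 1(2) IH int by (intro arc_join) auto
  then show ?case
    using IH by (auto simp: path_image_join trace_def seg_def)
qed (auto simp: trace_def seg_def)

lemma set_zip_snoc: "set (zip (a # ys) (ys @ [b])) = insert (last (a # ys), b) (set (zip (a # ys) ys))"
  by (induction ys arbitrary: a) auto

lemma set_zip_rotate1:
  assumes "xs \<noteq> []"
  shows "set (zip xs (rotate1 xs)) = insert (last xs, hd xs) (set (zip xs (tl xs)))"
  using assms set_zip_snoc[of "hd xs" "tl xs" "hd xs"] by (cases xs) simp_all

lemma closed_chain_rotate1:
  assumes "distinct xs" shows "closed_chain (set (zip xs (rotate1 xs)))"
proof -
  have "map fst (zip xs (rotate1 xs)) = xs" "map snd (zip xs (rotate1 xs)) = rotate1 xs"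
    by simp_all
  then have "distinct (map fst (zip xs (rotate1 xs)))" "distinct (map snd (zip xs (rotate1 xs)))"
    "set (map fst (zip xs (rotate1 xs))) = set (map snd (zip xs (rotate1 xs)))"
    using assms by simp_all
  then show ?thesis
    unfolding closed_chain_def distinct_map by (metis List.finite_set list.set_map)
qed

lemma polygon_simple_path:
  assumes "distinct xs" "length xs \<ge> 2" "simple_chain (set (zip xs (rotate1 xs)))"
  obtains c where "simple_path c" "pathfinish c = pathstart c"
    "path_image c = trace (set (zip xs (rotate1 xs)))"
proof -
  let ?E = "set (zip xs (tl xs))"
  have ne: "xs \<noteq> []" using assms by auto
  have E: "set (zip xs (rotate1 xs)) = insert (last xs, hd xs) ?E"
    by (rule set_zip_rotate1[OF ne])
  have "simple_chain ?E" using assms(3) unfolding E by (auto simp: simple_chain_def)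
  note arc = polypath_arc[OF assms(1,2) this]
  have hl: "last xs \<noteq> hd xs"
    using assms(1,2) by (cases xs) (auto split: if_splits)
  have "seg (last xs, hd xs) \<inter> seg g \<subseteq> {hd xs, last xs}" if "g \<in> ?E" for g
  proof -
    have "snd g \<in> set (tl xs)" using that by (metis prod.collapse set_zip_rightD)
    moreover have "hd xs \<notin> set (tl xs)" using assms(1) ne by (cases xs) auto
    ultimately have "g \<noteq> (last xs, hd xs)" by auto
    then show ?thesis
      using assms(3) that unfolding E simple_chain_def by fastforce
  qed
  then have "simple_path (polypath xs +++ linepath (last xs) (hd xs))"
    using arc hl by (intro simple_path_join_loop) (auto simp: trace_def seg_def)
  moreover have "path_image (polypath xs +++ linepath (last xs) (hd xs)) = trace (set (zip xs (rotate1 xs)))"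
    using arc unfolding E by (auto simp: path_image_join trace_def seg_def)
  ultimately show ?thesis using that arc by fastforce
qed

text \<open>The crossing number is constant on either component of the complement, zero on the outer
  one by a look at a point far below, and it jumps by one across an edge. Hence it is 1 or -1
  inside, according to the orientation.\<close>

theorem polygon_Jordan:
  assumes "distinct xs" "length xs \<ge> 2" and E: "E = set (zip xs (rotate1 xs))"
    and sc: "simple_chain E" and l: "l \<noteq> 0"
    and e: "e \<in> E" "det2 (snd e - fst e) l \<noteq> 0"
  obtains s :: int where "s = 1 \<or> s = -1"
    "\<And>z. z \<in> inside (trace E) \<Longrightarrow> crossings l E z = s"
    "\<And>z. z \<in> outside (trace E) \<Longrightarrow> crossings l E z = 0"
    "connected (inside (trace E))" "connected (outside (trace E))"
proof -
  obtain c where c: "simple_path c" "pathfinish c = pathstart c" "path_image c = trace E"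
    using polygon_simple_path assms by metis
  have J: "open (inside (trace E))" "connected (inside (trace E))" "open (outside (trace E))"
    "connected (outside (trace E))" "bounded (inside (trace E))"
    using Jordan_inside_outside[OF c(1,2)] unfolding c(3) by auto
  have ch: "closed_chain E" using closed_chain_rotate1 assms by simp
  then have fin: "finite E" by (simp add: closed_chain_def)
  have bd: "bounded (trace E)" using compact_trace[OF fin] compact_imp_bounded by blast
  \<comment> \<open>One point far below serves twice: beyond the bound \<open>r\<close> it lies in
    the outer component, and its crossing number is zero.\<close>
  obtain r where r: "\<And>z. z \<in> trace E \<union> inside (trace E) \<Longrightarrow> cmod z \<le> r"
    using bd J(5) by (metis bounded_Un bounded_iff)
  have "\<forall>\<^sub>F T in at_top. (r + 1) / cmod l \<le> T"
    by (rule eventually_ge_at_top)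
  then have "\<forall>\<^sub>F T in at_top. crossings l E (0 - of_real T * l) = 0 \<and> (r + 1) / cmod l \<le> T"
    by (intro eventually_conj crossings_far_below[OF fin])
  then obtain T where T: "crossings l E (0 - of_real T * l) = 0" "(r + 1) / cmod l \<le> T"
    using eventually_happens'[OF trivial_limit_at_top_linorder] by blast
  have "r + 1 \<le> \<bar>T\<bar> * cmod l" using T(2) l
    by (smt (verit) divide_le_eq mult_right_mono norm_ge_zero zero_less_norm_iff)
  then have "0 - of_real T * l \<notin> trace E \<union> inside (trace E)"
    using r[of "0 - of_real T * l"] by (auto simp: norm_mult)
  then have w: "0 - of_real T * l \<in> outside (trace E)"
    using inside_Un_outside[of "trace E"] by blast
  have out: "crossings l E z = 0" if "z \<in> outside (trace E)" for z
    using crossings_constant[OF ch l J(4,3) _ that w] outside_no_overlap T(1) by auto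
  obtain x where x: "x \<in> open_segment (fst e) (snd e)"
    using e(2) by (metis open_segment_eq_empty det2_simps(1) diff_self ex_in_conv)
  have "x \<notin> seg g" if "g \<in> E" "g \<noteq> e" for g
    using sc e that x unfolding simple_chain_def seg_def open_segment_def by fastforce
  from crossings_jump[OF ch l e x this]
  have "\<forall>\<^sub>F \<delta> in at_right 0. crossings l E (x + of_real \<delta> * \<i> * (snd e - fst e))
             = crossings l E (x - of_real \<delta> * \<i> * (snd e - fst e)) + 1 \<and>
           x + of_real \<delta> * \<i> * (snd e - fst e) \<notin> trace E \<and>
           x - of_real \<delta> * \<i> * (snd e - fst e) \<notin> trace E" .
  then obtain a b where ab: "a \<notin> trace E" "b \<notin> trace E" "crossings l E b = crossings l E a + 1"
    by (metis (mono_tags, lifting) eventually_happens' trivial_limit_at_right_real)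
  have const: "crossings l E y = crossings l E z" if "y \<in> inside (trace E)" "z \<in> inside (trace E)" for y z
    using crossings_constant[OF ch l J(2,1) _ that] inside_no_overlap by auto
  have io: "z \<in> inside (trace E) \<or> z \<in> outside (trace E)" if "z \<notin> trace E" for z
    using that inside_Un_outside by blast
  \<comment> \<open>The values at \<open>a\<close> and \<open>b\<close> differ, so one of the two
    points is inside. If both were inside or both outside, constancy would make the values
    equal.\<close>
  have "(a \<in> inside (trace E) \<and> crossings l E a = -1) \<or> (b \<in> inside (trace E) \<and> crossings l E b = 1)"
    using ab(3) io[OF ab(1)] io[OF ab(2)] out[of a] out[of b] const[of a b] by auto
  then obtain y s where "y \<in> inside (trace E)" "crossings l E y = s" "s = 1 \<or> s = -1" by blast
  then show ?thesis using that[of s] const out J by blast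
qed

section \<open>Plabic networks in the disc\<close>

text \<open>What remains of \<open>plabic_network\<close> without colours, weights, valencies and
  orientation. It holds at every moment of a deformation.\<close>

definition drawn_network :: "'v network \<Rightarrow> bool" where
  "drawn_network N \<longleftrightarrow> plane_drawing N \<and> finite (internals N) \<and>
     arcs N \<subseteq> vertices N \<times> vertices N \<and> (\<forall>e\<in>arcs N. fst e \<noteq> snd e)"

lemma plabic_drawn: "plabic_network N \<Longrightarrow> drawn_network N"
  by (simp add: plabic_network_def drawn_network_def)

lemma finite_vertices: "drawn_network N \<Longrightarrow> finite (vertices N)"
  by (simp add: drawn_network_def vertices_def)

lemma finite_arcs: "drawn_network N \<Longrightarrow> finite (arcs N)"
  by (metis drawn_network_def finite_cartesian_product finite_subset finite_vertices)

lemma arc_vertices: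
  assumes "drawn_network N" "e \<in> arcs N"
  shows "fst e \<in> vertices N" "snd e \<in> vertices N" "fst e \<noteq> snd e"
  using assms by (auto simp: drawn_network_def)

lemma Internal_vertices [simp]: "Internal u \<in> vertices N \<longleftrightarrow> u \<in> internals N"
  by (auto simp: vertices_def)

lemma Boundary_vertices [simp]: "Boundary j \<in> vertices N \<longleftrightarrow> j \<in> {1..bdcount N}"
  by (auto simp: vertices_def)

lemma pos_eq_iff:
  assumes "drawn_network N" "v \<in> vertices N" "w \<in> vertices N"
  shows "pos N v = pos N w \<longleftrightarrow> v = w"
  using assms by (auto simp: drawn_network_def plane_drawing_def inj_on_eq_iff)

lemma boundary_on_circle:
  assumes "drawn_network N" "j \<in> {1..bdcount N}"
  shows "dist (center N) (bpos N j) = radius N"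
proof -
  have "radius N > 0" using assms by (simp add: drawn_network_def plane_drawing_def)
  then show ?thesis
    using assms by (auto simp: drawn_network_def plane_drawing_def clockwise_boundary_def
        dist_norm norm_mult)
qed

lemma vertex_in_cball:
  assumes "drawn_network N" "v \<in> vertices N"
  shows "pos N v \<in> cball (center N) (radius N)"
proof (cases v)
  case (Boundary j)
  then show ?thesis using boundary_on_circle assms by fastforce
next
  case (Internal u)
  then show ?thesis using assms
    by (auto simp: drawn_network_def plane_drawing_def disc_def)
qed

lemma edge_seg_seg: "edge_seg N e = seg (pos N (fst e), pos N (snd e))"
  by (simp add: edge_seg_def seg_def)

lemma seg_in_cball: "a \<in> cball c r \<Longrightarrow> b \<in> cball c r \<Longrightarrow> seg (a, b) \<subseteq> cball c r"
  unfolding seg_def by (simp add: closed_segment_subset)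

lemma edges_meet:
  assumes "drawn_network N" "e \<in> arcs N" "f \<in> arcs N" "e \<noteq> f"
  shows "edge_seg N e \<inter> edge_seg N f \<subseteq> pos N ` (ends e \<inter> ends f)"
  using assms by (auto simp: drawn_network_def plane_drawing_def)

text \<open>Two different arcs with the same ends would have the same segment and meet only in
  finitely many points, although a proper segment is infinite.\<close>

lemma arc_eqI:
  assumes "drawn_network N" "e \<in> arcs N" "f \<in> arcs N" "ends e = ends f"
  shows "e = f"
proof (rule ccontr)
  assume "e \<noteq> f"
  have v: "fst e \<in> vertices N" "snd e \<in> vertices N" "fst e \<noteq> snd e"
    using arc_vertices[OF assms(1,2)] by auto
  have "edge_seg N e = edge_seg N f"
    using assms(4) by (auto simp: ends_def edge_seg_def doubleton_eq_iff closed_segment_commute)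
  then have "edge_seg N e \<subseteq> pos N ` ends e"
    using edges_meet[OF assms(1-3) \<open>e \<noteq> f\<close>] by auto
  then have "finite (edge_seg N e)"
    by (rule finite_subset) (simp add: ends_def)
  then have "pos N (fst e) = pos N (snd e)"
    unfolding edge_seg_def by (simp add: finite_closed_segment)
  then show False using v pos_eq_iff[OF assms(1)] by auto
qed

lemma no_antiparallel:
  assumes "drawn_network N" "(u, v) \<in> arcs N" shows "(v, u) \<notin> arcs N"
  using arc_eqI[OF assms(1) assms(2), of "(v, u)"] arc_vertices[OF assms] by (auto simp: ends_def)

text \<open>The part of \<open>gauge_direction\<close> that survives throughout a deformation, when
  edges may become parallel to \<open>l\<close> and vertices may lie on rays.\<close>

definition admissible :: "'v network \<Rightarrow> complex \<Rightarrow> bool" where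
  "admissible N l \<longleftrightarrow> l \<noteq> 0 \<and> (\<forall>j\<in>{1..bdcount N}. ray (bpos N j) l \<inter> disc N \<noteq> {})"

lemma gauge_admissible: "gauge_direction N l \<Longrightarrow> admissible N l"
  by (simp add: gauge_direction_def admissible_def)

text \<open>A point of the circle is not strictly between a point of the open disc and a point of
  the closed disc, since the norm would be too small there.\<close>

lemma not_between_cball:
  fixes b l :: complex
  assumes "dist c b = r" "b + of_real t * l \<in> ball c r" "b - of_real a * l \<in> cball c r" "t > 0"
  shows "a \<le> 0"
proof (rule ccontr)
  assume "\<not> a \<le> 0"
  then have a: "a > 0" by simp
  let ?y = "b + of_real t * l" and ?z = "b - of_real a * l"
  have "(t + a) *\<^sub>R (c - b) = a *\<^sub>R (c - ?y) + t *\<^sub>R (c - ?z)"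
    by (simp add: scaleR_conv_of_real algebra_simps)
  moreover have scale: "norm (s *\<^sub>R w) = s * norm w" if "s > 0" for s and w :: complex
    using that by simp
  ultimately have "(t + a) * norm (c - b) = norm (a *\<^sub>R (c - ?y) + t *\<^sub>R (c - ?z))"
    using a assms(4) by (metis add_pos_pos)
  also have "\<dots> \<le> a * norm (c - ?y) + t * norm (c - ?z)"
    using norm_triangle_ineq scale[OF a] scale[OF assms(4)] by metis
  finally have "(t + a) * norm (c - b) \<le> a * norm (c - ?y) + t * norm (c - ?z)" .
  moreover have "a * norm (c - ?y) < a * r" "t * norm (c - ?z) \<le> t * r"
    using assms a by (auto simp: dist_norm)
  ultimately show False
    using assms(1) by (simp add: dist_norm algebra_simps)
qed

text \<open>The ray from a boundary vertex enters the disc upwards, so by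
  \<open>not_between_cball\<close> no point of the closed disc is below it. Within the disc, gauge
  rays may therefore be replaced by full vertical lines.\<close>

lemma on_vertical_line:
  assumes "drawn_network N" "admissible N l" "j \<in> {1..bdcount N}"
    and "z \<in> cball (center N) (radius N)" "det2 z l = det2 (bpos N j) l"
  shows "z = bpos N j \<or> z \<in> ray (bpos N j) l"
proof -
  have "det2 (z - bpos N j) l = 0" "l \<noteq> 0"
    using assms by (simp_all add: det2_linear admissible_def)
  then obtain a where a: "z - bpos N j = of_real a * l" by (rule det2_zero_imp)
  obtain t where t: "t > 0" "bpos N j + of_real t * l \<in> disc N"
    using assms(2,3) unfolding admissible_def ray_def by blast
  have "z = bpos N j - of_real (- a) * l" using a by (simp add: algebra_simps)
  then have "- a \<le> 0"
    using not_between_cball[OF boundary_on_circle[OF assms(1,3)], of t l "- a"] t assms(4)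
    by (simp add: disc_def)
  then consider "a = 0" | "a > 0" by linarith
  then show ?thesis
  proof cases
    case 2
    moreover have "z = bpos N j + of_real a * l" using a by (simp add: algebra_simps)
    ultimately show ?thesis unfolding ray_def by blast
  qed (use a in simp)
qed

lemma ray_iff:
  assumes "drawn_network N" "admissible N l" "j \<in> {1..bdcount N}"
    and "z \<in> cball (center N) (radius N)" "z \<noteq> bpos N j"
  shows "z \<in> ray (bpos N j) l \<longleftrightarrow> det2 z l = det2 (bpos N j) l"
proof
  assume "z \<in> ray (bpos N j) l"
  then show "det2 z l = det2 (bpos N j) l" by (auto simp: ray_def det2_linear)
qed (use on_vertical_line[OF assms(1-4)] assms(5) in auto)

lemma apex_notin_ray: "l \<noteq> 0 \<Longrightarrow> b \<notin> ray b l"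
  by (auto simp: ray_def)

text \<open>Two boundary vertices on one vertical line would each lie strictly above the
  other.\<close>

lemma boundary_det2_ne:
  assumes "drawn_network N" "admissible N l" "i \<in> {1..bdcount N}" "j \<in> {1..bdcount N}" "i \<noteq> j"
  shows "det2 (bpos N i) l \<noteq> det2 (bpos N j) l"
proof
  assume eq: "det2 (bpos N i) l = det2 (bpos N j) l"
  have cb: "bpos N k \<in> cball (center N) (radius N)" if "k \<in> {1..bdcount N}" for k
    using vertex_in_cball[OF assms(1)] that by simp
  have "bpos N i \<noteq> bpos N j"
    using pos_eq_iff[OF assms(1), of "Boundary i" "Boundary j"] assms by simp
  then have "bpos N i \<in> ray (bpos N j) l" "bpos N j \<in> ray (bpos N i) l"
    using ray_iff[OF assms(1,2)] assms(3,4) cb eq by metis+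
  then obtain s t where st: "s > 0" "bpos N i = bpos N j + of_real s * l"
    "t > 0" "bpos N j = bpos N i + of_real t * l"
    unfolding ray_def by blast
  then have "of_real s * l = bpos N i - bpos N j" "of_real t * l = bpos N j - bpos N i"
    by (metis add_diff_cancel_left')+
  then have "complex_of_real (s + t) * l = 0" by (simp only: of_real_add distrib_right) simp
  moreover have "l \<noteq> 0" using assms by (simp add: admissible_def)
  ultimately have "complex_of_real (s + t) = 0" by (metis mult_eq_0_iff)
  then have "s + t = 0" by (simp only: of_real_eq_0_iff)
  then show False using st(1,3) by simp
qed

lemma vertex_det2_ne:
  assumes "drawn_network N" "gauge_direction N l" "j \<in> {1..bdcount N}" "v \<in> vertices N"
    "v \<noteq> Boundary j"
  shows "det2 (pos N v) l \<noteq> det2 (bpos N j) l"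
proof (cases v)
  case (Boundary i)
  then show ?thesis using boundary_det2_ne gauge_admissible assms by fastforce
next
  case (Internal u)
  then have "pos N v \<notin> ray (bpos N j) l" using assms by (auto simp: gauge_direction_def)
  moreover have "pos N v \<noteq> bpos N j"
    using pos_eq_iff[OF assms(1,4), of "Boundary j"] assms(3,5) by simp
  ultimately show ?thesis
    using ray_iff[OF assms(1) gauge_admissible[OF assms(2)] assms(3) vertex_in_cball[OF assms(1,4)]]
    by simp
qed

lemma edge_vec_ne:
  assumes "gauge_direction N l" "e \<in> arcs N" shows "det2 (edge_vec N e) l \<noteq> 0"
  using assms by (auto simp: gauge_direction_def turn_det2)

lemma sphere_point_in_segment:
  assumes "b \<in> seg (P, Q)" "P \<in> cball c r" "Q \<in> cball c r" "dist c b = r"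
  shows "b = P \<or> b = Q"
proof (rule ccontr)
  assume "\<not> ?thesis"
  then have "b \<in> open_segment P Q" using assms(1) by (auto simp: seg_def open_segment_def)
  from dist_decreases_open_segment[OF this, of c] show False using assms by auto
qed

lemma segment_line_point:
  assumes "det2 (Q - P) l \<noteq> 0"
  shows "finite (seg (P, Q) \<inter> {z. det2 z l = x})"
    "card (seg (P, Q) \<inter> {z. det2 z l = x}) =
      of_bool (min (det2 P l) (det2 Q l) \<le> x \<and> x \<le> max (det2 P l) (det2 Q l))"
proof -
  define s where "s = (x - det2 P l) / det2 (Q - P) l"
  have eq: "(1 - u) *\<^sub>R P + u *\<^sub>R Q = P + of_real u * (Q - P)" for u
    by (simp add: scaleR_conv_of_real algebra_simps)
  have det: "det2 (P + of_real u * (Q - P)) l = det2 P l + u * det2 (Q - P) l" for u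
    by (simp only: det2_linear(1,7))
  have "seg (P, Q) \<inter> {z. det2 z l = x} = (if 0 \<le> s \<and> s \<le> 1 then {P + of_real s * (Q - P)} else {})"
  proof (intro equalityI subsetI)
    fix z assume "z \<in> seg (P, Q) \<inter> {z. det2 z l = x}"
    then obtain u where u: "0 \<le> u" "u \<le> 1" "z = P + of_real u * (Q - P)" "det2 z l = x"
      unfolding seg_def by (auto simp: in_segment eq)
    then have "u * det2 (Q - P) l = x - det2 P l" using det[of u] by simp
    then have "u = s" using assms unfolding s_def by (simp add: eq_divide_eq)
    then show "z \<in> (if 0 \<le> s \<and> s \<le> 1 then {P + of_real s * (Q - P)} else {})" using u by simp
  next
    fix z assume "z \<in> (if 0 \<le> s \<and> s \<le> 1 then {P + of_real s * (Q - P)} else {})"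
    then have z: "0 \<le> s" "s \<le> 1" "z = P + of_real s * (Q - P)" by (auto split: if_splits)
    moreover have "det2 z l = x" unfolding z(3) det using assms by (simp add: s_def)
    moreover have "z \<in> seg (P, Q)"
      unfolding z(3) eq[symmetric] seg_def in_segment using z(1,2) by auto
    ultimately show "z \<in> seg (P, Q) \<inter> {z. det2 z l = x}"
      by simp
  qed
  moreover have "0 \<le> s \<and> s \<le> 1 \<longleftrightarrow> min (det2 P l) (det2 Q l) \<le> x \<and> x \<le> max (det2 P l) (det2 Q l)"
    using assms unfolding s_def
    by (cases "det2 (Q - P) l > 0")
      (auto simp: zero_le_divide_iff divide_le_eq_1 det2_linear min_def max_def)
  ultimately show "finite (seg (P, Q) \<inter> {z. det2 z l = x})"
    "card (seg (P, Q) \<inter> {z. det2 z l = x}) =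
      of_bool (min (det2 P l) (det2 Q l) \<le> x \<and> x \<le> max (det2 P l) (det2 Q l))"
    by auto
qed

definition side :: "'v network \<Rightarrow> complex \<Rightarrow> nat \<Rightarrow> 'v vertex \<Rightarrow> bool" where
  "side N l j v \<longleftrightarrow> lefter l (bpos N j) (pos N v)"

text \<open>Rays are vertical lines within the disc, so an edge not starting or ending at
  \<open>b\<^sub>j\<close> meets the ray in one point or none, according to whether the line
  separates its ends.\<close>

lemma card_edge_ray:
  assumes N: "drawn_network N" and l: "gauge_direction N l" and j: "j \<in> {1..bdcount N}"
    and e: "e \<in> arcs N"
  shows "card (edge_seg N e \<inter> ray (bpos N j) l) =
    of_bool (Boundary j \<notin> ends e \<and> side N l j (fst e) \<noteq> side N l j (snd e))"
proof -
  let ?P = "pos N (fst e)" and ?Q = "pos N (snd e)" and ?b = "bpos N j"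
  note v = arc_vertices[OF N e]
  note adm = gauge_admissible[OF l]
  have cb: "?P \<in> cball (center N) (radius N)" "?Q \<in> cball (center N) (radius N)"
    using vertex_in_cball[OF N] v by auto
  have ne: "det2 (?Q - ?P) l \<noteq> 0" using edge_vec_ne[OF l e] by (simp add: edge_vec_def)
  have l0: "l \<noteq> 0" using l by (simp add: gauge_direction_def)
  have sub: "edge_seg N e \<subseteq> cball (center N) (radius N)"
    unfolding edge_seg_seg by (rule seg_in_cball[OF cb])
  have "z \<in> ray ?b l \<longleftrightarrow> det2 z l = det2 ?b l \<and> z \<noteq> ?b" if "z \<in> edge_seg N e" for z
    using ray_iff[OF N adm j, of z] that sub apex_notin_ray[OF l0, of ?b] by blast
  then have eq: "edge_seg N e \<inter> ray ?b l = seg (?P, ?Q) \<inter> {z. det2 z l = det2 ?b l} - {?b}"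
    unfolding edge_seg_seg[symmetric] by blast
  note line = segment_line_point[OF ne, of "det2 ?b l"]
  have bs: "?b \<in> seg (?P, ?Q) \<longleftrightarrow> Boundary j \<in> ends e"
    using sphere_point_in_segment[OF _ cb boundary_on_circle[OF N j]]
      pos_eq_iff[OF N, of "Boundary j"] v j
    by (auto simp: ends_def seg_def)
  show ?thesis
  proof (cases "Boundary j \<in> ends e")
    case True
    \<comment> \<open>An edge at \<open>b\<^sub>j\<close> meets the vertical line in
      \<open>b\<^sub>j\<close> alone, and the starting point does not belong to the ray.\<close>
    then have "det2 ?P l = det2 ?b l \<or> det2 ?Q l = det2 ?b l" by (auto simp: ends_def)
    then have "card (seg (?P, ?Q) \<inter> {z. det2 z l = det2 ?b l}) = 1"
      using line(2) by auto
    then have "card (edge_seg N e \<inter> ray ?b l) = 0"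
      unfolding eq using True bs by (subst card_Diff_singleton) auto
    then show ?thesis using True by simp
  next
    case False
    then have "edge_seg N e \<inter> ray ?b l = seg (?P, ?Q) \<inter> {z. det2 z l = det2 ?b l}"
      unfolding eq using bs by auto
    moreover have "det2 ?P l \<noteq> det2 ?b l" "det2 ?Q l \<noteq> det2 ?b l"
      using vertex_det2_ne[OF N l j] v False by (auto simp: ends_def)
    then have "min (det2 ?P l) (det2 ?Q l) \<le> det2 ?b l \<and> det2 ?b l \<le> max (det2 ?P l) (det2 ?Q l)
        \<longleftrightarrow> side N l j (fst e) \<noteq> side N l j (snd e)"
      unfolding side_def lefter_def by linarith
    ultimately show ?thesis
      using False line(2) by simp
  qed
qed

definition int_parity :: "'v network \<Rightarrow> complex \<Rightarrow> 'v vertex \<times> 'v vertex \<Rightarrow> int" where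
  "int_parity N l e = (\<Sum>j\<in>sources N.
     of_bool (Boundary j \<notin> ends e \<and> side N l j (fst e) \<noteq> side N l j (snd e)))"

text \<open>The sign in the intersection index is 1 or -1 and disappears modulo two.\<close>

lemma even_edge_int:
  assumes "drawn_network N" "gauge_direction N l" "e \<in> arcs N"
  shows "even (edge_int N l e - int_parity N l e)"
proof -
  have "turn l (edge_vec N e) = 1 \<or> turn l (edge_vec N e) = -1"
    using edge_vec_ne[OF assms(2,3)] det2_commute[of l "edge_vec N e"] by (simp add: turn_det2)
  moreover have "int (\<Sum>j\<in>sources N. card (edge_seg N e \<inter> ray (bpos N j) l)) = int_parity N l e"
    unfolding int_parity_def of_nat_sum
    by (intro sum.cong[OF HOL.refl]) (use card_edge_ray[OF assms(1,2) _ assms(3)] in \<open>auto simp: sources_def\<close>)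
  ultimately show ?thesis by (auto simp: edge_int_def)
qed

text \<open>If both segments left \<open>a\<close> in the same direction, the end of the shorter one
  would lie on the longer one.\<close>

lemma not_overlapping:
  assumes "seg (a, b) \<inter> seg (a, c) \<subseteq> {a}" "a \<noteq> b" "a \<noteq> c"
  shows "\<not> aligned (b - a) (c - a)"
proof
  assume "aligned (b - a) (c - a)"
  then obtain k where k: "k > 0" "b - a = of_real k * (c - a)" by (auto simp: aligned_def)
  show False
  proof (cases "k \<le> 1")
    case True
    have "b = (1 - k) *\<^sub>R a + k *\<^sub>R c"
      using k(2) by (simp add: scaleR_conv_of_real algebra_simps)
    then have "b \<in> seg (a, c)"
      using k(1) True unfolding seg_def in_segment by (intro exI[of _ k] conjI) simp_all
    then show False using assms by (auto simp: seg_def)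
  next
    case False
    have "of_real (1 / k) * (b - a) = c - a"
      using k by simp
    moreover have "(1 - r) *\<^sub>R a + r *\<^sub>R b = a + of_real r * (b - a)" for r
      by (simp add: scaleR_conv_of_real algebra_simps)
    ultimately have "c = (1 - 1 / k) *\<^sub>R a + (1 / k) *\<^sub>R b"
      by simp
    then have "c \<in> seg (a, b)"
      using k(1) False unfolding seg_def in_segment by (intro exI[of _ "1 / k"] conjI) simp_all
    then show False using assms by (auto simp: seg_def)
  qed
qed

lemma not_aligned_det2:
  assumes "\<not> aligned v q" "det2 v l * det2 q l > 0"
  shows "det2 q v \<noteq> 0"
proof
  assume "det2 q v = 0"
  have "q \<noteq> 0" using assms(2) by auto
  moreover have "det2 v q = 0" using \<open>det2 q v = 0\<close> det2_commute[of v q] by simp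
  ultimately obtain k where k: "v = of_real k * q" using det2_zero_imp by metis
  then have "k * (det2 q l)\<^sup>2 > 0"
    using assms(2) by (simp add: det2_linear power2_eq_square mult.assoc)
  then have "k > 0" by (simp add: zero_less_mult_iff)
  then show False using assms(1) k by (auto simp: aligned_def)
qed

lemma outward_not_aligned:
  assumes N: "drawn_network N" and e: "e \<in> arcs N" "f \<in> arcs N" "e \<noteq> f"
    and "ends e = {u, v}" "ends f = {u, w}"
  shows "\<not> aligned (pos N v - pos N u) (pos N w - pos N u)" "v \<noteq> w"
proof -
  have uv: "u \<noteq> v" "u \<noteq> w" "u \<in> vertices N" "v \<in> vertices N" "w \<in> vertices N"
    using arc_vertices[OF N e(1)] arc_vertices[OF N e(2)] assms(5,6)
    by (auto simp: ends_def doubleton_eq_iff)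
  show vw: "v \<noteq> w" using arc_eqI[OF N e(1,2)] e(3) assms(5,6) by auto
  have "edge_seg N e = seg (pos N u, pos N v)" "edge_seg N f = seg (pos N u, pos N w)"
    using assms(5,6) by (auto simp: edge_seg_def seg_def ends_def doubleton_eq_iff closed_segment_commute)
  then have "seg (pos N u, pos N v) \<inter> seg (pos N u, pos N w) \<subseteq> {pos N u}"
    using edges_meet[OF N e] assms(5,6) vw uv by auto
  then show "\<not> aligned (pos N v - pos N u) (pos N w - pos N u)"
    by (rule not_overlapping) (use pos_eq_iff[OF N] uv in auto)
qed

lemma consecutive_not_antiparallel:
  assumes N: "drawn_network N" and "e \<in> in_arcs N u" "f \<in> out_arcs N u"
  shows "\<not> aligned (- edge_vec N e) (edge_vec N f)" "fst e \<noteq> snd f" "e \<noteq> f"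
proof -
  have ef: "e \<in> arcs N" "f \<in> arcs N" "snd e = u" "fst f = u"
    using assms by (auto simp: in_arcs_def out_arcs_def)
  show "e \<noteq> f" using arc_vertices(3)[OF N] ef by auto
  then show "\<not> aligned (- edge_vec N e) (edge_vec N f)" "fst e \<noteq> snd f"
    using outward_not_aligned[OF N ef(1,2), of u "fst e" "snd f"] ef
    by (auto simp: ends_def edge_vec_def)
qed

section \<open>The geometric signature modulo two\<close>

lemma in_arc_eq:
  assumes "card (in_arcs N (Internal v)) = 1" shows "in_arcs N (Internal v) = {in_arc N v}"
proof -
  obtain e where "in_arcs N (Internal v) = {e}" using assms card_1_singletonE by blast
  then show ?thesis by (simp add: in_arc_def)
qed

lemma out_arc_eq:
  assumes "card (out_arcs N (Internal v)) = 1" shows "out_arcs N (Internal v) = {out_arc N v}"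
proof -
  obtain e where "out_arcs N (Internal v) = {e}" using assms card_1_singletonE by blast
  then show ?thesis by (simp add: out_arc_def)
qed

lemma white_in_arc:
  assumes "plabic_network N" "v \<in> white N"
  shows "in_arcs N (Internal v) = {in_arc N v}"
  using assms by (intro in_arc_eq) (auto simp: plabic_network_def perfect_orientation_def)

lemma black_out_arc:
  assumes "plabic_network N" "v \<in> internals N" "v \<notin> white N"
  shows "out_arcs N (Internal v) = {out_arc N v}"
  using assms by (intro out_arc_eq) (auto simp: plabic_network_def perfect_orientation_def)

text \<open>The case distinction in \<open>arc_sign\<close> is additive modulo two: the intersection
  parity plus one term for each end, depending only on the kind of that end. This lets both ends of
  an arc be treated separately throughout.\<close>

definition tail_term :: "'v network \<Rightarrow> complex \<Rightarrow> 'v vertex \<times> 'v vertex \<Rightarrow> int" where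
  "tail_term N l e = (case fst e of
     Boundary _ \<Rightarrow> 1
   | Internal u \<Rightarrow> if u \<in> white N then 1 + edge_wind N l (in_arc N u) e else 0)"

definition head_term :: "'v network \<Rightarrow> complex \<Rightarrow> 'v vertex \<times> 'v vertex \<Rightarrow> int" where
  "head_term N l e = (case snd e of
     Boundary _ \<Rightarrow> 0
   | Internal v \<Rightarrow> if v \<in> white N then 0 else edge_wind N l e (out_arc N v))"

lemma even_arc_sign:
  assumes "drawn_network N" "gauge_direction N l" "e \<in> arcs N"
    and "fst e \<in> range Internal \<or> snd e \<in> range Internal"
  shows "even (arc_sign N l e - (int_parity N l e + tail_term N l e + head_term N l e))"
proof -
  have "even (arc_sign N l e - (edge_int N l e + tail_term N l e + head_term N l e))"
    using assms(4) by (cases e; cases "fst e"; cases "snd e")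
      (auto simp: arc_sign_def tail_term_def head_term_def mod_2_eq_odd)
  then show ?thesis using even_edge_int[OF assms(1-3)] by (auto simp: even_diff_iff)
qed

lemma geom_signature_ends:
  assumes "drawn_network N" "e \<in> arcs N"
  shows "geom_signature N l (ends e) = arc_sign N l e"
proof -
  have "(THE f. f \<in> arcs N \<and> ends f = ends e) = e"
    by (rule the_equality) (simp add: assms(2), metis arc_eqI[OF assms(1)] assms(2))
  then show ?thesis by (simp add: geom_signature_def)
qed

text \<open>Both cases of gauge equivalence amount to one congruence per arc, with \<open>\<eta>\<close> extended by zero
  to the boundary.\<close>

definition vertex_gauge :: "('v \<Rightarrow> int) \<Rightarrow> 'v vertex \<Rightarrow> int" where
  "vertex_gauge \<eta> v = (case v of Boundary _ \<Rightarrow> 0 | Internal u \<Rightarrow> \<eta> u)"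

lemma gauge_transformsI:
  assumes N: "drawn_network N" and "\<And>u. u \<in> internals N \<Longrightarrow> \<eta> u \<in> {0, 1}"
    and *: "\<And>e. e \<in> arcs N \<Longrightarrow> fst e \<in> range Internal \<or> snd e \<in> range Internal \<Longrightarrow>
      even (\<epsilon>' (ends e) - (\<epsilon> (ends e) + vertex_gauge \<eta> (fst e) + vertex_gauge \<eta> (snd e)))"
  shows "gauge_transforms N \<eta> \<epsilon> \<epsilon>'"
proof -
  have "[\<epsilon>' {x, y} = \<epsilon> {x, y} + vertex_gauge \<eta> x + vertex_gauge \<eta> y] (mod 2)"
    if xy: "{x, y} \<in> edges N" and "x \<in> range Internal" for x y
  proof -
    obtain e where "e \<in> arcs N" "ends e = {x, y}" using xy by (auto simp: edges_def)
    then have xy: "fst e = x \<and> snd e = y \<or> fst e = y \<and> snd e = x"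
      by (auto simp: ends_def doubleton_eq_iff)
    then have "even (\<epsilon>' (ends e) - (\<epsilon> (ends e) + vertex_gauge \<eta> (fst e) + vertex_gauge \<eta> (snd e)))"
      using *[OF \<open>e \<in> arcs N\<close>] that(2) by blast
    moreover have "vertex_gauge \<eta> (fst e) + vertex_gauge \<eta> (snd e) = vertex_gauge \<eta> x + vertex_gauge \<eta> y"
      using xy by auto
    ultimately have "even (\<epsilon>' {x, y} - (\<epsilon> {x, y} + vertex_gauge \<eta> x + vertex_gauge \<eta> y))"
      unfolding \<open>ends e = {x, y}\<close> by (simp add: add.assoc)
    then show ?thesis by (simp add: cong_iff_dvd_diff)
  qed
  from this[of "Internal u" "Internal v" for u v] this[of "Internal u" "Boundary j" for u j]
  show ?thesis
    unfolding gauge_transforms_def using assms(2) by (auto simp: vertex_gauge_def)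
qed

section \<open>Deformations\<close>

lemma eventually_unique_value:
  assumes "F \<noteq> bot" "\<forall>\<^sub>F s in F. g s = a" "\<forall>\<^sub>F s in F. g s = b" shows "a = b"
proof -
  have "\<forall>\<^sub>F s in F. a = b"
    using assms(2,3) by eventually_elim simp
  then show ?thesis using assms(1) by (simp add: eventually_const)
qed

lemma eventually_value:
  assumes "F \<noteq> bot" "\<forall>\<^sub>F s in F. g s = b" shows "(\<forall>\<^sub>F s in F. g s) = b"
  using eventually_unique_value[OF assms(1), of g True b] assms(2) by auto

text \<open>A truth value with one-sided limits everywhere toggles only at the times in
  \<open>T\<close>. Values at these times are irrelevant, so the comparison is made with the limits
  from the right, over half-open intervals, which makes the claim additive and accessible to a
  bisection argument.\<close>

lemma toggle_parity:
  fixes g :: "real \<Rightarrow> bool" and T :: "real set"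
  assumes "a \<le> b"
    and loc: "\<And>t. \<exists>\<alpha> \<beta>. (\<forall>\<^sub>F s in at_left t. g s = \<alpha>) \<and> (\<forall>\<^sub>F s in at_right t. g s = \<beta>) \<and>
        (\<alpha> \<noteq> \<beta> \<longleftrightarrow> t \<in> T)"
  defines "R \<equiv> \<lambda>t. \<forall>\<^sub>F s in at_right t. g s"
  shows "finite (T \<inter> {a<..b}) \<and> (odd (card (T \<inter> {a<..b})) \<longleftrightarrow> R a \<noteq> R b)"
  using assms(1)
proof (induction rule: Bolzano)
  case (trans a b c)
  have "T \<inter> {a<..c} = (T \<inter> {a<..b}) \<union> (T \<inter> {b<..c})" using trans by auto
  moreover have "(T \<inter> {a<..b}) \<inter> (T \<inter> {b<..c}) = {}" by auto
  ultimately have "card (T \<inter> {a<..c}) = card (T \<inter> {a<..b}) + card (T \<inter> {b<..c})"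
    "finite (T \<inter> {a<..c})"
    using trans by (auto simp: card_Un_disjoint)
  then show ?case using trans by (simp del: greaterThanAtMost_iff) blast
next
  case (local x)
  have R: "R t = \<beta>" if "\<forall>\<^sub>F s in at_right t. g s = \<beta>" for t \<beta>
    unfolding R_def using that by (intro eventually_value) auto
  obtain \<alpha> \<beta> where ab: "\<forall>\<^sub>F s in at_left x. g s = \<alpha>" "\<forall>\<^sub>F s in at_right x. g s = \<beta>"
    "\<alpha> \<noteq> \<beta> \<longleftrightarrow> x \<in> T" using loc by blast
  obtain d1 d2 where d: "d1 < x" "\<And>s. d1 < s \<Longrightarrow> s < x \<Longrightarrow> g s = \<alpha>"
    "x < d2" "\<And>s. x < s \<Longrightarrow> s < d2 \<Longrightarrow> g s = \<beta>"
    using ab(1,2) unfolding eventually_at_left_field eventually_at_right_field by metis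
  have const: "R t = \<gamma> \<and> t \<notin> T" if "\<And>s. p < s \<Longrightarrow> s < q \<Longrightarrow> g s = \<gamma>" "p < t" "t < q" for p q t \<gamma>
  proof -
    have l: "\<forall>\<^sub>F s in at_left t. g s = \<gamma>" "\<forall>\<^sub>F s in at_right t. g s = \<gamma>"
      unfolding eventually_at_left_field eventually_at_right_field using that by force+
    obtain \<alpha>' \<beta>' where ab': "\<forall>\<^sub>F s in at_left t. g s = \<alpha>'" "\<forall>\<^sub>F s in at_right t. g s = \<beta>'"
      "\<alpha>' \<noteq> \<beta>' \<longleftrightarrow> t \<in> T" using loc by blast
    have "\<gamma> = \<alpha>'" "\<gamma> = \<beta>'"
      using eventually_unique_value[OF _ l(1) ab'(1)] eventually_unique_value[OF _ l(2) ab'(2)] by auto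
    then show ?thesis using ab'(3) R[OF l(2)] by simp
  qed
  have left: "R t = \<alpha> \<and> t \<notin> T" if "d1 < t" "t < x" for t
    using const[of d1 x \<alpha> t] d(2) that by blast
  have right: "R t = \<beta> \<and> t \<notin> T" if "x < t" "t < d2" for t
    using const[of x d2 \<beta> t] d(4) that by blast
  show ?case
  proof (intro exI[of _ "min (x - d1) (d2 - x)"] conjI allI impI)
    show "0 < min (x - d1) (d2 - x)" using d by simp
    fix a b assume "a \<le> x \<and> x \<le> b \<and> b - a < min (x - d1) (d2 - x)"
    then have ab': "a \<le> x" "x \<le> b" "d1 < a" "b < d2" by auto
    have Rb: "R b = \<beta>"
      using ab' right R[OF ab(2)] by (cases "x = b") auto
    have Ra: "R a = (if a < x then \<alpha> else \<beta>)"
      using ab' left R[OF ab(2)] by (cases "x = a") auto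
    have nT: "s \<notin> T" if "a < s" "s \<le> b" "s \<noteq> x" for s
      using that ab' left[of s] right[of s] by (cases "s < x") auto
    have "T \<inter> {a<..b} \<subseteq> {x}" using nT by fastforce
    then have "T \<inter> {a<..b} = (if a < x \<and> x \<in> T then {x} else {})"
      using ab' by (cases "a < x \<and> x \<in> T") auto
    then show "finite (T \<inter> {a<..b})" "odd (card (T \<inter> {a<..b})) \<longleftrightarrow> R a \<noteq> R b"
      unfolding Ra Rb using ab(3) by auto
  qed
qed

text \<open>Extends functions of the deformation time constantly beyond both ends, so that two-sided
  limits make sense at 0 and 1.\<close>

definition clamp01 :: "real \<Rightarrow> real" where "clamp01 t = max 0 (min 1 t)"

lemma clamp01 [simp]:
  "clamp01 t \<in> {0..1}" "0 \<le> t \<Longrightarrow> t \<le> 1 \<Longrightarrow> clamp01 t = t" "t \<le> 0 \<Longrightarrow> clamp01 t = 0" "t \<ge> 1 \<Longrightarrow> clamp01 t = 1"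
  by (auto simp: clamp01_def)

lemma isCont_clamp01:
  assumes "continuous_on {0..1} f" shows "isCont (\<lambda>t. f (clamp01 t)) t"
proof -
  have "continuous_on UNIV clamp01" unfolding clamp01_def by (intro continuous_intros)
  then have "continuous_on UNIV (\<lambda>t. f (clamp01 t))"
    by (rule continuous_on_compose2[OF assms]) (metis clamp01(1) image_subsetI)
  then show ?thesis by (simp add: continuous_on_eq_continuous_at)
qed

lemma eventually_pos: "isCont f (t::real) \<Longrightarrow> (0::real) < f t \<Longrightarrow> \<forall>\<^sub>F s in at t. 0 < f s"
  unfolding isCont_def by (rule order_tendstoD)

lemma eventually_neg: "isCont f (t::real) \<Longrightarrow> f t < (0::real) \<Longrightarrow> \<forall>\<^sub>F s in at t. f s < 0"
  unfolding isCont_def by (rule order_tendstoD)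

lemma toggle_parity_01:
  fixes g :: "real \<Rightarrow> bool" and T :: "real set"
  assumes "\<And>t. \<exists>\<alpha> \<beta>. (\<forall>\<^sub>F s in at_left t. g (clamp01 s) = \<alpha>) \<and> (\<forall>\<^sub>F s in at_right t. g (clamp01 s) = \<beta>) \<and>
        (\<alpha> \<noteq> \<beta> \<longleftrightarrow> t \<in> T)" and "T \<subseteq> {0..1}"
  shows "finite T" "odd (card T) \<longleftrightarrow> g 0 \<noteq> g 1"
proof -
  \<comment> \<open>The bounds -1 and 2 are arbitrary times before and after the deformation, where
    the clamped function is constant.\<close>
  have eq: "T \<inter> {-1<..2} = T" using assms(2) by force
  have "(\<forall>\<^sub>F s in at_right (-1). g (clamp01 s)) = g 0"
  proof -
    have "\<forall>\<^sub>F s in at_right (-1). g (clamp01 s) = g 0"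
      unfolding eventually_at_right_field by (intro exI[of _ 0]) simp
    then show ?thesis by (intro eventually_value) auto
  qed
  moreover have "(\<forall>\<^sub>F s in at_right 2. g (clamp01 s)) = g 1"
  proof -
    have "\<forall>\<^sub>F s in at_right 2. g (clamp01 s) = g 1"
      unfolding eventually_at_right_field by (intro exI[of _ 3]) simp
    then show ?thesis by (intro eventually_value) auto
  qed
  ultimately show "finite T" "odd (card T) \<longleftrightarrow> g 0 \<noteq> g 1"
    using toggle_parity[of "-1" 2 "\<lambda>s. g (clamp01 s)" T, OF _ assms(1)] unfolding eq by simp_all
qed

text \<open>The counterpart of \<open>changes_sign_at\<close> for real functions.\<close>

definition sign_change :: "(real \<Rightarrow> real) \<Rightarrow> real \<Rightarrow> bool" where
  "sign_change x t \<longleftrightarrow> (\<exists>\<alpha>. (\<forall>\<^sub>F s in at_left t. x s \<noteq> 0 \<and> (x s > 0) = \<alpha>) \<and>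
     (\<forall>\<^sub>F s in at_right t. x s \<noteq> 0 \<and> (x s > 0) = (\<not> \<alpha>)))"

lemma changes_sign_turn:
  assumes "changes_sign_at (\<lambda>s. turn (m s) (v s)) t"
  shows "sign_change (\<lambda>s. det2 (v s) (m s)) t"
proof -
  obtain \<sigma> where \<sigma>: "\<sigma> \<noteq> 0" "\<forall>\<^sub>F s in at_left t. turn (m s) (v s) = \<sigma>"
    "\<forall>\<^sub>F s in at_right t. turn (m s) (v s) = - \<sigma>"
    using assms by (auto simp: changes_sign_at_def)
  have eq: "det2 (v s) (m s) \<noteq> 0 \<and> (det2 (v s) (m s) > 0) = (\<tau> < 0)"
    if "turn (m s) (v s) = \<tau>" "\<tau> \<noteq> 0" for s \<tau>
    using that det2_commute[of "v s" "m s"] by (auto simp: turn_det2 split: if_splits)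
  show ?thesis unfolding sign_change_def
    by (rule exI[of _ "\<sigma> < 0"], intro conjI)
      (use \<sigma>(2) in \<open>eventually_elim, use eq \<sigma>(1) in blast\<close>,
       use \<sigma>(3) in \<open>eventually_elim, use eq[of _ "- \<sigma>"] \<sigma>(1) in force\<close>)
qed

lemma eventually_clamp01:
  assumes "0 < t" "t < 1"
  shows "\<forall>\<^sub>F s in at t. clamp01 s = s"
proof -
  have "\<forall>\<^sub>F s in at t. s \<in> {0<..<1}"
    using assms by (intro eventually_at_in_open') auto
  then show ?thesis by eventually_elim simp
qed

lemma sign_change_clamp01:
  assumes "0 < t" "t < 1" "sign_change x t"
  shows "sign_change (\<lambda>s. x (clamp01 s)) t"
proof -
  have "\<forall>\<^sub>F s in at_left t. clamp01 s = s" "\<forall>\<^sub>F s in at_right t. clamp01 s = s"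
    using eventually_clamp01[OF assms(1,2)] by (simp_all add: eventually_at_split)
  moreover obtain \<alpha> where "\<forall>\<^sub>F s in at_left t. x s \<noteq> 0 \<and> (x s > 0) = \<alpha>"
    "\<forall>\<^sub>F s in at_right t. x s \<noteq> 0 \<and> (x s > 0) = (\<not> \<alpha>)"
    using assms(3) unfolding sign_change_def by blast
  ultimately have "\<forall>\<^sub>F s in at_left t. x (clamp01 s) \<noteq> 0 \<and> (x (clamp01 s) > 0) = \<alpha>"
    "\<forall>\<^sub>F s in at_right t. x (clamp01 s) \<noteq> 0 \<and> (x (clamp01 s) > 0) = (\<not> \<alpha>)"
    by (auto elim: eventually_elim2)
  then show ?thesis unfolding sign_change_def by blast
qed

lemma zero_count_parity:
  assumes "continuous_on {0..1} x" "x 0 \<noteq> 0" "x 1 \<noteq> (0::real)"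
    and sc: "\<And>t. t \<in> {0..1} \<Longrightarrow> x t = 0 \<Longrightarrow> sign_change x t"
  shows "odd (card {t \<in> {0..1}. x t = 0}) \<longleftrightarrow> (x 0 > 0) \<noteq> (x 1 > 0)"
proof (rule toggle_parity_01(2))
  fix t :: real
  note cont = isCont_clamp01[OF assms(1), of t]
  show "\<exists>\<alpha> \<beta>. (\<forall>\<^sub>F s in at_left t. (0 < x (clamp01 s)) = \<alpha>) \<and>
      (\<forall>\<^sub>F s in at_right t. (0 < x (clamp01 s)) = \<beta>) \<and> (\<alpha> \<noteq> \<beta> \<longleftrightarrow> t \<in> {t \<in> {0..1}. x t = 0})"
  proof (cases "x (clamp01 t) = 0")
    case True
    then have "0 < t" "t < 1" using assms(2,3) by (auto simp: clamp01_def split: if_splits simp: not_le[symmetric])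
    then have t: "t \<in> {0..1}" "x t = 0" using True by auto
    obtain \<alpha> where "\<forall>\<^sub>F s in at_left t. x (clamp01 s) \<noteq> 0 \<and> (x (clamp01 s) > 0) = \<alpha>"
     "\<forall>\<^sub>F s in at_right t. x (clamp01 s) \<noteq> 0 \<and> (x (clamp01 s) > 0) = (\<not> \<alpha>)"
      using sign_change_clamp01[OF \<open>0 < t\<close> \<open>t < 1\<close> sc[OF t]] unfolding sign_change_def by blast
    then have "\<forall>\<^sub>F s in at_left t. (0 < x (clamp01 s)) = \<alpha>" "\<forall>\<^sub>F s in at_right t. (0 < x (clamp01 s)) = (\<not> \<alpha>)"
      by (auto elim: eventually_mono)
    then show ?thesis using t by blast
  next
    case False
    have "\<forall>\<^sub>F s in at t. (0 < x (clamp01 s)) = (0 < x (clamp01 t))"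
    proof (cases "x (clamp01 t) > 0")
      case True
      then show ?thesis using eventually_pos[OF cont] by (auto elim: eventually_mono)
    next
      case f: False
      then show ?thesis using eventually_neg[OF cont] False by (auto elim: eventually_mono)
    qed
    moreover have "t \<notin> {t \<in> {0..1}. x t = 0}" using False by auto
    ultimately show ?thesis unfolding eventually_at_split by blast
  qed
qed auto

text \<open>Coordinates with \<open>l\<close> upwards, both scaled by the length of
  \<open>l\<close>. The bracket is the determinant of \<open>e\<close> and \<open>f\<close> times
  the square of that length.\<close>

lemma under_cases:
  assumes "fx = det2 f l" "fy = f \<bullet> l" "ex = det2 e l" "ey = e \<bullet> l" "l \<noteq> 0"
  shows "under l f (- e) \<longleftrightarrow> fx * ex < 0 \<and> (ex * fy - ey * fx) * ex > 0"
proof -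
  have "det2 e f * (cmod l)\<^sup>2 = ex * fy - ey * fx"
    unfolding cmod_power2 assms(1-4) det2_def inner_complex_def
    by (simp add: algebra_simps power2_eq_square)
  moreover have "(cmod l)\<^sup>2 > 0" using assms(5) by simp
  ultimately have "(ex * fy - ey * fx) * ex > 0 \<longleftrightarrow> det2 e f * ex > 0"
    by (metis mult.commute mult.assoc zero_less_mult_pos mult_pos_pos zero_less_mult_pos2)
  then show ?thesis
    unfolding under_def det2_linear assms(1,3)[symmetric] by (simp add: mult.commute)
qed

lemma aligned_iff:
  assumes "l \<noteq> 0" shows "aligned d l \<longleftrightarrow> det2 d l = 0 \<and> d \<bullet> l > 0"
proof
  assume "aligned d l"
  then obtain c where "c > 0" "d = of_real c * l" by (auto simp: aligned_def)
  then have "det2 d l = 0" by (simp add: det2_linear)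
  moreover have "d \<bullet> l > 0"
    using assms \<open>c > 0\<close> \<open>d = _\<close> by (simp add: scaleR_conv_of_real[symmetric])
  ultimately show "det2 d l = 0 \<and> d \<bullet> l > 0" ..
next
  assume *: "det2 d l = 0 \<and> d \<bullet> l > 0"
  then obtain c where c: "d = of_real c * l" using det2_zero_imp assms by blast
  then have "c * (l \<bullet> l) > 0" using * by (simp add: scaleR_conv_of_real[symmetric])
  then have "c > 0" using assms by (metis inner_gt_zero_iff zero_less_mult_pos2)
  then show "aligned d l" using c by (auto simp: aligned_def)
qed

lemma antiparallel_iff:
  assumes "l \<noteq> 0" "det2 f l \<noteq> 0" "det2 e l * det2 f l < 0" "det2 e f = 0"
  shows "aligned (- e) f"
proof -
  have "f \<noteq> 0" using assms by auto
  then obtain k where k: "e = of_real k * f" using det2_zero_imp assms(4) by metis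
  then have "k * (det2 f l)\<^sup>2 < 0" using assms(3) by (simp add: det2_linear power2_eq_square mult.assoc)
  then have "k < 0" by (simp add: mult_less_0_iff)
  then show ?thesis using k by (auto simp: aligned_def intro!: exI[of _ "- k"])
qed

text \<open>At time \<open>t\<close> the winding parity toggles iff exactly one of the two
  consecutive edges points in the gauge direction. Edges pointing against it have no effect, and two
  edges passing through it at once cancel.\<close>

lemma wind_local:
  fixes e f l :: "real \<Rightarrow> complex"
  assumes cont: "isCont e t" "isCont f t" "isCont l t"
    and nz: "l t \<noteq> 0" "e t \<noteq> 0" "f t \<noteq> 0" and anti: "\<not> aligned (- e t) (f t)"
    and sc: "aligned (e t) (l t) \<Longrightarrow> sign_change (\<lambda>s. det2 (e s) (l s)) t"
      "aligned (f t) (l t) \<Longrightarrow> sign_change (\<lambda>s. det2 (f s) (l s)) t"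
  shows "\<exists>\<alpha> \<beta>. (\<forall>\<^sub>F s in at_left t. under (l s) (f s) (- e s) = \<alpha>) \<and>
      (\<forall>\<^sub>F s in at_right t. under (l s) (f s) (- e s) = \<beta>) \<and>
      (\<alpha> \<noteq> \<beta> \<longleftrightarrow> aligned (e t) (l t) \<noteq> aligned (f t) (l t))"
proof -
  define ex ey fx fy where "ex = (\<lambda>s. det2 (e s) (l s))" and "ey = (\<lambda>s. e s \<bullet> l s)"
    and "fx = (\<lambda>s. det2 (f s) (l s))" and "fy = (\<lambda>s. f s \<bullet> l s)"
  define D where "D = (\<lambda>s. ex s * fy s - ey s * fx s)"
  have c: "isCont ex t" "isCont ey t" "isCont fx t" "isCont fy t"
    using cont unfolding isCont_def ex_def ey_def fx_def fy_def by (auto intro!: tendsto_intros)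
  then have cD: "isCont D t" unfolding D_def by (auto intro!: continuous_intros)
  have "\<forall>\<^sub>F s in at t. l s \<noteq> 0"
    using cont(3) nz(1) unfolding isCont_def by (rule tendsto_imp_eventually_ne)
  then have g: "\<forall>\<^sub>F s in at t. under (l s) (f s) (- e s) \<longleftrightarrow> fx s * ex s < 0 \<and> D s * ex s > 0"
  proof eventually_elim
    case (elim s)
    then show ?case unfolding D_def ex_def ey_def fx_def fy_def by (intro under_cases) auto
  qed
  have al: "aligned (e t) (l t) \<longleftrightarrow> ex t = 0 \<and> ey t > 0" "aligned (f t) (l t) \<longleftrightarrow> fx t = 0 \<and> fy t > 0"
    unfolding ex_def ey_def fx_def fy_def by (simp_all add: aligned_iff nz)
  have nz': "ex t = 0 \<Longrightarrow> ey t \<noteq> 0" "fx t = 0 \<Longrightarrow> fy t \<noteq> 0"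
  proof -
    have *: "z = 0" if z: "det2 z (l t) = 0" "z \<bullet> l t = 0" for z
    proof -
      obtain a where "z = of_real a * l t" using det2_zero_imp[OF z(1) nz(1)] by blast
      then show ?thesis using z(2) nz by (simp add: scaleR_conv_of_real[symmetric])
    qed
    then show "ex t = 0 \<Longrightarrow> ey t \<noteq> 0" "fx t = 0 \<Longrightarrow> fy t \<noteq> 0"
      using nz unfolding ex_def ey_def fx_def fy_def by blast+
  qed
  \<comment> \<open>Two vertical edges pointing oppositely would run back along each other, which a
    plane drawing excludes.\<close>
  have opp: False if op: "ex t = 0" "fx t = 0" "ey t * fy t < 0"
  proof -
    obtain a b where "e t = of_real a * l t" "f t = of_real b * l t"
      using op(1,2) nz(1) det2_zero_imp unfolding ex_def fx_def by metis
    moreover from this have "a * b < 0"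
    proof -
      have "ey t = a * (l t \<bullet> l t)" "fy t = b * (l t \<bullet> l t)"
        using \<open>e t = _\<close> \<open>f t = _\<close> by (simp_all add: ey_def fy_def scaleR_conv_of_real[symmetric])
      then have "(a * b) * (l t \<bullet> l t)\<^sup>2 < 0" using op(3) by (simp add: power2_eq_square algebra_simps)
      then show ?thesis by (simp add: mult_less_0_iff)
    qed
    then have "- e t = of_real (- a / b) * f t" "- a / b > 0"
      using \<open>e t = _\<close> \<open>f t = _\<close> by (auto simp: mult_less_0_iff divide_less_0_iff)
    then show False using anti unfolding aligned_def by blast
  qed
  have pos: "\<forall>\<^sub>F s in at t. 0 < \<phi> s" if "isCont \<phi> t" "0 < \<phi> t" for \<phi> :: "real \<Rightarrow> real"
    using eventually_pos that .
  have neg: "\<forall>\<^sub>F s in at t. \<phi> s < 0" if "isCont \<phi> t" "\<phi> t < 0" for \<phi> :: "real \<Rightarrow> real"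
    using eventually_neg that .
  show ?thesis
  proof (cases "aligned (e t) (l t) \<or> aligned (f t) (l t)")
    case True
    \<comment> \<open>Close to the time when one of the edges points upwards, every turn back is a
      turn over the top. So \<open>under\<close> reduces to the horizontal condition, and its value
      is governed by the signs of \<open>ex\<close> and \<open>fx\<close> alone.\<close>
    have g': "\<forall>\<^sub>F s in at t. fx s * ex s < 0 \<longrightarrow> D s * ex s > 0"
    proof (cases "ey t > 0 \<and> fy t > 0")
      case True
      then have "\<forall>\<^sub>F s in at t. ey s > 0 \<and> fy s > 0" using pos c by (simp add: eventually_conj)
      then show ?thesis
      proof eventually_elim
        case (elim s)
        have "D s * ex s = fy s * (ex s)\<^sup>2 - ey s * (fx s * ex s)"
          by (simp add: D_def power2_eq_square algebra_simps)
        then show ?case using elim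
          by (smt (verit) mult_pos_neg mult_nonneg_nonneg zero_le_power2)
      qed
    next
      case f: False
      consider "ex t = 0" "ey t > 0" "fx t \<noteq> 0" | "fx t = 0" "fy t > 0" "ex t \<noteq> 0"
        using True f al opp nz' by (smt (verit) mult_pos_neg mult_neg_pos)
      then show ?thesis
      proof cases
        case 1
        then have "fx t * D t = - (ey t * (fx t)\<^sup>2)" by (simp add: D_def power2_eq_square)
        then have "fx t * D t < 0" using 1 by simp
        then have "\<forall>\<^sub>F s in at t. fx s * D s < 0" by (intro neg) (use c cD in \<open>auto intro!: continuous_intros\<close>)
        then show ?thesis by eventually_elim (auto simp: mult_less_0_iff zero_less_mult_iff)
      next
        case 2
        then have "D t * ex t = fy t * (ex t)\<^sup>2" by (simp add: D_def power2_eq_square)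
        then have "D t * ex t > 0" using 2 by simp
        then have "\<forall>\<^sub>F s in at t. D s * ex s > 0" by (intro pos) (use c cD in \<open>auto intro!: continuous_intros\<close>)
        then show ?thesis by eventually_elim simp
      qed
    qed
    have sgn: "\<exists>\<alpha> \<beta>. (\<forall>\<^sub>F s in at_left t. \<phi> s \<noteq> 0 \<and> (\<phi> s > 0) = \<alpha>) \<and>
        (\<forall>\<^sub>F s in at_right t. \<phi> s \<noteq> 0 \<and> (\<phi> s > 0) = \<beta>) \<and> (\<alpha> \<noteq> \<beta> \<longleftrightarrow> P)"
      if phi: "isCont \<phi> t" "P \<Longrightarrow> sign_change \<phi> t" "\<not> P \<Longrightarrow> \<phi> t \<noteq> 0" for \<phi> :: "real \<Rightarrow> real" and P
    proof (cases P)
      case True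
      then show ?thesis using phi(2) unfolding sign_change_def by blast
    next
      case False
      then consider "\<phi> t > 0" | "\<phi> t < 0" using phi(3) by linarith
      then have "\<forall>\<^sub>F s in at t. \<phi> s \<noteq> 0 \<and> (\<phi> s > 0) = (\<phi> t > 0)"
      proof cases
        case 1
        then show ?thesis using pos[OF phi(1)] by (auto elim: eventually_mono)
      next
        case 2
        then show ?thesis using neg[OF phi(1)] by (auto elim!: eventually_mono)
      qed
      then show ?thesis using False unfolding eventually_at_split by blast
    qed
    have "\<not> aligned (e t) (l t) \<Longrightarrow> ex t \<noteq> 0" "\<not> aligned (f t) (l t) \<Longrightarrow> fx t \<noteq> 0"
      using True al opp nz' by (smt (verit) mult_pos_neg mult_neg_pos)+
    then obtain \<alpha> \<beta> \<alpha>' \<beta>' where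
      e: "\<forall>\<^sub>F s in at_left t. ex s \<noteq> 0 \<and> (ex s > 0) = \<alpha>"
        "\<forall>\<^sub>F s in at_right t. ex s \<noteq> 0 \<and> (ex s > 0) = \<beta>" "\<alpha> \<noteq> \<beta> \<longleftrightarrow> aligned (e t) (l t)" and
      f: "\<forall>\<^sub>F s in at_left t. fx s \<noteq> 0 \<and> (fx s > 0) = \<alpha>'"
        "\<forall>\<^sub>F s in at_right t. fx s \<noteq> 0 \<and> (fx s > 0) = \<beta>'" "\<alpha>' \<noteq> \<beta>' \<longleftrightarrow> aligned (f t) (l t)"
      using sgn[OF c(1), of "aligned (e t) (l t)"] sgn[OF c(3), of "aligned (f t) (l t)"] sc
      unfolding ex_def fx_def by blast
    have gg: "\<forall>\<^sub>F s in at_left t. under (l s) (f s) (- e s) \<longleftrightarrow> fx s * ex s < 0"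
      "\<forall>\<^sub>F s in at_right t. under (l s) (f s) (- e s) \<longleftrightarrow> fx s * ex s < 0"
      using eventually_conj[OF g g'] unfolding eventually_at_split by (auto elim: eventually_mono)
    have "\<forall>\<^sub>F s in at_left t. under (l s) (f s) (- e s) = (\<alpha> \<noteq> \<alpha>')"
      using gg(1) e(1) f(1) by eventually_elim (auto simp: mult_less_0_iff)
    moreover have "\<forall>\<^sub>F s in at_right t. under (l s) (f s) (- e s) = (\<beta> \<noteq> \<beta>')"
      using gg(2) e(2) f(2) by eventually_elim (auto simp: mult_less_0_iff)
    ultimately show ?thesis using e(3) f(3) by blast
  next
    case False
    \<comment> \<open>Without an upward edge the truth value is locally constant: it is so when both
      horizontal signs are stable, and next to a downward edge any turn back passes below and does
      not count.\<close>
    have "\<exists>\<gamma>. \<forall>\<^sub>F s in at t. (fx s * ex s < 0 \<and> D s * ex s > 0) = \<gamma>"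
    proof -
      consider "fx t * ex t > 0" | "fx t * ex t < 0" | "ex t = 0" "fx t \<noteq> 0" | "fx t = 0" "ex t \<noteq> 0"
        | "ex t = 0" "fx t = 0" by (metis mult_eq_0_iff linorder_neqE_linordered_idom)
      then show ?thesis
      proof cases
        case 1
        then have "\<forall>\<^sub>F s in at t. fx s * ex s > 0" by (intro pos) (use c in \<open>auto intro!: continuous_intros\<close>)
        then have "\<forall>\<^sub>F s in at t. (fx s * ex s < 0 \<and> D s * ex s > 0) = False"
          by eventually_elim simp
        then show ?thesis by blast
      next
        case 2
        have "D t * (1::real) = det2 (e t) (f t) * (cmod (l t))\<^sup>2"
          unfolding D_def cmod_power2 ex_def ey_def fx_def fy_def det2_def inner_complex_def
          by (simp add: algebra_simps power2_eq_square)
        moreover have "det2 (f t) (l t) \<noteq> 0" using 2 by (auto simp: fx_def)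
        then have "det2 (e t) (f t) \<noteq> 0"
          using 2 anti antiparallel_iff[of "l t" "f t" "e t"] nz by (auto simp: ex_def fx_def mult.commute)
        ultimately have "D t \<noteq> 0" "ex t \<noteq> 0" using nz 2 by auto
        have F: "\<forall>\<^sub>F s in at t. fx s * ex s < 0" by (intro neg) (use 2 c in \<open>auto intro!: continuous_intros\<close>)
        show ?thesis
        proof (cases "D t * ex t > 0")
          case True
          then have "\<forall>\<^sub>F s in at t. D s * ex s > 0" by (intro pos) (use c cD in \<open>auto intro!: continuous_intros\<close>)
          with F have "\<forall>\<^sub>F s in at t. (fx s * ex s < 0 \<and> D s * ex s > 0) = True" by eventually_elim simp
          then show ?thesis by blast
        next
          case False
          then have "D t * ex t < 0" using \<open>D t \<noteq> 0\<close> \<open>ex t \<noteq> 0\<close>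
            by (metis mult_eq_0_iff linorder_neqE_linordered_idom)
          then have "\<forall>\<^sub>F s in at t. D s * ex s < 0" by (intro neg) (use c cD in \<open>auto intro!: continuous_intros\<close>)
          then have "\<forall>\<^sub>F s in at t. (fx s * ex s < 0 \<and> D s * ex s > 0) = False" by eventually_elim simp
          then show ?thesis by blast
        qed
      next
        case 3
        then have "ey t < 0" using False al nz' by fastforce
        moreover have "fx t * D t = - (ey t * (fx t)\<^sup>2)" using 3 by (simp add: D_def power2_eq_square)
        ultimately have "fx t * D t > 0" using 3 by (simp add: mult_neg_pos)
        then have "\<forall>\<^sub>F s in at t. fx s * D s > 0" by (intro pos) (use c cD in \<open>auto intro!: continuous_intros\<close>)
        then have "\<forall>\<^sub>F s in at t. (fx s * ex s < 0 \<and> D s * ex s > 0) = False"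
          by eventually_elim (auto simp: mult_less_0_iff zero_less_mult_iff)
        then show ?thesis by blast
      next
        case 4
        then have "fy t < 0" using False al nz' by fastforce
        moreover have "D t * ex t = fy t * (ex t)\<^sup>2" using 4 by (simp add: D_def power2_eq_square)
        ultimately have "D t * ex t < 0" using 4 by (simp add: mult_neg_pos)
        then have "\<forall>\<^sub>F s in at t. D s * ex s < 0" by (intro neg) (use c cD in \<open>auto intro!: continuous_intros\<close>)
        then have "\<forall>\<^sub>F s in at t. (fx s * ex s < 0 \<and> D s * ex s > 0) = False" by eventually_elim simp
        then show ?thesis by blast
      next
        case 5
        then have "ey t < 0" "fy t < 0" using False al nz' by fastforce+
        then have "\<forall>\<^sub>F s in at t. ey s < 0" "\<forall>\<^sub>F s in at t. fy s < 0" using neg c by blast+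
        then have "\<forall>\<^sub>F s in at t. (fx s * ex s < 0 \<and> D s * ex s > 0) = False"
        proof eventually_elim
          case (elim s)
          have "D s * ex s = fy s * (ex s)\<^sup>2 - ey s * (fx s * ex s)"
            by (simp add: D_def power2_eq_square algebra_simps)
          moreover have "fy s * (ex s)\<^sup>2 \<le> 0" using elim by (simp add: mult_nonpos_nonneg)
          moreover have "ey s * (fx s * ex s) > 0" if "fx s * ex s < 0" using elim that by (rule_tac mult_neg_neg)
          ultimately show ?case by force
        qed
        then show ?thesis by blast
      qed
    qed
    then obtain \<gamma> where "\<forall>\<^sub>F s in at t. (fx s * ex s < 0 \<and> D s * ex s > 0) = \<gamma>" by blast
    with g have "\<forall>\<^sub>F s in at t. under (l s) (f s) (- e s) = \<gamma>" by eventually_elim simp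
    then show ?thesis using False unfolding eventually_at_split by blast
  qed
qed

text \<open>The toggling times form the symmetric difference of the two sets of alignment times,
  whose size has the parity of the sum of the two sizes.\<close>

lemma wind_parity:
  fixes e f l :: "real \<Rightarrow> complex"
  assumes cont: "continuous_on {0..1} e" "continuous_on {0..1} f" "continuous_on {0..1} l"
    and nz: "\<And>t. t \<in> {0..1} \<Longrightarrow> l t \<noteq> 0 \<and> e t \<noteq> 0 \<and> f t \<noteq> 0 \<and> \<not> aligned (- e t) (f t)"
    and sc: "\<And>t. t \<in> {0..1} \<Longrightarrow> aligned (e t) (l t) \<Longrightarrow> sign_change (\<lambda>s. det2 (e s) (l s)) t"
      "\<And>t. t \<in> {0..1} \<Longrightarrow> aligned (f t) (l t) \<Longrightarrow> sign_change (\<lambda>s. det2 (f s) (l s)) t"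
    and ends: "det2 (e 0) (l 0) \<noteq> 0" "det2 (e 1) (l 1) \<noteq> 0" "det2 (f 0) (l 0) \<noteq> 0" "det2 (f 1) (l 1) \<noteq> 0"
  shows "odd (wind (l 0) (e 0) (f 0)) \<noteq> odd (wind (l 1) (e 1) (f 1)) \<longleftrightarrow>
    odd (card {t \<in> {0..1}. aligned (e t) (l t)}) \<noteq> odd (card {t \<in> {0..1}. aligned (f t) (l t)})"
proof -
  define A where "A d = {t \<in> {0..1}. aligned (d t) (l t)}" for d :: "real \<Rightarrow> complex"
  have interior: "0 < t \<and> t < 1 \<and> clamp01 t = t"
    if "aligned (d (clamp01 t)) (l (clamp01 t))" "det2 (d 0) (l 0) \<noteq> 0" "det2 (d 1) (l 1) \<noteq> 0" for d t
  proof -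
    have "det2 (d (clamp01 t)) (l (clamp01 t)) = 0"
      using that(1) by (auto simp: aligned_def det2_linear)
    then have "clamp01 t \<noteq> 0" "clamp01 t \<noteq> 1" using that by auto
    then show ?thesis by (auto simp: clamp01_def max_def min_def split: if_splits)
  qed
  have A_iff: "t \<in> A d \<longleftrightarrow> aligned (d (clamp01 t)) (l (clamp01 t))"
    if "det2 (d 0) (l 0) \<noteq> 0" "det2 (d 1) (l 1) \<noteq> 0" for d t
    using interior[OF _ that] by (fastforce simp: A_def)
  \<comment> \<open>Finiteness is essential because the cardinality of an infinite set is 0. An
    accumulation point is excluded by the isolated sign changes at alignment times, and elsewhere by
    a nonzero horizontal or a negative vertical coordinate that persists.\<close>
  have fin: "finite (A d)"
    if d: "continuous_on {0..1} d" "\<And>t. t \<in> {0..1} \<Longrightarrow> d t \<noteq> 0" "det2 (d 0) (l 0) \<noteq> 0" "det2 (d 1) (l 1) \<noteq> 0"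
      "\<And>t. t \<in> {0..1} \<Longrightarrow> aligned (d t) (l t) \<Longrightarrow> sign_change (\<lambda>s. det2 (d s) (l s)) t" for d
  proof -
    define x where "x = (\<lambda>t. det2 (d (clamp01 t)) (l (clamp01 t)))"
    define y where "y = (\<lambda>t. d (clamp01 t) \<bullet> l (clamp01 t))"
    have c: "isCont x t" "isCont y t" for t
      unfolding x_def y_def
      using isCont_clamp01[OF d(1), of t] isCont_clamp01[OF cont(3), of t]
      by (auto simp: isCont_def intro!: tendsto_intros)
    have notin: "t \<notin> A d" if "x t \<noteq> 0 \<or> y t < 0" for t
      using that aligned_iff[of "l (clamp01 t)" "d (clamp01 t)"] nz[OF clamp01(1), of t]
      by (auto simp: A_iff[OF d(3,4)] x_def y_def)
    have "\<not> t islimpt A d" for t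
    proof -
      have "\<forall>\<^sub>F s in at t. s \<notin> A d"
      proof (cases "t \<in> A d")
        case True
        then have t: "t \<in> {0..1}" "aligned (d t) (l t)" by (auto simp: A_def)
        have "0 < t \<and> t < 1" using interior[OF _ d(3,4), of t] t by simp
        then have "sign_change x t"
          unfolding x_def using sign_change_clamp01 d(5)[OF t] by blast
        then have "\<forall>\<^sub>F s in at_left t. x s \<noteq> 0" "\<forall>\<^sub>F s in at_right t. x s \<noteq> 0"
          unfolding sign_change_def by (auto elim: eventually_mono)
        then have "\<forall>\<^sub>F s in at t. x s \<noteq> 0" by (simp add: eventually_at_split)
        then show ?thesis by eventually_elim (use notin in blast)
      next
        case False
        have "x t \<noteq> 0 \<or> y t < 0"
        proof (rule ccontr)
          assume *: "\<not> ?thesis"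
          then obtain a where a: "d (clamp01 t) = of_real a * l (clamp01 t)"
            using det2_zero_imp nz[OF clamp01(1), of t] unfolding x_def by auto
          then have "y t = a * (l (clamp01 t) \<bullet> l (clamp01 t))"
            by (simp add: y_def scaleR_conv_of_real[symmetric])
          moreover have "a \<noteq> 0" using a d(2)[OF clamp01(1), of t] by auto
          ultimately have "y t \<noteq> 0" using nz[OF clamp01(1), of t] by simp
          then have "aligned (d (clamp01 t)) (l (clamp01 t))"
            using * aligned_iff[of "l (clamp01 t)" "d (clamp01 t)"] nz[OF clamp01(1), of t]
            by (auto simp: x_def y_def)
          then show False using False A_iff[OF d(3,4)] by simp
        qed
        then show ?thesis
        proof
          assume "x t \<noteq> 0"
          then have "\<forall>\<^sub>F s in at t. x s \<noteq> 0"
            using c(1)[of t] unfolding isCont_def by (intro tendsto_imp_eventually_ne)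
          then show ?thesis by eventually_elim (use notin in blast)
        next
          assume "y t < 0"
          then have "\<forall>\<^sub>F s in at t. y s < 0" by (rule eventually_neg[OF c(2)])
          then show ?thesis by eventually_elim (use notin in blast)
        qed
      qed
      then show ?thesis by (simp add: islimpt_iff_eventually)
    qed
    then have "finite ({0..1} \<inter> A d)"
      by (intro finite_not_islimpt_in_compact) auto
    moreover have "{0..1} \<inter> A d = A d" by (auto simp: A_def)
    ultimately show ?thesis by simp
  qed
  have finA: "finite (A e)" "finite (A f)"
    using fin[OF cont(1) _ ends(1,2) sc(1)] fin[OF cont(2) _ ends(3,4) sc(2)] nz by auto
  \<comment> \<open>The moments when exactly one of the two edges is aligned.\<close>
  define T where "T = (A e - A f) \<union> (A f - A e)"
  have T_iff: "t \<in> T \<longleftrightarrow> aligned (e (clamp01 t)) (l (clamp01 t)) \<noteq> aligned (f (clamp01 t)) (l (clamp01 t))" for t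
    unfolding T_def using A_iff[OF ends(1,2), of t] A_iff[OF ends(3,4), of t] by auto
  have "odd (card T) \<longleftrightarrow> under (l 0) (f 0) (- e 0) \<noteq> under (l 1) (f 1) (- e 1)"
  proof (rule toggle_parity_01(2)[of "\<lambda>s. under (l s) (f s) (- e s)"])
    show "T \<subseteq> {0..1}" by (auto simp: T_def A_def)
    fix t :: real
    have sc': "sign_change (\<lambda>s. det2 (d (clamp01 s)) (l (clamp01 s))) t"
      if "aligned (d (clamp01 t)) (l (clamp01 t))" "det2 (d 0) (l 0) \<noteq> 0" "det2 (d 1) (l 1) \<noteq> 0"
       "\<And>t. t \<in> {0..1} \<Longrightarrow> aligned (d t) (l t) \<Longrightarrow> sign_change (\<lambda>s. det2 (d s) (l s)) t" for d
      using interior[OF that(1-3)] that(4)[of t] that(1) sign_change_clamp01[of t "\<lambda>s. det2 (d s) (l s)"]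
      by auto
    show "\<exists>\<alpha> \<beta>. (\<forall>\<^sub>F s in at_left t. under (l (clamp01 s)) (f (clamp01 s)) (- e (clamp01 s)) = \<alpha>) \<and>
      (\<forall>\<^sub>F s in at_right t. under (l (clamp01 s)) (f (clamp01 s)) (- e (clamp01 s)) = \<beta>) \<and> (\<alpha> \<noteq> \<beta> \<longleftrightarrow> t \<in> T)"
      unfolding T_iff
      by (rule wind_local[where e = "\<lambda>s. e (clamp01 s)" and f = "\<lambda>s. f (clamp01 s)" and l = "\<lambda>s. l (clamp01 s)"])
        (use isCont_clamp01 cont nz[OF clamp01(1), of t] sc' ends sc in auto)
  qed
  moreover have "card T = card (A e - A f) + card (A f - A e)"
    unfolding T_def using finA by (intro card_Un_disjoint) auto
  moreover have "card (A e) = card (A e - A f) + card (A e \<inter> A f)"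
    "card (A f) = card (A f - A e) + card (A e \<inter> A f)"
    using finA by (simp_all add: card_Diff_subset_Int Int_commute card_mono)
  ultimately show ?thesis
    unfolding A_def[symmetric] using odd_wind[OF ends(1,3)] odd_wind[OF ends(2,4)] by auto
qed

section \<open>Effect of a deformation on the signature\<close>

text \<open>Rotations of the gauge direction and moves of one vertex are the two instances. Only the
  two end states are generic; in between, alignments and ray crossings occur, each with a genuine
  change of sign.\<close>

locale deformation =
  fixes N :: "'v network" and P :: "real \<Rightarrow> 'v vertex \<Rightarrow> complex" and M :: "real \<Rightarrow> 'v network"
    and m :: "real \<Rightarrow> complex"
  assumes M: "\<And>t. M t = N\<lparr>pos := P t\<rparr>"
    and continuous_P: "\<And>v. v \<in> vertices N \<Longrightarrow> continuous_on {0..1} (\<lambda>t. P t v)"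
    and continuous_m: "continuous_on {0..1} m"
    and drawn: "\<And>t. t \<in> {0..1} \<Longrightarrow> plane_drawing (M t)"
    and adm: "\<And>t. t \<in> {0..1} \<Longrightarrow> admissible (M t) (m t)"
    and valid0: "valid_gauged (M 0) (m 0)" and valid1: "valid_gauged (M 1) (m 1)"
    and arc_change: "\<And>t e. t \<in> {0..1} \<Longrightarrow> e \<in> arcs N \<Longrightarrow> aligned (edge_vec (M t) e) (m t) \<Longrightarrow>
      sign_change (\<lambda>s. det2 (edge_vec (M s) e) (m s)) t"
    and ray_change: "\<And>t u j. t \<in> {0..1} \<Longrightarrow> u \<in> internals N \<Longrightarrow> j \<in> sources N \<Longrightarrow>
      ipos (M t) u \<in> ray (bpos (M t) j) (m t) \<Longrightarrow>
      sign_change (\<lambda>s. det2 (ipos (M s) u - bpos (M s) j) (m s)) t"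
begin

lemma M_simps [simp]:
  "center (M t) = center N" "radius (M t) = radius N" "bdcount (M t) = bdcount N"
  "internals (M t) = internals N" "white (M t) = white N" "arcs (M t) = arcs N" "pos (M t) = P t"
  "vertices (M t) = vertices N" "in_arcs (M t) = in_arcs N" "out_arcs (M t) = out_arcs N"
  "in_arc (M t) = in_arc N" "out_arc (M t) = out_arc N" "sources (M t) = sources N"
  by (simp_all add: M vertices_def in_arcs_def[abs_def] out_arcs_def[abs_def] in_arc_def[abs_def]
      out_arc_def[abs_def] sources_def)

lemma plabic0: "plabic_network (M 0)" using valid0 by (simp add: valid_gauged_def)

lemma gauge01: "gauge_direction (M 0) (m 0)" "gauge_direction (M 1) (m 1)"
  using valid0 valid1 by (simp_all add: valid_gauged_def)

lemma drawn_M: "t \<in> {0..1} \<Longrightarrow> drawn_network (M t)"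
  using plabic_drawn[OF plabic0] drawn[of t] by (simp add: drawn_network_def)

lemma edge_vec_M: "edge_vec (M t) e = P t (snd e) - P t (fst e)"
  by (simp add: edge_vec_def)

text \<open>The net effect of the \<open>j\<close>-th ray on a vertex; it has the parity of the
  number of passages counted by \<open>cr\<close>.\<close>

definition sweeps :: "nat \<Rightarrow> 'v vertex \<Rightarrow> bool" where
  "sweeps j v \<longleftrightarrow> side (M 0) (m 0) j v \<noteq> side (M 1) (m 1) j v"

definition crosses :: "'v vertex \<times> 'v vertex \<Rightarrow> bool" where
  "crosses e \<longleftrightarrow> odd (card {t \<in> {0..1}. aligned (edge_vec (M t) e) (m t)})"

lemma par_crosses: "par M m e = of_bool (crosses e)"
  by (simp add: par_def crosses_def)

lemma side_M: "side (M t) (m t) j v \<longleftrightarrow> det2 (P t v - P t (Boundary j)) (m t) > 0"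
  by (simp add: side_def lefter_def det2_linear)

lemma continuous_det2_P:
  "v \<in> vertices N \<Longrightarrow> w \<in> vertices N \<Longrightarrow> continuous_on {0..1} (\<lambda>t. det2 (P t v - P t w) (m t))"
  by (intro continuous_intros continuous_P continuous_m)

text \<open>Within the disc, being on the ray means that the horizontal difference from its starting
  point is zero, and zeros with sign change are counted modulo two by the signs at the ends.\<close>

lemma odd_card_ray:
  assumes u: "u \<in> internals N" and j: "j \<in> sources N"
  shows "odd (card {t \<in> {0..1}. ipos (M t) u \<in> ray (bpos (M t) j) (m t)}) \<longleftrightarrow> sweeps j (Internal u)"
proof -
  have jb: "j \<in> {1..bdcount N}" using j by (simp add: sources_def)
  define x where "x = (\<lambda>t. det2 (P t (Internal u) - P t (Boundary j)) (m t))"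
  have ray: "ipos (M t) u \<in> ray (bpos (M t) j) (m t) \<longleftrightarrow> x t = 0" if t: "t \<in> {0..1}" for t
  proof -
    have "pos (M t) (Internal u) \<noteq> pos (M t) (Boundary j)"
      using pos_eq_iff[OF drawn_M[OF t], of "Internal u" "Boundary j"] u jb by simp
    then show ?thesis
      using ray_iff[OF drawn_M[OF t] adm[OF t], of j "ipos (M t) u"]
        vertex_in_cball[OF drawn_M[OF t], of "Internal u"] u jb by (simp add: x_def det2_linear)
  qed
  have "{t \<in> {0..1}. ipos (M t) u \<in> ray (bpos (M t) j) (m t)} = {t \<in> {0..1}. x t = 0}"
    using ray by blast
  moreover have "odd (card {t \<in> {0..1}. x t = 0}) \<longleftrightarrow> (x 0 > 0) \<noteq> (x 1 > 0)"
  proof (rule zero_count_parity)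
    show "continuous_on {0..1} x" unfolding x_def using u jb by (intro continuous_det2_P) auto
    show "x 0 \<noteq> 0" "x 1 \<noteq> 0"
      using vertex_det2_ne[OF drawn_M gauge01(1), of j "Internal u"]
        vertex_det2_ne[OF drawn_M gauge01(2), of j "Internal u"] u jb
      by (auto simp: x_def det2_linear)
    show "sign_change x t" if "t \<in> {0..1}" "x t = 0" for t
      using ray_change[OF that(1) u j] ray[OF that(1)] that(2) by (simp add: x_def)
  qed
  ultimately show ?thesis by (simp add: sweeps_def side_M x_def)
qed

lemma even_cr:
  assumes "u \<in> internals N"
  shows "even (cr M m u - (\<Sum>j\<in>sources N. of_bool (sweeps j (Internal u))))"
proof -
  have "cr M m u - (\<Sum>j\<in>sources N. of_bool (sweeps j (Internal u))) =
    (\<Sum>j\<in>sources N. int (card {t \<in> {0..1}. ipos (M t) u \<in> ray (bpos (M t) j) (m t)}) - of_bool (sweeps j (Internal u)))"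
    unfolding cr_def sum_subtractf of_nat_sum by simp
  moreover have "even \<dots>"
    by (intro dvd_sum) (use odd_card_ray[OF assms] in auto)
  ultimately show ?thesis by simp
qed

text \<open>Different boundary vertices are never on one vertical line during the deformation, so by
  the intermediate value theorem their horizontal order is constant.\<close>

lemma boundary_not_swept:
  assumes "i \<in> {1..bdcount N}" "j \<in> {1..bdcount N}" "i \<noteq> j"
  shows "\<not> sweeps j (Boundary i)"
proof -
  define x where "x = (\<lambda>t. det2 (P t (Boundary i) - P t (Boundary j)) (m t))"
  have c: "continuous_on {0..1} x" unfolding x_def using assms by (intro continuous_det2_P) auto
  have nz: "x t \<noteq> 0" if "t \<in> {0..1}" for t
    using boundary_det2_ne[OF drawn_M[OF that] adm[OF that], of i j] assms by (simp add: x_def det2_linear)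
  have "(x 0 > 0) = (x 1 > 0)"
  proof (rule ccontr)
    assume "(x 0 > 0) \<noteq> (x 1 > 0)"
    then have "\<exists>t\<ge>0. t \<le> 1 \<and> x t = 0"
      using IVT'[of x 0 0 1] IVT2'[of x 1 0 0] c by fastforce
    then show False using nz by auto
  qed
  then show ?thesis by (simp add: sweeps_def side_M x_def)
qed

text \<open>Whether a ray separates the ends of \<open>e\<close> changes once for each end that it
  sweeps over.\<close>

lemma even_int_parity_change:
  "even (int_parity (M 1) (m 1) e - int_parity (M 0) (m 0) e -
    (\<Sum>j\<in>sources N. of_bool (Boundary j \<notin> ends e \<and> sweeps j (fst e)) +
       of_bool (Boundary j \<notin> ends e \<and> sweeps j (snd e))))"
  unfolding int_parity_def M_simps sum_subtractf[symmetric]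
  by (intro dvd_sum) (auto simp: sweeps_def)

lemma odd_wind_change:
  assumes "e \<in> in_arcs N v" "f \<in> out_arcs N v"
  shows "odd (edge_wind (M 0) (m 0) e f) \<noteq> odd (edge_wind (M 1) (m 1) e f) \<longleftrightarrow> crosses e \<noteq> crosses f"
proof -
  have ef: "e \<in> arcs N" "f \<in> arcs N" using assms by (auto simp: in_arcs_def out_arcs_def)
  have cont: "continuous_on {0..1} (\<lambda>t. edge_vec (M t) g)" if "g \<in> arcs N" for g
    unfolding edge_vec_M using arc_vertices[OF drawn_M[of 0], of g] that
    by (intro continuous_intros continuous_P) auto
  have nz: "edge_vec (M t) g \<noteq> 0" if "g \<in> arcs N" "t \<in> {0..1}" for g t
    using pos_eq_iff[OF drawn_M[OF that(2)], of "snd g" "fst g"] arc_vertices[OF drawn_M[OF that(2)], of g] that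
    by (auto simp: edge_vec_M)
  have na: "\<not> aligned (- edge_vec (M t) e) (edge_vec (M t) f)" if "t \<in> {0..1}" for t
    using consecutive_not_antiparallel(1)[OF drawn_M[OF that], of e v f] assms by simp
  have "m t \<noteq> 0" if "t \<in> {0..1}" for t using adm[OF that] by (simp add: admissible_def)
  then show ?thesis
    unfolding edge_wind_def crosses_def
    by (intro wind_parity cont ef continuous_m arc_change)
      (use nz na ef edge_vec_ne[OF gauge01(1)] edge_vec_ne[OF gauge01(2)] in auto)
qed

text \<open>If an edge into a sink pointed along the gauge direction, the sink would be strictly
  between its other end and the disc points ahead on its ray.\<close>

lemma sink_not_crossed:
  assumes "e \<in> arcs N" "snd e = Boundary j" shows "\<not> crosses e"
proof -
  have j: "j \<in> {1..bdcount N}" "fst e \<in> vertices N"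
    using arc_vertices[OF drawn_M[of 0], of e] assms by auto
  have "\<not> aligned (edge_vec (M t) e) (m t)" if t: "t \<in> {0..1}" for t
  proof
    assume "aligned (edge_vec (M t) e) (m t)"
    then obtain c where c: "c > 0" "P t (Boundary j) - P t (fst e) = of_real c * m t"
      using assms by (auto simp: aligned_def edge_vec_M)
    obtain s where s: "s > 0" "P t (Boundary j) + of_real s * m t \<in> disc (M t)"
    proof -
      have "ray (bpos (M t) j) (m t) \<inter> disc (M t) \<noteq> {}"
        using adm[OF t] j by (simp add: admissible_def)
      then show ?thesis using that unfolding ray_def by auto
    qed
    have "P t (Boundary j) - of_real c * m t = P t (fst e)" using c(2) by (simp add: algebra_simps)
    then have "c \<le> 0"
      using not_between_cball[OF boundary_on_circle[OF drawn_M[OF t], of j], of s "m t" c] s j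
        vertex_in_cball[OF drawn_M[OF t], of "fst e"] by (simp add: disc_def)
    then show False using c by simp
  qed
  then have "{t \<in> {0..1}. aligned (edge_vec (M t) e) (m t)} = {}" by blast
  then show ?thesis by (simp only: crosses_def) simp
qed

text \<open>The edge from a source is aligned exactly when its head lies on the ray from that
  source. This compensates for the ray that \<open>int_parity\<close> leaves out for such an
  edge.\<close>

lemma source_crossed:
  assumes "(Boundary j, Internal v) \<in> arcs N"
  shows "crosses (Boundary j, Internal v) \<longleftrightarrow> sweeps j (Internal v)"
proof -
  have v: "v \<in> internals N" "j \<in> {1..bdcount N}"
    using arc_vertices[OF drawn_M[of 0], of "(Boundary j, Internal v)"] assms by auto
  have "j \<in> sources N" using v assms by (auto simp: sources_def out_arcs_def)
  moreover have "aligned (edge_vec (M t) (Boundary j, Internal v)) (m t) \<longleftrightarrow>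
      ipos (M t) v \<in> ray (bpos (M t) j) (m t)" for t
    by (auto simp: aligned_def ray_def edge_vec_M algebra_simps)
  ultimately show ?thesis using odd_card_ray[OF v(1)] by (simp add: crosses_def)
qed

definition own_arc :: "'v \<Rightarrow> 'v vertex \<times> 'v vertex" where
  "own_arc u = (if u \<in> white N then in_arc N u else out_arc N u)"

lemma even_deformation_gauge:
  assumes "u \<in> internals N"
  shows "even (deformation_gauge M m u -
    ((\<Sum>j\<in>sources N. of_bool (sweeps j (Internal u))) + of_bool (crosses (own_arc u))))"
proof -
  have "even (deformation_gauge M m u - (cr M m u + of_bool (crosses (own_arc u))))"
    by (simp add: deformation_gauge_def own_arc_def par_crosses mod_2_eq_odd)
  then show ?thesis using even_cr[OF assms] by (auto simp: even_diff_iff)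
qed

text \<open>At a white vertex this is the change of the winding from the incoming arc to
  \<open>e\<close>. At a black vertex \<open>e\<close> is itself \<open>own_arc\<close>, so both
  crossings cancel and the term is constant. The crossing of \<open>e\<close> occurs again at its
  head and drops out.\<close>

lemma even_tail_change:
  assumes "e \<in> arcs N" "fst e = Internal u"
  shows "even (tail_term (M 1) (m 1) e - tail_term (M 0) (m 0) e - (of_bool (crosses (own_arc u)) + of_bool (crosses e)))"
proof -
  have u: "u \<in> internals N" using arc_vertices(1)[OF drawn_M[of 0], of e] assms by auto
  have out: "e \<in> out_arcs N (Internal u)" using assms by (simp add: out_arcs_def)
  show ?thesis
  proof (cases "u \<in> white N")
    case True
    then have "in_arc N u \<in> in_arcs N (Internal u)" using white_in_arc[OF plabic0, of u] by auto
    from odd_wind_change[OF this out] show ?thesis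
      using True assms by (auto simp: tail_term_def own_arc_def)
  next
    case False
    then have "out_arc N u = e" using black_out_arc[OF plabic0, of u] u out by auto
    then show ?thesis using False assms by (simp add: tail_term_def own_arc_def)
  qed
qed

lemma even_head_change:
  assumes "e \<in> arcs N" "snd e = Internal v"
  shows "even (head_term (M 1) (m 1) e - head_term (M 0) (m 0) e - (of_bool (crosses (own_arc v)) + of_bool (crosses e)))"
proof -
  have v: "v \<in> internals N" using arc_vertices(2)[OF drawn_M[of 0], of e] assms by auto
  have "in": "e \<in> in_arcs N (Internal v)" using assms by (simp add: in_arcs_def)
  show ?thesis
  proof (cases "v \<in> white N")
    case True
    then have "in_arc N v = e" using white_in_arc[OF plabic0, of v] "in" by auto
    then show ?thesis using True assms by (simp add: head_term_def own_arc_def)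
  next
    case False
    then have "out_arc N v \<in> out_arcs N (Internal v)" using black_out_arc[OF plabic0, of v] v by auto
    from odd_wind_change[OF "in" this] show ?thesis
      using False assms by (auto simp: head_term_def own_arc_def)
  qed
qed

lemma sink_not_source:
  assumes "e \<in> arcs N" "snd e = Boundary j" shows "j \<notin> sources N"
proof
  assume "j \<in> sources N"
  then have j: "j \<in> {1..bdcount N}" "out_arcs N (Boundary j) \<noteq> {}" by (auto simp: sources_def)
  have fin: "finite (in_arcs N (Boundary j))" "finite (out_arcs N (Boundary j))"
    using finite_arcs[OF drawn_M[of 0]] by (auto simp: in_arcs_def out_arcs_def)
  have "e \<in> in_arcs N (Boundary j)" using assms by (simp add: in_arcs_def)
  then have "in_arcs N (Boundary j) \<noteq> {}" by blast
  then have "card (in_arcs N (Boundary j)) \<ge> 1" "card (out_arcs N (Boundary j)) \<ge> 1"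
    using fin j by (simp_all add: Suc_leI card_gt_0_iff)
  moreover have "valency (M 0) (Boundary j) = 1" using plabic0 j by (simp add: plabic_network_def)
  ultimately show False by (simp add: valency_def)
qed

theorem deformation_gauge_transforms:
  "gauge_transforms N (deformation_gauge M m) (geom_signature (M 0) (m 0)) (geom_signature (M 1) (m 1))"
proof -
  have "gauge_transforms (M 0) (deformation_gauge M m) (geom_signature (M 0) (m 0)) (geom_signature (M 1) (m 1))"
  proof (rule gauge_transformsI)
    show "drawn_network (M 0)" by (simp add: drawn_M)
    show "deformation_gauge M m u \<in> {0, 1}" for u
      by (auto simp: deformation_gauge_def)
    fix e assume "e \<in> arcs (M 0)" and int: "fst e \<in> range Internal \<or> snd e \<in> range Internal"
    then have e: "e \<in> arcs N" by simp
    define S where "S v = (\<Sum>j\<in>sources N. of_bool (Boundary j \<notin> ends e \<and> sweeps j v) :: int)" for v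
    define F where "F v = (\<Sum>j\<in>sources N. of_bool (sweeps j v) :: int)" for v
    note v = arc_vertices[OF drawn_M[of 0], of e, simplified, OF e]
    have sg: "even (arc_sign (M 1) (m 1) e - arc_sign (M 0) (m 0) e
        - (int_parity (M 1) (m 1) e - int_parity (M 0) (m 0) e
         + (tail_term (M 1) (m 1) e - tail_term (M 0) (m 0) e) + (head_term (M 1) (m 1) e - head_term (M 0) (m 0) e)))"
      using even_arc_sign[OF drawn_M gauge01(1), of e] even_arc_sign[OF drawn_M gauge01(2), of e] e int
      by auto
    have ip: "even (int_parity (M 1) (m 1) e - int_parity (M 0) (m 0) e - (S (fst e) + S (snd e)))"
      using even_int_parity_change[of e] by (simp add: S_def sum.distrib)
    let ?g = "vertex_gauge (deformation_gauge M m)"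
    have "even (arc_sign (M 1) (m 1) e - arc_sign (M 0) (m 0) e - (?g (fst e) + ?g (snd e)))"
    proof (cases "fst e")
      case (Internal u)
      have u: "u \<in> internals N" using v Internal by simp
      have j: "Boundary j \<notin> ends e" if "j \<in> sources N" for j
        using sink_not_source[OF e] that Internal by (auto simp: ends_def)
      then have SF: "S = F" by (auto simp: S_def F_def intro!: sum.cong)
      note t = even_tail_change[OF e Internal] and gu = even_deformation_gauge[OF u, folded F_def]
      show ?thesis
      proof (cases "snd e")
        case B: (Boundary j)
        \<comment> \<open>No ray sweeps over a sink, and the gauge has no value there.\<close>
        have "S (snd e) = 0"
          unfolding S_def
        proof (intro sum.neutral ballI)
          fix i assume i: "i \<in> sources N"
          then have "i \<noteq> j" using sink_not_source[OF e B] by auto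
          then have "\<not> sweeps i (snd e)"
            using boundary_not_swept[of j i] i v B by (auto simp: sources_def)
          then show "of_bool (Boundary i \<notin> ends e \<and> sweeps i (snd e)) = (0::int)" by simp
        qed
        moreover have "head_term (M 1) (m 1) e - head_term (M 0) (m 0) e = 0"
          using B by (simp add: head_term_def)
        ultimately show ?thesis
          using sg ip t gu sink_not_crossed[OF e B] Internal B SF by (auto simp: vertex_gauge_def)
      next
        case I: (Internal w)
        have w: "w \<in> internals N" using v I by simp
        note h = even_head_change[OF e I] and gw = even_deformation_gauge[OF w, folded F_def]
        show ?thesis
          using sg ip t h gu gw Internal I SF by (auto simp: vertex_gauge_def)
      qed
    next
      case (Boundary i)
      then obtain w where I: "snd e = Internal w" using int by auto
      have w: "w \<in> internals N" using v I by simp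
      have ei: "e = (Boundary i, Internal w)" using Boundary I by (simp add: prod_eq_iff)
      have i: "i \<in> sources N" using v e ei by (auto simp: sources_def out_arcs_def)
      have fin: "finite (sources N)" by (simp add: sources_def)
      have "S (fst e) = 0"
        unfolding S_def
      proof (intro sum.neutral ballI)
        fix j assume j: "j \<in> sources N"
        show "of_bool (Boundary j \<notin> ends e \<and> sweeps j (fst e)) = (0::int)"
          using boundary_not_swept[of i j] i j Boundary by (cases "i = j") (auto simp: sources_def ends_def)
      qed
      \<comment> \<open>The gauge at the head counts all rays, the intersection parity all but the
        one from the source \<open>i\<close>. The difference is the sweep of that ray, which equals
        the crossing of \<open>e\<close>.\<close>
      moreover have "F (Internal w) = of_bool (sweeps i (Internal w)) + S (Internal w)"
      proof -
        have "F (Internal w) = of_bool (sweeps i (Internal w)) + (\<Sum>j\<in>sources N - {i}. of_bool (sweeps j (Internal w)))"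
          unfolding F_def by (rule sum.remove[OF fin i])
        also have "(\<Sum>j\<in>sources N - {i}. of_bool (sweeps j (Internal w)) :: int) = S (Internal w)"
          unfolding S_def ei ends_def using fin
          by (intro sum.mono_neutral_cong_left) auto
        finally show ?thesis .
      qed
      moreover have "tail_term (M 1) (m 1) e - tail_term (M 0) (m 0) e = 0"
        using Boundary by (simp add: tail_term_def)
      moreover note h = even_head_change[OF e I] and gw = even_deformation_gauge[OF w, folded F_def]
      moreover have "crosses e \<longleftrightarrow> sweeps i (Internal w)" using source_crossed e ei by simp
      ultimately show ?thesis
        using sg ip Boundary I by (auto simp: vertex_gauge_def)
    qed
    then show "even (geom_signature (M 1) (m 1) (ends e) -
        (geom_signature (M 0) (m 0) (ends e) + ?g (fst e) + ?g (snd e)))"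
      using geom_signature_ends[OF drawn_M, of 0 e] geom_signature_ends[OF drawn_M, of 1 e] e
      by (simp add: algebra_simps)
  qed
  then show ?thesis by (simp add: gauge_transforms_def edges_def)
qed

end

section \<open>Rotation of the gauge direction and motion of one vertex\<close>

lemma gauge_transforms_cong:
  assumes "drawn_network N" "gauge_transforms N \<eta> \<epsilon> \<epsilon>'" "\<And>u. u \<in> internals N \<Longrightarrow> \<eta> u = \<zeta> u"
  shows "gauge_transforms N \<zeta> \<epsilon> \<epsilon>'"
proof -
  have v: "x \<in> vertices N" if "x \<in> d" "d \<in> edges N" for x d
    using that arc_vertices[OF assms(1)] by (auto simp: edges_def ends_def)
  have "u \<in> internals N" if "Internal u \<in> d" "d \<in> edges N" for u d
    using v[OF that] by simp
  then show ?thesis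
    using assms(2,3) unfolding gauge_transforms_def by (metis insertCI)
qed

text \<open>An affine function that is not zero at time 0 has at most one zero, and changes sign
  there. Rotating along a segment of directions makes all relevant determinants affine in
  time.\<close>

lemma affine_sign_change:
  assumes "\<And>s. x s = (1 - s) * a + s * b" "a \<noteq> 0" "x t = 0"
  shows "sign_change x t"
proof -
  have ab: "b \<noteq> a" using assms by (auto simp: algebra_simps)
  have eq: "x s = (s - t) * (b - a)" for s
    using assms(1)[of s] assms(1)[of t] assms(3) by (simp add: algebra_simps)
  have "\<forall>\<^sub>F s in at_left t. s < t" "\<forall>\<^sub>F s in at_right t. s > t"
    by (simp_all add: eventually_at_filter)
  then have "\<forall>\<^sub>F s in at_left t. x s \<noteq> 0 \<and> (x s > 0) = (b < a)"
    "\<forall>\<^sub>F s in at_right t. x s \<noteq> 0 \<and> (x s > 0) = (\<not> b < a)"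
    unfolding eq using ab by (auto elim!: eventually_mono simp: zero_less_mult_iff)
  then show ?thesis unfolding sign_change_def by blast
qed

text \<open>The disc is convex, so between disc points on the two extreme rays from a boundary
  vertex there is one on the rotated ray. A vanishing direction would put the vertex itself into the
  open disc.\<close>

lemma admissible_rotation:
  assumes "admissible N l" "admissible N l'" "drawn_network N" "bdcount N \<ge> 1" "t \<in> {0..1}"
  shows "admissible N (rotation l l' t)"
proof -
  have *: "\<exists>c>0. bpos N j + of_real c * rotation l l' t \<in> disc N" if j: "j \<in> {1..bdcount N}" for j
  proof -
    let ?b = "bpos N j"
    obtain a a' where a: "a > 0" "?b + of_real a * l \<in> disc N" "a' > 0" "?b + of_real a' * l' \<in> disc N"
      using assms(1,2) j unfolding admissible_def ray_def by blast
    \<comment> \<open>The weights solve \<open>(1 - u) * a : u * a' = (1 - t) : t\<close>, which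
      puts the combination of the two disc points on the ray in direction
      \<open>rotation l l' t\<close>.\<close>
    define D where "D = t * a + (1 - t) * a'"
    have D: "D > 0" using a assms(5) unfolding D_def
      by (cases "t = 0") (auto intro: add_pos_nonneg)
    define u where "u = t * a / D"
    have u: "0 \<le> u" "u \<le> 1" using D a assms(5) by (auto simp: u_def D_def divide_simps)
    have "(1 - u) * a = a * a' / D * (1 - t)" "u * a' = a * a' / D * t"
      using D by (auto simp: u_def field_simps) (simp add: D_def algebra_simps)
    then have "(1 - u) *\<^sub>R (?b + of_real a * l) + u *\<^sub>R (?b + of_real a' * l')
        = ?b + of_real (a * a' / D) * rotation l l' t"
    proof -
      have "(1 - u) *\<^sub>R (?b + of_real a * l) + u *\<^sub>R (?b + of_real a' * l')
        = ?b + of_real ((1 - u) * a) * l + of_real (u * a') * l'"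
        by (simp add: scaleR_conv_of_real algebra_simps)
      then show ?thesis
        unfolding \<open>(1 - u) * a = _\<close> \<open>u * a' = _\<close>
        by (simp only: rotation_def of_real_mult distrib_left mult.assoc add.assoc)
    qed
    moreover have "(1 - u) *\<^sub>R (?b + of_real a * l) + u *\<^sub>R (?b + of_real a' * l') \<in> disc N"
      using a u unfolding disc_def by (intro convexD convex_ball) auto
    moreover have "a * a' / D > 0" using a D by simp
    ultimately show ?thesis by metis
  qed
  have "rotation l l' t \<noteq> 0"
  proof
    assume "rotation l l' t = 0"
    then have "bpos N 1 \<in> disc N" using *[of 1] assms(4) by auto
    then show False using boundary_on_circle[OF assms(3), of 1] assms(4) by (simp add: disc_def)
  qed
  then show ?thesis using * by (fastforce simp: admissible_def ray_def)
qed

text \<open>Every internal vertex is connected to the boundary. This settles the rotation when there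
  is no boundary vertex and hence no guarantee that the rotated direction stays nonzero.\<close>

lemma no_boundary_trivial:
  assumes "plabic_network N" "\<not> bdcount N \<ge> 1"
  shows "internals N = {}" "arcs N = {}"
proof -
  show i: "internals N = {}" using assms by (auto simp: plabic_network_def)
  then have "vertices N = {}" using assms(2) by (simp add: vertices_def)
  then show "arcs N = {}" using assms(1) by (auto simp: plabic_network_def)
qed

theorem ray_rotation_gauge:
  assumes "valid_gauged N l" "valid_gauged N l'"
  shows "gauge_transforms N (rotation_gauge N l l') (geom_signature N l) (geom_signature N l')"
proof (cases "bdcount N \<ge> 1")
  case False
  have "plabic_network N" using assms by (simp add: valid_gauged_def)
  from no_boundary_trivial[OF this False] show ?thesis
    by (simp add: gauge_transforms_def edges_def)
next
  case True
  have N: "plabic_network N" "gauge_direction N l" "gauge_direction N l'"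
    using assms by (simp_all add: valid_gauged_def)
  note dN = plabic_drawn[OF N(1)]
  have det: "det2 v (rotation l l' s) = (1 - s) * det2 v l + s * det2 v l'" for v s
    by (simp only: rotation_def det2_linear(2,8))
  have zero: "det2 v w = 0" if "aligned v w" for v w
    using that by (auto simp: aligned_def det2_linear)
  have r01: "rotation l l' 0 = l" "rotation l l' 1 = l'" by (simp_all add: rotation_def)
  interpret deformation N "\<lambda>_. pos N" "\<lambda>_. N" "rotation l l'"
  proof
    show "N = N\<lparr>pos := pos N\<rparr>" by simp
    show "continuous_on {0..1} (rotation l l')" unfolding rotation_def by (intro continuous_intros)
    show "plane_drawing N" using dN by (simp add: drawn_network_def)
    show "admissible N (rotation l l' t)" if "t \<in> {0..1}" for t
      using admissible_rotation[OF _ _ dN True that] N gauge_admissible by blast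
    show "valid_gauged N (rotation l l' 0)" "valid_gauged N (rotation l l' 1)"
      using assms by (simp_all add: r01)
    show "sign_change (\<lambda>s. det2 (edge_vec N e) (rotation l l' s)) t"
      if "e \<in> arcs N" "aligned (edge_vec N e) (rotation l l' t)" for t e
      by (rule affine_sign_change[OF det]) (use zero[OF that(2)] edge_vec_ne[OF N(2) that(1)] in auto)
    show "sign_change (\<lambda>s. det2 (ipos N u - bpos N j) (rotation l l' s)) t"
      if "u \<in> internals N" "j \<in> sources N" "ipos N u \<in> ray (bpos N j) (rotation l l' t)" for t u j
    proof (rule affine_sign_change[OF det])
      show "det2 (ipos N u - bpos N j) l \<noteq> 0"
        using vertex_det2_ne[OF dN N(2), of j "Internal u"] that by (simp add: det2_linear sources_def)
      show "det2 (ipos N u - bpos N j) (rotation l l' t) = 0"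
        using that(3) by (auto simp: ray_def det2_linear)
    qed
  qed auto
  show ?thesis using deformation_gauge_transforms by (simp add: rotation_gauge_def r01)
qed

text \<open>For a fixed vertex \<open>v\<close> the formula of case (2) degenerates:
  \<open>v\<close> meets no ray, and its distinguished arc turns only if it joins \<open>v\<close>
  to \<open>u\<close>, that is, comes from \<open>u\<close> for white \<open>v\<close> and goes to
  \<open>u\<close> for black \<open>v\<close>. This is \<open>motion_gauge\<close>.\<close>

theorem vertex_move_gauge:
  assumes val: "valid_gauged N l" "valid_gauged (move N u (p 1)) l" and mot: "vertex_motion N l u p"
  shows "gauge_transforms N (motion_gauge N l u p) (geom_signature N l) (geom_signature (move N u (p 1)) l)"
proof -
  have N: "plabic_network N" "gauge_direction N l" using val by (simp_all add: valid_gauged_def)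
  note dN = plabic_drawn[OF N(1)]
  have u: "u \<in> internals N" and cont: "continuous_on {0..1} p" and p0: "p 0 = ipos N u"
    and dr: "\<And>t. t \<in> {0..1} \<Longrightarrow> plane_drawing (move N u (p t))"
    using mot by (auto simp: vertex_motion_def)
  have m0: "move N u (p 0) = N" by (simp add: move_def p0)
  have vec: "edge_vec (move N u z) e = edge_vec N e" if "Internal u \<notin> ends e" for e z
    using that by (auto simp add: edge_vec_def move_def ends_def)
  have not_al: "\<not> aligned (edge_vec (move N u z) e) l" if "e \<in> arcs N" "Internal u \<notin> ends e" for e z
    using vec[OF that(2)] edge_vec_ne[OF N(2) that(1)] by (auto simp: aligned_def det2_linear)
  have not_ray: "ipos (move N u z) v \<notin> ray (bpos (move N u z) j) l"
    if "v \<in> internals N" "v \<noteq> u" "j \<in> sources N" for v j z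
    using N(2) that by (auto simp: gauge_direction_def move_def sources_def)
  interpret deformation N "\<lambda>t. (pos N)(Internal u := p t)" "\<lambda>t. move N u (p t)" "\<lambda>_. l"
  proof
    show "continuous_on {0..1} (\<lambda>t. ((pos N)(Internal u := p t)) v)" for v
      using cont by (cases "v = Internal u") auto
    show "admissible (move N u (p t)) l" for t
      using gauge_admissible[OF N(2)] by (simp add: admissible_def move_def disc_def)
    show "valid_gauged (move N u (p 0)) l" "valid_gauged (move N u (p 1)) l"
      using val by (simp_all add: m0)
    show "sign_change (\<lambda>s. det2 (edge_vec (move N u (p s)) e) l) t"
      if "t \<in> {0..1}" "e \<in> arcs N" "aligned (edge_vec (move N u (p t)) e) l" for t e
    proof (rule changes_sign_turn)
      have "Internal u \<in> ends e" using not_al that by blast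
      then show "changes_sign_at (\<lambda>s. turn l (edge_vec (move N u (p s)) e)) t"
        using mot that by (simp add: vertex_motion_def)
    qed
    show "sign_change (\<lambda>s. det2 (ipos (move N u (p s)) v - bpos (move N u (p s)) j) l) t"
      if "t \<in> {0..1}" "v \<in> internals N" "j \<in> sources N"
        "ipos (move N u (p t)) v \<in> ray (bpos (move N u (p t)) j) l" for t v j
    proof (rule changes_sign_turn)
      have "v = u" using not_ray that by blast
      then show "changes_sign_at (\<lambda>s. turn l (ipos (move N u (p s)) v - bpos (move N u (p s)) j)) t"
        using mot that by (auto simp: vertex_motion_def move_def)
    qed
  qed (use dr in \<open>auto simp: move_def\<close>)
  let ?M = "\<lambda>t. move N u (p t)"
  have par0: "par ?M (\<lambda>_. l) e = 0" if "e \<in> arcs N" "Internal u \<notin> ends e" for e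
  proof -
    have "{t \<in> {0..1}. aligned (edge_vec (?M t) e) l} = {}" using not_al[OF that] by blast
    then show ?thesis by (simp only: par_def) simp
  qed
  have "deformation_gauge ?M (\<lambda>_. l) v = motion_gauge N l u p v" if v: "v \<in> internals N" for v
  proof (cases "v = u")
    case False
    have empty: "{t \<in> {0..1}. ipos (?M t) v \<in> ray (bpos (?M t) j) l} = {}" if "j \<in> sources N" for j
      using not_ray[OF v False that] by blast
    then have cr: "cr ?M (\<lambda>_. l) v = 0"
    proof -
      have "(\<Sum>j\<in>sources N. card {t \<in> {0..1}. ipos (?M t) v \<in> ray (bpos (?M t) j) l}) = 0"
      proof (intro sum.neutral ballI)
        fix j assume "j \<in> sources N"
        from empty[OF this] show "card {t \<in> {0..1}. ipos (?M t) v \<in> ray (bpos (?M t) j) l} = 0"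
          by (simp only: card.empty)
      qed
      then show ?thesis unfolding cr_def m0 by (simp only: of_nat_0)
    qed
    have pm: "par ?M (\<lambda>_. l) e mod 2 = par ?M (\<lambda>_. l) e" for e by (simp add: par_def)
    show ?thesis
    proof (cases "v \<in> white N")
      case True
      have e: "in_arcs N (Internal v) = {in_arc N v}" using white_in_arc[OF N(1) True] .
      then have ea: "in_arc N v \<in> arcs N" "snd (in_arc N v) = Internal v"
        by (auto simp: in_arcs_def)
      have "par ?M (\<lambda>_. l) (in_arc N v) = motion_gauge N l u p v"
      proof (cases "(Internal u, Internal v) \<in> arcs N")
        case a: True
        then have "(Internal u, Internal v) \<in> in_arcs N (Internal v)" by (simp add: in_arcs_def)
        then have "in_arc N v = (Internal u, Internal v)" using e by auto
        then show ?thesis using False True a by (simp add: motion_gauge_def Let_def)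
      next
        case a: False
        then have "Internal u \<notin> ends (in_arc N v)"
          using ea False by (cases "in_arc N v") (auto simp: ends_def)
        then show ?thesis using par0[OF ea(1)] False True a by (simp add: motion_gauge_def Let_def)
      qed
      then show ?thesis using True cr pm[of "in_arc N v"] by (simp add: deformation_gauge_def m0)
    next
      case F: False
      have e: "out_arcs N (Internal v) = {out_arc N v}" using black_out_arc[OF N(1) v F] .
      then have ea: "out_arc N v \<in> arcs N" "fst (out_arc N v) = Internal v"
        by (auto simp: out_arcs_def)
      have "par ?M (\<lambda>_. l) (out_arc N v) = motion_gauge N l u p v"
      proof (cases "(Internal v, Internal u) \<in> arcs N")
        case a: True
        then have "(Internal v, Internal u) \<in> out_arcs N (Internal v)" by (simp add: out_arcs_def)
        then have "out_arc N v = (Internal v, Internal u)" using e by auto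
        then show ?thesis using False F a by (simp add: motion_gauge_def Let_def)
      next
        case a: False
        then have "Internal u \<notin> ends (out_arc N v)"
          using ea False by (cases "out_arc N v") (auto simp: ends_def)
        then show ?thesis using par0[OF ea(1)] False F a by (simp add: motion_gauge_def Let_def)
      qed
      then show ?thesis using F cr pm[of "out_arc N v"] by (simp add: deformation_gauge_def m0)
    qed
  qed (simp add: motion_gauge_def Let_def)
  then show ?thesis
    using gauge_transforms_cong[OF dN deformation_gauge_transforms] by (simp add: m0)
qed

section \<open>Reversal of arcs\<close>

lemma valency_one:
  assumes "drawn_network N" "valency N v = 1" "e \<in> arcs N" "f \<in> arcs N" "v \<in> ends e" "v \<in> ends f"
  shows "e = f"
proof -
  have fin: "finite (in_arcs N v)" "finite (out_arcs N v)"
    using finite_arcs[OF assms(1)] by (auto simp: in_arcs_def out_arcs_def)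
  have "in_arcs N v \<inter> out_arcs N v = {}"
    using arc_vertices(3)[OF assms(1)] by (auto simp: in_arcs_def out_arcs_def)
  then have "card (in_arcs N v \<union> out_arcs N v) = 1"
    using fin assms(2) by (simp add: valency_def card_Un_disjoint)
  moreover have "e \<in> in_arcs N v \<union> out_arcs N v" "f \<in> in_arcs N v \<union> out_arcs N v"
    using assms by (auto simp: ends_def in_arcs_def out_arcs_def)
  ultimately show ?thesis by (metis card_1_singletonE singletonD)
qed

lemma valency_pos:
  assumes "valency N v \<noteq> 0" obtains e where "e \<in> arcs N" "v \<in> ends e"
proof -
  have "in_arcs N v \<noteq> {} \<or> out_arcs N v \<noteq> {}" using assms by (auto simp: valency_def)
  then show ?thesis using that by (auto simp: in_arcs_def out_arcs_def ends_def)
qed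

lemma under_parity:
  assumes "\<not> aligned v q"
  shows "even (of_bool (under l v q) + of_bool (under l q v) - of_bool (det2 v l * det2 q l > 0) :: int)"
proof (cases "det2 v l * det2 q l > 0")
  case True
  then show ?thesis using under_antisym[OF True not_aligned_det2[OF assms True]] by auto
next
  case False
  then show ?thesis using under_same_side[of l v q] under_same_side[of l q v] by (auto simp: mult.commute)
qed

text \<open>Stated additively to avoid subtraction of natural numbers. The sets involved are
  disjoint because a drawing has no antiparallel arcs.\<close>

lemma card_reverse_arcs:
  assumes "drawn_network N" "D \<subseteq> arcs N"
  shows "card (in_arcs (reverse_arcs D N) v) + card (D \<inter> in_arcs N v) = card (in_arcs N v) + card (D \<inter> out_arcs N v)"
    and "card (out_arcs (reverse_arcs D N) v) + card (D \<inter> out_arcs N v) = card (out_arcs N v) + card (D \<inter> in_arcs N v)"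
proof -
  have fin: "finite (in_arcs N v)" "finite (out_arcs N v)"
    using finite_arcs[OF assms(1)] by (auto simp: in_arcs_def out_arcs_def)
  have eq: "in_arcs (reverse_arcs D N) v = (in_arcs N v - D) \<union> (D \<inter> out_arcs N v)\<inverse>"
    "out_arcs (reverse_arcs D N) v = (out_arcs N v - D) \<union> (D \<inter> in_arcs N v)\<inverse>"
    using assms(2) by (auto simp: in_arcs_def out_arcs_def reverse_arcs_def)
  have "D\<inverse> \<inter> arcs N = {}" using no_antiparallel[OF assms(1)] assms(2) by auto
  then have dis: "(in_arcs N v - D) \<inter> (D \<inter> out_arcs N v)\<inverse> = {}" "(out_arcs N v - D) \<inter> (D \<inter> in_arcs N v)\<inverse> = {}"
    by (auto simp: in_arcs_def out_arcs_def)
  have "card (in_arcs (reverse_arcs D N) v) = card (in_arcs N v - D) + card (D \<inter> out_arcs N v)"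
    "card (out_arcs (reverse_arcs D N) v) = card (out_arcs N v - D) + card (D \<inter> in_arcs N v)"
    unfolding eq using dis fin by (simp_all add: card_Un_disjoint card_inverse)
  moreover have "card (in_arcs N v) = card (in_arcs N v - D) + card (D \<inter> in_arcs N v)"
    "card (out_arcs N v) = card (out_arcs N v - D) + card (D \<inter> out_arcs N v)"
    using fin by (simp_all add: card_Diff_subset_Int Int_commute card_mono)
  ultimately show "card (in_arcs (reverse_arcs D N) v) + card (D \<inter> in_arcs N v) = card (in_arcs N v) + card (D \<inter> out_arcs N v)"
    "card (out_arcs (reverse_arcs D N) v) + card (D \<inter> out_arcs N v) = card (out_arcs N v) + card (D \<inter> in_arcs N v)"
    by simp_all
qed

text \<open>An arbitrary set \<open>D\<close> is reversed; that it consists of disjoint paths and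
  cycles is a consequence of both orientations being perfect.\<close>

locale reversal =
  fixes N :: "'v network" and l :: complex and D :: "('v vertex \<times> 'v vertex) set"
  assumes valid: "valid_gauged N l" and D: "D \<subseteq> arcs N" and valid': "valid_gauged (reverse_arcs D N) l"
begin

abbreviation "N' \<equiv> reverse_arcs D N"

lemma rev_simps [simp]:
  "center N' = center N" "radius N' = radius N" "bdcount N' = bdcount N"
  "internals N' = internals N" "white N' = white N" "pos N' = pos N"
  "vertices N' = vertices N" "arcs N' = (arcs N - D) \<union> D\<inverse>" "edge_vec N' = edge_vec N"
  by (simp_all add: reverse_arcs_def vertices_def edge_vec_def[abs_def])

lemma plabic: "plabic_network N" "plabic_network N'"
  using valid valid' by (simp_all add: valid_gauged_def)

lemma gauge: "gauge_direction N l" "gauge_direction N' l"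
  using valid valid' by (simp_all add: valid_gauged_def)

lemma l_nz: "l \<noteq> 0" using gauge by (simp add: gauge_direction_def)

lemma drawn: "drawn_network N" "drawn_network N'"
  using plabic plabic_drawn by blast+

lemma finite_D: "finite D" using D finite_arcs[OF drawn(1)] finite_subset by blast

lemma in_arcs': "in_arcs N' v = (in_arcs N v - D) \<union> (D \<inter> out_arcs N v)\<inverse>"
  using D by (auto simp: in_arcs_def out_arcs_def)

lemma out_arcs': "out_arcs N' v = (out_arcs N v - D) \<union> (D \<inter> in_arcs N v)\<inverse>"
  using D by (auto simp: in_arcs_def out_arcs_def)

lemma finite_io: "finite (in_arcs N v)" "finite (out_arcs N v)"
  using finite_arcs[OF drawn(1)] by (auto simp: in_arcs_def out_arcs_def)

lemmas card_arcs' = card_reverse_arcs[OF drawn(1) D]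

text \<open>The unique incoming arc of a white vertex, or outgoing arc of a black one, remains
  unique after reversal, so \<open>D\<close> enters and leaves the vertex equally often and at most
  once.\<close>

lemma balanced:
  assumes "u \<in> internals N"
  shows "card (D \<inter> in_arcs N (Internal u)) = card (D \<inter> out_arcs N (Internal u))"
    "card (D \<inter> in_arcs N (Internal u)) \<le> 1"
proof -
  have le: "card (D \<inter> in_arcs N (Internal u)) \<le> card (in_arcs N (Internal u))"
    "card (D \<inter> out_arcs N (Internal u)) \<le> card (out_arcs N (Internal u))"
    using finite_io by (simp_all add: card_mono)
  have "if u \<in> white N then card (in_arcs N (Internal u)) = 1 \<and> card (in_arcs N' (Internal u)) = 1
    else card (out_arcs N (Internal u)) = 1 \<and> card (out_arcs N' (Internal u)) = 1"
    using plabic assms unfolding plabic_network_def perfect_orientation_def by fastforce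
  then show "card (D \<inter> in_arcs N (Internal u)) = card (D \<inter> out_arcs N (Internal u))"
    "card (D \<inter> in_arcs N (Internal u)) \<le> 1"
    using card_arcs'[of "Internal u"] le by (auto split: if_splits)
qed

definition on_D :: "'v vertex \<Rightarrow> bool" where "on_D v \<longleftrightarrow> v \<in> \<Union> (ends ` D)"

lemma on_D_iff: "on_D v \<longleftrightarrow> D \<inter> in_arcs N v \<noteq> {} \<or> D \<inter> out_arcs N v \<noteq> {}"
  using D by (fastforce simp: on_D_def ends_def in_arcs_def out_arcs_def)

lemma through_arcs:
  assumes "u \<in> internals N" "on_D (Internal u)"
  obtains x y where "D \<inter> in_arcs N (Internal u) = {(x, Internal u)}"
    "D \<inter> out_arcs N (Internal u) = {(Internal u, y)}"
proof -
  have "card (D \<inter> in_arcs N (Internal u)) = 1" "card (D \<inter> out_arcs N (Internal u)) = 1"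
    using balanced[OF assms(1)] assms(2) finite_io[of "Internal u"] unfolding on_D_iff
    by (metis One_nat_def Suc_leI card_0_eq finite_Int le_antisym neq0_conv)+
  then obtain e f where "D \<inter> in_arcs N (Internal u) = {e}" "D \<inter> out_arcs N (Internal u) = {f}"
    by (metis card_1_singletonE)
  moreover from this have "snd e = Internal u" "fst f = Internal u"
    by (auto simp: in_arcs_def out_arcs_def)
  ultimately show ?thesis using that[of "fst e" "snd f"] by (metis prod.collapse)
qed

lemma boundary_arc_unique:
  assumes "j \<in> {1..bdcount N}" "e \<in> arcs N" "f \<in> arcs N" "Boundary j \<in> ends e" "Boundary j \<in> ends f"
  shows "e = f"
  using valency_one[OF drawn(1) _ assms(2-5)] plabic(1) assms(1) by (simp add: plabic_network_def)

definition touched :: "nat set" where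
  "touched = {j \<in> {1..bdcount N}. on_D (Boundary j)}"

lemma finite_touched: "finite touched" by (simp add: touched_def)

text \<open>A boundary vertex has a single arc, so it changes between source and sink exactly when
  this arc is reversed.\<close>

lemma sources': "sources N' = (sources N - touched) \<union> (touched - sources N)"
proof -
  have "out_arcs N' (Boundary j) \<noteq> {} \<longleftrightarrow> (out_arcs N (Boundary j) \<noteq> {}) \<noteq> on_D (Boundary j)"
    if j: "j \<in> {1..bdcount N}" for j
  proof -
    have "valency N (Boundary j) \<noteq> 0" using plabic(1) j by (simp add: plabic_network_def)
    then obtain e where e: "e \<in> arcs N" "Boundary j \<in> ends e" by (rule valency_pos)
    have ne: "fst e \<noteq> snd e" using arc_vertices(3)[OF drawn(1) e(1)] .
    have un: "f = e" if "f \<in> arcs N" "Boundary j \<in> ends f" for f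
      using boundary_arc_unique[OF j that(1) e(1) that(2) e(2)] .
    consider "fst e = Boundary j" "snd e \<noteq> Boundary j" | "snd e = Boundary j" "fst e \<noteq> Boundary j"
      using e(2) ne by (auto simp: ends_def)
    then show ?thesis
    proof cases
      case 1
      have "f = e" if "f \<in> in_arcs N (Boundary j) \<or> f \<in> out_arcs N (Boundary j)" for f
        by (rule un) (use that in \<open>auto simp: in_arcs_def out_arcs_def ends_def\<close>)
      moreover have "e \<in> out_arcs N (Boundary j)" "e \<notin> in_arcs N (Boundary j)"
        using 1 e(1) by (simp_all add: in_arcs_def out_arcs_def)
      ultimately have "in_arcs N (Boundary j) = {}" "out_arcs N (Boundary j) = {e}" by blast+
      then show ?thesis by (auto simp: on_D_iff out_arcs')
    next
      case 2
      have "f = e" if "f \<in> in_arcs N (Boundary j) \<or> f \<in> out_arcs N (Boundary j)" for f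
        by (rule un) (use that in \<open>auto simp: in_arcs_def out_arcs_def ends_def\<close>)
      moreover have "e \<notin> out_arcs N (Boundary j)" "e \<in> in_arcs N (Boundary j)"
        using 2 e(1) by (simp_all add: in_arcs_def out_arcs_def)
      ultimately have "in_arcs N (Boundary j) = {e}" "out_arcs N (Boundary j) = {}" by blast+
      then show ?thesis by (cases e) (auto simp: on_D_iff out_arcs')
    qed
  qed
  then show ?thesis by (auto simp: sources_def touched_def)
qed

definition pt :: "'v vertex \<times> 'v vertex \<Rightarrow> complex \<times> complex" where
  "pt e = (pos N (fst e), pos N (snd e))"

definition E :: "(complex \<times> complex) set" where "E = pt ` D"

lemma pos_eq: "v \<in> vertices N \<Longrightarrow> w \<in> vertices N \<Longrightarrow> pos N v = pos N w \<longleftrightarrow> v = w"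
  using pos_eq_iff[OF drawn(1)] .

lemma arc_ends: "e \<in> arcs N \<Longrightarrow> fst e \<in> vertices N \<and> snd e \<in> vertices N \<and> fst e \<noteq> snd e"
  using arc_vertices[OF drawn(1)] by auto

lemma inj_pt: "inj_on pt D"
proof (rule inj_onI)
  fix e f assume "e \<in> D" "f \<in> D" "pt e = pt f"
  moreover from this have "e \<in> arcs N" "f \<in> arcs N" using D by auto
  ultimately show "e = f"
    using pos_eq arc_ends unfolding pt_def by (metis prod.collapse prod.inject)
qed

lemma sum_E: "(\<Sum>g\<in>E. F g) = (\<Sum>e\<in>D. F (pt e))"
  unfolding E_def using inj_pt by (simp add: sum.reindex)

lemma finite_E: "finite E" by (simp add: E_def finite_D)

lemma E_vec: "g \<in> E \<Longrightarrow> det2 (snd g - fst g) l \<noteq> 0"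
  using edge_vec_ne[OF gauge(1) subsetD[OF D]] by (auto simp: E_def pt_def edge_vec_def)

lemma is_end_pt:
  assumes "v \<in> vertices N" "e \<in> D" shows "is_end (pos N v) (pt e) \<longleftrightarrow> v \<in> ends e"
proof -
  have "fst e \<in> vertices N" "snd e \<in> vertices N" using arc_ends[OF subsetD[OF D assms(2)]] by auto
  then show ?thesis
    unfolding is_end_def pt_def ends_def fst_conv snd_conv using pos_eq[OF _ assms(1)] by blast
qed

text \<open>Internal vertices have degree 0 or 2 in \<open>D\<close> and cancel modulo two; the
  boundary vertices on \<open>D\<close> have degree 1 and remain.\<close>

lemma degree_sum:
  fixes h :: "'v vertex \<Rightarrow> int"
  shows "even ((\<Sum>e\<in>D. h (fst e) + h (snd e)) - (\<Sum>j\<in>touched. h (Boundary j)))"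
proof -
  note finV = finite_vertices[OF drawn(1)]
  have "(\<Sum>e\<in>D. h (fst e)) = (\<Sum>v\<in>vertices N. \<Sum>e\<in>{e\<in>D. fst e = v}. h (fst e))"
    by (intro sum.group[symmetric] finite_D finV) (use D arc_ends in auto)
  moreover have "(\<Sum>e\<in>D. h (snd e)) = (\<Sum>v\<in>vertices N. \<Sum>e\<in>{e\<in>D. snd e = v}. h (snd e))"
    by (intro sum.group[symmetric] finite_D finV) (use D arc_ends in auto)
  moreover have "{e\<in>D. fst e = v} = D \<inter> out_arcs N v" "{e\<in>D. snd e = v} = D \<inter> in_arcs N v" for v
    using D by (auto simp: out_arcs_def in_arcs_def)
  moreover have "(\<Sum>e\<in>D \<inter> out_arcs N v. h (fst e)) = h v * int (card (D \<inter> out_arcs N v))"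
    "(\<Sum>e\<in>D \<inter> in_arcs N v. h (snd e)) = h v * int (card (D \<inter> in_arcs N v))" for v
    by (simp_all add: in_arcs_def out_arcs_def)
  ultimately have 1: "(\<Sum>e\<in>D. h (fst e) + h (snd e)) =
      (\<Sum>v\<in>vertices N. h v * int (card (D \<inter> out_arcs N v) + card (D \<inter> in_arcs N v)))"
    by (simp add: sum.distrib distrib_left)
  have "(\<Sum>j\<in>touched. h (Boundary j)) = (\<Sum>v\<in>Boundary ` touched. h v)"
    by (simp add: sum.reindex inj_on_def)
  also have "\<dots> = (\<Sum>v\<in>vertices N. h v * of_bool (v \<in> Boundary ` touched))"
    using finV by (intro sum.mono_neutral_cong_left) (auto simp: touched_def)
  finally have 2: "(\<Sum>j\<in>touched. h (Boundary j)) = \<dots>" .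
  have "even (int (card (D \<inter> out_arcs N v) + card (D \<inter> in_arcs N v)) - of_bool (v \<in> Boundary ` touched))"
    if "v \<in> vertices N" for v
  proof (cases v)
    case (Internal u)
    then show ?thesis using balanced[of u] that by auto
  next
    case (Boundary j)
    have j: "j \<in> {1..bdcount N}" using that Boundary by simp
    show ?thesis
    proof (cases "on_D v")
      case True
      then obtain e where e: "e \<in> D" "v \<in> ends e" by (auto simp: on_D_def)
      have "f = e" if "f \<in> (D \<inter> out_arcs N v) \<union> (D \<inter> in_arcs N v)" for f
        using boundary_arc_unique[OF j, of f e] that e D Boundary
        by (auto simp: in_arcs_def out_arcs_def ends_def)
      moreover have "e \<in> (D \<inter> out_arcs N v) \<union> (D \<inter> in_arcs N v)"
        using e D by (auto simp: in_arcs_def out_arcs_def ends_def)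
      ultimately have "(D \<inter> out_arcs N v) \<union> (D \<inter> in_arcs N v) = {e}" by blast
      moreover have "(D \<inter> out_arcs N v) \<inter> (D \<inter> in_arcs N v) = {}"
        using arc_ends[of "(v, v)"] by (auto simp: in_arcs_def out_arcs_def)
      ultimately have "card (D \<inter> out_arcs N v) + card (D \<inter> in_arcs N v) = 1"
        using finite_D by (subst card_Un_disjoint[symmetric]) auto
      moreover have "v \<in> Boundary ` touched" using True j Boundary by (auto simp: touched_def)
      ultimately show ?thesis by simp
    next
      case False
      then have "D \<inter> out_arcs N v = {}" "D \<inter> in_arcs N v = {}" by (auto simp: on_D_iff)
      then show ?thesis using False Boundary by (auto simp: touched_def)
    qed
  qed
  then have "even (\<Sum>v\<in>vertices N. h v * (int (card (D \<inter> out_arcs N v) + card (D \<inter> in_arcs N v))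
      - of_bool (v \<in> Boundary ` touched)))"
    by (intro dvd_sum) simp
  then show ?thesis unfolding 1 2 by (simp add: sum_subtractf[symmetric] right_diff_distrib)
qed

text \<open>Whatever the disc contains on the vertical line through a boundary vertex is above it,
  so a segment in the disc is met by the upward ray iff the line separates its ends.\<close>

lemma upw_boundary:
  assumes j: "j \<in> {1..bdcount N}" and ab: "seg (a, b) \<subseteq> cball (center N) (radius N)" and nj: "bpos N j \<notin> seg (a, b)"
  shows "odd (upw l (bpos N j) (a, b)) \<longleftrightarrow> lefter l (bpos N j) a \<noteq> lefter l (bpos N j) b"
proof (cases "lefter l (bpos N j) a = lefter l (bpos N j) b")
  case False
  let ?p = "bpos N j"
  have ne: "det2 (b - a) l \<noteq> 0" using False by (auto simp: lefter_def det2_linear)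
  have "seg (a, b) \<inter> {z. det2 z l = det2 ?p l} \<noteq> {}"
    using segment_line_point(2)[OF ne, of "det2 ?p l"] False by (auto simp: lefter_def)
  then obtain z where z: "z \<in> seg (a, b)" "det2 z l = det2 ?p l" by blast
  then have "z \<in> ray ?p l"
    using on_vertical_line[OF drawn(1) gauge_admissible[OF gauge(1)] j, of z] ab nj by auto
  then obtain t where t: "t > 0" "z = ?p + of_real t * l" by (auto simp: ray_def)
  obtain s where s: "z = (1 - s) *\<^sub>R a + s *\<^sub>R b" using z(1) by (auto simp: seg_def in_segment)
  have "z = a + of_real s * (b - a)" unfolding s by (simp add: scaleR_conv_of_real algebra_simps)
  then have "?p - (a + of_real s * (b - a)) = of_real (- t) * l" using t by (simp add: algebra_simps)
  from above_iff(2)[OF ne this] have "below l ?p (a, b)" using t by simp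
  then show ?thesis using False by (auto simp: upw_def)
qed (simp add: upw_def)

text \<open>The disc has no points below a boundary vertex. This matches the convention that the
  gauge vanishes on the boundary.\<close>

lemma count_below_boundary:
  assumes j: "j \<in> {1..bdcount N}" shows "count_below l E (bpos N j) = 0"
  unfolding count_below_def
proof (intro sum.neutral ballI)
  let ?p = "bpos N j"
  fix g assume g: "g \<in> E"
  obtain P Q where PQ: "g = (P, Q)" by (cases g)
  obtain e where e: "e \<in> D" "g = pt e" using g by (auto simp: E_def)
  then have ea: "e \<in> arcs N" using D by auto
  have cb: "P \<in> cball (center N) (radius N)" "Q \<in> cball (center N) (radius N)"
    using vertex_in_cball[OF drawn(1)] arc_ends[OF ea] e PQ by (auto simp: pt_def)
  have "down l ?p g = 0" if ni: "\<not> is_end ?p g"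
  proof (cases "lefter l P ?p = lefter l Q ?p")
    case False
    obtain s a where sa: "?p - (P + of_real s * (Q - P)) = of_real a * l"
      "det2 (Q - P) l \<noteq> 0" "P + of_real s * (Q - P) \<in> seg (P, Q)"
      by (metis vertical_projection[OF l_nz False])
    have "P + of_real s * (Q - P) \<in> cball (center N) (radius N)"
      using sa(3) seg_in_cball[OF cb] by blast
    moreover have "P + of_real s * (Q - P) = ?p - of_real a * l" using sa(1) by (simp add: algebra_simps)
    moreover obtain t where "t > 0" "?p + of_real t * l \<in> ball (center N) (radius N)"
      using gauge_admissible[OF gauge(1)] j unfolding admissible_def ray_def disc_def by blast
    ultimately have "a \<le> 0"
      using not_between_cball[OF boundary_on_circle[OF drawn(1) j], of t l a] by simp
    then show ?thesis using above_iff(1)[OF sa(2,1)] by (simp add: down_def PQ)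
  qed (simp add: down_def PQ)
  then show "(if is_end ?p g then 0 else down l ?p g) = 0" by simp
qed

lemma vertex_on_edge:
  assumes "v \<in> vertices N" "e \<in> arcs N" "pos N v \<in> edge_seg N e" shows "v \<in> ends e"
proof -
  have "valency N v \<noteq> 0"
    using plabic(1) assms(1) by (cases v) (auto simp: plabic_network_def)
  then obtain f where f: "f \<in> arcs N" "v \<in> ends f" by (rule valency_pos)
  show ?thesis
  proof (cases "e = f")
    case False
    have "pos N v \<in> edge_seg N f" using f(2) by (auto simp: ends_def edge_seg_def)
    then have "pos N v \<in> pos N ` (ends e \<inter> ends f)"
      using edges_meet[OF drawn(1) assms(2) f(1) False] assms(3) by blast
    then obtain w where "w \<in> ends e" "pos N v = pos N w" by blast
    then show ?thesis using pos_eq[OF assms(1), of w] arc_ends[OF assms(2)] by (auto simp: ends_def)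
  qed (use f in simp)
qed

definition other_end :: "'v vertex \<Rightarrow> 'v vertex \<times> 'v vertex \<Rightarrow> 'v vertex" where
  "other_end x g = (if fst g = x then snd g else fst g)"

text \<open>Counts the reversed edges at \<open>x\<close>, other than \<open>xy\<close>, that start
  out below \<open>xy\<close>.\<close>

definition branch :: "'v vertex \<Rightarrow> 'v vertex \<Rightarrow> int" where
  "branch x y = (\<Sum>g\<in>D. if x \<in> ends g \<and> y \<notin> ends g
     then of_bool (under l (pos N y - pos N x) (pos N (other_end x g) - pos N x)) else 0)"

lemma count_under_branch:
  assumes "x \<in> vertices N" "y \<in> vertices N"
  shows "count_under l E (pos N x) (pos N y) = branch x y"
  unfolding count_under_def sum_E branch_def
proof (intro sum.cong[OF HOL.refl])
  fix e assume e: "e \<in> D"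
  then have "fst e \<in> vertices N" using D arc_ends[of e] by auto
  then have "opposite (pos N x) (pt e) = pos N (other_end x e)"
    using pos_eq[of "fst e" x] assms(1) by (simp add: opposite_def other_end_def pt_def)
  then show "(if is_end (pos N x) (pt e) \<and> \<not> is_end (pos N y) (pt e) then of_bool (under l (pos N y - pos N x) (opposite (pos N x) (pt e) - pos N x)) else 0)
    = (if x \<in> ends e \<and> y \<notin> ends e then of_bool (under l (pos N y - pos N x) (pos N (other_end x e) - pos N x)) else (0::int))"
    using is_end_pt[OF _ e] assms by simp
qed

abbreviation "depth v \<equiv> count_below l E (pos N v)"

abbreviation "crossed j e \<equiv> Boundary j \<notin> ends e \<and> side N l j (fst e) \<noteq> side N l j (snd e)"

text \<open>\<open>count_parity\<close> along the arc \<open>e\<close>. By \<open>degree_sum\<close>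
  the middle sum is left with the boundary ends of \<open>D\<close>, and these count whether their
  rays cross \<open>e\<close>. The equation links the depths at both ends to the change of
  \<open>int_parity\<close>.\<close>

lemma arc_parity:
  assumes e: "e \<in> arcs N"
  shows "even (depth (fst e) + depth (snd e) + (\<Sum>j\<in>touched. of_bool (crossed j e))
    + branch (fst e) (snd e) + branch (snd e) (fst e))"
proof -
  let ?a = "pos N (fst e)" and ?b = "pos N (snd e)"
  have v: "fst e \<in> vertices N" "snd e \<in> vertices N" "fst e \<noteq> snd e" using arc_ends[OF e] by auto
  have par: "even (depth (fst e) + depth (snd e)
    + (\<Sum>g\<in>E. upw_proper l ?a ?b (fst g) + upw_proper l ?a ?b (snd g))
    + count_under l E ?a ?b + count_under l E ?b ?a)"
  proof (rule count_parity[OF finite_E l_nz])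
    show "det2 (?b - ?a) l \<noteq> 0" using edge_vec_ne[OF gauge(1) e] by (simp add: edge_vec_def)
    show "det2 (snd g - fst g) l \<noteq> 0" if "g \<in> E" for g using E_vec[OF that] .
    fix g assume "g \<in> E"
    then obtain f where f: "f \<in> D" "g = pt f" by (auto simp: E_def)
    show "seg (?a, ?b) \<inter> seg g \<subseteq> {?a, ?b} \<inter> {fst g, snd g} \<or> {fst g, snd g} = {?a, ?b}"
    proof (cases "f = e")
      case True
      then show ?thesis using f by (auto simp: pt_def)
    next
      case False
      have "edge_seg N e \<inter> edge_seg N f \<subseteq> pos N ` (ends e \<inter> ends f)"
        using edges_meet[OF drawn(1) e] f D False by blast
      also have "\<dots> \<subseteq> {?a, ?b} \<inter> {pos N (fst f), pos N (snd f)}"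
        unfolding ends_def by auto
      finally show ?thesis by (intro disjI1) (simp only: edge_seg_seg f(2) pt_def fst_conv snd_conv)
    qed
  qed
  have s1: "(\<Sum>g\<in>E. upw_proper l ?a ?b (fst g) + upw_proper l ?a ?b (snd g))
    = (\<Sum>f\<in>D. upw_proper l ?a ?b (pos N (fst f)) + upw_proper l ?a ?b (pos N (snd f)))"
    unfolding sum_E by (simp add: pt_def)
  have s2: "even ((\<Sum>f\<in>D. upw_proper l ?a ?b (pos N (fst f)) + upw_proper l ?a ?b (pos N (snd f)))
      - (\<Sum>j\<in>touched. upw_proper l ?a ?b (bpos N j)))"
    using degree_sum[of "\<lambda>v. upw_proper l ?a ?b (pos N v)"] .
  have s3: "even ((\<Sum>j\<in>touched. upw_proper l ?a ?b (bpos N j)) - (\<Sum>j\<in>touched. of_bool (crossed j e)))"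
    unfolding sum_subtractf[symmetric]
  proof (intro dvd_sum)
    fix j assume "j \<in> touched"
    then have j: "j \<in> {1..bdcount N}" by (simp add: touched_def)
    then have bv: "Boundary j \<in> vertices N" by simp
    have cb: "?a \<in> cball (center N) (radius N)" "?b \<in> cball (center N) (radius N)"
      using vertex_in_cball[OF drawn(1)] v by auto
    show "even (upw_proper l ?a ?b (bpos N j) - of_bool (crossed j e))"
    proof (cases "Boundary j \<in> ends e")
      case True
      then show ?thesis using v by (auto simp: upw_proper_def ends_def)
    next
      case False
      then have "bpos N j \<notin> seg (?a, ?b)" using vertex_on_edge[OF bv e] by (auto simp: edge_seg_seg)
      moreover have "bpos N j \<noteq> ?a" "bpos N j \<noteq> ?b"
        using pos_eq[OF bv] v False by (auto simp: ends_def)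
      ultimately show ?thesis
        using upw_boundary[OF j seg_in_cball[OF cb]] False by (auto simp: upw_proper_def side_def)
    qed
  qed
  have shift: "even (x + y + S3 + p + q)" if "even (x + y + S1 + p + q)" "S1 = S0" "even (S0 - S2)" "even (S2 - S3)"
    for x y p q S0 S1 S2 S3 :: int
    using that by presburger
  show ?thesis
    by (rule shift[OF par[unfolded count_under_branch[OF v(1,2)] count_under_branch[OF v(2,1)]] s1 s2 s3])
qed

text \<open>The set of sources changes by symmetric difference with \<open>touched\<close>, so the
  change is the sum over \<open>touched\<close> that also occurs in
  \<open>arc_parity\<close>.\<close>

lemma even_int_parity_reverse:
  assumes "ends e' = ends e" "{fst e', snd e'} = {fst e, snd e}"
  shows "even (int_parity N' l e' - int_parity N l e - (\<Sum>j\<in>touched. of_bool (crossed j e)))"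
proof -
  have fin: "finite (sources N)" by (simp add: sources_def)
  have eq: "Boundary j \<notin> ends e' \<and> side N' l j (fst e') \<noteq> side N' l j (snd e') \<longleftrightarrow> crossed j e" for j
    using assms(2) unfolding assms(1) side_def doubleton_eq_iff by auto
  define c where "c j = (of_bool (crossed j e) :: int)" for j
  have "int_parity N' l e' = sum c (sources N - touched) + sum c (touched - sources N)"
    unfolding int_parity_def eq c_def[symmetric] unfolding sources'
    using fin finite_touched by (intro sum.union_disjoint) auto
  moreover have "sum c (sources N) = sum c (sources N - touched) + sum c (sources N \<inter> touched)"
    using fin by (metis add.commute sum.Int_Diff)
  moreover have "sum c touched = sum c (touched - sources N) + sum c (sources N \<inter> touched)"
    using finite_touched by (metis add.commute sum.Int_Diff Int_commute)
  moreover have "int_parity N l e = sum c (sources N)" by (simp add: int_parity_def c_def)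
  ultimately show ?thesis by (simp add: c_def)
qed

lemma branch_boundary:
  assumes "e \<in> arcs N" "ends e = {Boundary j, y}" shows "branch (Boundary j) y = 0"
  unfolding branch_def
proof (intro sum.neutral ballI)
  fix g assume g: "g \<in> D"
  have "j \<in> {1..bdcount N}" using arc_ends[OF assms(1)] assms(2)
    by (auto simp: ends_def doubleton_eq_iff)
  then have "Boundary j \<in> ends g \<Longrightarrow> g = e"
    using boundary_arc_unique[of j g e] g D assms by auto
  then show "(if Boundary j \<in> ends g \<and> y \<notin> ends g
     then of_bool (under l (pos N y - pos N (Boundary j)) (pos N (other_end (Boundary j) g) - pos N (Boundary j))) else 0) = (0::int)"
    using assms(2) by auto
qed

lemma branch_off:
  assumes "\<not> on_D x" shows "branch x y = 0"
  unfolding branch_def using assms by (intro sum.neutral ballI) (auto simp: on_D_def)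

text \<open>The two neighbours \<open>x\<close> and \<open>y\<close> of \<open>v\<close> lie on
  different horizontal sides of \<open>v\<close>.\<close>

definition straight :: "'v vertex \<Rightarrow> 'v vertex \<Rightarrow> 'v vertex \<Rightarrow> bool" where
  "straight x v y \<longleftrightarrow> det2 (pos N x - pos N v) l * det2 (pos N y - pos N v) l < 0"

text \<open>The gauge of the reversal in a form that does not mention regions: the parity of the number
  of reversed edges below the vertex, corrected at those black vertices on the reversed curve where
  the curve does not turn back horizontally.\<close>

definition reversal_parity :: "'v \<Rightarrow> bool \<Rightarrow> bool" where
  "reversal_parity u b \<longleftrightarrow> (b \<longleftrightarrow> odd (depth (Internal u)) \<noteq>
     (u \<notin> white N \<and> (\<exists>x y. (x, Internal u) \<in> D \<and> (Internal u, y) \<in> D \<and> straight x (Internal u) y)))"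

lemma reversal_parity_cases:
  assumes "reversal_parity u b"
  shows "u \<in> white N \<or> \<not> on_D (Internal u) \<Longrightarrow> b \<longleftrightarrow> odd (depth (Internal u))"
    "u \<notin> white N \<Longrightarrow> D \<inter> in_arcs N (Internal u) = {(x, Internal u)} \<Longrightarrow>
      D \<inter> out_arcs N (Internal u) = {(Internal u, y)} \<Longrightarrow>
      b \<longleftrightarrow> odd (depth (Internal u)) \<noteq> straight x (Internal u) y"
proof -
  assume "u \<in> white N \<or> \<not> on_D (Internal u)"
  then have "\<not> (u \<notin> white N \<and> (\<exists>x y. (x, Internal u) \<in> D \<and> (Internal u, y) \<in> D \<and> straight x (Internal u) y))"
    by (auto simp: on_D_def ends_def)
  then show "b \<longleftrightarrow> odd (depth (Internal u))" using assms by (simp add: reversal_parity_def)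
next
  assume u: "u \<notin> white N" and 1: "D \<inter> in_arcs N (Internal u) = {(x, Internal u)}"
    and 2: "D \<inter> out_arcs N (Internal u) = {(Internal u, y)}"
  have "(x', Internal u) \<in> D \<longleftrightarrow> x' = x" for x' using 1 D by (auto simp: in_arcs_def)
  moreover have "(Internal u, y') \<in> D \<longleftrightarrow> y' = y" for y' using 2 D by (auto simp: out_arcs_def)
  ultimately show "b \<longleftrightarrow> odd (depth (Internal u)) \<noteq> straight x (Internal u) y"
    using assms u by (simp add: reversal_parity_def)
qed

abbreviation "dir x y \<equiv> pos N y - pos N x"

lemma dir_ne: "(x, y) \<in> arcs N \<or> (y, x) \<in> arcs N \<Longrightarrow> det2 (dir x y) l \<noteq> 0"
  using edge_vec_ne[OF gauge(1), of "(x, y)"] edge_vec_ne[OF gauge(1), of "(y, x)"]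
  by (auto simp: edge_vec_def det2_linear)

lemma odd_edge_wind:
  assumes "(x, v) \<in> arcs N \<or> (v, x) \<in> arcs N" "(v, y) \<in> arcs N \<or> (y, v) \<in> arcs N"
  shows "odd (edge_wind N l (x, v) (v, y)) \<longleftrightarrow> under l (dir v y) (dir v x)"
    "odd (edge_wind N' l (x, v) (v, y)) \<longleftrightarrow> under l (dir v y) (dir v x)"
proof -
  have "odd (wind l (dir x v) (dir v y)) \<longleftrightarrow> under l (dir v y) (- dir x v)"
    by (rule odd_wind) (use dir_ne assms in auto)
  then show "odd (edge_wind N l (x, v) (v, y)) \<longleftrightarrow> under l (dir v y) (dir v x)"
    "odd (edge_wind N' l (x, v) (v, y)) \<longleftrightarrow> under l (dir v y) (dir v x)"
    by (simp_all add: edge_wind_def) (simp_all add: edge_vec_def)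
qed

lemma dir_parity:
  assumes "e \<in> arcs N" "f \<in> arcs N" "e \<noteq> f" "ends e = {v, x}" "ends f = {v, y}"
  shows "under l (dir v x) (dir v y) \<noteq> under l (dir v y) (dir v x) \<longleftrightarrow>
    det2 (dir v x) l * det2 (dir v y) l > 0"
  using under_parity[OF outward_not_aligned(1)[OF drawn(1) assms], of l]
  by (auto simp: of_bool_def split: if_splits)

lemma branch_through:
  assumes in1: "D \<inter> in_arcs N v = {(x, v)}" and out1: "D \<inter> out_arcs N v = {(v, y)}" and "x \<noteq> v" "y \<noteq> v" "x \<noteq> y"
  shows "branch v z = (if z = x \<or> z = v then 0 else of_bool (under l (dir v z) (dir v x)))
    + (if z = y \<or> z = v then 0 else of_bool (under l (dir v z) (dir v y)))"
proof -
  have "{g \<in> D. v \<in> ends g} = {(x, v), (v, y)}"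
  proof -
    have "{g \<in> D. v \<in> ends g} = (D \<inter> in_arcs N v) \<union> (D \<inter> out_arcs N v)"
      using D by (auto simp: ends_def in_arcs_def out_arcs_def)
    then show ?thesis unfolding in1 out1 by auto
  qed
  moreover have "branch v z = (\<Sum>g\<in>{g \<in> D. v \<in> ends g}. if z \<notin> ends g
     then of_bool (under l (dir v z) (dir v (other_end v g))) else 0)"
    unfolding branch_def using finite_D by (intro sum.mono_neutral_cong_right) auto
  ultimately show ?thesis
    using assms(3-5) by (auto simp: ends_def other_end_def)
qed

lemma through_distinct:
  assumes "D \<inter> in_arcs N v = {(x, v)}" "D \<inter> out_arcs N v = {(v, y)}"
  shows "(x, v) \<in> D" "(v, y) \<in> D" "(x, v) \<in> arcs N" "(v, y) \<in> arcs N" "x \<noteq> v" "y \<noteq> v" "x \<noteq> y"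
proof -
  show D': "(x, v) \<in> D" "(v, y) \<in> D" using assms by auto
  then show a: "(x, v) \<in> arcs N" "(v, y) \<in> arcs N" using D by auto
  show "x \<noteq> v" "y \<noteq> v" using arc_ends[OF a(1)] arc_ends[OF a(2)] by auto
  show "x \<noteq> y" using no_antiparallel[OF drawn(1) a(1)] a(2) by auto
qed

lemma in_arc':
  assumes "u \<in> white N" "D \<inter> in_arcs N (Internal u) = {(x, Internal u)}" "D \<inter> out_arcs N (Internal u) = {(Internal u, y)}"
  shows "in_arc N u = (x, Internal u)" "in_arc N' u = (y, Internal u)"
proof -
  have "(x, Internal u) \<in> in_arcs N (Internal u)" using assms by blast
  then show "in_arc N u = (x, Internal u)" using white_in_arc[OF plabic(1) assms(1)] by auto
  have "(y, Internal u) \<in> in_arcs N' (Internal u)" unfolding in_arcs' using assms(3) by auto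
  then show "in_arc N' u = (y, Internal u)" using white_in_arc[OF plabic(2), of u] assms(1) by auto
qed

lemma out_arc':
  assumes "u \<in> internals N" "u \<notin> white N" "D \<inter> in_arcs N (Internal u) = {(x, Internal u)}" "D \<inter> out_arcs N (Internal u) = {(Internal u, y)}"
  shows "out_arc N u = (Internal u, y)" "out_arc N' u = (Internal u, x)"
proof -
  have "(Internal u, y) \<in> out_arcs N (Internal u)" using assms by blast
  then show "out_arc N u = (Internal u, y)" using black_out_arc[OF plabic(1) assms(1,2)] by auto
  have "(Internal u, x) \<in> out_arcs N' (Internal u)" unfolding out_arcs' using assms(3) by auto
  then show "out_arc N' u = (Internal u, x)" using black_out_arc[OF plabic(2), of u] assms(1,2) by auto
qed

lemma off_arcs:
  assumes "\<not> on_D (Internal u)"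
  shows "in_arc N' u = in_arc N u" "out_arc N' u = out_arc N u"
proof -
  have "D \<inter> in_arcs N (Internal u) = {}" "D \<inter> out_arcs N (Internal u) = {}"
    using assms by (auto simp: on_D_iff)
  then have "in_arcs N' (Internal u) = in_arcs N (Internal u)" "out_arcs N' (Internal u) = out_arcs N (Internal u)"
    unfolding in_arcs' out_arcs' by auto
  then show "in_arc N' u = in_arc N u" "out_arc N' u = out_arc N u"
    by (simp_all add: in_arc_def out_arc_def)
qed

lemma edge_wind_N': "edge_wind N' l e f = edge_wind N l e f"
  by (simp add: edge_wind_def)

text \<open>Here \<open>d\<close>, \<open>d'\<close> are the depths at the two ends,
  \<open>p\<close>, \<open>q\<close> the branch terms and \<open>X\<close> the crossings with rays
  from touched vertices. The last assumption is \<open>arc_parity\<close>; the others compare old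
  and new terms one by one.\<close>

lemma parity_combine:
  fixes a :: int
  assumes "even (a' - (i' + t' + h'))" "even (a - (i + t + h))" "even (i' - i - X)"
    "even (t' - t - p + d - g)" "even (h' - h - q + d' - g')" "even (d + d' + X + p + q)"
  shows "even (a' - (a + g + g'))"
proof -
  have "a' - (a + g + g') = (a' - (i' + t' + h')) - (a - (i + t + h)) + (i' - i - X)
     + (t' - t - p + d - g) + (h' - h - q + d' - g') + (d + d' + X + p + q) - 2 * (d + d')" by simp
  then show ?thesis using assms by (simp only: dvd_add dvd_diff dvd_triv_left)
qed

text \<open>For a reversed arc the new head term replaces the old tail term and conversely; the
  constants 1 at the two ends cancel.\<close>

lemma parity_combine_reversed:
  fixes a :: int
  assumes "even (a' - (i' + t' + h'))" "even (a - (i + t + h))" "even (i' - i - X)"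
    "even (h' - t - 1 - p + d - g)" "even (t' - h - 1 - q + d' - g')" "even (d + d' + X + p + q)"
  shows "even (a' - (a + g + g'))"
proof -
  have "a' - (a + g + g') = (a' - (i' + t' + h')) - (a - (i + t + h)) + (i' - i - X)
     + (h' - t - 1 - p + d - g) + (t' - h - 1 - q + d' - g') + (d + d' + X + p + q) - 2 * (d + d' - 1)" by simp
  then show ?thesis using assms by (simp only: dvd_add dvd_diff dvd_triv_left)
qed

text \<open>If the tail is on the reversed curve it must be white, since the only arc out of a black
  vertex would be reversed. Its incoming neighbour changes from \<open>x\<close> to
  \<open>y\<close>, and the two windings together are exactly \<open>branch\<close>.\<close>

lemma tail_unreversed:
  assumes e: "e \<in> arcs N" "e \<notin> D" and u: "fst e = Internal u" and b: "reversal_parity u b"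
  shows "even (tail_term N' l e - tail_term N l e - branch (fst e) (snd e) + depth (fst e) - of_bool b)"
proof -
  have ui: "u \<in> internals N" using arc_ends[OF e(1)] u by simp
  obtain z where ez: "e = (Internal u, z)" using u by (cases e) auto
  show ?thesis
  proof (cases "on_D (Internal u)")
    case False
    then have "tail_term N' l e = tail_term N l e"
      using off_arcs by (simp add: tail_term_def u edge_wind_N')
    then show ?thesis using branch_off[OF False] reversal_parity_cases(1)[OF b] False u by auto
  next
    case True
    obtain x y where xy: "D \<inter> in_arcs N (Internal u) = {(x, Internal u)}" "D \<inter> out_arcs N (Internal u) = {(Internal u, y)}"
      using through_arcs[OF ui True] .
    note t = through_distinct[OF xy]
    have "u \<in> white N"
    proof (rule ccontr)
      assume w: "u \<notin> white N"
      have "e \<in> out_arcs N (Internal u)" using e u by (simp add: out_arcs_def)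
      then have "e = out_arc N u" using black_out_arc[OF plabic(1) ui w] by auto
      then show False using out_arc'(1)[OF ui w xy] t(2) e(2) by simp
    qed
    have z: "z \<noteq> Internal u" "z \<noteq> x" "z \<noteq> y"
      using arc_ends[OF e(1)] e t no_antiparallel[OF drawn(1) t(3)] ez by auto
    have "odd (edge_wind N l (in_arc N u) e) \<longleftrightarrow> under l (dir (Internal u) z) (dir (Internal u) x)"
      "odd (edge_wind N' l (in_arc N' u) e) \<longleftrightarrow> under l (dir (Internal u) z) (dir (Internal u) y)"
      unfolding in_arc'[OF \<open>u \<in> white N\<close> xy] ez
      by (rule odd_edge_wind; use t e ez in auto)+
    moreover have "b \<longleftrightarrow> odd (depth (Internal u))"
      using reversal_parity_cases(1)[OF b] \<open>u \<in> white N\<close> by simp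
    ultimately show ?thesis
      using branch_through[OF xy t(5-7), of z] z \<open>u \<in> white N\<close>
      by (auto simp: tail_term_def ez)
  qed
qed

text \<open>Dually the head is black. Now the winding asks whether \<open>e\<close> is below the
  reversed edge, while \<open>branch\<close> asks for the converse. Swapping both comparisons costs
  whether \<open>e\<close> leaves to the same side as each neighbour, and these two costs sum to
  \<open>straight\<close>.\<close>

lemma head_unreversed:
  assumes e: "e \<in> arcs N" "e \<notin> D" and v: "snd e = Internal v" and b: "reversal_parity v b"
  shows "even (head_term N' l e - head_term N l e - branch (snd e) (fst e) + depth (snd e) - of_bool b)"
proof -
  have vi: "v \<in> internals N" using arc_ends[OF e(1)] v by simp
  obtain z where ez: "e = (z, Internal v)" using v by (cases e) auto
  show ?thesis
  proof (cases "on_D (Internal v)")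
    case False
    then have "head_term N' l e = head_term N l e"
      using off_arcs by (simp add: head_term_def v edge_wind_N')
    then show ?thesis using branch_off[OF False] reversal_parity_cases(1)[OF b] False v by auto
  next
    case True
    obtain x y where xy: "D \<inter> in_arcs N (Internal v) = {(x, Internal v)}" "D \<inter> out_arcs N (Internal v) = {(Internal v, y)}"
      using through_arcs[OF vi True] .
    note t = through_distinct[OF xy]
    have w: "v \<notin> white N"
    proof
      assume w: "v \<in> white N"
      have "e \<in> in_arcs N (Internal v)" using e v by (simp add: in_arcs_def)
      then have "e = in_arc N v" using white_in_arc[OF plabic(1) w] by auto
      then show False using in_arc'(1)[OF w xy] t(1) e(2) by simp
    qed
    let ?v = "Internal v"
    have z: "z \<noteq> ?v" "z \<noteq> x" "z \<noteq> y"
      using arc_ends[OF e(1)] e t no_antiparallel[OF drawn(1) t(4)] ez by auto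
    have "odd (edge_wind N l e (out_arc N v)) \<longleftrightarrow> under l (dir ?v y) (dir ?v z)"
      "odd (edge_wind N' l e (out_arc N' v)) \<longleftrightarrow> under l (dir ?v x) (dir ?v z)"
      unfolding out_arc'[OF vi w xy] ez
      by (rule odd_edge_wind; use t e ez in auto)+
    moreover have "b \<longleftrightarrow> odd (depth ?v) \<noteq> straight x ?v y"
      by (rule reversal_parity_cases(2)[OF b w xy])
    moreover have "under l (dir ?v z) (dir ?v x) \<noteq> under l (dir ?v x) (dir ?v z) \<longleftrightarrow> det2 (dir ?v z) l * det2 (dir ?v x) l > 0"
      by (rule dir_parity[OF e(1) t(3)]) (use e t ez in \<open>auto simp: ends_def\<close>)
    moreover have "under l (dir ?v z) (dir ?v y) \<noteq> under l (dir ?v y) (dir ?v z) \<longleftrightarrow> det2 (dir ?v z) l * det2 (dir ?v y) l > 0"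
      by (rule dir_parity[OF e(1) t(4)]) (use e t ez in \<open>auto simp: ends_def\<close>)
    moreover have "straight x ?v y \<longleftrightarrow> (det2 (dir ?v z) l * det2 (dir ?v x) l > 0) \<noteq> (det2 (dir ?v z) l * det2 (dir ?v y) l > 0)"
    proof -
      have "det2 (dir ?v z) l \<noteq> 0" "det2 (dir ?v x) l \<noteq> 0" "det2 (dir ?v y) l \<noteq> 0"
        using dir_ne t e ez by auto
      then show ?thesis unfolding straight_def zero_less_mult_iff mult_less_0_iff by linarith
    qed
    ultimately show ?thesis
      using branch_through[OF xy t(5-7), of z] z w
      by (simp add: head_term_def ez) blast
  qed
qed

text \<open>The constant 1 is the one in the tail terms of white vertices and sources. A black tail
  has no such constant, and its absence together with the interchange of \<open>x\<close> and
  \<open>y\<close> in the winding gives \<open>straight\<close>.\<close>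

lemma start_reversed:
  assumes e: "e \<in> D" and u: "fst e = Internal u" and b: "reversal_parity u b"
  shows "even (head_term N' l (snd e, fst e) - tail_term N l e - 1 - branch (fst e) (snd e) + depth (fst e) - of_bool b)"
proof -
  have ea: "e \<in> arcs N" using e D by auto
  have ui: "u \<in> internals N" using arc_ends[OF ea] u by simp
  have "Internal u \<in> ends e" using u by (simp add: ends_def)
  then have on: "on_D (Internal u)" using e by (auto simp: on_D_def)
  let ?u = "Internal u"
  obtain x y where xy: "D \<inter> in_arcs N ?u = {(x, ?u)}" "D \<inter> out_arcs N ?u = {(?u, y)}"
    using through_arcs[OF ui on] .
  note t = through_distinct[OF xy]
  have "e \<in> D \<inter> out_arcs N ?u" using e ea u by (simp add: out_arcs_def)
  then have ey: "e = (?u, y)" using xy(2) by auto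
  have br: "branch ?u y = of_bool (under l (dir ?u y) (dir ?u x))"
    using branch_through[OF xy t(5-7), of y] t by simp
  show ?thesis
  proof (cases "u \<in> white N")
    case True
    have "odd (edge_wind N l (in_arc N u) e) \<longleftrightarrow> under l (dir ?u y) (dir ?u x)"
      unfolding in_arc'[OF True xy] ey by (rule odd_edge_wind) (use t in auto)
    moreover have "b \<longleftrightarrow> odd (depth ?u)" using reversal_parity_cases(1)[OF b] True by simp
    ultimately show ?thesis using br True by (auto simp: head_term_def tail_term_def ey)
  next
    case False
    have "odd (edge_wind N' l (y, ?u) (out_arc N' u)) \<longleftrightarrow> under l (dir ?u x) (dir ?u y)"
      unfolding out_arc'[OF ui False xy] by (rule odd_edge_wind) (use t in auto)
    moreover have "b \<longleftrightarrow> odd (depth ?u) \<noteq> straight x ?u y"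
      by (rule reversal_parity_cases(2)[OF b False xy])
    moreover have "under l (dir ?u x) (dir ?u y) \<noteq> under l (dir ?u y) (dir ?u x) \<longleftrightarrow> det2 (dir ?u x) l * det2 (dir ?u y) l > 0"
      by (rule dir_parity[OF t(3,4)]) (use t in \<open>auto simp: ends_def\<close>)
    moreover have "straight x ?u y \<longleftrightarrow> \<not> det2 (dir ?u x) l * det2 (dir ?u y) l > 0"
    proof -
      have "det2 (dir ?u x) l \<noteq> 0" "det2 (dir ?u y) l \<noteq> 0" using dir_ne t by auto
      then show ?thesis unfolding straight_def zero_less_mult_iff mult_less_0_iff by linarith
    qed
    ultimately show ?thesis using br False
      by (simp add: head_term_def tail_term_def ey) blast
  qed
qed

lemma end_reversed:
  assumes e: "e \<in> D" and v: "snd e = Internal v" and b: "reversal_parity v b"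
  shows "even (tail_term N' l (snd e, fst e) - head_term N l e - 1 - branch (snd e) (fst e) + depth (snd e) - of_bool b)"
proof -
  have ea: "e \<in> arcs N" using e D by auto
  have vi: "v \<in> internals N" using arc_ends[OF ea] v by simp
  have "Internal v \<in> ends e" using v by (simp add: ends_def)
  then have on: "on_D (Internal v)" using e by (auto simp: on_D_def)
  let ?v = "Internal v"
  obtain x y where xy: "D \<inter> in_arcs N ?v = {(x, ?v)}" "D \<inter> out_arcs N ?v = {(?v, y)}"
    using through_arcs[OF vi on] .
  note t = through_distinct[OF xy]
  have "e \<in> D \<inter> in_arcs N ?v" using e ea v by (simp add: in_arcs_def)
  then have ex: "e = (x, ?v)" using xy(1) by auto
  have br: "branch ?v x = of_bool (under l (dir ?v x) (dir ?v y))"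
    using branch_through[OF xy t(5-7), of x] t by simp
  show ?thesis
  proof (cases "v \<in> white N")
    case True
    have "odd (edge_wind N' l (in_arc N' v) (?v, x)) \<longleftrightarrow> under l (dir ?v x) (dir ?v y)"
      unfolding in_arc'[OF True xy] by (rule odd_edge_wind) (use t in auto)
    moreover have "b \<longleftrightarrow> odd (depth ?v)" using reversal_parity_cases(1)[OF b] True by simp
    ultimately show ?thesis using br True by (auto simp: head_term_def tail_term_def ex)
  next
    case False
    have "odd (edge_wind N l e (out_arc N v)) \<longleftrightarrow> under l (dir ?v y) (dir ?v x)"
      unfolding out_arc'[OF vi False xy] ex by (rule odd_edge_wind) (use t in auto)
    moreover have "b \<longleftrightarrow> odd (depth ?v) \<noteq> straight x ?v y"
      by (rule reversal_parity_cases(2)[OF b False xy])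
    moreover have "under l (dir ?v x) (dir ?v y) \<noteq> under l (dir ?v y) (dir ?v x) \<longleftrightarrow> det2 (dir ?v x) l * det2 (dir ?v y) l > 0"
      by (rule dir_parity[OF t(3,4)]) (use t in \<open>auto simp: ends_def\<close>)
    moreover have "straight x ?v y \<longleftrightarrow> \<not> det2 (dir ?v x) l * det2 (dir ?v y) l > 0"
    proof -
      have "det2 (dir ?v x) l \<noteq> 0" "det2 (dir ?v y) l \<noteq> 0" using dir_ne t by auto
      then show ?thesis unfolding straight_def zero_less_mult_iff mult_less_0_iff by linarith
    qed
    ultimately show ?thesis using br False
      by (simp add: head_term_def tail_term_def ex) blast
  qed
qed

text \<open>The criterion that both the cycle and the path case are reduced to: no regions occur,
  only parities of depths.\<close>

theorem reversal_gauge_transforms: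
  assumes range: "\<And>u. u \<in> internals N \<Longrightarrow> \<eta> u \<in> {0, 1}"
    and par: "\<And>u. u \<in> internals N \<Longrightarrow> reversal_parity u (odd (\<eta> u))"
  shows "gauge_transforms N \<eta> (geom_signature N l) (geom_signature N' l)"
proof (rule gauge_transformsI[OF drawn(1) range])
  fix e assume e: "e \<in> arcs N" and int: "fst e \<in> range Internal \<or> snd e \<in> range Internal"
  let ?g = "vertex_gauge \<eta>"
  define X where "X = (\<Sum>j\<in>touched. of_bool (crossed j e) :: int)"
  note v = arc_ends[OF e]
  have g: "even (?g (Internal u) - of_bool (odd (\<eta> u)))" for u by (simp add: vertex_gauge_def)
  have bd: "branch (Boundary j) y = 0 \<and> depth (Boundary j) = 0 \<and> ?g (Boundary j) = 0"
    if "ends e = {Boundary j, y}" for j y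
  proof -
    have "j \<in> {1..bdcount N}" using v that by (auto simp: ends_def doubleton_eq_iff)
    then show ?thesis using branch_boundary[OF e that] count_below_boundary[of j] by (simp add: vertex_gauge_def)
  qed
  note ap = arc_parity[OF e, folded X_def]
  have s0: "even (arc_sign N l e - (int_parity N l e + tail_term N l e + head_term N l e))"
    by (rule even_arc_sign[OF drawn(1) gauge(1) e int])
  have "even (geom_signature N' l (ends e) - (geom_signature N l (ends e) + ?g (fst e) + ?g (snd e)))"
  proof (cases "e \<in> D")
    case False
    then have e': "e \<in> arcs N'" using e by simp
    have s1: "even (arc_sign N' l e - (int_parity N' l e + tail_term N' l e + head_term N' l e))"
      by (rule even_arc_sign[OF drawn(2) gauge(2) e' int])
    have ip: "even (int_parity N' l e - int_parity N l e - X)"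
      unfolding X_def by (rule even_int_parity_reverse) auto
    have t: "even (tail_term N' l e - tail_term N l e - branch (fst e) (snd e) + depth (fst e) - ?g (fst e))"
    proof (cases "fst e")
      case (Internal u)
      then show ?thesis using tail_unreversed[OF e False Internal par] v g[of u] by auto
    next
      case (Boundary j)
      then show ?thesis using bd[of j "snd e"] by (simp add: tail_term_def ends_def)
    qed
    have h: "even (head_term N' l e - head_term N l e - branch (snd e) (fst e) + depth (snd e) - ?g (snd e))"
    proof (cases "snd e")
      case (Internal u)
      then show ?thesis using head_unreversed[OF e False Internal par] v g[of u] by auto
    next
      case (Boundary j)
      then show ?thesis using bd[of j "fst e"] by (simp add: head_term_def ends_def insert_commute)
    qed
    have "geom_signature N' l (ends e) = arc_sign N' l e" "geom_signature N l (ends e) = arc_sign N l e"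
      using geom_signature_ends[OF drawn(2) e'] geom_signature_ends[OF drawn(1) e] by auto
    then show ?thesis using parity_combine[OF s1 s0 ip t h ap] by simp
  next
    case True
    let ?e = "(snd e, fst e)"
    have e': "?e \<in> arcs N'" using True by simp
    have s1: "even (arc_sign N' l ?e - (int_parity N' l ?e + tail_term N' l ?e + head_term N' l ?e))"
      by (rule even_arc_sign[OF drawn(2) gauge(2) e']) (use int in auto)
    have ip: "even (int_parity N' l ?e - int_parity N l e - X)"
      unfolding X_def by (rule even_int_parity_reverse) (auto simp: ends_def)
    have t: "even (head_term N' l ?e - tail_term N l e - 1 - branch (fst e) (snd e) + depth (fst e) - ?g (fst e))"
    proof (cases "fst e")
      case (Internal u)
      then show ?thesis using start_reversed[OF True Internal par] v g[of u] by auto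
    next
      case (Boundary j)
      then show ?thesis using bd[of j "snd e"] by (simp add: head_term_def tail_term_def ends_def)
    qed
    have h: "even (tail_term N' l ?e - head_term N l e - 1 - branch (snd e) (fst e) + depth (snd e) - ?g (snd e))"
    proof (cases "snd e")
      case (Internal u)
      then show ?thesis using end_reversed[OF True Internal par] v g[of u] by auto
    next
      case (Boundary j)
      then show ?thesis using bd[of j "fst e"] by (simp add: head_term_def tail_term_def ends_def insert_commute)
    qed
    have "ends ?e = ends e" by (auto simp: ends_def)
    then have "geom_signature N' l (ends e) = arc_sign N' l ?e" "geom_signature N l (ends e) = arc_sign N l e"
      using geom_signature_ends[OF drawn(2) e'] geom_signature_ends[OF drawn(1) e] by auto
    then show ?thesis using parity_combine_reversed[OF s1 s0 ip t h ap] by simp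
  qed
  then show "even (geom_signature N' l (ends e) - (geom_signature N l (ends e) + ?g (fst e) + ?g (snd e)))" .
qed

end

section \<open>Region markings expressed by crossing parities\<close>

lemma segments_from_point:
  assumes "det2 q w \<noteq> 0 \<or> det2 w l * det2 q l < 0"
  shows "seg (a, a + w) \<inter> seg (a, a + q) \<subseteq> {a}"
proof
  fix v assume "v \<in> seg (a, a + w) \<inter> seg (a, a + q)"
  then obtain s r where s: "0 \<le> s" "v = (1 - s) *\<^sub>R a + s *\<^sub>R (a + w)"
    and r: "0 \<le> r" "v = (1 - r) *\<^sub>R a + r *\<^sub>R (a + q)"
    by (auto simp: seg_def in_segment)
  then have eq: "v - a = of_real s * w" "v - a = of_real r * q"
    by (simp_all add: scaleR_conv_of_real algebra_simps)
  then have e: "of_real s * w = of_real r * q" by simp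
  have "s * det2 q w = r * det2 q q" "s * det2 w l = r * det2 q l"
    using arg_cong[OF e, of "det2 q"] arg_cong[OF e, of "\<lambda>z. det2 z l"] by (simp_all add: det2_linear)
  then have "s = 0"
    using assms
  proof (elim disjE)
    assume "det2 w l * det2 q l < 0" and *: "s * det2 w l = r * det2 q l"
    have "(s * det2 w l) * det2 q l = r * (det2 q l)\<^sup>2"
      by (simp only: * power2_eq_square mult.assoc)
    then have "(s * det2 w l) * det2 q l \<ge> 0" using r(1) by simp
    then have "s * (det2 w l * det2 q l) \<ge> 0" by (simp add: mult.assoc)
    then show "s = 0" using mult_pos_neg[OF _ \<open>det2 w l * det2 q l < 0\<close>, of s] s(1) by linarith
  qed simp
  then show "v \<in> {a}" using eq(1) by simp
qed

context reversal
begin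

lemma trace_of_D: "trace_of N D = trace E"
  by (simp add: trace_of_def trace_def E_def pt_def edge_seg_seg)

lemma vertex_on_trace: "v \<in> vertices N \<Longrightarrow> pos N v \<in> trace E \<Longrightarrow> on_D v"
  using vertex_on_edge D unfolding trace_of_D[symmetric] trace_of_def on_D_def by blast

lemma count_below_off_trace: "z \<notin> trace E \<Longrightarrow> count_below l E z = crossings l E z"
  unfolding count_below_def crossings_def
  by (intro sum.cong[OF HOL.refl]) (force simp: is_end_def trace_def seg_def)

text \<open>Evaluates what \<open>gamma1\<close> sees: the crossing parity just left of an edge near
  its end \<open>u\<close>, in terms of the depth of \<open>u\<close>. The quantifiers are nested as
  in \<open>gamma1\<close>, since how close to the edge one must be depends on
  \<open>t\<close>.\<close>

lemma crossings_near_end: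
  assumes u: "u \<in> internals N" and in1: "D \<inter> in_arcs N (Internal u) = {(x, Internal u)}"
    and out1: "D \<inter> out_arcs N (Internal u) = {(Internal u, y)}"
  shows "\<forall>\<^sub>F t in at_left 1. \<forall>\<^sub>F \<delta> in at_right 0.
    (\<lambda>z. z \<in> disc N \<and> z \<notin> trace E \<and> (\<forall>j\<in>touched. z \<notin> ray (bpos N j) l) \<and>
      (odd (crossings l E z) \<longleftrightarrow> odd (depth (Internal u)) \<noteq>
        ((det2 (dir x (Internal u)) l > 0) \<noteq> under l (dir (Internal u) x) (dir (Internal u) y))))
    (pos N x + of_real t * dir x (Internal u) + of_real \<delta> * \<i> * dir x (Internal u))"
proof -
  let ?u = "Internal u"
  note t = through_distinct[OF in1 out1]
  define a d p q where "a = pos N ?u" and "d = dir x ?u" and "p = dir ?u x" and "q = dir ?u y"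
  have pd: "p = - d" by (simp add: p_def d_def)
  have uv: "?u \<in> vertices N" using u by simp
  have pl: "det2 p l = - det2 d l" unfolding pd by (rule det2_linear(5))
  have "det2 p l \<noteq> 0" "det2 q l \<noteq> 0"
    using dir_ne[of ?u x] dir_ne[of ?u y] t unfolding p_def q_def by blast+
  then have det: "det2 p l \<noteq> 0" "det2 q l \<noteq> 0" "det2 d l \<noteq> 0" using pl by auto
  have na: "\<not> aligned p q"
    unfolding p_def q_def
    by (rule outward_not_aligned(1)[OF drawn(1) t(3,4)]) (use t in \<open>auto simp: ends_def\<close>)
  \<comment> \<open>A neighbourhood of \<open>u\<close> that meets only the reversed edges at
    \<open>u\<close> and lies on the same side as \<open>u\<close> of every relevant ray.\<close>
  define U where "U = disc N \<inter> - trace {g \<in> E. \<not> is_end a g} \<inter>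
    (\<Inter>j\<in>touched. {z. (det2 z l - det2 (bpos N j) l) * (det2 a l - det2 (bpos N j) l) > 0})"
  have "closed (trace {g \<in> E. \<not> is_end a g})"
    using finite_E by (intro compact_imp_closed compact_trace) simp
  then have "open U" unfolding U_def disc_def
    by (intro open_Int open_ball open_INT finite_touched ballI open_Collect_less continuous_intros
        open_Compl) (auto intro!: continuous_intros)
  have hx: "det2 a l \<noteq> det2 (bpos N j) l" if "j \<in> touched" for j
    unfolding a_def by (rule vertex_det2_ne[OF drawn(1) gauge(1)]) (use that u in \<open>auto simp: touched_def\<close>)
  have "a \<in> U"
  proof -
    have "a \<in> disc N" using drawn(1) u by (auto simp: a_def drawn_network_def plane_drawing_def)
    moreover have "a \<notin> seg g" if g: "g \<in> E" "\<not> is_end a g" for g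
    proof
      assume "a \<in> seg g"
      obtain e where e: "e \<in> D" "g = pt e" using g by (auto simp: E_def)
      have "?u \<in> ends e"
        using vertex_on_edge[OF uv, of e] e D \<open>a \<in> seg g\<close> by (auto simp: edge_seg_seg pt_def a_def)
      then show False using is_end_pt[OF uv e(1)] g(2) e(2) by (simp add: a_def)
    qed
    moreover have "(det2 a l - det2 (bpos N j) l) * (det2 a l - det2 (bpos N j) l) > 0" if "j \<in> touched" for j
      using hx[OF that] by (simp add: zero_less_mult_iff) linarith
    ultimately show ?thesis by (auto simp: U_def trace_def)
  qed
  then obtain r where r: "r > 0" "ball a r \<subseteq> U" using \<open>open U\<close> openE by blast
  have incident: "{g \<in> E. is_end a g} = {pt (x, ?u), pt (?u, y)}"
  proof -
    have "{g \<in> D. ?u \<in> ends g} = (D \<inter> in_arcs N ?u) \<union> (D \<inter> out_arcs N ?u)"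
      using D by (auto simp: ends_def in_arcs_def out_arcs_def)
    then have "{g \<in> D. ?u \<in> ends g} = {(x, ?u), (?u, y)}" unfolding in1 out1 by auto
    moreover have "{g \<in> E. is_end a g} = pt ` {g \<in> D. ?u \<in> ends g}"
      using is_end_pt[OF uv] by (auto simp: E_def a_def)
    ultimately show ?thesis by simp
  qed
  have xa: "pos N x = a + p" "pos N y = a + q" by (simp_all add: a_def p_def q_def)
  \<comment> \<open>\<open>count_parity\<close> along the short segment from \<open>u\<close> to
    \<open>z\<close>. No ray separates the two points, \<open>z\<close> is no end of an edge, and so
    only the incoming edge \<open>p\<close> and the outgoing edge \<open>q\<close> contribute,
    according to whether they start below \<open>w\<close>.\<close>
  have core: "z \<in> disc N \<and> z \<notin> trace E \<and> (\<forall>j\<in>touched. z \<notin> ray (bpos N j) l) \<and>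
      (odd (crossings l E z) \<longleftrightarrow> odd (depth ?u) \<noteq> ((det2 d l > 0) \<noteq> under l p q))"
    if z: "z \<in> ball a r" and w: "w = z - a" "det2 w l * det2 p l > 0"
      "det2 p w \<noteq> 0" "under l w p \<longleftrightarrow> det2 d l > 0"
      "det2 q w \<noteq> 0 \<or> det2 w l * det2 q l < 0" "under l w q \<longleftrightarrow> under l p q" for z w
  proof -
    have za: "z = a + w" using w by simp
    have zU: "z \<in> U" using z r by blast
    have wl: "det2 w l \<noteq> 0" using w(2) by auto
    have seg1: "seg (a, z) \<inter> seg g \<subseteq> {a}" if "g \<in> E" "is_end a g" for g
    proof -
      have "g = pt (x, ?u) \<or> g = pt (?u, y)" using incident that by blast
      then have "seg g = seg (a, a + p) \<or> seg g = seg (a, a + q)"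
        using xa by (auto simp: pt_def seg_def a_def closed_segment_commute)
      then show ?thesis
      proof
        assume "seg g = seg (a, a + p)"
        moreover have "seg (a, a + w) \<inter> seg (a, a + p) \<subseteq> {a}"
          by (rule segments_from_point[of p w l]) (use w(3) in simp)
        ultimately show ?thesis unfolding za by simp
      next
        assume "seg g = seg (a, a + q)"
        moreover have "seg (a, a + w) \<inter> seg (a, a + q) \<subseteq> {a}"
          by (rule segments_from_point[OF w(5)])
        ultimately show ?thesis unfolding za by simp
      qed
    qed
    have seg2: "seg (a, z) \<inter> seg g = {}" if "g \<in> E" "\<not> is_end a g" for g
    proof -
      have "seg (a, z) \<subseteq> ball a r" unfolding seg_def
        by (rule closed_segment_subset) (use z r in auto)
      then have "seg (a, z) \<subseteq> U" using r by blast
      then show ?thesis using that by (auto simp: U_def trace_def)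
    qed
    have "z \<noteq> a" using wl w(1) by auto
    have zt: "z \<notin> trace E"
    proof
      assume "z \<in> trace E"
      then obtain g where "g \<in> E" "z \<in> seg g" by (auto simp: trace_def)
      moreover have "z \<in> seg (a, z)" by (simp add: seg_def)
      ultimately show False using seg1[of g] seg2[of g] \<open>z \<noteq> a\<close> by blast
    qed
    then have nz: "\<not> is_end z g" if "g \<in> E" for g
      using that by (force simp: is_end_def trace_def seg_def)
    have left: "lefter l (bpos N j) z = lefter l (bpos N j) a" "z \<notin> ray (bpos N j) l" if "j \<in> touched" for j
    proof -
      have "(det2 z l - det2 (bpos N j) l) * (det2 a l - det2 (bpos N j) l) > 0"
        using zU that by (auto simp: U_def)
      then show "lefter l (bpos N j) z = lefter l (bpos N j) a" "z \<notin> ray (bpos N j) l"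
        by (auto simp: lefter_def zero_less_mult_iff ray_def det2_linear)
    qed
    have par: "even (count_below l E a + count_below l E z
        + (\<Sum>g\<in>E. upw_proper l a z (fst g) + upw_proper l a z (snd g))
        + count_under l E a z + count_under l E z a)"
    proof (rule count_parity[OF finite_E l_nz])
      show "det2 (z - a) l \<noteq> 0" using wl w(1) by simp
      show "det2 (snd g - fst g) l \<noteq> 0" if "g \<in> E" for g using E_vec[OF that] .
      fix g assume "g \<in> E"
      then show "seg (a, z) \<inter> seg g \<subseteq> {a, z} \<inter> {fst g, snd g} \<or> {fst g, snd g} = {a, z}"
        using seg1[of g] seg2[of g] by (cases "is_end a g") (auto simp: is_end_def)
    qed
    have "(\<Sum>g\<in>E. upw_proper l a z (fst g) + upw_proper l a z (snd g))
      = (\<Sum>f\<in>D. upw_proper l a z (pos N (fst f)) + upw_proper l a z (pos N (snd f)))"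
      unfolding sum_E by (simp add: pt_def)
    moreover have "even (\<dots> - (\<Sum>j\<in>touched. upw_proper l a z (bpos N j)))"
      using degree_sum[of "\<lambda>v. upw_proper l a z (pos N v)"] .
    moreover have "(\<Sum>j\<in>touched. upw_proper l a z (bpos N j)) = 0"
      using left(1) by (intro sum.neutral ballI) (auto simp: upw_proper_def upw_def)
    moreover have "count_under l E z a = 0"
      unfolding count_under_def using nz by (intro sum.neutral ballI) auto
    moreover have "count_under l E a z = of_bool (under l w p) + of_bool (under l w q)"
    proof -
      have "count_under l E a z = (\<Sum>g\<in>{g \<in> E. is_end a g}. of_bool (under l w (opposite a g - a)))"
        unfolding count_under_def w(1) using nz finite_E by (intro sum.mono_neutral_cong_right) auto
      moreover have "pt (x, ?u) \<noteq> pt (?u, y)" using inj_pt t by (auto simp: inj_on_def)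
      moreover have "opposite a (pt (x, ?u)) = a + p" "opposite a (pt (?u, y)) = a + q"
      proof -
        have "p \<noteq> 0" using det by auto
        then show "opposite a (pt (x, ?u)) = a + p" "opposite a (pt (?u, y)) = a + q"
          using xa by (auto simp: opposite_def pt_def a_def)
      qed
      ultimately show ?thesis unfolding incident by simp
    qed
    moreover have "count_below l E z = crossings l E z" by (rule count_below_off_trace[OF zt])
    ultimately have "odd (crossings l E z) \<longleftrightarrow> odd (depth ?u) \<noteq> (under l w p \<noteq> under l w q)"
      using par by (auto simp: a_def)
    then show ?thesis using zU zt left w by (auto simp: U_def)
  qed
  have "\<forall>\<^sub>F t in at_left (1::real). t \<in> {0<..<1}"
    unfolding eventually_at_left_field by (intro exI[of _ 0]) auto
  moreover have "((\<lambda>t. pos N x + of_real t * d) \<longlongrightarrow> pos N x + of_real 1 * d) (at_left 1)"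
    by (intro tendsto_intros)
  then have "((\<lambda>t. pos N x + of_real t * d) \<longlongrightarrow> a) (at_left 1)" by (simp add: d_def a_def)
  then have "\<forall>\<^sub>F t in at_left 1. pos N x + of_real t * d \<in> ball a r"
    using r by (intro topological_tendstoD) auto
  ultimately show ?thesis
    unfolding d_def[symmetric] p_def[symmetric] q_def[symmetric]
  proof eventually_elim
    case (elim t)
    define z where "z = (\<lambda>\<delta>. pos N x + of_real t * d + of_real \<delta> * \<i> * d)"
    define w where "w = (\<lambda>\<delta>. z \<delta> - a)"
    have w_eq: "w \<delta> = of_real (1 - t) * p + of_real \<delta> * (\<i> * d)" for \<delta>
      by (simp add: w_def z_def xa pd algebra_simps)
    have wlim: "(w \<longlongrightarrow> of_real (1 - t) * p) (at_right 0)"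
    proof -
      have "(w \<longlongrightarrow> of_real (1 - t) * p + of_real 0 * (\<i> * d)) (at_right 0)"
        unfolding w_eq by (intro tendsto_intros)
      then show ?thesis by simp
    qed
    have zlim: "(z \<longlongrightarrow> pos N x + of_real t * d + of_real 0 * \<i> * d) (at_right 0)"
      unfolding z_def by (intro tendsto_intros)
    then have 1: "\<forall>\<^sub>F \<delta> in at_right 0. z \<delta> \<in> ball a r"
      using elim by (intro topological_tendstoD) auto
    have 2: "\<forall>\<^sub>F \<delta> in at_right 0. det2 (w \<delta>) l * det2 p l > 0"
    proof (rule order_tendstoD(1))
      show "((\<lambda>\<delta>. det2 (w \<delta>) l * det2 p l) \<longlongrightarrow> det2 (of_real (1 - t) * p) l * det2 p l) (at_right 0)"
        by (intro tendsto_intros wlim)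
      have "det2 (of_real (1 - t) * p) l * det2 p l = (1 - t) * (det2 p l)\<^sup>2"
        by (simp only: det2_linear(7)) (simp add: power2_eq_square mult.assoc)
      then show "0 < det2 (of_real (1 - t) * p) l * det2 p l" using det elim by simp
    qed
    \<comment> \<open>As \<open>w\<close> is close to the direction \<open>p\<close>, it compares
      with \<open>q\<close> as \<open>p\<close> does: by the nonzero determinant if \<open>p\<close>
      and \<open>q\<close> leave to the same side, and trivially if they do not.\<close>
    have 3: "\<forall>\<^sub>F \<delta> in at_right 0. (det2 q (w \<delta>) \<noteq> 0 \<or> det2 (w \<delta>) l * det2 q l < 0) \<and> (under l (w \<delta>) q \<longleftrightarrow> under l p q)"
    proof (cases "det2 p l * det2 q l > 0")
      case True
      have nz: "det2 q p \<noteq> 0" by (rule not_aligned_det2[OF na True])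
      have "\<forall>\<^sub>F \<delta> in at_right 0. det2 q (w \<delta>) * det2 q p > 0"
      proof (rule order_tendstoD(1))
        show "((\<lambda>\<delta>. det2 q (w \<delta>) * det2 q p) \<longlongrightarrow> det2 q (of_real (1 - t) * p) * det2 q p) (at_right 0)"
          by (intro tendsto_intros wlim)
        have "det2 q (of_real (1 - t) * p) * det2 q p = (1 - t) * (det2 q p)\<^sup>2"
          by (simp only: det2_linear(8)) (simp add: power2_eq_square mult.assoc)
        then show "0 < det2 q (of_real (1 - t) * p) * det2 q p" using nz elim by simp
      qed
      with 2 show ?thesis
      proof eventually_elim
        case (elim \<delta>)
        have "det2 (w \<delta>) l * det2 q l > 0" using elim(1) True by (simp add: zero_less_mult_iff) linarith
        then show ?case using elim True unfolding under_def by (simp add: zero_less_mult_iff) linarith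
      qed
    next
      case False
      show ?thesis using 2
      proof eventually_elim
        case (elim \<delta>)
        have "det2 p l * det2 q l < 0" using False det
          by (metis linorder_neqE_linordered_idom mult_eq_0_iff)
        then have "det2 (w \<delta>) l * det2 q l < 0"
          using elim by (simp add: zero_less_mult_iff mult_less_0_iff) linarith
        then show ?case using False unfolding under_def by auto
      qed
    qed
    have 4: "\<forall>\<^sub>F \<delta>::real in at_right 0. \<delta> > 0" by (simp add: eventually_at_right_less)
    show ?case
    proof (rule eventually_mono[OF eventually_conj[OF eventually_conj[OF 1 2] eventually_conj[OF 3 4]]])
      fix \<delta> assume "(z \<delta> \<in> ball a r \<and> det2 (w \<delta>) l * det2 p l > 0) \<and>
        ((det2 q (w \<delta>) \<noteq> 0 \<or> det2 (w \<delta>) l * det2 q l < 0) \<and> (under l (w \<delta>) q \<longleftrightarrow> under l p q)) \<and> \<delta> > 0"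
      then have el: "z \<delta> \<in> ball a r" "det2 (w \<delta>) l * det2 p l > 0"
        "det2 q (w \<delta>) \<noteq> 0 \<or> det2 (w \<delta>) l * det2 q l < 0" "under l (w \<delta>) q \<longleftrightarrow> under l p q" "\<delta> > 0"
        by blast+
      have pw: "det2 p (w \<delta>) = - \<delta> * (cmod d)\<^sup>2"
        unfolding w_eq pd cmod_power2 by (simp add: det2_def algebra_simps power2_eq_square)
      have "(cmod d)\<^sup>2 > 0" using det by auto
      then have neg: "det2 p (w \<delta>) < 0" unfolding pw using el(5) by (simp add: mult_neg_pos)
      have "under l (w \<delta>) p \<longleftrightarrow> det2 d l > 0"
        using el(2) neg pl by (auto simp: under_def zero_less_mult_iff mult_less_0_iff)
      then have "z \<delta> \<in> disc N \<and> z \<delta> \<notin> trace E \<and> (\<forall>j\<in>touched. z \<delta> \<notin> ray (bpos N j) l) \<and>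
        (odd (crossings l E (z \<delta>)) \<longleftrightarrow> odd (depth ?u) \<noteq> ((det2 d l > 0) \<noteq> under l p q))"
        by (intro core[OF el(1) _ el(2) _ _ el(3,4)]) (use neg in \<open>auto simp: w_def\<close>)
      then show "(\<lambda>z. z \<in> disc N \<and> z \<notin> trace E \<and> (\<forall>j\<in>touched. z \<notin> ray (bpos N j) l) \<and>
          (odd (crossings l E z) \<longleftrightarrow> odd (depth ?u) \<noteq> ((det2 d l > 0) \<noteq> under l p q)))
        (pos N x + of_real t * d + of_real \<delta> * \<i> * d)"
        unfolding z_def .
    qed
  qed
qed

text \<open>The common form of cases (1) for paths and cycles: a set \<open>A\<close> that off the
  curve and off the rays from its boundary ends is described by the crossing parity.\<close>

context
  fixes A :: "complex set"
  assumes marks: "\<And>z. z \<in> disc N \<Longrightarrow> z \<notin> trace E \<Longrightarrow> (\<And>j. j \<in> touched \<Longrightarrow> z \<notin> ray (bpos N j) l) \<Longrightarrow>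
    z \<in> A \<longleftrightarrow> even (crossings l E z)"
begin

lemma gamma1_value:
  assumes u: "u \<in> internals N" and in1: "D \<inter> in_arcs N (Internal u) = {(x, Internal u)}"
    and out1: "D \<inter> out_arcs N (Internal u) = {(Internal u, y)}"
  shows "gamma1 A N (x, Internal u) = of_bool (odd (depth (Internal u)) \<noteq>
        ((det2 (dir x (Internal u)) l > 0) \<noteq> under l (dir (Internal u) x) (dir (Internal u) y)))"
    (is "_ = of_bool ?B")
proof -
  let ?d = "dir x (Internal u)"
  have "\<forall>\<^sub>F t in at_left 1. lies_left A (pos N x + of_real t * ?d) ?d = (\<not> ?B)"
    using crossings_near_end[OF assms]
  proof eventually_elim
    case (elim t)
    then have "\<forall>\<^sub>F \<delta> in at_right 0. (pos N x + of_real t * ?d + of_real \<delta> * \<i> * ?d \<in> A) = (\<not> ?B)"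
      by eventually_elim (use marks in blast)
    then show ?case unfolding lies_left_def by (intro eventually_value) auto
  qed
  then have "(\<forall>\<^sub>F t in at_left 1. lies_left A (pos N x + of_real t * ?d) ?d) = (\<not> ?B)"
    by (intro eventually_value) auto
  then show ?thesis by (simp add: gamma1_def edge_vec_def)
qed

text \<open>On the curve, the winding and the comparison hidden in \<open>gamma1\<close> add up to
  whether the two neighbours lie on the same horizontal side. Together with the directions read off
  by \<open>gamma2\<close> this cancels at white vertices and leaves \<open>straight\<close> at
  black ones.\<close>

lemma reversal_gauge_parity:
  assumes u: "u \<in> internals N"
  shows "reversal_parity u (odd (reversal_gauge A N l D u))"
proof (cases "on_D (Internal u)")
  case False
  let ?z = "ipos N u"
  have uv: "Internal u \<in> vertices N" using u by simp
  have "?z \<in> disc N" using drawn(1) u by (auto simp: drawn_network_def plane_drawing_def)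
  moreover have zt: "?z \<notin> trace E" using vertex_on_trace[OF uv] False by blast
  moreover have "?z \<notin> ray (bpos N j) l" if "j \<in> touched" for j
    using gauge(1) u that by (auto simp: gauge_direction_def touched_def)
  ultimately have "?z \<in> A \<longleftrightarrow> even (depth (Internal u))"
    using marks count_below_off_trace by simp
  moreover have "\<not> (\<exists>x y. (x, Internal u) \<in> D)" using False by (auto simp: on_D_def ends_def)
  ultimately show ?thesis
    using False by (auto simp: reversal_parity_def reversal_gauge_def on_D_def)
next
  case True
  let ?u = "Internal u"
  obtain x y where xy: "D \<inter> in_arcs N ?u = {(x, ?u)}" "D \<inter> out_arcs N ?u = {(?u, y)}"
    using through_arcs[OF u True] .
  note t = through_distinct[OF xy]
  have e1: "(THE e. e \<in> D \<and> snd e = ?u) = (x, ?u)"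
    using xy(1) D by (intro the_equality) (auto simp: in_arcs_def)
  have e2: "(THE e. e \<in> D \<and> fst e = ?u) = (?u, y)"
    using xy(2) D by (intro the_equality) (auto simp: out_arcs_def)
  have w: "odd (edge_wind N l (x, ?u) (?u, y)) \<longleftrightarrow> under l (dir ?u y) (dir ?u x)"
    by (rule odd_edge_wind(1)) (use t in auto)
  have s: "under l (dir ?u x) (dir ?u y) \<noteq> under l (dir ?u y) (dir ?u x) \<longleftrightarrow> det2 (dir ?u x) l * det2 (dir ?u y) l > 0"
    by (rule dir_parity[OF t(3,4)]) (use t in \<open>auto simp: ends_def\<close>)
  have d: "det2 (dir ?u x) l \<noteq> 0" "det2 (dir ?u y) l \<noteq> 0" using dir_ne t by auto
  have dx: "det2 (dir x ?u) l = - det2 (dir ?u x) l" by (simp add: det2_linear)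
  have g2: "odd (gamma2 N l (?u, y)) \<longleftrightarrow> det2 (dir ?u y) l < 0"
    using d by (auto simp: gamma2_def turn_det2 edge_vec_def)
  have g2': "odd (gamma2 N l (x, ?u)) \<longleftrightarrow> det2 (dir ?u x) l > 0"
    using d dx by (auto simp: gamma2_def turn_det2 edge_vec_def)
  note g1 = gamma1_value[OF u xy]
  have rg: "reversal_gauge A N l D u = (if u \<in> white N
      then edge_wind N l (x, ?u) (?u, y) + gamma1 A N (x, ?u) + gamma2 N l (?u, y) + 1
      else edge_wind N l (x, ?u) (?u, y) + gamma1 A N (x, ?u) + gamma2 N l (x, ?u)) mod 2"
    using True unfolding reversal_gauge_def e1 e2 by (simp add: on_D_def Let_def)
  show ?thesis
  proof (cases "u \<in> white N")
    case W: True
    have "odd (reversal_gauge A N l D u) \<longleftrightarrow> odd (depth ?u)"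
      unfolding rg g1 using W w s d g2 dx
      by (simp add: zero_less_mult_iff) (smt (verit))
    then show ?thesis using W by (simp add: reversal_parity_def)
  next
    case B: False
    have "(x', ?u) \<in> D \<longleftrightarrow> x' = x" "(?u, y') \<in> D \<longleftrightarrow> y' = y" for x' y'
      using xy D by (auto simp: in_arcs_def out_arcs_def)
    moreover have "odd (reversal_gauge A N l D u) \<longleftrightarrow> odd (depth ?u) \<noteq> straight x ?u y"
      unfolding rg g1 straight_def using B w s d g2' dx
      by (simp add: zero_less_mult_iff mult_less_0_iff) (smt (verit))
    ultimately show ?thesis using B by (simp add: reversal_parity_def)
  qed
qed

theorem region_gauge_transforms:
  "gauge_transforms N (reversal_gauge A N l D) (geom_signature N l) (geom_signature N' l)"
proof (rule reversal_gauge_transforms)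
  show "reversal_gauge A N l D u \<in> {0, 1}" for u
    by (auto simp: reversal_gauge_def Let_def)
qed (rule reversal_gauge_parity)

end

end

section \<open>Reversal along a cycle\<close>

context reversal
begin

lemma simple_chain_E: "simple_chain E"
  unfolding simple_chain_def
proof (intro ballI impI)
  fix g h assume "g \<in> E" "h \<in> E" "g \<noteq> h"
  then obtain e f where ef: "e \<in> D" "f \<in> D" "g = pt e" "h = pt f" "e \<noteq> f" by (auto simp: E_def)
  then have "edge_seg N e \<inter> edge_seg N f \<subseteq> pos N ` (ends e \<inter> ends f)"
    using edges_meet[OF drawn(1)] D by blast
  also have "\<dots> \<subseteq> {fst g, snd g} \<inter> {fst h, snd h}"
    unfolding ends_def ef pt_def by auto
  finally show "seg g \<inter> seg h \<subseteq> {fst g, snd g} \<inter> {fst h, snd h}"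
    by (simp only: ef pt_def edge_seg_seg)
qed

lemma on_D_ends: "(x, y) \<in> D \<Longrightarrow> on_D x" "(x, y) \<in> D \<Longrightarrow> on_D y"
  unfolding on_D_def ends_def by force+

lemma not_on_D_boundary:
  assumes "j \<in> {1..bdcount N}" "(x, Boundary j) \<in> D" "(Boundary j, y) \<in> D" shows False
proof -
  have "(x, Boundary j) = (Boundary j, y)"
    using assms(2,3) D
    by (intro boundary_arc_unique[OF assms(1)]) (auto simp: ends_def)
  then show False using arc_ends[of "(x, Boundary j)"] assms(2) D by auto
qed

end

lemma det2_affine: "det2 (u *\<^sub>R a + v *\<^sub>R b) l = u * det2 a l + v * det2 b l"
  by (simp add: det2_def algebra_simps)

lemma zip_map_rotate1:
  "set (zip (map f q) (rotate1 (map f q))) = map_prod f f ` set (zip q (rotate1 q))"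
  by (simp add: rotate1_map zip_map_map map_prod_def case_prod_beta' image_image)

lemma zip_tl_last:
  assumes "x \<in> set p" "x \<noteq> last p" shows "\<exists>y. (x, y) \<in> set (zip p (tl p))"
  using assms
proof (induction p)
  case (Cons a p)
  then show ?case by (cases p) auto
qed simp

lemma zip_tl_hd:
  assumes "x \<in> set p" "x \<noteq> hd p" shows "\<exists>y. (y, x) \<in> set (zip p (tl p))"
  using assms
proof (induction p)
  case (Cons a p)
  then show ?case by (cases p) auto
qed simp

lemma cycle_arcs_through:
  assumes "v \<in> set q" shows "\<exists>x y. (x, v) \<in> cycle_arcs q \<and> (v, y) \<in> cycle_arcs q"
proof -
  have "map fst (zip q (rotate1 q)) = q" "map snd (zip q (rotate1 q)) = rotate1 q" by simp_all
  then have "v \<in> fst ` cycle_arcs q" "v \<in> snd ` cycle_arcs q"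
    using assms unfolding cycle_arcs_def by (metis list.set_map set_rotate1)+
  then show ?thesis by force
qed

text \<open>The polygon is the cycle itself: the crossing number is 1 or -1 inside and 0 outside, so
  \<open>+\<close> means an even number of edges below.\<close>

lemma cycle_reversal_gauge:
  assumes val: "valid_gauged N l" "valid_gauged (reverse_arcs D N) l" and q: "simple_cycle N q" and Dq: "D = cycle_arcs q"
  shows "gauge_transforms N (reversal_gauge (cycle_plus N D) N l D) (geom_signature N l) (geom_signature (reverse_arcs D N) l)"
proof -
  have DN: "D \<subseteq> arcs N" using q Dq by (simp add: simple_cycle_def)
  interpret reversal N l D using val DN by unfold_locales
  have qv: "v \<in> vertices N" if v: "v \<in> set q" for v
  proof -
    obtain x where "(x, v) \<in> D" using cycle_arcs_through[OF v] Dq by blast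
    then show ?thesis using arc_ends[of "(x, v)"] DN by auto
  qed
  have qd: "distinct q" "q \<noteq> []" using q by (simp_all add: simple_cycle_def)
  define xs where "xs = map (pos N) q"
  have E: "E = set (zip xs (rotate1 xs))"
  proof -
    have "pt ` cycle_arcs q = set (zip xs (rotate1 xs))"
      unfolding xs_def zip_map_rotate1 cycle_arcs_def
      by (intro image_cong[OF HOL.refl]) (simp add: pt_def map_prod_def case_prod_beta')
    then show ?thesis using E_def Dq by simp
  qed
  have dx: "distinct xs"
    unfolding xs_def distinct_map using qd pos_eq qv by (auto simp: inj_on_def)
  have "length q \<noteq> 1"
  proof
    assume "length q = 1"
    then obtain v where "q = [v]" by (cases q) auto
    then have "(v, v) \<in> D" by (simp add: Dq cycle_arcs_def)
    then show False using arc_ends[of "(v, v)"] DN by auto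
  qed
  then have len: "length xs \<ge> 2" using qd(2) by (cases q) (auto simp: xs_def Suc_le_eq)
  have "E \<noteq> {}" using len unfolding E by (cases xs) auto
  then obtain e where e: "e \<in> E" by blast
  obtain s :: int where s: "s = 1 \<or> s = -1" "\<And>z. z \<in> inside (trace E) \<Longrightarrow> crossings l E z = s"
    "\<And>z. z \<in> outside (trace E) \<Longrightarrow> crossings l E z = 0"
    using polygon_Jordan[OF dx len E simple_chain_E l_nz e E_vec[OF e]] by metis
  show ?thesis
  proof (rule region_gauge_transforms)
    fix z assume "z \<notin> trace E"
    then have "z \<in> inside (trace E) \<or> z \<in> outside (trace E)" using inside_Un_outside by blast
    moreover have "\<not> (z \<in> inside (trace E) \<and> z \<in> outside (trace E))" using inside_Int_outside by blast
    ultimately show "z \<in> cycle_plus N D \<longleftrightarrow> even (crossings l E z)"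
      unfolding cycle_plus_def trace_of_D using s by auto
  qed
qed

section \<open>Reversal along a path: the polygon that closes it up\<close>

locale path_reversal = reversal N l D for N :: "'v network" and l D +
  fixes i j :: nat and p :: "'v vertex list"
  assumes path: "source_sink_path N i j p" and D_path: "D = path_arcs p"
begin

abbreviation "bi \<equiv> bpos N i"
abbreviation "bj \<equiv> bpos N j"
abbreviation "xi \<equiv> det2 (bpos N i) l"
abbreviation "xj \<equiv> det2 (bpos N j) l"
abbreviation "hx z \<equiv> det2 z l"

lemma ij: "i \<in> {1..bdcount N}" "j \<in> {1..bdcount N}"
  using path by (auto simp: source_sink_path_def sources_def sinks_def)

lemma ij_ne: "i \<noteq> j"
proof
  assume "i = j"
  then have "in_arcs N (Boundary i) \<noteq> {}" "out_arcs N (Boundary i) \<noteq> {}"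
    using path by (auto simp: source_sink_path_def sources_def sinks_def)
  then obtain e f where "e \<in> arcs N" "f \<in> arcs N" "snd e = Boundary i" "fst f = Boundary i"
    by (auto simp: in_arcs_def out_arcs_def)
  moreover from this have "e = f" using boundary_arc_unique[OF ij(1), of e f] by (auto simp: ends_def)
  ultimately show False using arc_ends[of e] by auto
qed

lemma xij: "xi \<noteq> xj"
  using boundary_det2_ne[OF drawn(1) gauge_admissible[OF gauge(1)] ij ij_ne] .

text \<open>The crossing number inside the closed polygon, which runs along its bottom from
  \<open>bj\<close> to \<open>bi\<close>. Equally, the inside is to the left of the path if this is
  1 and to the right if it is -1.\<close>

definition s :: int where "s = (if xj < xi then 1 else -1)"

lemma s_cases: "s = 1 \<and> xj < xi \<or> s = -1 \<and> xi < xj"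
  using xij by (auto simp: s_def)

definition strip :: "complex set" where "strip = {z. (hx z - xi) * (hx z - xj) < 0}"

lemma strip_iff: "z \<in> strip \<longleftrightarrow> min xi xj < hx z \<and> hx z < max xi xj"
  unfolding strip_def using xij by (auto simp: mult_less_0_iff min_def max_def)

abbreviation "ht z \<equiv> z \<bullet> l"

text \<open>The path is closed up by vertical legs from \<open>b\<^sub>i\<close> and \<open>b\<^sub>j\<close>, long enough to get below the disc.\<close>

definition drop :: "complex \<Rightarrow> complex" where
  "drop z = z - of_real ((2 * radius N + 1) / cmod l) * l"

lemma radius_pos: "radius N > 0"
  using drawn(1) by (simp add: drawn_network_def plane_drawing_def)

lemma hx_drop: "hx (drop z) = hx z"
  unfolding drop_def by (simp only: det2_linear(3,7)) simp

lemma ht_mult: "ht (of_real c * l) = c * (cmod l)\<^sup>2"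
proof -
  have "of_real c * l = c *\<^sub>R l" by (simp add: scaleR_conv_of_real)
  then show ?thesis by (simp only: inner_scaleR_left dot_square_norm)
qed

lemma ht_drop: "ht (drop z) = ht z - (2 * radius N + 1) * cmod l"
proof -
  have "ht (drop z) = ht z - (2 * radius N + 1) / cmod l * (cmod l)\<^sup>2"
    by (simp only: drop_def inner_diff_left ht_mult)
  then show ?thesis using l_nz by (simp add: power2_eq_square)
qed

lemma ht_cball:
  assumes "z \<in> cball (center N) (radius N)"
  shows "ht (center N) - radius N * cmod l \<le> ht z" "ht z \<le> ht (center N) + radius N * cmod l"
proof -
  have "\<bar>(z - center N) \<bullet> l\<bar> \<le> cmod (z - center N) * cmod l" by (rule Cauchy_Schwarz_ineq2)
  also have "\<dots> \<le> radius N * cmod l"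
    using assms by (intro mult_right_mono) (auto simp: dist_norm norm_minus_commute)
  finally show "ht (center N) - radius N * cmod l \<le> ht z" "ht z \<le> ht (center N) + radius N * cmod l"
    by (auto simp: inner_diff_left abs_le_iff)
qed

lemma b_cball: "bi \<in> cball (center N) (radius N)" "bj \<in> cball (center N) (radius N)"
  using vertex_in_cball[OF drawn(1)] ij by auto

text \<open>The height of the lowest point of the disc; heights \<open>ht\<close> are scaled by the
  length of \<open>l\<close>.\<close>

definition floor_ht :: real where "floor_ht = ht (center N) - radius N * cmod l"

text \<open>The length of the legs is the diameter plus one, so their lower ends are at least one
  unit below the disc, which is \<open>cmod l\<close> in scaled height.\<close>

lemma drop_low: "ht (drop bi) \<le> floor_ht - cmod l" "ht (drop bj) \<le> floor_ht - cmod l"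
  using ht_cball(2)[OF b_cball(1)] ht_cball(2)[OF b_cball(2)]
  by (simp_all add: ht_drop floor_ht_def algebra_simps)

definition legs :: "(complex \<times> complex) set" where
  "legs = {(bj, drop bj), (drop bj, drop bi), (drop bi, bi)}"

definition F :: "(complex \<times> complex) set" where "F = E \<union> legs"

lemma p_facts: "p \<noteq> []" "hd p = Boundary i" "last p = Boundary j" "distinct p" "length p \<ge> 2"
proof -
  show 1: "p \<noteq> []" "hd p = Boundary i" "last p = Boundary j" "distinct p"
    using path by (auto simp: source_sink_path_def)
  have "length p \<noteq> 1"
  proof
    assume "length p = 1"
    then obtain v where "p = [v]" by (cases p) auto
    then show False using 1 ij_ne by simp
  qed
  then show "length p \<ge> 2" using 1(1) by (cases p) (auto simp: Suc_le_eq)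
qed

lemma p_vertices: "v \<in> set p \<Longrightarrow> v \<in> vertices N"
proof (cases "v = last p")
  case True
  then show "v \<in> vertices N" using p_facts ij by simp
next
  case False
  assume "v \<in> set p"
  then obtain y where "(v, y) \<in> D"
    using zip_tl_last[of v p] False unfolding D_path path_arcs_def by blast
  then show "v \<in> vertices N" using arc_ends[of "(v, y)"] D by auto
qed

lemma ends_touched: "i \<in> touched" "j \<in> touched"
proof -
  obtain y where "(Boundary i, y) \<in> D"
    using zip_tl_last[of "Boundary i" p] p_facts ij_ne unfolding D_path path_arcs_def
    by (metis hd_in_set vertex.inject(1))
  then show "i \<in> touched" using ij on_D_ends by (auto simp: touched_def)
  obtain x where "(x, Boundary j) \<in> D"
    using zip_tl_hd[of "Boundary j" p] p_facts ij_ne unfolding D_path path_arcs_def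
    by (metis last_in_set vertex.inject(1))
  then show "j \<in> touched" using ij on_D_ends by (auto simp: touched_def)
qed

definition xs :: "complex list" where "xs = map (pos N) p @ [drop bj, drop bi]"

lemma seg_E_cball: "g \<in> E \<Longrightarrow> seg g \<subseteq> cball (center N) (radius N)"
proof -
  assume "g \<in> E"
  then obtain e where e: "e \<in> D" "g = pt e" by (auto simp: E_def)
  then have "fst e \<in> vertices N" "snd e \<in> vertices N" using arc_ends[of e] D by auto
  then show ?thesis unfolding e(2) pt_def by (intro seg_in_cball vertex_in_cball[OF drawn(1)])
qed

lemma trace_E_cball: "trace E \<subseteq> cball (center N) (radius N)"
  using seg_E_cball by (auto simp: trace_def)

lemma xs_edges: "set (zip xs (rotate1 xs)) = F"
proof -
  have z: "set (zip (a @ [u, v]) (tl (a @ [u, v]))) = set (zip a (tl a)) \<union> {(last a, u), (u, v)}"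
    if "a \<noteq> []" for a :: "complex list" and u v
    using that by (induction a rule: list_nonempty_induct) (auto simp: neq_Nil_conv)
  have ne: "map (pos N) p \<noteq> []" using p_facts by simp
  have "hd xs = bi" "last (map (pos N) p) = bj"
    using p_facts by (auto simp: xs_def hd_append hd_map last_map)
  moreover have "set (zip (map (pos N) p) (tl (map (pos N) p))) = E"
  proof -
    have "pt ` path_arcs p = set (zip (map (pos N) p) (tl (map (pos N) p)))"
      by (auto simp: path_arcs_def map_tl[symmetric] zip_map_map pt_def image_iff case_prod_beta')
    then show ?thesis using E_def D_path by simp
  qed
  moreover have "xs \<noteq> []" by (simp add: xs_def)
  ultimately show ?thesis
    using set_zip_rotate1[of xs] z[OF ne, of "drop bj" "drop bi"]
    by (simp add: F_def legs_def xs_def[symmetric]) (auto simp: xs_def)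
qed

lemma low_notin_cball: "ht z < floor_ht \<Longrightarrow> z \<notin> cball (center N) (radius N)"
  using ht_cball(1)[of z] by (auto simp: floor_ht_def)

lemma lm_pos: "cmod l > 0" using l_nz by simp

lemma drop_notin: "drop bi \<notin> cball (center N) (radius N)" "drop bj \<notin> cball (center N) (radius N)"
  using low_notin_cball[of "drop bi"] low_notin_cball[of "drop bj"] drop_low lm_pos by auto

lemma drop_ne: "drop bi \<noteq> drop bj"
  using hx_drop[of bi] hx_drop[of bj] xij by metis

text \<open>A leg leaves the closed disc at once, because its upper end is a boundary vertex whose
  ray enters the disc upwards.\<close>

lemma leg_cball:
  assumes b: "b = bi \<or> b = bj" and z: "z \<in> seg (b, drop b)" "z \<in> cball (center N) (radius N)"
  shows "z = b"
proof -
  obtain k where k: "k \<in> {1..bdcount N}" "b = bpos N k" using b ij by blast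
  obtain u where u: "0 \<le> u" "z = (1 - u) *\<^sub>R b + u *\<^sub>R drop b" using z by (auto simp: seg_def in_segment)
  define a where "a = u * ((2 * radius N + 1) / cmod l)"
  have za: "z = b - of_real a * l"
    unfolding u(2) drop_def a_def by (simp add: scaleR_conv_of_real algebra_simps)
  have a0: "a \<ge> 0" using u radius_pos by (simp add: a_def)
  obtain t where "t > 0" "b + of_real t * l \<in> ball (center N) (radius N)"
    using gauge_admissible[OF gauge(1)] k unfolding admissible_def ray_def disc_def by blast
  then have "a \<le> 0"
    using not_between_cball[OF boundary_on_circle[OF drawn(1) k(1)], of t l a] z(2) za k(2) by simp
  then show ?thesis using a0 za by simp
qed

lemma hx_leg: "z \<in> seg (b, drop b) \<Longrightarrow> hx z = hx b"
proof -
  assume "z \<in> seg (b, drop b)"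
  then obtain u where "z = (1 - u) *\<^sub>R b + u *\<^sub>R drop b" by (auto simp: seg_def in_segment)
  then have "hx z = (1 - u) * hx b + u * hx (drop b)"
    by (simp add: det2_affine)
  then show "hx z = hx b" by (simp add: hx_drop algebra_simps)
qed

lemma bottom_low: "z \<in> seg (drop bj, drop bi) \<Longrightarrow> ht z \<le> floor_ht - cmod l"
proof -
  assume "z \<in> seg (drop bj, drop bi)"
  then obtain u where u: "0 \<le> u" "u \<le> 1" "z = (1 - u) *\<^sub>R drop bj + u *\<^sub>R drop bi" by (auto simp: seg_def in_segment)
  have "ht z = (1 - u) * ht (drop bj) + u * ht (drop bi)" by (simp add: u(3) inner_add_left)
  also have "\<dots> \<le> (1 - u) * (floor_ht - cmod l) + u * (floor_ht - cmod l)"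
    using u drop_low by (intro add_mono mult_left_mono) auto
  finally show ?thesis by (simp add: algebra_simps)
qed

lemma seg_commute: "seg (a, b) = seg (b, a)" by (simp add: seg_def closed_segment_commute)

lemma bottom_hx:
  assumes z: "z \<in> seg (drop bj, drop bi)" shows "hx z = xi \<Longrightarrow> z = drop bi" "hx z = xj \<Longrightarrow> z = drop bj"
proof -
  obtain u where u: "z = (1 - u) *\<^sub>R drop bj + u *\<^sub>R drop bi" using z by (auto simp: seg_def in_segment)
  have h: "hx z = xj + u * (xi - xj)"
    unfolding u det2_affine hx_drop by (simp add: algebra_simps)
  show "z = drop bi" if "hx z = xi"
  proof -
    have "(u - 1) * (xi - xj) = 0" using h that by (simp add: algebra_simps)
    then have "u = 1" using xij by simp
    then show ?thesis using u by simp
  qed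
  show "z = drop bj" if "hx z = xj"
  proof -
    have "u = 0" using h that xij by simp
    then show ?thesis using u by simp
  qed
qed

lemma end_of_E: "b \<in> {bi, bj} \<Longrightarrow> g \<in> E \<Longrightarrow> b \<in> seg g \<Longrightarrow> b \<in> {fst g, snd g}"
proof -
  assume b: "b \<in> {bi, bj}" and g: "g \<in> E" "b \<in> seg g"
  obtain k where k: "k \<in> {1..bdcount N}" "b = bpos N k" using b ij by blast
  have "fst g \<in> cball (center N) (radius N)" "snd g \<in> cball (center N) (radius N)"
    using seg_E_cball[OF g(1)] by (auto simp: seg_def)
  then have "b = fst g \<or> b = snd g"
    using sphere_point_in_segment[of b "fst g" "snd g"] boundary_on_circle[OF drawn(1) k(1)] g(2) k(2) by simp
  then show ?thesis by simp
qed

text \<open>The vertical legs meet the disc only in \<open>bi\<close> and \<open>bj\<close>, lie on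
  different vertical lines, and the bottom leg lies below the disc.\<close>

lemma simple_chain_F: "simple_chain F"
proof -
  let ?ok = "\<lambda>g h. seg g \<inter> seg h \<subseteq> {fst g, snd g} \<inter> {fst h, snd h}"
  have EE: "?ok g h" if "g \<in> E" "h \<in> E" "g \<noteq> h" for g h
    using simple_chain_E that by (simp add: simple_chain_def)
  have leg: "x = b \<and> x \<in> {fst g, snd g}" if "g \<in> E" "b \<in> {bi, bj}" "x \<in> seg g" "x \<in> seg (b, drop b)" for g b x
  proof -
    have "x = b" using leg_cball[of b x] seg_E_cball[OF that(1)] that by blast
    then show ?thesis using end_of_E[OF that(2,1)] that(3) by simp
  qed
  have 1: "?ok g (bj, drop bj)" if "g \<in> E" for g
    using leg[OF that, of bj] by auto
  have 2: "?ok g (drop bi, bi)" if "g \<in> E" for g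
    using leg[OF that, of bi] unfolding seg_commute[of "drop bi"] by auto
  have 3: "?ok g (drop bj, drop bi)" if "g \<in> E" for g
  proof -
    have "x \<notin> cball (center N) (radius N)" if "x \<in> seg (drop bj, drop bi)" for x
      by (rule low_notin_cball) (use bottom_low[OF that] lm_pos in linarith)
    then show ?thesis using seg_E_cball[OF that] by blast
  qed
  have 4: "?ok (bj, drop bj) (drop bi, bi)"
    using hx_leg[of _ bj] hx_leg[of _ bi] xij unfolding seg_commute[of "drop bi"] by fastforce
  have 5: "?ok (bj, drop bj) (drop bj, drop bi)"
    using hx_leg[of _ bj] bottom_hx(2) by auto
  have 6: "?ok (drop bi, bi) (drop bj, drop bi)"
    using hx_leg[of _ bi] bottom_hx(1) unfolding seg_commute[of "drop bi"] by auto
  define ok where "ok g h \<longleftrightarrow> ?ok g h" for g h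
  have sym: "ok h g" if "ok g h" for g h using that unfolding ok_def by blast
  note oks = EE[folded ok_def] 1[folded ok_def] 2[folded ok_def] 3[folded ok_def]
    4[folded ok_def] 5[folded ok_def] 6[folded ok_def]
  show ?thesis
    unfolding simple_chain_def ok_def[symmetric] F_def legs_def using oks sym by auto
qed

lemma distinct_xs: "distinct xs"
proof -
  have "inj_on (pos N) (set p)" using pos_eq p_vertices by (auto simp: inj_on_def)
  moreover have "pos N ` set p \<subseteq> cball (center N) (radius N)"
    using p_vertices vertex_in_cball[OF drawn(1)] by blast
  ultimately show ?thesis
    using p_facts(4) drop_notin drop_ne by (auto simp: xs_def distinct_map)
qed

text \<open>Vertical legs contribute nothing under the half-open convention, so closing up costs
  only the bottom leg.\<close>

lemma crossings_F:
  "crossings l F z = crossings l E z + down l z (drop bj, drop bi)"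
proof -
  have "drop bi \<in> seg g \<or> drop bj \<in> seg g" if "g \<in> legs" for g
    using that by (auto simp: legs_def seg_def)
  then have "g \<notin> E" if "g \<in> legs" for g
    using that seg_E_cball[of g] drop_notin by blast
  then have dis: "E \<inter> legs = {}" by blast
  have "crossings l F z = crossings l E z + (\<Sum>g\<in>legs. down l z g)"
    unfolding crossings_def F_def using finite_E dis by (intro sum.union_disjoint) (auto simp: legs_def)
  moreover have "(\<Sum>g\<in>legs. down l z g) = (\<Sum>g\<in>{(drop bj, drop bi)}. down l z g)"
    by (rule sum.mono_neutral_right) (auto simp: legs_def down_def lefter_def hx_drop)
  ultimately show ?thesis by simp
qed

text \<open>Hence within the disc the crossing parity of the path is even iff being inside the
  polygon and being in the strip are equivalent.\<close>

lemma down_bottom: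
  assumes "ht z > floor_ht - cmod l" "hx z \<noteq> xi" "hx z \<noteq> xj"
  shows "down l z (drop bj, drop bi) = (if z \<in> strip then s else 0)"
proof (cases "lefter l (drop bj) z = lefter l (drop bi) z")
  case True
  then have "z \<notin> strip" by (auto simp: lefter_def hx_drop strip_def mult_less_0_iff)
  then show ?thesis using True by (simp add: down_def)
next
  case False
  obtain r a where ra: "z - (drop bj + of_real r * (drop bi - drop bj)) = of_real a * l"
    "det2 (drop bi - drop bj) l \<noteq> 0" "drop bj + of_real r * (drop bi - drop bj) \<in> seg (drop bj, drop bi)"
    by (metis vertical_projection[OF l_nz False])
  have "ht (of_real a * l) > 0"
    unfolding ra(1)[symmetric] inner_diff_left using bottom_low[OF ra(3)] assms(1) by simp
  then have "a * (l \<bullet> l) > 0" by (simp add: scaleR_conv_of_real[symmetric])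
  then have "a > 0" using l_nz by (metis inner_gt_zero_iff zero_less_mult_pos2)
  then have "above l z (drop bj, drop bi)" using above_iff(1)[OF ra(2,1)] by simp
  moreover have "z \<in> strip" "of_bool (lefter l (drop bj) z) - of_bool (lefter l (drop bi) z) = s"
    using False assms(2,3) s_cases by (auto simp: lefter_def hx_drop strip_def mult_less_0_iff)
  ultimately show ?thesis by (simp add: down_def)
qed

lemma crossings_E_low:
  assumes "\<And>t. t > 0 \<Longrightarrow> z - of_real t * l \<notin> cball (center N) (radius N)"
  shows "crossings l E z = 0"
  unfolding crossings_def
proof (intro sum.neutral ballI)
  fix g assume g: "g \<in> E"
  obtain P Q where PQ: "g = (P, Q)" by (cases g)
  show "down l z g = 0"
  proof (cases "lefter l P z = lefter l Q z")
    case False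
    obtain r a where ra: "z - (P + of_real r * (Q - P)) = of_real a * l"
      "det2 (Q - P) l \<noteq> 0" "P + of_real r * (Q - P) \<in> seg (P, Q)"
      by (metis vertical_projection[OF l_nz False])
    have "z - of_real a * l \<in> cball (center N) (radius N)"
    proof -
      have "z - of_real a * l = P + of_real r * (Q - P)" using ra(1) by (simp add: algebra_simps)
      then show ?thesis using ra(3) seg_E_cball[OF g] PQ by auto
    qed
    then have "\<not> a > 0" using assms by blast
    then show ?thesis using above_iff(1)[OF ra(2,1)] by (simp add: down_def PQ)
  qed (simp add: down_def PQ)
qed

text \<open>A point half a unit above the middle of the bottom leg, still below the disc. It
  identifies the inside of the polygon and the value \<open>s\<close> there.\<close>

definition base :: complex where
  "base = (1 / 2) *\<^sub>R drop bj + (1 / 2) *\<^sub>R drop bi + of_real (1 / (2 * cmod l)) * l"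

lemma base_facts: "hx base = (xi + xj) / 2" "ht base > (ht (drop bi) + ht (drop bj)) / 2" "ht base \<le> floor_ht - cmod l / 2"
proof -
  show "hx base = (xi + xj) / 2"
    unfolding base_def det2_linear(1)[of _ "of_real _ * l"] det2_linear(7) det2_affine
    by (simp add: hx_drop)
  have "ht base = (ht (drop bi) + ht (drop bj)) / 2 + 1 / (2 * cmod l) * (cmod l)\<^sup>2"
    unfolding base_def by (simp only: inner_add_left inner_scaleR_left ht_mult) simp
  then have "ht base = (ht (drop bi) + ht (drop bj)) / 2 + cmod l / 2"
    using l_nz by (simp add: power2_eq_square)
  then show "ht base > (ht (drop bi) + ht (drop bj)) / 2" "ht base \<le> floor_ht - cmod l / 2"
    using add_mono[OF drop_low] lm_pos by (simp_all add: field_simps)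
qed

end

context path_reversal
begin

lemma closed_chain_F: "closed_chain F"
  using closed_chain_rotate1[OF distinct_xs] xs_edges by simp

lemma trace_F_cases:
  assumes "z \<in> trace F"
  shows "z \<in> trace E \<or> z \<in> seg (bj, drop bj) \<or> z \<in> seg (drop bj, drop bi) \<or> z \<in> seg (bi, drop bi)"
  using assms unfolding trace_def F_def legs_def seg_commute[of bi] by auto

lemma crossings_base: "crossings l F base = s" "base \<notin> trace F"
proof -
  have low: "base - of_real t * l \<notin> cball (center N) (radius N)" if "t \<ge> 0" for t
  proof (rule low_notin_cball)
    have "ht (base - of_real t * l) = ht base - t * (cmod l)\<^sup>2" by (simp only: inner_diff_left ht_mult)
    moreover have "t * (cmod l)\<^sup>2 \<ge> 0" using that by simp
    ultimately show "ht (base - of_real t * l) < floor_ht" using base_facts(3) lm_pos by linarith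
  qed
  have cE: "crossings l E base = 0" by (rule crossings_E_low) (use low in simp)
  have ne: "det2 (drop bi - drop bj) l \<noteq> 0" using xij by (simp add: det2_linear hx_drop)
  have "base - (drop bj + of_real (1/2) * (drop bi - drop bj)) = of_real (1 / (2 * cmod l)) * l"
    by (simp add: base_def scaleR_conv_of_real algebra_simps)
  from above_iff(1)[OF ne this] have "above l base (drop bj, drop bi)" using lm_pos by simp
  moreover have "of_bool (lefter l (drop bj) base) - of_bool (lefter l (drop bi) base) = s"
    using s_cases by (auto simp: lefter_def hx_drop base_facts(1))
  ultimately show "crossings l F base = s" using cE by (simp add: crossings_F down_def)
  show "base \<notin> trace F"
  proof
    assume "base \<in> trace F"
    then consider "base \<in> trace E" | "base \<in> seg (bj, drop bj)" | "base \<in> seg (drop bj, drop bi)" | "base \<in> seg (bi, drop bi)"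
      using trace_F_cases by blast
    then show False
    proof cases
      case 1
      then show False using low[of 0] trace_E_cball by auto
    next
      case 2
      then show False using hx_leg[OF 2] base_facts(1) xij by simp
    next
      case 3
      then obtain u where u: "base = (1 - u) *\<^sub>R drop bj + u *\<^sub>R drop bi" by (auto simp: seg_def in_segment)
      have "hx base = xj + u * (xi - xj)"
        unfolding u det2_affine hx_drop by (simp add: algebra_simps)
      then have "(2 * u - 1) * (xi - xj) = 0" using base_facts(1) by (simp add: field_simps)
      then have u2: "u = 1 / 2" using xij by simp
      have "ht base = (1 - u) * ht (drop bj) + u * ht (drop bi)" unfolding u by (simp add: inner_add_left)
      then have "ht base = (ht (drop bi) + ht (drop bj)) / 2" unfolding u2 by simp
      then show False using base_facts(2) by simp
    next
      case 4
      then show False using hx_leg[OF 4] base_facts(1) xij by simp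
    qed
  qed
qed

text \<open>\<open>polygon_Jordan\<close> leaves the sign open; it is fixed by \<open>base\<close>,
  which sees only the bottom leg below it.\<close>

lemma inside_outside:
  shows crossings_inside: "z \<in> inside (trace F) \<Longrightarrow> crossings l F z = s"
    and crossings_outside: "z \<in> outside (trace F) \<Longrightarrow> crossings l F z = 0"
    and connected_inside_F: "connected (inside (trace F))"
    and connected_outside_F: "connected (outside (trace F))"
    and base_inside: "base \<in> inside (trace F)"
proof -
  have e: "(drop bj, drop bi) \<in> F" by (simp add: F_def legs_def)
  have ne: "det2 (snd (drop bj, drop bi) - fst (drop bj, drop bi)) l \<noteq> 0"
    using xij by (simp add: det2_linear hx_drop)
  have len: "length xs \<ge> 2" by (simp add: xs_def)
  obtain s' :: int where J: "\<And>z. z \<in> inside (trace F) \<Longrightarrow> crossings l F z = s'"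
    "\<And>z. z \<in> outside (trace F) \<Longrightarrow> crossings l F z = 0"
    "connected (inside (trace F))" "connected (outside (trace F))"
    using polygon_Jordan[OF distinct_xs len xs_edges[symmetric] simple_chain_F l_nz e ne] by metis
  show base: "base \<in> inside (trace F)"
  proof -
    have "base \<in> inside (trace F) \<or> base \<in> outside (trace F)"
      using inside_Un_outside crossings_base(2) by blast
    moreover have "base \<notin> outside (trace F)" using J(2) crossings_base(1) s_cases by force
    ultimately show ?thesis by blast
  qed
  then have "s' = s" using J(1) crossings_base by auto
  then show "z \<in> inside (trace F) \<Longrightarrow> crossings l F z = s" using J(1) by simp
  show "z \<in> outside (trace F) \<Longrightarrow> crossings l F z = 0" "connected (inside (trace F))"
    "connected (outside (trace F))"
    using J(2-4) by auto
qed

text \<open>A point on the left (\<open>\<sigma>\<close> is 1) or right (\<open>\<sigma>\<close> is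
  -1) of the direction \<open>d\<close> at \<open>x\<close>. A uniform notation is needed because
  the roles of left and right depend on \<open>s\<close>.\<close>

definition probe :: "int \<Rightarrow> complex \<Rightarrow> complex \<Rightarrow> real \<Rightarrow> complex" where
  "probe \<sigma> x d \<delta> = x + of_real (of_int \<sigma> * \<delta>) * \<i> * d"

lemma eventually_probe:
  assumes "open U" "x \<in> U" "\<sigma> = 1 \<or> \<sigma> = -1"
  shows "\<forall>\<^sub>F \<delta> in at_right 0. probe \<sigma> x d \<delta> \<in> U"
  using eventually_left_right_in[OF assms(1,2), of d]
  by eventually_elim (use assms(3) in \<open>auto simp: probe_def seg_def\<close>)

lemma closed_trace_F: "closed (trace F)"
  using closed_chain_F by (intro compact_imp_closed compact_trace) (simp add: closed_chain_def)

lemma open_inside_F: "open (inside (trace F))" "open (outside (trace F))"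
  using closed_trace_F open_inside open_outside by blast+

lemma s_sq: "s = 1 \<or> s = -1" "- s = 1 \<or> - s = -1" using s_cases by auto

text \<open>Left of an edge the crossing number is one larger than right of it, and the two
  available values are 0 and \<open>s\<close>.\<close>

lemma edge_sides:
  assumes e: "e \<in> D" and x: "x \<in> open_segment (pos N (fst e)) (pos N (snd e))"
  shows "\<forall>\<^sub>F \<delta> in at_right 0. probe s x (edge_vec N e) \<delta> \<in> inside (trace F) \<and>
    probe (- s) x (edge_vec N e) \<delta> \<in> outside (trace F)"
proof -
  have pE: "pt e \<in> E" using e by (simp add: E_def)
  then have pF: "pt e \<in> F" by (simp add: F_def)
  have d: "edge_vec N e = snd (pt e) - fst (pt e)" by (simp add: edge_vec_def pt_def)
  have x': "x \<in> open_segment (fst (pt e)) (snd (pt e))" using x by (simp add: pt_def)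
  have others: "x \<notin> seg g" if "g \<in> F" "g \<noteq> pt e" for g
  proof
    assume "x \<in> seg g"
    moreover have "x \<in> seg (pt e)" using x' by (simp add: seg_def open_segment_def)
    moreover have "seg g \<inter> seg (pt e) \<subseteq> {fst g, snd g} \<inter> {fst (pt e), snd (pt e)}"
      using simple_chain_F that pF by (simp add: simple_chain_def)
    ultimately show False using x' by (auto simp: open_segment_def)
  qed
  have "\<forall>\<^sub>F \<delta> in at_right 0. crossings l F (x + of_real \<delta> * \<i> * edge_vec N e)
             = crossings l F (x - of_real \<delta> * \<i> * edge_vec N e) + 1 \<and>
           x + of_real \<delta> * \<i> * edge_vec N e \<notin> trace F \<and> x - of_real \<delta> * \<i> * edge_vec N e \<notin> trace F"
    unfolding d by (rule crossings_jump[OF closed_chain_F l_nz pF E_vec[OF pE] x' others])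
  then show ?thesis
  proof eventually_elim
    case (elim \<delta>)
    define a b where "a = x - of_real \<delta> * \<i> * edge_vec N e" and "b = x + of_real \<delta> * \<i> * edge_vec N e"
    have io: "z \<in> inside (trace F) \<or> z \<in> outside (trace F)" if "z \<notin> trace F" for z
      using inside_Un_outside that by blast
    have vals: "(crossings l F z = s \<longleftrightarrow> z \<in> inside (trace F)) \<and> (crossings l F z = 0 \<longleftrightarrow> z \<in> outside (trace F))
      \<and> (crossings l F z = s \<or> crossings l F z = 0)" if "z \<notin> trace F" for z
      using io[OF that] crossings_inside[of z] crossings_outside[of z] s_sq(1) by fastforce
    have *: "crossings l F b = crossings l F a + 1" "a \<notin> trace F" "b \<notin> trace F"
      using elim by (auto simp: a_def b_def)
    from s_sq(1) show ?case
    proof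
      assume s1: "s = 1"
      then have "probe s x (edge_vec N e) \<delta> = b" "probe (- s) x (edge_vec N e) \<delta> = a"
        by (simp_all add: probe_def a_def b_def)
      then show ?thesis using vals[OF *(2)] vals[OF *(3)] *(1) s1 by auto
    next
      assume s1: "s = -1"
      then have "probe s x (edge_vec N e) \<delta> = a" "probe (- s) x (edge_vec N e) \<delta> = b"
        by (simp_all add: probe_def a_def b_def)
      then show ?thesis using vals[OF *(2)] vals[OF *(3)] *(1) s1 by auto
    qed
  qed
qed

subsection \<open>The boundary circle\<close>

lemma on_circle: "dist (center N) bi = radius N" "dist (center N) bj = radius N"
  using boundary_on_circle[OF drawn(1)] ij by auto

text \<open>A segment in the disc reaches the circle only in its ends, and an inner vertex of the
  path is no boundary vertex, as it has two arcs.\<close>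

lemma circle_trace_E:
  assumes "y \<in> trace E" "dist (center N) y = radius N" shows "y \<in> {bi, bj}"
proof -
  obtain e where e: "e \<in> D" "y \<in> seg (pt e)" using assms(1) by (auto simp: trace_def E_def)
  then have v: "fst e \<in> vertices N" "snd e \<in> vertices N" using arc_ends[of e] D by auto
  then have "y = pos N (fst e) \<or> y = pos N (snd e)"
    using sphere_point_in_segment[of y "pos N (fst e)" "pos N (snd e)"] vertex_in_cball[OF drawn(1)] e(2) assms(2)
    unfolding pt_def by blast
  then obtain v where v: "v \<in> vertices N" "y = pos N v" "on_D v"
    using v on_D_ends[of "fst e" "snd e"] e(1) by auto
  show ?thesis
  proof (cases v)
    case (Internal u)
    then have "y \<in> disc N" using v drawn(1) by (auto simp: drawn_network_def plane_drawing_def)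
    then show ?thesis using assms(2) by (simp add: disc_def)
  next
    case (Boundary k)
    have "v \<in> set p"
    proof -
      obtain f where "f \<in> D" "v \<in> ends f" using v(3) by (auto simp: on_D_def)
      then have "(fst f, snd f) \<in> set (zip p (tl p))" "v = fst f \<or> v = snd f"
        unfolding D_path path_arcs_def ends_def by auto
      then show ?thesis
        using set_zip_leftD[of "fst f" "snd f" p "tl p"] set_zip_rightD[of "fst f" "snd f" p "tl p"]
          list.set_sel(2)[OF p_facts(1)] by blast
    qed
    have "v = hd p \<or> v = last p"
    proof (rule ccontr)
      assume "\<not> ?thesis"
      then obtain x w where "(x, v) \<in> D" "(v, w) \<in> D"
        using zip_tl_last[OF \<open>v \<in> set p\<close>] zip_tl_hd[OF \<open>v \<in> set p\<close>] unfolding D_path path_arcs_def by blast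
      then show False using not_on_D_boundary[of k x w] v(1) Boundary by simp
    qed
    then show ?thesis using p_facts v(2) by auto
  qed
qed

lemma in_b: "b \<in> {bi, bj} \<Longrightarrow> \<exists>k\<in>{1..bdcount N}. b = bpos N k"
  using ij by blast

lemma above_b:
  assumes "b \<in> {bi, bj}" "z \<in> cball (center N) (radius N)" "hx z = hx b" "z \<noteq> b"
  obtains t where "t > 0" "z = b + of_real t * l"
proof -
  obtain k where k: "k \<in> {1..bdcount N}" "b = bpos N k" using in_b[OF assms(1)] by blast
  then have "z \<in> ray b l"
    using on_vertical_line[OF drawn(1) gauge_admissible[OF gauge(1)] k(1) assms(2)] assms(3,4) by auto
  then show ?thesis using that by (auto simp: ray_def)
qed

text \<open>The quantity tested by \<open>above\<close> for the chord from \<open>bj\<close> to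
  \<open>bi\<close>: positive above the chord, negative below it.\<close>

definition chord_side :: "complex \<Rightarrow> real" where
  "chord_side y = det2 (bi - bj) (y - bj) * (xi - xj)"

lemma chord_side_swap: "chord_side y = det2 (bj - bi) (y - bi) * (xj - xi)"
  by (simp add: chord_side_def det2_def algebra_simps)

text \<open>Consider a disc point \<open>y\<close> that is horizontally beyond \<open>b\<close> as
  seen from \<open>b'\<close>. The segment from \<open>b'\<close> to \<open>y\<close> crosses the
  vertical line through \<open>b\<close> inside the disc, hence at or above \<open>b\<close>, so
  \<open>y\<close> is not below the chord.\<close>

lemma circle_beyond:
  assumes y: "y \<in> cball (center N) (radius N)" and b: "b = bi \<and> b' = bj \<or> b = bj \<and> b' = bi"
    and beyond: "(hx y - hx b) * (hx b - hx b') \<ge> 0"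
  shows "det2 (b - b') (y - b') * (hx b - hx b') \<ge> 0"
proof -
  have ne: "hx b \<noteq> hx b'" using b xij by auto
  define r where "r = (hx b - hx b') / (hx y - hx b')"
  have ny: "hx y \<noteq> hx b'"
  proof
    assume "hx y = hx b'"
    then have "- ((hx b - hx b')\<^sup>2) \<ge> 0" using beyond by (simp add: power2_eq_square algebra_simps)
    then show False using ne by simp
  qed
  have pos: "(hx y - hx b') * (hx b - hx b') > 0"
  proof -
    have "(hx y - hx b') * (hx b - hx b') = (hx y - hx b) * (hx b - hx b') + (hx b - hx b')\<^sup>2"
      by (simp add: power2_eq_square algebra_simps)
    moreover have "(hx b - hx b')\<^sup>2 > 0" using ne by simp
    ultimately show ?thesis using beyond by linarith
  qed
  have r: "0 < r" "r \<le> 1"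
  proof -
    consider "hx b - hx b' > 0" "hx y - hx b' > 0" | "hx b - hx b' < 0" "hx y - hx b' < 0"
      using pos by (auto simp: zero_less_mult_iff)
    then show "0 < r" "r \<le> 1"
      using beyond unfolding r_def
      by (cases; auto simp: zero_le_mult_iff zero_less_divide_iff divide_le_eq_1)+
  qed
  define q where "q = (1 - r) *\<^sub>R b' + r *\<^sub>R y"
  have "b' \<in> cball (center N) (radius N)" using b b_cball by auto
  then have q: "q \<in> cball (center N) (radius N)"
    unfolding q_def using y r by (intro convexD convex_cball) auto
  have "hx q = (1 - r) * hx b' + r * hx y" by (simp add: q_def det2_affine)
  then have "hx q = hx b' + r * (hx y - hx b')" by (simp add: algebra_simps)
  then have hq: "hx q = hx b" using ny by (simp add: r_def)
  obtain t where t: "t \<ge> 0" "q = b + of_real t * l"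
  proof (cases "q = b")
    case True
    then show ?thesis using that[of 0] by simp
  next
    case False
    then obtain t where "t > 0" "q = b + of_real t * l" using above_b[OF _ q hq] b by auto
    then show ?thesis using that[of t] by simp
  qed
  have "det2 (b - b') (q - b') = t * (hx b - hx b')"
    unfolding t(2) by (simp add: det2_def algebra_simps)
  moreover have "q - b' = of_real r * (y - b')" by (simp add: q_def scaleR_conv_of_real algebra_simps)
  ultimately have eq: "r * det2 (b - b') (y - b') = t * (hx b - hx b')" by (simp only: det2_linear(8))
  have "r * (det2 (b - b') (y - b') * (hx b - hx b')) = t * (hx b - hx b')\<^sup>2"
    unfolding mult.assoc[symmetric] eq power2_eq_square ..
  then have "r * (det2 (b - b') (y - b') * (hx b - hx b')) \<ge> 0" using t(1) by simp
  then show ?thesis using r(1) by (simp add: zero_le_mult_iff)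
qed

lemma chord_side_neg_strip:
  assumes "y \<in> cball (center N) (radius N)" "chord_side y < 0" shows "y \<in> strip"
proof (rule ccontr)
  assume "y \<notin> strip"
  then have *: "(hx y - xi) * (hx y - xj) \<ge> 0" by (simp add: strip_def)
  have "(hx y - xi) * (xi - xj) \<ge> 0 \<or> (hx y - xj) * (xj - xi) \<ge> 0"
  proof (rule ccontr)
    assume "\<not> ?thesis"
    then have "(hx y - xi) * (xi - xj) < 0" "(hx y - xj) * (xi - xj) > 0" by (auto simp: algebra_simps)
    then show False using * by (auto simp: mult_less_0_iff zero_less_mult_iff zero_le_mult_iff)
  qed
  then have "chord_side y \<ge> 0"
    using circle_beyond[OF assms(1), of bi bj] circle_beyond[OF assms(1), of bj bi]
    unfolding chord_side_def[symmetric] chord_side_swap[symmetric] by blast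
  then show False using assms(2) by simp
qed

text \<open>A line meets a circle in at most two points, here \<open>bi\<close> and
  \<open>bj\<close>.\<close>

lemma chord_side_nonzero:
  assumes y: "dist (center N) y = radius N" "y \<noteq> bi" "y \<noteq> bj" shows "chord_side y \<noteq> 0"
proof
  assume "chord_side y = 0"
  then have "det2 (y - bj) (bi - bj) = 0"
    using xij det2_commute[of "y - bj" "bi - bj"] by (simp add: chord_side_def)
  moreover have "bi - bj \<noteq> 0" using xij by auto
  ultimately obtain k where k: "y - bj = of_real k * (bi - bj)" by (rule det2_zero_imp)
  define v w where "v = bi - bj" and "w = bj - center N"
  have sq: "(cmod (z - center N))\<^sup>2 = (radius N)\<^sup>2" if "dist (center N) z = radius N" for z
    using that by (simp add: dist_norm norm_minus_commute)
  have vw: "y - center N = w + k *\<^sub>R v" "bi - center N = w + v"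
    using k by (simp_all add: v_def w_def scaleR_conv_of_real algebra_simps)
  have "(cmod (w + k *\<^sub>R v))\<^sup>2 = (cmod w)\<^sup>2" "(cmod (w + v))\<^sup>2 = (cmod w)\<^sup>2"
    using sq[OF y(1)] sq[OF on_circle(1)] sq[OF on_circle(2)] unfolding vw w_def[symmetric] by simp_all
  then have 1: "k * (2 * (w \<bullet> v) + k * (v \<bullet> v)) = 0" and 2: "2 * (w \<bullet> v) + v \<bullet> v = 0"
    by (simp_all add: power2_norm_eq_inner inner_add_left inner_add_right inner_commute algebra_simps)
  have "v \<bullet> v > 0" using xij by (auto simp: v_def)
  have "k = 0 \<or> 2 * (w \<bullet> v) + k * (v \<bullet> v) = 0" using 1 by (simp only: mult_eq_0_iff)
  moreover have "(k - 1) * (v \<bullet> v) = (2 * (w \<bullet> v) + k * (v \<bullet> v)) - (2 * (w \<bullet> v) + v \<bullet> v)"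
    by (simp add: algebra_simps)
  ultimately have "k = 0 \<or> (k - 1) * (v \<bullet> v) = 0" using 2 by simp
  then have "k = 0 \<or> k = 1" using \<open>v \<bullet> v > 0\<close> by (metis eq_iff_diff_eq_0 mult_eq_0_iff less_irrefl)
  then show False using k y by auto
qed

lemma chord_point:
  assumes "min xi xj \<le> hx y" "hx y \<le> max xi xj"
  obtains q a where "q \<in> cball (center N) (radius N)" "y - q = of_real a * l" "chord_side y > 0 \<longleftrightarrow> a > 0"
    "chord_side y < 0 \<longleftrightarrow> a < 0"
proof -
  define r where "r = (hx y - xj) / (xi - xj)"
  have r: "0 \<le> r" "r \<le> 1" using assms xij unfolding r_def by (auto simp: divide_simps min_def max_def split: if_splits)
  have ne: "det2 (bi - bj) l \<noteq> 0" using xij by (simp add: det2_linear)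
  define q where "q = bj + of_real r * (bi - bj)"
  have "q = (1 - r) *\<^sub>R bj + r *\<^sub>R bi" by (simp add: q_def scaleR_conv_of_real algebra_simps)
  then have q: "q \<in> cball (center N) (radius N)" using convexD[OF convex_cball b_cball(2,1), of "1 - r" r] r by simp
  have "hx (y - q) = hx y - (xj + r * (xi - xj))"
    unfolding q_def by (simp add: det2_def algebra_simps)
  then have "hx (y - q) = 0" using xij by (simp add: r_def)
  then obtain a where a: "y - q = of_real a * l" using det2_zero_imp l_nz by blast
  have "above l y (bj, bi) \<longleftrightarrow> a > 0" "below l y (bj, bi) \<longleftrightarrow> a < 0"
    using above_iff[OF ne, of y r a] a by (simp_all add: q_def)
  then have "chord_side y > 0 \<longleftrightarrow> a > 0" "chord_side y < 0 \<longleftrightarrow> a < 0"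
    by (simp_all add: above_def below_def chord_side_def det2_linear)
  then show ?thesis using that q a by blast
qed

text \<open>Strict convexity of the disc along a vertical line.\<close>

lemma circle_not_between:
  assumes y: "dist (center N) y = radius N" and c: "y + of_real a * l \<in> cball (center N) (radius N)"
    "y - of_real t * l \<in> cball (center N) (radius N)" "a > 0" "t > 0"
  shows False
proof -
  define u where "u = t / (a + t)"
  have 1: "(1 - u) *\<^sub>R (y - of_real t * l) + u *\<^sub>R (y + of_real a * l) = y + of_real (u * (a + t) - t) * l"
    by (simp add: scaleR_conv_of_real algebra_simps)
  have 2: "u * (a + t) - t = 0" using c by (simp add: u_def)
  have "y = (1 - u) *\<^sub>R (y - of_real t * l) + u *\<^sub>R (y + of_real a * l)"
    unfolding 1 2 by simp
  moreover have "0 \<le> u" "u \<le> 1" using c by (simp_all add: u_def)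
  ultimately have "y \<in> seg (y - of_real t * l, y + of_real a * l)"
    unfolding seg_def in_segment fst_conv snd_conv by blast
  from sphere_point_in_segment[OF this c(2,1) y] show False using c l_nz by auto
qed

lemma circle_trace_F:
  assumes y: "dist (center N) y = radius N" "y \<noteq> bi" "y \<noteq> bj" shows "y \<notin> trace F"
proof
  have cb: "y \<in> cball (center N) (radius N)" using y by simp
  assume "y \<in> trace F"
  then consider "y \<in> trace E" | "y \<in> seg (bj, drop bj)" | "y \<in> seg (drop bj, drop bi)" | "y \<in> seg (bi, drop bi)"
    using trace_F_cases by blast
  then show False
  proof cases
    case 1
    then show False using circle_trace_E[OF _ y(1)] y by blast
  next
    case 2
    then show False using leg_cball[of bj y] cb y by blast
  next
    case 3
    then show False using bottom_low[OF 3] ht_cball(1)[OF cb] lm_pos unfolding floor_ht_def by linarith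
  next
    case 4
    then show False using leg_cball[of bi y] cb y by blast
  qed
qed

lemma cball_above_bottom: "y \<in> cball (center N) (radius N) \<Longrightarrow> floor_ht - cmod l < ht y"
  using ht_cball(1)[of y] lm_pos unfolding floor_ht_def by linarith

text \<open>The vertical line through such a point continues upwards to the chord inside the disc,
  so below the point there is no disc and hence no edge of the path. Only the bottom leg is
  counted.\<close>

lemma circle_below_chord:
  assumes y: "dist (center N) y = radius N" "y \<noteq> bi" "y \<noteq> bj" and k: "chord_side y < 0"
  shows "y \<in> strip" "y \<in> inside (trace F)"
proof -
  have cb: "y \<in> cball (center N) (radius N)" using y by simp
  show st: "y \<in> strip" by (rule chord_side_neg_strip[OF cb k])
  then have hs: "min xi xj < hx y" "hx y < max xi xj" by (auto simp: strip_iff)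
  obtain q a where q: "q \<in> cball (center N) (radius N)" "y - q = of_real a * l" "a < 0"
    using chord_point[of y] hs k by (metis less_imp_le)
  have "y + of_real (- a) * l \<in> cball (center N) (radius N)"
  proof -
    have "y + of_real (- a) * l = q" using q(2) by (simp add: algebra_simps)
    then show ?thesis using q(1) by simp
  qed
  then have "y - of_real t * l \<notin> cball (center N) (radius N)" if "t > 0" for t
    using circle_not_between[OF y(1), of "- a" t] that q(3) by auto
  then have "crossings l E y = 0" by (rule crossings_E_low)
  moreover have "hx y \<noteq> xi" "hx y \<noteq> xj" using hs by auto
  ultimately have "crossings l F y = s"
    using st down_bottom[OF cball_above_bottom[OF cb]] by (simp add: crossings_F)
  then have "y \<notin> outside (trace F)" using crossings_outside[of y] s_sq by auto
  then show "y \<in> inside (trace F)" using circle_trace_F[OF y] inside_Un_outside by blast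
qed

text \<open>If the disc continues below \<open>y\<close>, it does not continue above, and the upward
  ray escapes to infinity without meeting the polygon. If it does not continue below, no path edge
  lies below \<open>y\<close>, and \<open>y\<close> is outside the strip since otherwise the chord
  would be below it.\<close>

lemma circle_above_chord:
  assumes y: "dist (center N) y = radius N" "y \<noteq> bi" "y \<noteq> bj" and k: "chord_side y > 0"
  shows "y \<in> outside (trace F)"
proof (cases "\<exists>t>0. y - of_real t * l \<in> cball (center N) (radius N)")
  case True
  then obtain t0 where t0: "t0 > 0" "y - of_real t0 * l \<in> cball (center N) (radius N)" by blast
  have cb: "y \<in> cball (center N) (radius N)" using y by simp
  have up: "y + of_real t * l \<notin> cball (center N) (radius N)" if "t > 0" for t
    using circle_not_between[OF y(1) _ t0(2) that t0(1)] by blast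
  define S where "S = (\<lambda>t. y + of_real t * l) ` {0..}"
  have htS: "ht (y + of_real t * l) = ht y + t * (cmod l)\<^sup>2" for t by (simp only: inner_add_left ht_mult)
  have hxS: "hx (y + of_real t * l) = hx y" for t by (simp add: det2_linear)
  have leg: False if b: "b \<in> {bi, bj}" and t: "t \<ge> 0" "y + of_real t * l \<in> seg (b, drop b)" for b t
  proof -
    have "hx y = hx b" using hx_leg[OF t(2)] by (simp only: hxS)
    then obtain c where c: "c > 0" "y = b + of_real c * l" using above_b[OF b cb] b y by auto
    obtain u where u: "0 \<le> u" "u \<le> 1" "y + of_real t * l = (1 - u) *\<^sub>R b + u *\<^sub>R drop b"
      using t(2) by (auto simp: seg_def in_segment)
    have "ht y + t * (cmod l)\<^sup>2 = (1 - u) * ht b + u * ht (drop b)"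
      unfolding htS[symmetric] u(3) by (simp add: inner_add_left)
    also have "\<dots> = ht b - u * ((2 * radius N + 1) * cmod l)" by (simp add: ht_drop algebra_simps)
    also have "\<dots> \<le> ht b" using u radius_pos by simp
    also have "\<dots> < ht y" unfolding c(2) inner_add_left ht_mult using c l_nz by simp
    finally have "t * (cmod l)\<^sup>2 < 0" by simp
    then show False using t(1) by (simp add: mult_less_0_iff)
  qed
  have "S \<inter> trace F = {}"
  proof (rule ccontr)
    assume "S \<inter> trace F \<noteq> {}"
    then obtain t where t: "t \<ge> 0" "y + of_real t * l \<in> trace F" by (auto simp: S_def)
    then consider "y + of_real t * l \<in> trace E" | "y + of_real t * l \<in> seg (bj, drop bj)"
      | "y + of_real t * l \<in> seg (drop bj, drop bi)" | "y + of_real t * l \<in> seg (bi, drop bi)"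
      using trace_F_cases by blast
    then show False
    proof cases
      case 1
      then have "\<not> t > 0" using up trace_E_cball by blast
      then have "t = 0" using t(1) by simp
      then show False using t(2) circle_trace_F[OF y] by simp
    next
      case 3
      have "ht y + t * (cmod l)\<^sup>2 \<le> floor_ht - cmod l" using bottom_low[OF 3] by (simp only: htS)
      moreover have "t * (cmod l)\<^sup>2 \<ge> 0" using t(1) by simp
      ultimately show False using cball_above_bottom[OF cb] by linarith
    qed (use leg[OF _ t(1)] in auto)
  qed
  moreover have "connected S" unfolding S_def
    by (intro connected_continuous_image continuous_intros) auto
  moreover have "y \<in> S" unfolding S_def by (rule image_eqI[of _ _ 0]) auto
  ultimately have "S \<subseteq> connected_component_set (- trace F) y"
    by (intro connected_component_maximal) auto
  moreover have "\<not> bounded S"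
  proof
    assume "bounded S"
    then obtain B where B: "\<And>z. z \<in> S \<Longrightarrow> cmod z \<le> B" by (auto simp: bounded_iff)
    define t where "t = (B + cmod y + 1) / cmod l"
    have "B \<ge> 0" using B[OF \<open>y \<in> S\<close>] by (meson norm_ge_zero order_trans)
    then have t: "t \<ge> 0" "t * cmod l = B + cmod y + 1" using lm_pos by (simp_all add: t_def)
    have "cmod (of_real t * l) \<le> cmod (y + of_real t * l) + cmod y"
      by (metis add.commute add_diff_cancel_left' norm_triangle_ineq4)
    moreover have "cmod (y + of_real t * l) \<le> B" using B t(1) by (auto simp: S_def)
    moreover have "cmod (of_real t * l) = t * cmod l" using t(1) by (simp add: norm_mult)
    ultimately show False using t(2) by linarith
  qed
  ultimately show ?thesis
    using circle_trace_F[OF y] bounded_subset unfolding outside_def by blast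
next
  case False
  have cb: "y \<in> cball (center N) (radius N)" using y by simp
  have "hx y \<noteq> hx b" if b: "b \<in> {bi, bj}" for b
  proof
    assume "hx y = hx b"
    then obtain c where c: "c > 0" "y = b + of_real c * l" using above_b[OF b cb] b y by auto
    then have "y - of_real c * l = b" by simp
    moreover have "b \<in> cball (center N) (radius N)" using b b_cball by auto
    ultimately show False using False c(1) by auto
  qed
  then have h: "hx y \<noteq> xi" "hx y \<noteq> xj" by auto
  have "y \<notin> strip"
  proof
    assume "y \<in> strip"
    then have "min xi xj \<le> hx y" "hx y \<le> max xi xj" by (auto simp: strip_iff)
    then obtain q a where q: "q \<in> cball (center N) (radius N)" "y - q = of_real a * l" "a > 0"
      using chord_point[of y] k by metis
    have "y - of_real a * l = q" using q(2) by (simp add: algebra_simps)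
    then show False using False q by auto
  qed
  moreover have "crossings l E y = 0" by (rule crossings_E_low) (use False in blast)
  ultimately have "crossings l F y = 0"
    using down_bottom[OF cball_above_bottom[OF cb] h] by (simp add: crossings_F)
  then have "y \<notin> inside (trace F)" using crossings_inside[of y] s_sq by auto
  then show ?thesis using circle_trace_F[OF y] inside_Un_outside by blast
qed

text \<open>Translates the prescribed orientation of the two boundary arcs, both from
  \<open>bj\<close> to \<open>bi\<close>, into their position relative to the chord.\<close>

lemma turn_chord:
  assumes y: "dist (center N) y = radius N" "y \<noteq> bi" "y \<noteq> bj"
  shows "turn (y - bj) (bi - y) = (if chord_side y < 0 then s else - s)"
proof -
  have "det2 (y - bj) (bi - y) = - det2 (bi - bj) (y - bj)" by (simp add: det2_def algebra_simps)
  then show ?thesis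
    using chord_side_nonzero[OF y] s_cases
    by (auto simp: turn_det2 chord_side_def mult_less_0_iff zero_less_mult_iff split: if_splits)
qed

end

context path_reversal
begin

subsection \<open>Regions\<close>

definition sided :: "int \<Rightarrow> complex set \<Rightarrow> complex \<Rightarrow> complex \<Rightarrow> bool" where
  "sided \<sigma> R x d \<longleftrightarrow> (\<forall>\<^sub>F \<delta> in at_right 0. probe \<sigma> x d \<delta> \<in> R)"

lemma sided_left_right: "sided 1 R x d \<longleftrightarrow> lies_left R x d" "sided (- 1) R x d \<longleftrightarrow> lies_right R x d"
  by (simp_all add: sided_def probe_def lies_left_def lies_right_def)

lemma coherent_sided:
  "coherent K R \<longleftrightarrow> (\<forall>(x, d)\<in>K. \<not> sided s R x d) \<or> (\<forall>(x, d)\<in>K. \<not> sided (- s) R x d)"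
  using s_sq(1) unfolding coherent_def sided_left_right[symmetric] by auto

abbreviation "curves \<equiv> oriented_curves N l i j D"

lemma open_strip: "open strip"
  unfolding strip_def by (intro open_Collect_less continuous_intros)

lemma hx_probe: "hx (probe \<sigma> x (of_real r * l) \<delta>) = hx x - r * of_int \<sigma> * \<delta> * (cmod l)\<^sup>2"
  unfolding probe_def cmod_power2 by (simp add: det2_def algebra_simps power2_eq_square)

text \<open>The two rays are oriented oppositely, so the strip between them is on the same side of
  both.\<close>

lemma ray_sides:
  assumes "b = bi \<and> r = 1 \<or> b = bj \<and> r = - 1" "hx x = hx b"
  shows "\<forall>\<^sub>F \<delta> in at_right 0. probe s x (of_real r * l) \<delta> \<in> strip \<and> probe (- s) x (of_real r * l) \<delta> \<notin> strip"
proof -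
  define L where "L = (cmod l)\<^sup>2"
  have L: "L > 0" using l_nz by (simp add: L_def)
  have "\<forall>\<^sub>F \<delta>::real in at_right 0. \<delta> > 0" by (simp add: eventually_at_right_less)
  moreover have "\<forall>\<^sub>F \<delta>::real in at_right 0. \<delta> < \<bar>xi - xj\<bar> / L"
    by (rule order_tendstoD(2)[OF tendsto_ident_at]) (use xij L in simp)
  ultimately show ?thesis
  proof eventually_elim
    case (elim \<delta>)
    have dl: "\<delta> * L > 0" "\<delta> * L < \<bar>xi - xj\<bar>" using elim L by (simp_all add: pos_less_divide_eq)
    have h: "hx (probe \<sigma> x (of_real r * l) \<delta>) = hx b - r * of_int \<sigma> * (\<delta> * L)" for \<sigma>
      unfolding hx_probe assms(2) L_def by simp
    show ?case
      unfolding strip_iff h using assms(1) s_cases dl by (auto simp: min_def max_def abs_if split: if_splits)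
  qed
qed

text \<open>Along every curve, the \<open>s\<close> side is in the strip, inside the polygon or off
  the disc, and the other side is not all three of in the strip, inside and in the disc. So a region
  inside the polygon and in the strip never lies on the \<open>- s\<close> side of a curve, and a
  region with neither property never on the \<open>s\<close> side. Both kinds are coherent.\<close>

lemma curve_sides:
  assumes K: "(x, d) \<in> curves"
  shows "\<forall>\<^sub>F \<delta> in at_right 0. probe s x d \<delta> \<in> strip \<union> inside (trace F) \<union> - disc N"
    "\<forall>\<^sub>F \<delta> in at_right 0. probe (- s) x d \<delta> \<notin> strip \<inter> inside (trace F) \<inter> disc N"
proof -
  have ray: "(\<forall>\<^sub>F \<delta> in at_right 0. probe s x d \<delta> \<in> strip \<union> inside (trace F) \<union> - disc N) \<and>
    (\<forall>\<^sub>F \<delta> in at_right 0. probe (- s) x d \<delta> \<notin> strip \<inter> inside (trace F) \<inter> disc N)"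
    if "b = bi \<and> r = 1 \<or> b = bj \<and> r = - 1" "x \<in> ray b l" "d = of_real r * l" for b and r :: real
  proof -
    have "hx x = hx b" using that(2) by (auto simp: ray_def det2_linear)
    from ray_sides[OF that(1) this] show ?thesis
      unfolding that(3) by (auto elim: eventually_mono)
  qed
  consider (i) "x \<in> ray bi l" "d = of_real 1 * l" | (j) "x \<in> ray bj l" "d = of_real (- 1) * l"
    | (e) e where "e \<in> D" "d = edge_vec N e" "x \<in> open_segment (pos N (fst e)) (pos N (snd e))"
    | (c) "dist (center N) x = radius N" "x \<noteq> bi" "x \<noteq> bj"
        "d = of_int (turn (x - bj) (bi - x)) * (\<i> * (x - center N))"
    using K unfolding oriented_curves_def by fastforce
  then have "(\<forall>\<^sub>F \<delta> in at_right 0. probe s x d \<delta> \<in> strip \<union> inside (trace F) \<union> - disc N) \<and>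
    (\<forall>\<^sub>F \<delta> in at_right 0. probe (- s) x d \<delta> \<notin> strip \<inter> inside (trace F) \<inter> disc N)"
  proof cases
    case i
    then show ?thesis using ray[of bi 1] by simp
  next
    case j
    then show ?thesis using ray[of bj "-1"] by simp
  next
    case e
    have "z \<notin> inside (trace F)" if "z \<in> outside (trace F)" for z using that inside_Int_outside by blast
    then show ?thesis
      using edge_sides[OF e(1,3)] unfolding e(2) by (auto elim: eventually_mono)
  next
    case c
    define \<tau> where "\<tau> = turn (x - bj) (bi - x)"
    have d: "d = of_int \<tau> * (\<i> * (x - center N))" using c by (simp add: \<tau>_def)
    have probe_d: "probe \<sigma> x d \<delta> = x - of_int (\<sigma> * \<tau>) * of_real \<delta> * (x - center N)" for \<sigma> \<delta>
      by (simp add: probe_def d algebra_simps)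
    have out: "\<forall>\<^sub>F \<delta> in at_right 0. probe \<sigma> x d \<delta> \<notin> disc N" if "\<sigma> * \<tau> = - 1" for \<sigma>
    proof -
      have "\<forall>\<^sub>F \<delta>::real in at_right 0. \<delta> > 0" by (simp add: eventually_at_right_less)
      then show ?thesis
      proof eventually_elim
        case (elim \<delta>)
        have "probe \<sigma> x d \<delta> - center N = of_real (1 + \<delta>) * (x - center N)"
          unfolding probe_d that by (simp add: algebra_simps)
        then have "dist (center N) (probe \<sigma> x d \<delta>) = cmod (of_real (1 + \<delta>) * (x - center N))"
          by (metis dist_commute dist_norm)
        also have "\<dots> = (1 + \<delta>) * cmod (x - center N)"
          unfolding norm_mult norm_of_real using elim by simp
        also have "cmod (x - center N) = radius N" using c(1) by (metis dist_commute dist_norm)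
        finally have "dist (center N) (probe \<sigma> x d \<delta>) = (1 + \<delta>) * radius N" .
        then show ?case using elim radius_pos by (simp add: disc_def)
      qed
    qed
    show ?thesis
    proof (cases "chord_side x < 0")
      case True
      then have \<tau>: "\<tau> = s" using turn_chord[OF c(1-3)] by (simp add: \<tau>_def)
      have "\<forall>\<^sub>F \<delta> in at_right 0. probe s x d \<delta> \<in> strip"
        using eventually_probe[OF open_strip circle_below_chord(1)[OF c(1-3) True] s_sq(1)] .
      moreover have "\<forall>\<^sub>F \<delta> in at_right 0. probe (- s) x d \<delta> \<notin> disc N"
        by (rule out) (use \<tau> s_sq in auto)
      ultimately show ?thesis by (auto elim: eventually_mono)
    next
      case False
      then have k: "chord_side x > 0" using chord_side_nonzero[OF c(1-3)] by simp
      have \<tau>: "\<tau> = - s" using False turn_chord[OF c(1-3)] by (simp add: \<tau>_def)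
      have "\<forall>\<^sub>F \<delta> in at_right 0. probe (- s) x d \<delta> \<in> outside (trace F)"
        using eventually_probe[OF open_inside_F(2) circle_above_chord[OF c(1-3) k] s_sq(2)] .
      moreover have "\<forall>\<^sub>F \<delta> in at_right 0. probe s x d \<delta> \<notin> disc N"
        by (rule out) (use \<tau> s_sq in auto)
      moreover have "z \<notin> inside (trace F)" if "z \<in> outside (trace F)" for z using that inside_Int_outside by blast
      ultimately show ?thesis by (auto elim: eventually_mono)
    qed
  qed
  then show "\<forall>\<^sub>F \<delta> in at_right 0. probe s x d \<delta> \<in> strip \<union> inside (trace F) \<union> - disc N"
    "\<forall>\<^sub>F \<delta> in at_right 0. probe (- s) x d \<delta> \<notin> strip \<inter> inside (trace F) \<inter> disc N" by blast+
qed

definition cut_disc :: "complex set" where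
  "cut_disc = disc N - (ray bi l \<union> ray bj l \<union> trace_of N D)"

lemma disc_ray: "b \<in> {bi, bj} \<Longrightarrow> z \<in> disc N \<Longrightarrow> z \<in> ray b l \<longleftrightarrow> hx z = hx b"
proof -
  assume b: "b \<in> {bi, bj}" and z: "z \<in> disc N"
  obtain k where k: "k \<in> {1..bdcount N}" "b = bpos N k" using in_b[OF b] by blast
  have "z \<in> cball (center N) (radius N)" "z \<noteq> b" using z b on_circle by (auto simp: disc_def)
  then show "z \<in> ray b l \<longleftrightarrow> hx z = hx b"
    using ray_iff[OF drawn(1) gauge_admissible[OF gauge(1)] k(1)] k(2) by simp
qed

lemma cut_disc_eq: "cut_disc = disc N \<inter> - trace E \<inter> {z. hx z \<noteq> xi} \<inter> {z. hx z \<noteq> xj}"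
  unfolding cut_disc_def trace_of_D using disc_ray by blast

lemma open_cut_disc: "open cut_disc"
proof -
  have "closed (trace E)" using finite_E by (intro compact_imp_closed compact_trace)
  then show ?thesis unfolding cut_disc_eq disc_def
    by (intro open_Int open_ball open_Compl open_Collect_neq continuous_intros)
qed

lemma hx_inner: "hx z = Complex (Im l) (- Re l) \<bullet> z"
  by (simp add: det2_def inner_complex_def)

lemma convex_hx: "convex {z. hx z < c}" "convex {z. hx z > c}"
  unfolding hx_inner by (rule convex_halfspace_lt, rule convex_halfspace_gt)

lemma convex_strip: "convex strip"
proof -
  have "strip = {z. hx z > min xi xj} \<inter> {z. hx z < max xi xj}" by (auto simp: strip_iff)
  then show ?thesis using convex_hx by (simp add: convex_Int)
qed

lemma trace_F_disc: "z \<in> disc N \<Longrightarrow> z \<in> trace F \<Longrightarrow> z \<in> trace E"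
proof -
  assume z: "z \<in> disc N" "z \<in> trace F"
  have cb: "z \<in> cball (center N) (radius N)" using z by (simp add: disc_def)
  have nb: "z \<noteq> bi" "z \<noteq> bj" using z on_circle by (auto simp: disc_def)
  consider "z \<in> trace E" | "z \<in> seg (bj, drop bj)" | "z \<in> seg (drop bj, drop bi)" | "z \<in> seg (bi, drop bi)"
    using trace_F_cases z by blast
  then show "z \<in> trace E"
  proof cases
    case 2
    then show ?thesis using leg_cball[of bj z] cb nb by blast
  next
    case 3
    then show ?thesis using bottom_low[OF 3] cball_above_bottom[OF cb] by simp
  next
    case 4
    then show ?thesis using leg_cball[of bi z] cb nb by blast
  qed
qed

context
  fixes R :: "complex set"
  assumes R: "R \<in> components cut_disc"
begin

lemma R_props: "open R" "connected R" "R \<subseteq> cut_disc" "R \<noteq> {}" "R \<subseteq> disc N"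
  using R open_components[OF open_cut_disc] in_components_connected in_components_subset
    in_components_nonempty cut_disc_def by blast+

lemma R_absorbs: "convex T \<or> connected T \<Longrightarrow> T \<subseteq> cut_disc \<Longrightarrow> T \<inter> R \<noteq> {} \<Longrightarrow> T \<subseteq> R"
  using components_maximal[OF R] convex_connected by blast

lemma R_inside_outside: "R \<subseteq> inside (trace F) \<or> R \<subseteq> outside (trace F)"
proof -
  have "z \<notin> trace F" if "z \<in> R" for z
    using that R_props(3) trace_F_disc unfolding cut_disc_eq by blast
  then have "R \<subseteq> inside (trace F) \<union> outside (trace F)" using inside_Un_outside by blast
  then show ?thesis
    using connectedD[OF R_props(2) open_inside_F] inside_Int_outside by blast
qed

lemma R_strip: "R \<subseteq> strip \<or> R \<inter> strip = {}"
proof -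
  have "open {z. (hx z - xi) * (hx z - xj) > 0}" by (intro open_Collect_less continuous_intros)
  moreover have "R \<subseteq> strip \<union> {z. (hx z - xi) * (hx z - xj) > 0}"
  proof
    fix z assume "z \<in> R"
    then have "(hx z - xi) * (hx z - xj) \<noteq> 0" using R_props(3) unfolding cut_disc_eq by auto
    then show "z \<in> strip \<union> {z. (hx z - xi) * (hx z - xj) > 0}"
      unfolding strip_def Un_iff mem_Collect_eq by linarith
  qed
  moreover have "strip \<inter> {z. (hx z - xi) * (hx z - xj) > 0} = {}" by (auto simp: strip_def)
  ultimately show ?thesis using connectedD[OF R_props(2) open_strip] by blast
qed

lemma R_frontier: "y \<in> frontier R \<Longrightarrow> y \<in> closure R \<and> y \<notin> cut_disc \<and> y \<in> cball (center N) (radius N)"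
proof (intro conjI)
  assume y: "y \<in> frontier R"
  then show cl: "y \<in> closure R" by (simp add: frontier_def)
  show "y \<notin> cut_disc"
  proof
    assume "y \<in> cut_disc"
    then obtain r where r: "r > 0" "ball y r \<subseteq> cut_disc" using open_cut_disc openE by blast
    have "R \<inter> ball y r \<noteq> {}" using cl r(1) by (metis centre_in_ball disjoint_iff open_Int_closure_eq_empty open_ball)
    then have "ball y r \<subseteq> R" using R_absorbs[of "ball y r"] r(2) by (auto simp: Int_commute)
    then have "y \<in> interior R" using r(1) by (meson centre_in_ball interior_maximal open_ball subsetD)
    then show False using y by (simp add: frontier_def)
  qed
  have "closure R \<subseteq> cball (center N) (radius N)"
    using R_props(5) by (intro closure_minimal) (auto simp: disc_def)
  then show "y \<in> cball (center N) (radius N)" using cl by blast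
qed

lemma closure_meets: "y \<in> closure R \<Longrightarrow> open U \<Longrightarrow> y \<in> U \<Longrightarrow> U \<inter> R \<noteq> {}"
  by (metis disjoint_iff open_Int_closure_eq_empty Int_commute)

text \<open>Near \<open>y\<close> the disc is cut by this one vertical line only. The region
  contains a half disc next to \<open>y\<close>, and \<open>ray_sides\<close> tells which
  half.\<close>

lemma ray_piece:
  assumes b: "b \<in> {bi, bj}" and y: "y \<in> closure R" "y \<in> disc N" "hx y = hx b" "y \<notin> trace E"
  shows "\<exists>(x, d)\<in>curves. sided (if R \<subseteq> strip then s else - s) R x d"
proof -
  define r :: real where "r = (if b = bi then 1 else -1)"
  define c where "c = (if b = bi then xj else xi)"
  have br: "b = bi \<and> r = 1 \<or> b = bj \<and> r = - 1" using b by (auto simp: r_def)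
  have hb: "hx b \<noteq> c" using b xij by (auto simp: c_def)
  have yr: "y \<in> ray b l" using disc_ray[OF b y(2)] y(3) by simp
  have K: "(y, of_real r * l) \<in> curves"
    using br y(2) yr unfolding oriented_curves_def by auto
  have "closed (trace E)" using finite_E by (intro compact_imp_closed compact_trace)
  then have "open (disc N \<inter> - trace E \<inter> {z. hx z \<noteq> c})" unfolding disc_def
    by (intro open_Int open_ball open_Compl open_Collect_neq continuous_intros)
  moreover have "y \<in> disc N \<inter> - trace E \<inter> {z. hx z \<noteq> c}" using y hb by auto
  ultimately obtain \<rho> where \<rho>: "\<rho> > 0" "ball y \<rho> \<subseteq> disc N \<inter> - trace E \<inter> {z. hx z \<noteq> c}" using openE by blast
  have cut: "z \<in> cut_disc" if "z \<in> ball y \<rho>" "hx z \<noteq> hx b" for z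
    using that \<rho>(2) br unfolding cut_disc_eq c_def by (auto split: if_splits)
  obtain w where w: "w \<in> R" "w \<in> ball y \<rho>" using closure_meets[OF y(1), of "ball y \<rho>"] \<rho>(1) by auto
  have "hx w \<noteq> hx b" using w(1) R_props(3) b unfolding cut_disc_eq by auto
  then consider "hx w < hx b" | "hx w > hx b" by linarith
  then obtain H where H: "H \<subseteq> R" "H = ball y \<rho> \<inter> {z. hx z < hx b} \<or> H = ball y \<rho> \<inter> {z. hx z > hx b}"
  proof cases
    case 1
    have "ball y \<rho> \<inter> {z. hx z < hx b} \<subseteq> R"
      by (rule R_absorbs) (use convex_hx cut w 1 in \<open>auto intro!: convex_Int\<close>)
    then show ?thesis using that by blast
  next
    case 2
    have "ball y \<rho> \<inter> {z. hx z > hx b} \<subseteq> R"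
      by (rule R_absorbs) (use convex_hx cut w 2 in \<open>auto intro!: convex_Int\<close>)
    then show ?thesis using that by blast
  qed
  have ball: "\<forall>\<^sub>F \<delta> in at_right 0. probe \<sigma> y (of_real r * l) \<delta> \<in> ball y \<rho>" if "\<sigma> = 1 \<or> \<sigma> = -1" for \<sigma>
    by (rule eventually_probe[OF _ _ that]) (use \<rho> in auto)
  have pos: "\<forall>\<^sub>F \<delta>::real in at_right 0. \<delta> > 0" by (simp add: eventually_at_right_less)
  have hp: "hx (probe \<sigma> y (of_real r * l) \<delta>) = hx b - r * of_int \<sigma> * (\<delta> * (cmod l)\<^sup>2)" for \<sigma> \<delta>
    unfolding hx_probe y(3) by simp
  obtain \<sigma> where \<sigma>: "\<sigma> = 1 \<or> \<sigma> = -1" "sided \<sigma> R y (of_real r * l)"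
  proof -
    have lp: "(cmod l)\<^sup>2 > 0" using l_nz by simp
    have r1: "r = 1 \<or> r = -1" by (simp add: r_def)
    have b12: "\<forall>\<^sub>F \<delta> in at_right 0. probe (if r = 1 then 1 else -1) y (of_real r * l) \<delta> \<in> ball y \<rho>"
      "\<forall>\<^sub>F \<delta> in at_right 0. probe (if r = 1 then -1 else 1) y (of_real r * l) \<delta> \<in> ball y \<rho>"
      by (rule ball, simp)+
    have 1: "\<forall>\<^sub>F \<delta> in at_right 0. probe (if r = 1 then 1 else -1) y (of_real r * l) \<delta> \<in> ball y \<rho> \<inter> {z. hx z < hx b}"
      using b12(1) pos
    proof eventually_elim
      case (elim \<delta>)
      have "r * of_int (if r = 1 then 1 else -1) * (\<delta> * (cmod l)\<^sup>2) > 0" using r1 elim(2) lp by auto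
      then show ?case using elim by (simp add: hp)
    qed
    have 2: "\<forall>\<^sub>F \<delta> in at_right 0. probe (if r = 1 then -1 else 1) y (of_real r * l) \<delta> \<in> ball y \<rho> \<inter> {z. hx z > hx b}"
      using b12(2) pos
    proof eventually_elim
      case (elim \<delta>)
      have "r * of_int (if r = 1 then -1 else 1) * (\<delta> * (cmod l)\<^sup>2) < 0" using r1 elim(2) lp by auto
      then show ?case using elim by (simp add: hp)
    qed
    from H(2) show ?thesis
    proof
      assume "H = ball y \<rho> \<inter> {z. hx z < hx b}"
      then have "sided (if r = 1 then 1 else -1) R y (of_real r * l)"
        unfolding sided_def using 1 H(1) by (auto elim!: eventually_mono)
      then show ?thesis using that by (metis (full_types))
    next
      assume "H = ball y \<rho> \<inter> {z. hx z > hx b}"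
      then have "sided (if r = 1 then -1 else 1) R y (of_real r * l)"
        unfolding sided_def using 2 H(1) by (auto elim!: eventually_mono)
      then show ?thesis using that by (metis (full_types))
    qed
  qed
  have "\<sigma> = (if R \<subseteq> strip then s else - s)"
  proof -
    have "\<forall>\<^sub>F \<delta> in at_right 0. (probe \<sigma> y (of_real r * l) \<delta> \<in> R) \<and>
        (probe s y (of_real r * l) \<delta> \<in> strip \<and> probe (- s) y (of_real r * l) \<delta> \<notin> strip)"
      using \<sigma>(2) ray_sides[OF br y(3)] unfolding sided_def by (rule eventually_conj)
    then obtain \<delta> where "probe \<sigma> y (of_real r * l) \<delta> \<in> R" "probe s y (of_real r * l) \<delta> \<in> strip"
        "probe (- s) y (of_real r * l) \<delta> \<notin> strip"
      by (metis (mono_tags, lifting) eventually_happens' trivial_limit_at_right_real)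
    then show ?thesis using R_strip \<sigma>(1) s_sq(1) by (cases "\<sigma> = s") auto
  qed
  then show ?thesis using K \<sigma>(2) by blast
qed

lemma det2_left_inner: "det2 d z = Complex (- Im d) (Re d) \<bullet> z"
  by (simp add: det2_def inner_complex_def)

text \<open>The analogue of \<open>ray_piece\<close> at an inner point of a path edge, with
  \<open>edge_sides\<close> deciding the side.\<close>

lemma edge_piece:
  assumes e: "e \<in> D" and y: "y \<in> closure R" "y \<in> disc N" "y \<in> open_segment (pos N (fst e)) (pos N (snd e))"
    "hx y \<noteq> xi" "hx y \<noteq> xj"
  shows "\<exists>(x, d)\<in>curves. sided (if R \<subseteq> inside (trace F) then s else - s) R x d"
proof -
  define d where "d = edge_vec N e"
  define P Q where "P = pos N (fst e)" and "Q = pos N (snd e)"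
  have d: "d = Q - P" by (simp add: d_def edge_vec_def P_def Q_def)
  have pe: "pt e = (P, Q)" "pt e \<in> E" using e by (auto simp: pt_def P_def Q_def E_def)
  have dl: "det2 d l \<noteq> 0" using E_vec[OF pe(2)] by (simp add: pe(1) d)
  have K: "(y, d) \<in> curves" using e y(3) unfolding oriented_curves_def d_def by auto
  have yo: "y \<in> open_segment P Q" using y(3) by (simp add: P_def Q_def)
  \<comment> \<open>The last condition keeps \<open>W\<close> horizontally between the ends of the
    edge, so that the line through the edge meets \<open>W\<close> only in the edge itself.\<close>
  define W where "W = disc N \<inter> - trace (E - {pt e}) \<inter> {z. hx z \<noteq> xi} \<inter> {z. hx z \<noteq> xj} \<inter>
     {z. (hx z - hx P) * (hx z - hx Q) < 0}"
  have "closed (trace (E - {pt e}))" using finite_E by (intro compact_imp_closed compact_trace) simp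
  then have oW: "open W" unfolding W_def disc_def
    by (intro open_Int open_ball open_Compl open_Collect_neq open_Collect_less continuous_intros)
  have "y \<notin> seg g" if "g \<in> E" "g \<noteq> pt e" for g
  proof
    assume "y \<in> seg g"
    moreover have "y \<in> seg (pt e)" using yo by (simp add: pe(1) seg_def open_segment_def)
    moreover have "seg g \<inter> seg (pt e) \<subseteq> {fst g, snd g} \<inter> {fst (pt e), snd (pt e)}"
      using simple_chain_E that pe(2) by (simp add: simple_chain_def)
    ultimately show False using yo by (auto simp: open_segment_def pe(1))
  qed
  moreover have "(hx y - hx P) * (hx y - hx Q) < 0"
    using open_segment_strictly_between[of y P Q l] open_segment_strictly_between[of y Q P l] yo dl
    by (cases "lefter l P Q") (auto simp: lefter_def d det2_linear open_segment_commute mult_less_0_iff)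
  ultimately have "y \<in> W" using y by (auto simp: W_def trace_def)
  then obtain \<rho> where \<rho>: "\<rho> > 0" "ball y \<rho> \<subseteq> W" using oW openE by blast
  have on_line: "z \<in> seg (P, Q)" if "z \<in> W" "det2 d (z - P) = 0" for z
  proof -
    have "det2 (z - P) d = 0" using that(2) det2_commute[of d "z - P"] by simp
    moreover have "d \<noteq> 0" using dl by auto
    ultimately obtain u where u: "z - P = of_real u * d" by (rule det2_zero_imp)
    then have "hx (z - P) = u * det2 d l" by (simp add: det2_linear)
    then have h: "hx z - hx P = u * det2 d l" by (simp add: det2_linear)
    have h': "hx z - hx Q = (u - 1) * det2 d l" using h by (simp add: d det2_linear algebra_simps)
    have "(hx z - hx P) * (hx z - hx Q) = (u * (u - 1)) * (det2 d l)\<^sup>2"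
      unfolding h h' by (simp add: power2_eq_square)
    moreover have "(hx z - hx P) * (hx z - hx Q) < 0" using that(1) by (simp add: W_def)
    ultimately have "(u * (u - 1)) * (det2 d l)\<^sup>2 < 0" by simp
    then have "u * (u - 1) < 0" by (simp add: mult_less_0_iff)
    then have "0 \<le> u" "u \<le> 1" by (auto simp: mult_less_0_iff)
    moreover have "z = (1 - u) *\<^sub>R P + u *\<^sub>R Q"
      using u by (simp add: d scaleR_conv_of_real algebra_simps)
    ultimately show ?thesis unfolding seg_def in_segment by auto
  qed
  have cut: "z \<in> cut_disc" if "z \<in> ball y \<rho>" "det2 d (z - P) \<noteq> 0" for z
  proof -
    have zW: "z \<in> W" using that \<rho> by blast
    have "z \<notin> seg (pt e)" using that(2) det2_on_segment[of z P Q] by (auto simp: pe(1) seg_def d)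
    then have "z \<notin> trace E" using zW by (auto simp: W_def trace_def)
    then show ?thesis using zW unfolding cut_disc_eq W_def by blast
  qed
  obtain w where w: "w \<in> R" "w \<in> ball y \<rho>" using closure_meets[OF y(1), of "ball y \<rho>"] \<rho>(1) by auto
  have "det2 d (w - P) \<noteq> 0"
  proof
    assume "det2 d (w - P) = 0"
    then have "w \<in> seg (P, Q)" using on_line[of w] w(2) \<rho>(2) by blast
    then have "w \<in> trace E" using pe by (auto simp: trace_def)
    then show False using w(1) R_props(3) unfolding cut_disc_eq by blast
  qed
  have conv: "convex {z. det2 d (z - P) < 0}" "convex {z. det2 d (z - P) > 0}"
  proof -
    have "{z. det2 d (z - P) < 0} = {z. Complex (- Im d) (Re d) \<bullet> z < det2 d P}"
      "{z. det2 d (z - P) > 0} = {z. Complex (- Im d) (Re d) \<bullet> z > det2 d P}"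
      unfolding det2_left_inner[symmetric] by (auto simp: det2_linear)
    then show "convex {z. det2 d (z - P) < 0}" "convex {z. det2 d (z - P) > 0}"
      by (simp_all add: convex_halfspace_lt convex_halfspace_gt)
  qed
  have dy: "det2 d (y - P) = 0"
    using det2_on_segment[of y P Q] yo by (simp add: d open_segment_def)
  have ball: "\<forall>\<^sub>F \<delta> in at_right 0. probe \<sigma> y d \<delta> \<in> ball y \<rho>" if "\<sigma> = 1 \<or> \<sigma> = -1" for \<sigma>
    by (rule eventually_probe[OF _ _ that]) (use \<rho> in auto)
  have pos: "\<forall>\<^sub>F \<delta>::real in at_right 0. \<delta> > 0" by (simp add: eventually_at_right_less)
  have dd: "(cmod d)\<^sup>2 > 0" using dl by auto
  have dp: "det2 d (probe \<sigma> y d \<delta> - P) = of_int \<sigma> * \<delta> * (cmod d)\<^sup>2" for \<sigma> \<delta>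
    using det2_left(1)[of d y "of_int \<sigma> * \<delta>" P] dy by (simp add: probe_def)
  obtain \<sigma> where \<sigma>: "\<sigma> = 1 \<or> \<sigma> = -1" "sided \<sigma> R y d"
  proof (cases "det2 d (w - P) > 0")
    case True
    have "ball y \<rho> \<inter> {z. det2 d (z - P) > 0} \<subseteq> R"
      by (rule R_absorbs) (use conv cut w True in \<open>auto intro!: convex_Int\<close>)
    moreover have "\<forall>\<^sub>F \<delta> in at_right 0. probe 1 y d \<delta> \<in> ball y \<rho> \<inter> {z. det2 d (z - P) > 0}"
      using ball[OF disjI1[OF HOL.refl]] pos by eventually_elim (use dp[of 1] dd in auto)
    ultimately have "sided 1 R y d" unfolding sided_def by (auto elim!: eventually_mono)
    then show ?thesis using that by blast
  next
    case False
    then have neg: "det2 d (w - P) < 0" using \<open>det2 d (w - P) \<noteq> 0\<close> by simp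
    have "ball y \<rho> \<inter> {z. det2 d (z - P) < 0} \<subseteq> R"
      by (rule R_absorbs) (use conv cut w neg in \<open>auto intro!: convex_Int\<close>)
    moreover have "\<forall>\<^sub>F \<delta> in at_right 0. probe (-1) y d \<delta> \<in> ball y \<rho> \<inter> {z. det2 d (z - P) < 0}"
      using ball[OF disjI2[OF HOL.refl]] pos by eventually_elim (use dp[of "-1"] dd in auto)
    ultimately have "sided (-1) R y d" unfolding sided_def by (auto elim!: eventually_mono)
    then show ?thesis using that by blast
  qed
  have "\<sigma> = (if R \<subseteq> inside (trace F) then s else - s)"
  proof -
    have "\<forall>\<^sub>F \<delta> in at_right 0. (probe \<sigma> y d \<delta> \<in> R) \<and>
        (probe s y d \<delta> \<in> inside (trace F) \<and> probe (- s) y d \<delta> \<in> outside (trace F))"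
      using \<sigma>(2) edge_sides[OF e y(3)] unfolding sided_def d_def[symmetric] by (rule eventually_conj)
    then obtain \<delta> where z: "probe \<sigma> y d \<delta> \<in> R" "probe s y d \<delta> \<in> inside (trace F)"
        "probe (- s) y d \<delta> \<in> outside (trace F)"
      by (metis (mono_tags, lifting) eventually_happens' trivial_limit_at_right_real)
    have io: "\<not> (z \<in> inside (trace F) \<and> z \<in> outside (trace F))" for z using inside_Int_outside by blast
    have "\<sigma> = s \<or> \<sigma> = - s" using \<sigma>(1) s_sq(1) by auto
    then show ?thesis
    proof
      assume \<sigma>s: "\<sigma> = s"
      then have "\<not> R \<subseteq> outside (trace F)" using z io by blast
      then show ?thesis using \<sigma>s R_inside_outside by simp
    next
      assume \<sigma>s: "\<sigma> = - s"
      then have "\<not> R \<subseteq> inside (trace F)" using z io by blast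
      then show ?thesis using \<sigma>s by simp
    qed
  qed
  then show ?thesis using K \<sigma>(2) by blast
qed

end

end

context path_reversal
begin

context
  fixes R :: "complex set"
  assumes R: "R \<in> components cut_disc"
begin

text \<open>At a point of the upper arc the region lies on the inner side of the circle, which is
  the \<open>- s\<close> side by \<open>turn_chord\<close>.\<close>

lemma circle_piece:
  assumes y: "y \<in> closure R" "dist (center N) y = radius N" "hx y \<noteq> xi" "hx y \<noteq> xj" and k: "chord_side y > 0"
  shows "R \<subseteq> outside (trace F)" "\<exists>(x, d)\<in>curves. sided (- s) R x d"
proof -
  have nb: "y \<noteq> bi" "y \<noteq> bj" using y by auto
  have yo: "y \<in> outside (trace F)" by (rule circle_above_chord[OF y(2) nb k])
  then have "outside (trace F) \<inter> R \<noteq> {}" using closure_meets[OF R y(1) open_inside_F(2)] by blast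
  then show "R \<subseteq> outside (trace F)"
    using R_inside_outside[OF R] inside_Int_outside[of "trace F"] by blast
  define \<tau> where "\<tau> = turn (y - bj) (bi - y)"
  have \<tau>: "\<tau> = - s" using turn_chord[OF y(2) nb] k by (simp add: \<tau>_def)
  define d where "d = of_int \<tau> * (\<i> * (y - center N))"
  have K: "(y, d) \<in> curves"
    using y(2) nb unfolding oriented_curves_def d_def \<tau>_def by auto
  have "y \<notin> trace E" using circle_trace_F[OF y(2) nb] by (auto simp: trace_def F_def)
  moreover have "closed (trace E)" using finite_E by (intro compact_imp_closed compact_trace)
  then have "open (- trace E \<inter> {z. hx z \<noteq> xi} \<inter> {z. hx z \<noteq> xj})"
    by (intro open_Int open_Compl open_Collect_neq continuous_intros)
  ultimately obtain \<rho> where \<rho>: "\<rho> > 0" "ball y \<rho> \<subseteq> - trace E \<inter> {z. hx z \<noteq> xi} \<inter> {z. hx z \<noteq> xj}"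
    using y(3,4) openE[of "- trace E \<inter> {z. hx z \<noteq> xi} \<inter> {z. hx z \<noteq> xj}" y] by auto
  have HR: "ball y \<rho> \<inter> disc N \<subseteq> R"
  proof (rule R_absorbs[OF R])
    show "convex (ball y \<rho> \<inter> disc N) \<or> connected (ball y \<rho> \<inter> disc N)"
      by (simp add: disc_def convex_Int)
    show "ball y \<rho> \<inter> disc N \<subseteq> cut_disc" using \<rho>(2) unfolding cut_disc_eq by blast
    show "ball y \<rho> \<inter> disc N \<inter> R \<noteq> {}"
      using closure_meets[OF R y(1), of "ball y \<rho>"] \<rho>(1) R_props(5)[OF R] by auto
  qed
  have s2: "complex_of_int s * complex_of_int s = 1" using s_sq(1) by auto
  have pd: "probe (- s) y d \<delta> = y - of_real \<delta> * (y - center N)" for \<delta>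
  proof -
    have "probe (- s) y d \<delta> = y - of_real \<delta> * (of_int s * of_int s) * (y - center N)"
      unfolding probe_def d_def \<tau> by (simp add: algebra_simps)
    then show ?thesis unfolding s2 by simp
  qed
  have "\<forall>\<^sub>F \<delta> in at_right 0. probe (- s) y d \<delta> \<in> ball y \<rho>"
    by (rule eventually_probe[OF _ _ s_sq(2)]) (use \<rho> in auto)
  moreover have "\<forall>\<^sub>F \<delta>::real in at_right 0. \<delta> > 0" by (simp add: eventually_at_right_less)
  moreover have "\<forall>\<^sub>F \<delta>::real in at_right 0. \<delta> < 1" by (rule order_tendstoD(2)[OF tendsto_ident_at]) simp
  ultimately have "\<forall>\<^sub>F \<delta> in at_right 0. probe (- s) y d \<delta> \<in> R"
  proof eventually_elim
    case (elim \<delta>)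
    have "probe (- s) y d \<delta> - center N = of_real (1 - \<delta>) * (y - center N)"
      unfolding pd by (simp add: algebra_simps)
    then have "dist (center N) (probe (- s) y d \<delta>) = cmod (of_real (1 - \<delta>) * (y - center N))"
      by (metis dist_commute dist_norm)
    also have "\<dots> = (1 - \<delta>) * cmod (y - center N)"
      unfolding norm_mult norm_of_real using elim by simp
    also have "cmod (y - center N) = radius N" using y(2) by (metis dist_commute dist_norm)
    finally have "dist (center N) (probe (- s) y d \<delta>) = (1 - \<delta>) * radius N" .
    then have "probe (- s) y d \<delta> \<in> disc N" using elim radius_pos by (simp add: disc_def)
    then show ?case using elim HR by blast
  qed
  then show "\<exists>(x, d)\<in>curves. sided (- s) R x d" using K unfolding sided_def by blast
qed

text \<open>A horizontal shift within the open region avoids the finitely many vertical lines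
  through vertices.\<close>

lemma generic_point: "\<exists>z\<in>R. \<forall>v\<in>vertices N. hx z \<noteq> hx (pos N v)"
proof -
  obtain w where w: "w \<in> R" using R_props(4)[OF R] by blast
  have "\<forall>\<^sub>F \<delta> in at_right 0. seg (w - of_real \<delta> * \<i> * l, w + of_real \<delta> * \<i> * l) \<subseteq> R"
    by (rule eventually_left_right_in[OF R_props(1)[OF R] w])
  then have "\<forall>\<^sub>F \<delta> in at_right 0. w + of_real \<delta> * \<i> * l \<in> R"
    by eventually_elim (auto simp: seg_def)
  then obtain c where c: "c > 0" "\<And>\<delta>. 0 < \<delta> \<Longrightarrow> \<delta> < c \<Longrightarrow> w + of_real \<delta> * \<i> * l \<in> R"
    unfolding eventually_at_right_field by metis
  have h: "hx (w + of_real \<delta> * \<i> * l) = hx w - \<delta> * (cmod l)\<^sup>2" for \<delta>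
    unfolding cmod_power2 by (simp add: det2_def algebra_simps power2_eq_square)
  have lp: "(cmod l)\<^sup>2 > 0" using l_nz by simp
  have "finite ((\<lambda>v. (hx w - hx (pos N v)) / (cmod l)\<^sup>2) ` vertices N)"
    using finite_vertices[OF drawn(1)] by simp
  moreover have "infinite {0<..<c}" using c(1) by simp
  ultimately obtain \<delta> where \<delta>: "\<delta> \<in> {0<..<c}" "\<delta> \<notin> (\<lambda>v. (hx w - hx (pos N v)) / (cmod l)\<^sup>2) ` vertices N"
    by (meson finite_subset subsetI)
  have "hx (w + of_real \<delta> * \<i> * l) \<noteq> hx (pos N v)" if "v \<in> vertices N" for v
  proof
    assume "hx (w + of_real \<delta> * \<i> * l) = hx (pos N v)"
    then have "\<delta> = (hx w - hx (pos N v)) / (cmod l)\<^sup>2" unfolding h using lp by (simp add: field_simps)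
    then show False using \<delta>(2) that by blast
  qed
  then show ?thesis using c(2) \<delta>(1) by (intro bexI[of _ "w + of_real \<delta> * \<i> * l"]) auto
qed

text \<open>Going straight up from a generic point, the region is left through an inner point of a
  path edge or through the upper arc, never through a ray. The side of that piece depends only on
  whether the region is inside the polygon.\<close>

lemma vertical_piece: "\<exists>(x, d)\<in>curves. sided (if R \<subseteq> inside (trace F) then s else - s) R x d"
proof -
  obtain z where z: "z \<in> R" "\<And>v. v \<in> vertices N \<Longrightarrow> hx z \<noteq> hx (pos N v)" using generic_point by blast
  have zb: "hx z \<noteq> xi" "hx z \<noteq> xj" using z(2)[of "Boundary i"] z(2)[of "Boundary j"] ij by auto
  define S where "S = (\<lambda>t. z + of_real t * l) ` {0..}"
  have "connected S" unfolding S_def by (intro connected_continuous_image continuous_intros) auto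
  moreover have "z \<in> S" unfolding S_def by (rule image_eqI[of _ _ 0]) auto
  moreover have "\<not> S \<subseteq> R"
  proof
    assume "S \<subseteq> R"
    define t where "t = (2 * radius N + 1) / cmod l"
    have t: "t \<ge> 0" "t * cmod l = 2 * radius N + 1" using lm_pos radius_pos by (simp_all add: t_def)
    have "z + of_real t * l \<in> S" using t(1) by (auto simp: S_def)
    then have "dist (center N) (z + of_real t * l) < radius N" "dist (center N) z < radius N"
      using \<open>S \<subseteq> R\<close> z(1) R_props(5)[OF R] by (auto simp: disc_def)
    then have "dist z (z + of_real t * l) < 2 * radius N" by (smt (verit) dist_commute dist_triangle)
    moreover have "dist z (z + of_real t * l) = t * cmod l" using t(1) by (simp add: dist_norm norm_mult)
    ultimately show False using t(2) by simp
  qed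
  ultimately have "S \<inter> frontier R \<noteq> {}" using z(1) by (intro connected_Int_frontier) auto
  then obtain t where t: "t \<ge> 0" "z + of_real t * l \<in> frontier R" by (auto simp: S_def)
  define y where "y = z + of_real t * l"
  have hy: "hx y = hx z" by (simp add: y_def det2_linear)
  have yf: "y \<in> closure R" "y \<notin> cut_disc" "y \<in> cball (center N) (radius N)"
    using R_frontier[OF R] t(2) by (auto simp: y_def)
  have "t \<noteq> 0"
  proof
    assume "t = 0"
    then have "z \<in> frontier R" using t(2) by simp
    then show False using z(1) R_props(1)[OF R] by (auto simp: frontier_def interior_open)
  qed
  then have "t > 0" using t(1) by simp
  show ?thesis
  proof (cases "y \<in> disc N")
    case True
    then have "y \<in> trace E" using yf(2) zb hy unfolding cut_disc_eq by auto
    then obtain e where e: "e \<in> D" "y \<in> seg (pt e)" by (auto simp: trace_def E_def)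
    then have v: "fst e \<in> vertices N" "snd e \<in> vertices N" using arc_ends[of e] D by auto
    have "y \<noteq> pos N (fst e)" "y \<noteq> pos N (snd e)" using z(2)[OF v(1)] z(2)[OF v(2)] hy by auto
    then have "y \<in> open_segment (pos N (fst e)) (pos N (snd e))"
      using e(2) by (simp add: open_segment_def seg_def pt_def)
    then show ?thesis using edge_piece[OF R e(1) yf(1) True] zb hy by simp
  next
    case False
    then have yc: "dist (center N) y = radius N" using yf(3) by (simp add: disc_def)
    have nb: "y \<noteq> bi" "y \<noteq> bj" using zb hy by auto
    have "\<not> chord_side y < 0"
    proof
      assume k: "chord_side y < 0"
      have "y \<in> strip" by (rule circle_below_chord(1)[OF yc nb k])
      then obtain q a where q: "q \<in> cball (center N) (radius N)" "y - q = of_real a * l" "a < 0"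
        using chord_point[of y] k strip_iff by (metis less_imp_le)
      have "y + of_real (- a) * l = q" using q(2) by (simp add: algebra_simps)
      moreover have "y - of_real t * l = z" by (simp add: y_def)
      moreover have "z \<in> cball (center N) (radius N)" using z(1) R_props(5)[OF R] by (auto simp: disc_def)
      ultimately show False
        using circle_not_between[OF yc, of "- a" t] q(1,3) \<open>t > 0\<close> by simp
    qed
    then have k: "chord_side y > 0" using chord_side_nonzero[OF yc nb] by simp
    have h: "hx y \<noteq> xi" "hx y \<noteq> xj" using zb hy by auto
    note cp = circle_piece[OF yf(1) yc h k]
    have "\<not> R \<subseteq> inside (trace F)"
      using cp(1) R_props(4)[OF R] inside_Int_outside[of "trace F"] by blast
    then show ?thesis using cp(2) by simp
  qed
qed

lemma closure_strip: "R \<subseteq> strip \<Longrightarrow> y \<in> closure R \<Longrightarrow> min xi xj \<le> hx y \<and> hx y \<le> max xi xj"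
proof -
  assume Rs: "R \<subseteq> strip" and y: "y \<in> closure R"
  have "closed {z. min xi xj \<le> hx z \<and> hx z \<le> max xi xj}"
    by (intro closed_Collect_conj closed_Collect_le continuous_intros)
  then have "closure R \<subseteq> {z. min xi xj \<le> hx z \<and> hx z \<le> max xi xj}"
    by (intro closure_minimal) (use Rs strip_iff in \<open>auto simp: less_imp_le\<close>)
  then show ?thesis using y by blast
qed

text \<open>The inside of the polygon is connected and contains \<open>base\<close>, which is in the
  strip, so the region has a frontier point inside the polygon. Being neither on the path nor on the
  circle, it is on a ray.\<close>

lemma ray_piece_inside:
  assumes "R \<subseteq> inside (trace F)" "R \<inter> strip = {}"
  shows "\<exists>(x, d)\<in>curves. sided (- s) R x d"
proof -
  have "base \<in> strip" unfolding strip_iff base_facts(1) using xij by (auto simp: min_def max_def)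
  then have "base \<notin> R" using assms by blast
  then have "inside (trace F) - R \<noteq> {}" "inside (trace F) \<inter> R \<noteq> {}"
    using base_inside assms(1) R_props(4)[OF R] by blast+
  then obtain y where y: "y \<in> inside (trace F)" "y \<in> frontier R"
    using connected_Int_frontier[OF connected_inside_F] by blast
  note yf = R_frontier[OF R y(2)]
  have ns: "y \<notin> strip" using closure_meets[OF R _ open_strip, of y] yf assms(2) by blast
  have nt: "y \<notin> trace F" using y(1) inside_no_overlap by blast
  have "bi \<in> trace F" "bj \<in> trace F" unfolding trace_def F_def legs_def seg_def by auto
  then have nb: "y \<noteq> bi" "y \<noteq> bj" using nt by auto
  have yd: "y \<in> disc N"
  proof (rule ccontr)
    assume "y \<notin> disc N"
    then have yc: "dist (center N) y = radius N" using yf by (simp add: disc_def)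
    have "chord_side y > 0"
      using chord_side_nonzero[OF yc nb] circle_below_chord(1)[OF yc nb] ns by linarith
    then have "y \<in> outside (trace F)" by (rule circle_above_chord[OF yc nb])
    then show False using y(1) inside_Int_outside[of "trace F"] by blast
  qed
  have nE: "y \<notin> trace E" using nt by (auto simp: trace_def F_def)
  have "\<not> R \<subseteq> strip" using assms(2) R_props(4)[OF R] by blast
  moreover have "hx y = xi \<or> hx y = xj" using yf yd nE unfolding cut_disc_eq by blast
  ultimately show ?thesis
    using ray_piece[OF R, of bi y] ray_piece[OF R, of bj y] yf yd nE by auto
qed

text \<open>The upper half circle, parametrised by the horizontal coordinate \<open>u\<close>. The
  minus sign is there because \<open>\<i> * l\<close> points to the left when \<open>l\<close>
  points upwards.\<close>

definition circle_top :: "real \<Rightarrow> complex" where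
  "circle_top u = center N + of_real (- u / cmod l) * (\<i> * l) + of_real (sqrt ((radius N)\<^sup>2 - u\<^sup>2) / cmod l) * l"

text \<open>The outside of the polygon is connected and unbounded, so the region has a frontier
  point in it. If this is on the circle and not on a ray, one slides along the upper arc within the
  strip, just below the circle, until the ray from \<open>bi\<close> is reached.\<close>

lemma ray_piece_outside:
  assumes Ro: "R \<subseteq> outside (trace F)" and Rs: "R \<subseteq> strip"
  shows "\<exists>(x, d)\<in>curves. sided s R x d"
proof -
  have "\<not> outside (trace F) \<subseteq> R"
  proof
    assume "outside (trace F) \<subseteq> R"
    then have "bounded (outside (trace F))"
      using R_props(5)[OF R] bounded_ball bounded_subset unfolding disc_def by blast
    moreover have "bounded (trace F)"
      using closed_chain_F by (intro compact_imp_bounded compact_trace) (simp add: closed_chain_def)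
    ultimately show False using unbounded_outside by blast
  qed
  then have "outside (trace F) - R \<noteq> {}" "outside (trace F) \<inter> R \<noteq> {}"
    using Ro R_props(4)[OF R] by blast+
  then obtain y where y: "y \<in> outside (trace F)" "y \<in> frontier R"
    using connected_Int_frontier[OF connected_outside_F] by blast
  note yf = R_frontier[OF R y(2)]
  have nt: "y \<notin> trace F" using y(1) outside_no_overlap by blast
  have nE: "y \<notin> trace E" using nt by (auto simp: trace_def F_def)
  have "bi \<in> trace F" "bj \<in> trace F" unfolding trace_def F_def legs_def seg_def by auto
  then have nb: "y \<noteq> bi" "y \<noteq> bj" using nt by auto
  show ?thesis
  proof (cases "y \<in> disc N")
    case True
    then have "hx y = xi \<or> hx y = xj" using yf nE unfolding cut_disc_eq by blast
    then show ?thesis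
      using ray_piece[OF R, of bi y] ray_piece[OF R, of bj y] yf True nE Rs by auto
  next
    case False
    then have yc: "dist (center N) y = radius N" using yf by (simp add: disc_def)
    have "\<not> chord_side y < 0"
      using circle_below_chord(2)[OF yc nb] y(1) inside_Int_outside[of "trace F"] by blast
    then have k: "chord_side y > 0" using chord_side_nonzero[OF yc nb] by simp
    have ys: "min xi xj \<le> hx y" "hx y \<le> max xi xj" using closure_strip[OF Rs] yf by auto
    obtain q a where q: "q \<in> cball (center N) (radius N)" "y - q = of_real a * l" "a > 0"
      using chord_point[OF ys] k by metis
    \<comment> \<open>Unscaled orthogonal coordinates around the centre, with the gauge direction
      upwards.\<close>
    define X where "X z = det2 (z - center N) l / cmod l" for z
    define Y where "Y z = ((z - center N) \<bullet> l) / cmod l" for z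
    have XY: "(X z)\<^sup>2 + (Y z)\<^sup>2 = (dist (center N) z)\<^sup>2" for z
    proof -
      have "(det2 v l)\<^sup>2 + (v \<bullet> l)\<^sup>2 = (cmod v)\<^sup>2 * (cmod l)\<^sup>2" for v
        unfolding cmod_power2 by (simp add: det2_def inner_complex_def power2_eq_square algebra_simps)
      then show ?thesis
        using lm_pos by (simp add: X_def Y_def dist_norm norm_minus_commute power_divide flip: add_divide_distrib)
    qed
    have Xhx: "X z = (hx z - hx (center N)) / cmod l" for z by (simp add: X_def det2_linear)
    have Y_add: "Y (z + of_real t * l) = Y z + t * cmod l" "X (z + of_real t * l) = X z" for z t
    proof -
      have "(z + of_real t * l - center N) \<bullet> l = (z - center N) \<bullet> l + t * (cmod l)\<^sup>2"
        by (simp only: inner_diff_left inner_add_left ht_mult)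
      then show "Y (z + of_real t * l) = Y z + t * cmod l"
        using lm_pos by (simp add: Y_def add_divide_distrib power2_eq_square)
      show "X (z + of_real t * l) = X z" by (simp add: X_def det2_linear)
    qed
    have Ypos: "Y y > 0"
    proof -
      have "y = q + of_real a * l" using q(2) by (simp add: algebra_simps)
      then have Yq: "Y y = Y q + a * cmod l" "X y = X q" using Y_add by auto
      have "(X q)\<^sup>2 + (Y q)\<^sup>2 \<le> (radius N)\<^sup>2" using XY[of q] q(1) by (simp add: power_mono)
      moreover have "(X y)\<^sup>2 + (Y y)\<^sup>2 = (radius N)\<^sup>2" using XY[of y] yc by simp
      ultimately have "(Y q)\<^sup>2 \<le> (Y y)\<^sup>2" using Yq by simp
      then have "\<bar>Y q\<bar> \<le> \<bar>Y y\<bar>" by (simp add: abs_le_square_iff)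
      then show ?thesis using Yq q(3) mult_pos_pos[OF q(3) lm_pos] by linarith
    qed
    \<comment> \<open>A boundary vertex whose ray enters the disc is on the open lower half circle.
      Hence the upper arc over the closed strip avoids \<open>bi\<close> and \<open>bj\<close>, and
      so the whole path.\<close>
    have Xb: "\<bar>X b\<bar> < radius N" "Y b < 0" if b: "b \<in> {bi, bj}" for b
    proof -
      obtain m where m: "m \<in> {1..bdcount N}" "b = bpos N m" using in_b[OF b] by blast
      obtain t where t: "t > 0" "b + of_real t * l \<in> ball (center N) (radius N)"
        using gauge_admissible[OF gauge(1)] m unfolding admissible_def ray_def disc_def by blast
      have "(X b)\<^sup>2 + (Y b + t * cmod l)\<^sup>2 < (radius N)\<^sup>2"
        using XY[of "b + of_real t * l"] t(2) radius_pos unfolding Y_add by (simp add: power_strict_mono)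
      moreover have e: "(X b)\<^sup>2 + (Y b)\<^sup>2 = (radius N)\<^sup>2" using XY[of b] b on_circle by auto
      ultimately have "(Y b + t * cmod l)\<^sup>2 < (Y b)\<^sup>2" by linarith
      then have "\<bar>Y b + t * cmod l\<bar> < \<bar>Y b\<bar>" by (metis abs_le_square_iff not_le)
      then show "Y b < 0" using mult_pos_pos[OF t(1) lm_pos] by linarith
      then have "(X b)\<^sup>2 < (radius N)\<^sup>2" using e by (smt (verit) zero_less_power2)
      then show "\<bar>X b\<bar> < radius N" using radius_pos by (metis abs_of_pos power2_abs power2_less_imp_less abs_ge_zero less_imp_le)
    qed
    define u0 u1 where "u0 = min (X bi) (X bj)" and "u1 = max (X bi) (X bj)"
    have "X bi \<noteq> X bj" using xij lm_pos by (simp add: Xhx)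
    then have u01: "u0 < u1" by (auto simp: u0_def u1_def)
    have strip_X: "z \<in> strip \<longleftrightarrow> u0 < X z \<and> X z < u1" for z
      unfolding strip_iff u0_def u1_def Xhx using lm_pos
      by (auto simp: min_def max_def divide_right_mono_neg divide_le_cancel divide_less_cancel)
    have yX: "u0 \<le> X y" "X y \<le> u1"
      using ys lm_pos unfolding u0_def u1_def Xhx by (auto simp: min_def max_def divide_le_cancel split: if_splits)
    have ub: "\<bar>u\<bar> < radius N" if "u0 \<le> u" "u \<le> u1" for u
      using Xb(1)[of bi] Xb(1)[of bj] that unfolding u0_def u1_def by (auto simp: min_def max_def split: if_splits)
    have top: "X (circle_top u) = u" "Y (circle_top u) = sqrt ((radius N)\<^sup>2 - u\<^sup>2)" for u
    proof -
      have "det2 (circle_top u - center N) l = u * cmod l"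
      proof -
        have "u * Re l * Re l / cmod l + u * Im l * Im l / cmod l = u * (cmod l * cmod l) / cmod l"
          by (simp add: cmod_power2 algebra_simps add_divide_distrib flip: power2_eq_square)
        also have "\<dots> = u * cmod l" using lm_pos by simp
        finally show ?thesis using lm_pos unfolding circle_top_def
          by (simp add: det2_linear) (simp add: det2_def)
      qed
      then show "X (circle_top u) = u" using lm_pos by (simp add: X_def)
      have "(\<i> * l) \<bullet> l = 0" by (simp add: inner_complex_def)
      then have "(of_real c * (\<i> * l)) \<bullet> l = 0" for c :: real
        by (simp add: scaleR_conv_of_real[symmetric])
      then have "(circle_top u - center N) \<bullet> l = sqrt ((radius N)\<^sup>2 - u\<^sup>2) / cmod l * (cmod l)\<^sup>2"
        unfolding circle_top_def by (simp only: inner_diff_left inner_add_left ht_mult)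
      then show "Y (circle_top u) = sqrt ((radius N)\<^sup>2 - u\<^sup>2)" using lm_pos by (simp add: Y_def power2_eq_square)
    qed
    have XY_eq: "z = w" if "X z = X w" "Y z = Y w" for z w
    proof -
      have "det2 (z - w) l = 0" "(z - w) \<bullet> l = 0"
        using that lm_pos by (simp_all add: X_def Y_def det2_linear inner_diff_left)
      then have "z - w = 0"
        using det2_zero_imp[of "z - w" l] l_nz ht_mult by (metis mult_eq_0_iff of_real_0 norm_eq_zero power_eq_0_iff mult_zero_left)
      then show ?thesis by simp
    qed
    have dist_top: "dist (center N) (circle_top u) = radius N" if "u0 \<le> u" "u \<le> u1" for u
    proof -
      have "u\<^sup>2 \<le> (radius N)\<^sup>2" using ub[OF that] by (metis abs_of_pos abs_le_square_iff less_imp_le radius_pos)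
      then have "(dist (center N) (circle_top u))\<^sup>2 = (radius N)\<^sup>2" using XY[of "circle_top u"] top by simp
      then show ?thesis using radius_pos by (simp add: power2_eq_iff_nonneg)
    qed
    have y_top: "y = circle_top (X y)"
    proof (rule XY_eq)
      show "X y = X (circle_top (X y))" using top by simp
      have "(Y y)\<^sup>2 = (radius N)\<^sup>2 - (X y)\<^sup>2" using XY[of y] yc by simp
      then show "Y y = Y (circle_top (X y))" unfolding top using Ypos by (simp add: real_sqrt_unique)
    qed
    have ct: "continuous_on UNIV circle_top" unfolding circle_top_def by (intro continuous_intros) (use lm_pos in auto)
    have "circle_top ` {u0..u1} \<inter> trace E = {}"
    proof (rule ccontr)
      assume "circle_top ` {u0..u1} \<inter> trace E \<noteq> {}"
      then obtain u where u: "u \<in> {u0..u1}" "circle_top u \<in> trace E" by blast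
      then have "circle_top u \<in> {bi, bj}" using circle_trace_E[OF u(2) dist_top] by simp
      then have "Y (circle_top u) < 0" using Xb(2) by blast
      moreover have "u\<^sup>2 \<le> (radius N)\<^sup>2" using ub[of u] u(1) by (metis abs_le_square_iff abs_of_pos atLeastAtMost_iff less_imp_le radius_pos)
      ultimately show False unfolding top by simp
    qed
    moreover have "compact (circle_top ` {u0..u1})"
      using ct continuous_on_subset by (intro compact_continuous_image) auto
    moreover have "closed (trace E)" using finite_E by (intro compact_imp_closed compact_trace)
    ultimately obtain \<kappa> where \<kappa>: "\<kappa> > 0" "\<And>x z. x \<in> circle_top ` {u0..u1} \<Longrightarrow> z \<in> trace E \<Longrightarrow> \<kappa> \<le> dist x z"
      using separate_compact_closed by metis
    define mu where "mu = max \<bar>u0\<bar> \<bar>u1\<bar>"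
    have mu: "0 \<le> mu" "mu < radius N" using ub[of u0] ub[of u1] u01 by (auto simp: mu_def)
    \<comment> \<open>Less than \<open>\<kappa>\<close>, to stay off the path, and less than the
      height of the arc over the strip, to stay in the upper half of the disc.\<close>
    define \<epsilon> where "\<epsilon> = min \<kappa> (sqrt ((radius N)\<^sup>2 - mu\<^sup>2)) / 2"
    have mu2: "mu\<^sup>2 < (radius N)\<^sup>2" using mu by (simp add: power_strict_mono)
    have \<epsilon>: "\<epsilon> > 0" using \<kappa>(1) mu2 by (simp add: \<epsilon>_def)
    define G where "G = (\<lambda>(u, e). circle_top u - of_real (e / cmod l) * l)"
    have XG: "X (G (u, e)) = u" "Y (G (u, e)) = sqrt ((radius N)\<^sup>2 - u\<^sup>2) - e" for u e
      using Y_add[of "circle_top u" "- e / cmod l"] lm_pos by (simp_all add: G_def top)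
    have G: "G (u, e) \<in> disc N \<and> G (u, e) \<notin> trace E" if "u0 \<le> u" "u \<le> u1" "0 < e" "e \<le> \<epsilon>" for u e
    proof
      have "\<bar>u\<bar> \<le> mu" using that by (auto simp: mu_def)
      then have "u\<^sup>2 \<le> mu\<^sup>2" using mu by (metis abs_le_square_iff abs_of_nonneg)
      then have "sqrt ((radius N)\<^sup>2 - mu\<^sup>2) \<le> sqrt ((radius N)\<^sup>2 - u\<^sup>2)" by simp
      moreover have "2 * \<epsilon> \<le> sqrt ((radius N)\<^sup>2 - mu\<^sup>2)" by (simp add: \<epsilon>_def)
      ultimately have e: "e < sqrt ((radius N)\<^sup>2 - u\<^sup>2)" using that \<epsilon> by linarith
      then have "(sqrt ((radius N)\<^sup>2 - u\<^sup>2) - e)\<^sup>2 < (sqrt ((radius N)\<^sup>2 - u\<^sup>2))\<^sup>2"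
        using that by (intro power_strict_mono) auto
      moreover have "(sqrt ((radius N)\<^sup>2 - u\<^sup>2))\<^sup>2 = (radius N)\<^sup>2 - u\<^sup>2"
        using \<open>u\<^sup>2 \<le> mu\<^sup>2\<close> mu2 by simp
      ultimately have "(dist (center N) (G (u, e)))\<^sup>2 < (radius N)\<^sup>2"
        using XY[of "G (u, e)"] XG by simp
      then show "G (u, e) \<in> disc N" using radius_pos by (simp add: disc_def power2_less_imp_less)
      have "dist (circle_top u) (G (u, e)) = e" using that lm_pos by (simp add: G_def dist_norm norm_mult norm_divide)
      moreover have "\<epsilon> < \<kappa>" using \<kappa>(1) by (simp add: \<epsilon>_def min_def)
      ultimately show "G (u, e) \<notin> trace E" using \<kappa>(2)[of "circle_top u" "G (u, e)"] that by force
    qed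
    have cG: "continuous_on UNIV G" unfolding G_def case_prod_beta'
      by (intro continuous_intros continuous_on_compose2[OF ct]) (use lm_pos in auto)
    \<comment> \<open>A connected band below the arc. It lies in the cut disc and touches the
      frontier point \<open>y\<close>, so the region absorbs it.\<close>
    define B where "B = G ` ({u0<..<u1} \<times> {0<..<\<epsilon>})"
    have Bc: "B \<subseteq> cut_disc \<inter> strip"
    proof
      fix z assume "z \<in> B"
      then obtain u e where ue: "u0 < u" "u < u1" "0 < e" "e < \<epsilon>" "z = G (u, e)" by (auto simp: B_def)
      then have "z \<in> strip" using XG by (simp add: strip_X)
      then show "z \<in> cut_disc \<inter> strip" using G[of u e] ue unfolding cut_disc_eq by (auto simp: strip_def)
    qed
    have clB: "G (u, e) \<in> closure B" if "u0 \<le> u" "u \<le> u1" "0 \<le> e" "e \<le> \<epsilon>" for u e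
    proof -
      have "closure ({u0<..<u1} \<times> {0<..<\<epsilon>}) = {u0..u1} \<times> {0..\<epsilon>}"
        using u01 \<epsilon> by (simp add: closure_Times)
      moreover have "G ` closure ({u0<..<u1} \<times> {0<..<\<epsilon>}) \<subseteq> closure B"
        unfolding B_def by (rule image_closure_subset) (auto intro: continuous_on_subset[OF cG] closure_subset[THEN subsetD])
      ultimately show ?thesis using that by (auto simp: image_subset_iff)
    qed
    have "B \<inter> R \<noteq> {}"
    proof -
      have "open (- trace E)" using \<open>closed (trace E)\<close> by (rule open_Compl)
      then obtain \<rho> where \<rho>: "\<rho> > 0" "ball y \<rho> \<subseteq> - trace E" using nE openE[of "- trace E" y] by auto
      have HR: "ball y \<rho> \<inter> disc N \<inter> strip \<subseteq> R"
      proof (rule R_absorbs[OF R])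
        show "convex (ball y \<rho> \<inter> disc N \<inter> strip) \<or> connected (ball y \<rho> \<inter> disc N \<inter> strip)"
          using convex_strip by (simp add: disc_def convex_Int)
        show "ball y \<rho> \<inter> disc N \<inter> strip \<subseteq> cut_disc" using \<rho>(2) unfolding cut_disc_eq by (auto simp: strip_def)
        show "ball y \<rho> \<inter> disc N \<inter> strip \<inter> R \<noteq> {}"
          using closure_meets[OF R, of y "ball y \<rho>"] yf \<rho>(1) R_props(5)[OF R] Rs by auto
      qed
      have "y = G (X y, 0)" using y_top by (simp add: G_def)
      then have "y \<in> closure B" using clB[of "X y" 0] yX \<epsilon> by simp
      then have "ball y \<rho> \<inter> B \<noteq> {}"
        by (metis \<rho>(1) centre_in_ball disjoint_iff open_Int_closure_eq_empty open_ball Int_commute)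
      moreover have "B \<subseteq> disc N \<inter> strip" using Bc unfolding cut_disc_eq by blast
      ultimately show ?thesis using HR by blast
    qed
    moreover have "connected B" unfolding B_def
      by (intro connected_continuous_image continuous_on_subset[OF cG] connected_Times) auto
    ultimately have BR: "B \<subseteq> R" using R_absorbs[OF R] Bc by blast
    \<comment> \<open>A point on the vertical edge of the band, hence on the ray from
      \<open>bi\<close> and in the closure of the region.\<close>
    define w where "w = G (X bi, \<epsilon>)"
    have biX: "u0 \<le> X bi" "X bi \<le> u1" by (simp_all add: u0_def u1_def)
    have "w \<in> closure R" using clB[OF biX, of \<epsilon>] \<epsilon> closure_mono[OF BR] by (auto simp: w_def)
    moreover have "w \<in> disc N" "w \<notin> trace E" using G[OF biX \<epsilon>] by (auto simp: w_def)
    moreover have "hx w = xi"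
    proof -
      have "X w = X bi" by (simp add: w_def XG)
      then show ?thesis using lm_pos by (simp add: Xhx)
    qed
    ultimately show ?thesis using ray_piece[OF R, of bi w] Rs by auto
  qed
qed

end

text \<open>The two coherent kinds of region come from \<open>curve_sides\<close>. In the two
  others, \<open>vertical_piece\<close> and a piece of a ray lie on opposite sides, since being
  inside and being in the strip disagree.\<close>

theorem path_marks:
  assumes z: "z \<in> disc N" "z \<notin> trace E" "z \<notin> ray bi l" "z \<notin> ray bj l"
  shows "z \<in> path_plus N l i j D \<longleftrightarrow> even (crossings l E z)"
proof -
  have zc: "z \<in> cut_disc" using z by (simp add: cut_disc_def trace_of_D)
  define R where "R = connected_component_set cut_disc z"
  have R: "R \<in> components cut_disc" using zc by (auto simp: R_def components_def)
  have zR: "z \<in> R" using zc by (simp add: R_def connected_component_refl_eq)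
  have "R' = R" if "R' \<in> components cut_disc" "z \<in> R'" for R'
    using components_eq[OF that(1) R] that(2) zR by blast
  moreover have "regions N l i j D = components cut_disc" by (simp add: regions_def cut_disc_def)
  ultimately have plus: "z \<in> path_plus N l i j D \<longleftrightarrow> coherent curves R"
    using R zR unfolding path_plus_def by blast
  have h: "hx z \<noteq> xi" "hx z \<noteq> xj" using zc unfolding cut_disc_eq by auto
  have zcb: "z \<in> cball (center N) (radius N)" using z by (simp add: disc_def)
  have F: "crossings l F z = crossings l E z + (if z \<in> strip then s else 0)"
    using down_bottom[OF cball_above_bottom[OF zcb] h] by (simp add: crossings_F)
  have ns: "\<not> sided s R x d" if "R \<inter> strip = {}" "R \<subseteq> outside (trace F)" "(x, d) \<in> curves" for x d
  proof
    assume "sided s R x d"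
    then have "\<forall>\<^sub>F \<delta> in at_right 0. probe s x d \<delta> \<in> R \<and> probe s x d \<delta> \<in> strip \<union> inside (trace F) \<union> - disc N"
      unfolding sided_def using curve_sides(1)[OF that(3)] by (rule eventually_conj)
    then obtain w where "w \<in> R" "w \<in> strip \<union> inside (trace F) \<union> - disc N"
      by (metis (mono_tags, lifting) eventually_happens' trivial_limit_at_right_real)
    then show False using that R_props(5)[OF R] inside_Int_outside[of "trace F"] by blast
  qed
  have nms: "\<not> sided (- s) R x d" if "R \<subseteq> strip" "R \<subseteq> inside (trace F)" "(x, d) \<in> curves" for x d
  proof
    assume "sided (- s) R x d"
    then have "\<forall>\<^sub>F \<delta> in at_right 0. probe (- s) x d \<delta> \<in> R \<and> probe (- s) x d \<delta> \<notin> strip \<inter> inside (trace F) \<inter> disc N"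
      unfolding sided_def using curve_sides(2)[OF that(3)] by (rule eventually_conj)
    then obtain w where "w \<in> R" "w \<notin> strip \<inter> inside (trace F) \<inter> disc N"
      by (metis (mono_tags, lifting) eventually_happens' trivial_limit_at_right_real)
    then show False using that R_props(5)[OF R] by blast
  qed
  note v = vertical_piece[OF R]
  have R_ne: "R \<noteq> {}" using zR by blast
  consider (1) "R \<subseteq> inside (trace F)" "R \<subseteq> strip" | (2) "R \<subseteq> inside (trace F)" "R \<inter> strip = {}"
    | (3) "R \<subseteq> outside (trace F)" "R \<subseteq> strip" | (4) "R \<subseteq> outside (trace F)" "R \<inter> strip = {}"
    using R_inside_outside[OF R] R_strip[OF R] by blast
  then show ?thesis
  proof cases
    case 1
    have zz: "z \<in> inside (trace F)" "z \<in> strip" using 1 zR by blast+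
    from 1 have "coherent curves R" using nms unfolding coherent_sided by blast
    moreover have "crossings l E z = 0" using F crossings_inside[OF zz(1)] zz(2) by simp
    ultimately show ?thesis using plus by simp
  next
    case 2
    have zz: "z \<in> inside (trace F)" "z \<notin> strip" using 2 zR by blast+
    have "\<not> coherent curves R"
      using ray_piece_inside[OF R 2] v 2(1) unfolding coherent_sided by auto
    moreover have "crossings l E z = s" using F crossings_inside[OF zz(1)] zz(2) by simp
    ultimately show ?thesis using plus s_sq by auto
  next
    case 3
    have zz: "z \<in> outside (trace F)" "z \<in> strip" using 3 zR by blast+
    have "\<not> R \<subseteq> inside (trace F)" using 3 R_ne inside_Int_outside[of "trace F"] by blast
    then have "\<not> coherent curves R"
      using ray_piece_outside[OF R 3] v unfolding coherent_sided by auto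
    moreover have "crossings l E z = - s" using F crossings_outside[OF zz(1)] zz(2) by simp
    ultimately show ?thesis using plus s_sq by auto
  next
    case 4
    have zz: "z \<in> outside (trace F)" "z \<notin> strip" using 4 zR by blast+
    from 4 have "coherent curves R" using ns unfolding coherent_sided by blast
    moreover have "crossings l E z = 0" using F crossings_outside[OF zz(1)] zz(2) by simp
    ultimately show ?thesis using plus by simp
  qed
qed

end

lemma path_reversal_gauge:
  assumes val: "valid_gauged N l" "valid_gauged (reverse_arcs D N) l" and p: "source_sink_path N i j p" and Dp: "D = path_arcs p"
  shows "gauge_transforms N (reversal_gauge (path_plus N l i j D) N l D) (geom_signature N l) (geom_signature (reverse_arcs D N) l)"
proof -
  have "D \<subseteq> arcs N" using p Dp by (simp add: source_sink_path_def)
  then interpret path_reversal N l D i j p using val p Dp by unfold_locales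
  show ?thesis
  proof (rule region_gauge_transforms)
    fix z assume "z \<in> disc N" "z \<notin> trace E" "\<And>j. j \<in> touched \<Longrightarrow> z \<notin> ray (bpos N j) l"
    then show "z \<in> path_plus N l i j D \<longleftrightarrow> even (crossings l E z)"
      using path_marks[of z] ends_touched by blast
  qed
qed

section \<open>Decomposing a reversal into paths and cycles\<close>

lemma turn_minus_eq_0: "turn (- d) l = 0 \<longleftrightarrow> turn d l = 0"
  by (auto simp: turn_def Let_def)

text \<open>Balance preserves the numbers of incoming and outgoing arcs at internal vertices, hence
  the perfect orientation. The geometric conditions do not see the orientation.\<close>

lemma reverse_arcs_valid:
  assumes val: "valid_gauged N l" and D: "D \<subseteq> arcs N"
    and bal: "\<And>u. u \<in> internals N \<Longrightarrow> card (D \<inter> in_arcs N (Internal u)) = card (D \<inter> out_arcs N (Internal u))"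
  shows "valid_gauged (reverse_arcs D N) l"
proof -
  let ?M = "reverse_arcs D N"
  have pN: "plabic_network N" and gN: "gauge_direction N l" using val by (simp_all add: valid_gauged_def)
  have dN: "drawn_network N" using plabic_drawn[OF pN] .
  have sm [simp]: "center ?M = center N" "radius ?M = radius N" "bdcount ?M = bdcount N"
    "internals ?M = internals N" "white ?M = white N" "pos ?M = pos N"
    "vertices ?M = vertices N" "disc ?M = disc N" "edge_vec ?M = edge_vec N" "edge_seg ?M = edge_seg N"
    by (simp_all add: reverse_arcs_def vertices_def disc_def edge_vec_def[abs_def] edge_seg_def[abs_def])
  have aM: "arcs ?M = (arcs N - D) \<union> D\<inverse>" by (simp add: reverse_arcs_def)
  have orig: "\<exists>f\<in>arcs N. ends f = ends e \<and> edge_seg N f = edge_seg N e \<and>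
      (f = e \<and> e \<notin> D \<or> f = prod.swap e \<and> f \<in> D)" if "e \<in> arcs ?M" for e
  proof (cases "e \<in> arcs N - D")
    case False
    then have "prod.swap e \<in> D" using that unfolding aM by (cases e) auto
    then show ?thesis using D
      by (intro bexI[of _ "prod.swap e"]) (auto simp: ends_def edge_seg_def closed_segment_commute)
  qed auto
  have val_eq: "valency ?M v = valency N v" for v
    using card_reverse_arcs[OF dN D, of v] by (simp add: valency_def)
  have io: "card (in_arcs ?M (Internal u)) = card (in_arcs N (Internal u))"
    "card (out_arcs ?M (Internal u)) = card (out_arcs N (Internal u))" if "u \<in> internals N" for u
    using card_reverse_arcs[OF dN D, of "Internal u"] bal[OF that] by simp_all
  have sym: "arcs ?M \<union> (arcs ?M)\<inverse> = arcs N \<union> (arcs N)\<inverse>" using D by (auto simp: aM)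
  have cb: "clockwise_boundary ?M = clockwise_boundary N" by (simp add: clockwise_boundary_def)
  have meet: "edge_seg N e \<inter> edge_seg N f \<subseteq> pos N ` (ends e \<inter> ends f)"
    if e: "e \<in> arcs ?M" and f: "f \<in> arcs ?M" and ne: "e \<noteq> f" for e f
  proof -
    obtain e' where e': "e' \<in> arcs N" "ends e' = ends e" "edge_seg N e' = edge_seg N e"
      "e' = e \<and> e \<notin> D \<or> e' = prod.swap e \<and> e' \<in> D" using orig[OF e] by blast
    obtain f' where f': "f' \<in> arcs N" "ends f' = ends f" "edge_seg N f' = edge_seg N f"
      "f' = f \<and> f \<notin> D \<or> f' = prod.swap f \<and> f' \<in> D" using orig[OF f] by blast
    have "e' \<noteq> f'" using e'(4) f'(4) ne by (metis swap_swap)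
    then show ?thesis using edges_meet[OF dN e'(1) f'(1)] e' f' by simp
  qed
  have "\<forall>e\<in>arcs ?M. \<forall>f\<in>arcs ?M. e \<noteq> f \<longrightarrow> edge_seg N e \<inter> edge_seg N f \<subseteq> pos N ` (ends e \<inter> ends f)"
    by (intro ballI impI meet)
  moreover have "plane_drawing N" using pN by (simp add: plabic_network_def)
  ultimately have pd: "plane_drawing ?M"
    unfolding plane_drawing_def cb sm by (elim conjE) (intro conjI; assumption)
  have po: "perfect_orientation ?M"
    using pN io unfolding plabic_network_def perfect_orientation_def by simp
  have ar: "arcs ?M \<subseteq> vertices N \<times> vertices N" "\<forall>e\<in>arcs ?M. fst e \<noteq> snd e"
    using pN D unfolding aM plabic_network_def by fastforce+
  have w: "\<forall>e\<in>arcs ?M. weight ?M e > 0"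
  proof
    fix e assume that: "e \<in> arcs ?M"
    obtain u v where e: "e = (u, v)" by (cases e)
    have "(v, u) \<in> D \<or> (u, v) \<in> arcs N" using that e unfolding aM by auto
    moreover have "\<forall>e\<in>arcs N. weight N e > 0" using pN by (simp add: plabic_network_def)
    ultimately show "weight ?M e > 0" using D e unfolding reverse_arcs_def by auto
  qed
  have "plabic_network ?M"
    using pN pd po ar w unfolding plabic_network_def sm val_eq sym by (elim conjE) (intro conjI; assumption)
  moreover have "turn (edge_vec N e) l \<noteq> 0" if e: "e \<in> arcs ?M" for e
  proof -
    obtain f where f: "f \<in> arcs N" "f = e \<or> f = prod.swap e" using orig[OF e] by blast
    have "turn (edge_vec N f) l \<noteq> 0" using gN f(1) by (simp add: gauge_direction_def)
    moreover have "edge_vec N (prod.swap e) = - edge_vec N e" by (simp add: edge_vec_def)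
    ultimately show ?thesis using f(2) turn_minus_eq_0[of "edge_vec N e" l] by auto
  qed
  then have "\<forall>e\<in>arcs ?M. turn (edge_vec N e) l \<noteq> 0" by blast
  then have "gauge_direction ?M l" using gN unfolding gauge_direction_def sm
    by (elim conjE) (intro conjI; assumption)
  ultimately show ?thesis by (simp add: valid_gauged_def)
qed

text \<open>As \<open>D\<close> contains no two opposite arcs, the second reversal does not touch
  the arcs or weights changed by the first.\<close>

lemma reverse_arcs_reverse_arcs:
  assumes "drawn_network N" "D \<subseteq> arcs N" "C \<subseteq> D"
  shows "reverse_arcs (D - C) (reverse_arcs C N) = reverse_arcs D N"
proof -
  have na: "(v, u) \<notin> D" if "(u, v) \<in> D" for u v
    using no_antiparallel[OF assms(1)] assms(2) that by blast
  have a: "((arcs N - C) \<union> C\<inverse>) - (D - C) \<union> (D - C)\<inverse> = (arcs N - D) \<union> D\<inverse>"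
    using assms(2,3) na by auto
  have w: "(\<lambda>(u, v). if (v, u) \<in> D - C then 1 / weight (reverse_arcs C N) (v, u) else weight (reverse_arcs C N) (u, v)) =
    (\<lambda>(u, v). if (v, u) \<in> D then 1 / weight N (v, u) else weight N (u, v))"
    using assms(3) na by (auto simp: reverse_arcs_def fun_eq_iff)
  show ?thesis
    unfolding reverse_arcs_def[of "D - C"] w unfolding reverse_arcs_def using a by simp
qed

lemma reverse_arcs_empty: "reverse_arcs {} N = N"
  by (simp add: reverse_arcs_def)

lemma path_arcs_Cons: "p \<noteq> [] \<Longrightarrow> path_arcs (x # p) = insert (x, hd p) (path_arcs p)"
  by (cases p) (auto simp: path_arcs_def)

lemma path_arcs_append:
  "p \<noteq> [] \<Longrightarrow> q \<noteq> [] \<Longrightarrow> path_arcs (p @ q) = path_arcs p \<union> {(last p, hd q)} \<union> path_arcs q"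
  by (induction p) (auto simp: path_arcs_Cons path_arcs_def[of "[_]"])

lemma cycle_arcs_path: "q \<noteq> [] \<Longrightarrow> cycle_arcs q = insert (last q, hd q) (path_arcs q)"
proof (induction q rule: rev_induct)
  case (snoc y q)
  show ?case
  proof (cases q)
    case (Cons a r)
    have "zip (a # r @ [y]) (r @ [y] @ [a]) = zip (a # r) (r @ [y]) @ zip [y] [a]"
      using zip_append[of "a # r" "r @ [y]" "[y]" "[a]"] by simp
    moreover have "zip (a # r @ [y]) (r @ [y]) = zip (a # r) (r @ [y])"
      using zip_append1[of "a # r" "[y]" "r @ [y]"] by simp
    ultimately show ?thesis using Cons by (simp add: cycle_arcs_def path_arcs_def)
  qed (simp add: cycle_arcs_def path_arcs_def)
qed simp

lemma path_arcs_subset: "path_arcs p \<subseteq> set p \<times> set p"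
proof -
  have "set (tl p) \<subseteq> set p" by (cases p) auto
  then show ?thesis unfolding path_arcs_def using set_zip_leftD set_zip_rightD by fastforce
qed

context reversal
begin

text \<open>If \<open>D\<close> contains no cycle, a longest path in \<open>D\<close> can be
  extended at neither end, and returning to the path would close a cycle. Since \<open>D\<close>
  passes through internal vertices, both ends are on the boundary.\<close>

lemma path_or_cycle:
  assumes ne: "D \<noteq> {}"
  obtains (path) i j p where "source_sink_path N i j p" "path_arcs p \<subseteq> D" "length p \<ge> 2"
  | (cycle) q where "simple_cycle N q" "cycle_arcs q \<subseteq> D"
proof (cases "\<exists>q. q \<noteq> [] \<and> distinct q \<and> cycle_arcs q \<subseteq> D")
  case True
  then show ?thesis using cycle D by (auto simp: simple_cycle_def)
next
  case no_cycle: False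
  define P where "P p \<longleftrightarrow> distinct p \<and> length p \<ge> 2 \<and> path_arcs p \<subseteq> D" for p
  obtain x y where xy: "(x, y) \<in> D" using ne by auto
  have P0: "P [x, y]" using xy arc_vertices(3)[OF drawn(1), of "(x, y)"] D by (auto simp: P_def path_arcs_def)
  have ends_D: "v \<in> vertices N" if "v \<in> fst ` D \<union> snd ` D" for v
    using that D arc_vertices[OF drawn(1)] by blast
  have ends_p: "(hd p, hd (tl p)) \<in> D" "(last (butlast p), last p) \<in> D" if p: "P p" for p
  proof -
    obtain a b r where ab: "p = a # b # r" using p by (cases p; cases "tl p") (auto simp: P_def)
    then show "(hd p, hd (tl p)) \<in> D" using p by (simp add: P_def path_arcs_def)
    have "p = butlast p @ [last p]" "butlast p \<noteq> []" using ab by auto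
    then have "(last (butlast p), last p) \<in> path_arcs p"
      using path_arcs_append[of "butlast p" "[last p]"] by simp
    then show "(last (butlast p), last p) \<in> D" using p by (auto simp: P_def)
  qed
  have len: "length p < Suc (card (vertices N))" if p: "P p" for p
  proof -
    have "set p \<subseteq> vertices N"
    proof
      fix v assume v: "v \<in> set p"
      have "v \<noteq> last p \<or> v = last p" by simp
      then show "v \<in> vertices N"
      proof
        assume "v \<noteq> last p"
        then obtain w where "(v, w) \<in> path_arcs p" using zip_tl_last[OF v] by (auto simp: path_arcs_def)
        then show ?thesis using p ends_D by (force simp: P_def)
      next
        assume "v = last p" then show ?thesis using ends_p(2)[OF p] ends_D by force
      qed
    qed
    then have "card (set p) \<le> card (vertices N)" using finite_vertices[OF drawn(1)] by (simp add: card_mono)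
    then show ?thesis using p by (simp add: P_def distinct_card)
  qed
  \<comment> \<open>Lengths are bounded by the number of vertices, as the paths are free of
    repetitions.\<close>
  obtain p where p: "P p" and mx: "\<And>q. P q \<Longrightarrow> length q \<le> length p"
    using ex_has_greatest_nat[of P "[x, y]" length] P0 len by blast
  have pne: "p \<noteq> []" and dp: "distinct p" and pD: "path_arcs p \<subseteq> D" and lp: "length p \<ge> 2" using p by (auto simp: P_def)
  have no_out: "(last p, w) \<notin> D" for w
  proof
    assume w: "(last p, w) \<in> D"
    show False
    proof (cases "w \<in> set p")
      case True
      then obtain as bs where s: "p = as @ w # bs" by (meson split_list)
      have "path_arcs (w # bs) \<subseteq> D" using pD path_arcs_append[of as "w # bs"] s by (cases "as = []") auto
      moreover have "last (w # bs) = last p" using s by simp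
      ultimately have "cycle_arcs (w # bs) \<subseteq> D" using w by (simp add: cycle_arcs_path del: last.simps)
      then show False using no_cycle dp s by (metis distinct_append list.distinct(1))
    next
      case False
      then have "P (p @ [w])" using p w path_arcs_append[of p "[w]"] pne by (auto simp: P_def path_arcs_def[of "[_]"])
      then show False using mx by fastforce
    qed
  qed
  have no_in: "(w, hd p) \<notin> D" for w
  proof
    assume w: "(w, hd p) \<in> D"
    show False
    proof (cases "w \<in> set p")
      case True
      then obtain as bs where s: "p = (as @ [w]) @ bs" by (metis split_list append.assoc append_Cons append_Nil)
      have "path_arcs (as @ [w]) \<subseteq> D" using pD path_arcs_append[of "as @ [w]" bs] s by (cases "bs = []") auto
      moreover have "hd (as @ [w]) = hd p" using s by (cases as) auto
      ultimately have "cycle_arcs (as @ [w]) \<subseteq> D" using w cycle_arcs_path[of "as @ [w]"] by simp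
      moreover have "distinct (as @ [w])" using dp unfolding s distinct_append by simp
      ultimately show False using no_cycle by blast
    next
      case False
      then have "P (w # p)" using p w path_arcs_Cons[of p w] pne by (auto simp: P_def)
      then show False using mx by fastforce
    qed
  qed
  have internal: "(\<exists>x. (x, Internal u) \<in> D) \<longleftrightarrow> (\<exists>y. (Internal u, y) \<in> D)" if u: "u \<in> internals N" for u
  proof (cases "on_D (Internal u)")
    case True
    obtain x y where "D \<inter> in_arcs N (Internal u) = {(x, Internal u)}" "D \<inter> out_arcs N (Internal u) = {(Internal u, y)}"
      by (rule through_arcs[OF u True])
    then show ?thesis by blast
  next
    case False
    then show ?thesis using on_D_ends by blast
  qed
  obtain i where i: "hd p = Boundary i"
  proof (cases "hd p")
    case (Internal u)
    then have "u \<in> internals N" using ends_D[of "hd p"] ends_p(1)[OF p] by force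
    then show thesis using internal[of u] ends_p(1)[OF p] no_in Internal by metis
  qed (use that in blast)
  obtain j where j: "last p = Boundary j"
  proof (cases "last p")
    case (Internal u)
    then have "u \<in> internals N" using ends_D[of "last p"] ends_p(2)[OF p] by force
    then show thesis using internal[of u] ends_p(2)[OF p] no_out Internal by metis
  qed (use that in blast)
  have "i \<in> {1..bdcount N}" "j \<in> {1..bdcount N}"
    using ends_D[of "hd p"] ends_D[of "last p"] ends_p[OF p] i j by force+
  moreover have "out_arcs N (Boundary i) \<noteq> {}" "in_arcs N (Boundary j) \<noteq> {}"
    using ends_p[OF p] D i j by (auto simp: out_arcs_def in_arcs_def)
  ultimately have "source_sink_path N i j p"
    using i j pne dp pD D by (auto simp: source_sink_path_def sources_def sinks_def)
  then show ?thesis using path pD lp by blast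
qed

lemma balanced_subset:
  assumes C: "C \<subseteq> D" and u: "u \<in> internals N"
    and iff: "(\<exists>x. (x, Internal u) \<in> C) \<longleftrightarrow> (\<exists>y. (Internal u, y) \<in> C)"
  shows "card (C \<inter> in_arcs N (Internal u)) = card (C \<inter> out_arcs N (Internal u))"
proof (cases "on_D (Internal u)")
  case True
  obtain x y where xy: "D \<inter> in_arcs N (Internal u) = {(x, Internal u)}" "D \<inter> out_arcs N (Internal u) = {(Internal u, y)}"
    by (rule through_arcs[OF u True])
  have io: "(a, Internal u) \<in> C \<longleftrightarrow> (a, Internal u) \<in> C \<inter> in_arcs N (Internal u)"
    "(Internal u, a) \<in> C \<longleftrightarrow> (Internal u, a) \<in> C \<inter> out_arcs N (Internal u)" for a
    using C D by (auto simp: in_arcs_def out_arcs_def)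
  have "C \<inter> in_arcs N (Internal u) \<subseteq> {(x, Internal u)}" "C \<inter> out_arcs N (Internal u) \<subseteq> {(Internal u, y)}"
    using xy C by auto
  then have "C \<inter> in_arcs N (Internal u) = {} \<or> C \<inter> in_arcs N (Internal u) = {(x, Internal u)}"
    "C \<inter> out_arcs N (Internal u) = {} \<or> C \<inter> out_arcs N (Internal u) = {(Internal u, y)}"
    by (auto dest: subset_singletonD)
  then show ?thesis using iff unfolding io by fastforce
next
  case False
  then have "C \<inter> in_arcs N (Internal u) = {}" "C \<inter> out_arcs N (Internal u) = {}"
    using C unfolding on_D_iff by blast+
  then show ?thesis by simp
qed

lemma elementary_part:
  assumes ne: "D \<noteq> {}"
  obtains C \<zeta> where "C \<noteq> {}" "C \<subseteq> D" "elementary (N, l) \<zeta> (reverse_arcs C N, l)" "valid_gauged (reverse_arcs C N) l"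
  using ne
proof (cases rule: path_or_cycle)
  case (path i j p)
  let ?C = "path_arcs p"
  have p: "hd p = Boundary i" "last p = Boundary j" "p \<noteq> []" using path(1) by (auto simp: source_sink_path_def)
  have iff: "(\<exists>x. (x, Internal u) \<in> ?C) \<longleftrightarrow> (\<exists>y. (Internal u, y) \<in> ?C)" for u
  proof
    assume "\<exists>x. (x, Internal u) \<in> ?C"
    then have "Internal u \<in> set p" using path_arcs_subset by blast
    then show "\<exists>y. (Internal u, y) \<in> ?C" using zip_tl_last[of "Internal u" p] p by (simp add: path_arcs_def)
  next
    assume "\<exists>y. (Internal u, y) \<in> ?C"
    then have "Internal u \<in> set p" using path_arcs_subset by blast
    then show "\<exists>x. (x, Internal u) \<in> ?C" using zip_tl_hd[of "Internal u" p] p by (simp add: path_arcs_def)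
  qed
  have v: "valid_gauged (reverse_arcs ?C N) l"
  proof (rule reverse_arcs_valid[OF valid])
    show "?C \<subseteq> arcs N" using path(2) D by (rule subset_trans)
  qed (rule balanced_subset[OF path(2) _ iff])
  have "?C \<noteq> {}" using path(3) by (cases p; cases "tl p") (auto simp: path_arcs_def)
  then show ?thesis by (rule that[OF _ path(2) elementary.path_reversal[OF valid path(1) HOL.refl v] v])
next
  case (cycle q)
  let ?C = "cycle_arcs q"
  have "v \<in> set q" if "(v, w) \<in> ?C \<or> (w, v) \<in> ?C" for v w
    using that unfolding cycle_arcs_def by (metis set_rotate1 set_zip_leftD set_zip_rightD)
  then have iff: "(\<exists>x. (x, Internal u) \<in> ?C) \<longleftrightarrow> (\<exists>y. (Internal u, y) \<in> ?C)" for u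
    using cycle_arcs_through[of "Internal u" q] by blast
  have v: "valid_gauged (reverse_arcs ?C N) l"
  proof (rule reverse_arcs_valid[OF valid])
    show "?C \<subseteq> arcs N" using cycle(2) D by (rule subset_trans)
  qed (rule balanced_subset[OF cycle(2) _ iff])
  have "?C \<noteq> {}" using cycle(1) by (auto simp: simple_cycle_def cycle_arcs_path)
  then show ?thesis by (rule that[OF _ cycle(2) elementary.cycle_reversal[OF valid cycle(1) HOL.refl v] v])
qed

end

definition step :: "'v network \<times> complex \<Rightarrow> 'v network \<times> complex \<Rightarrow> bool" where
  "step S T \<longleftrightarrow> (\<exists>\<zeta>. elementary S \<zeta> T)"

text \<open>The arcs left over after one path or cycle are again a reversal between two valid
  networks, so induction on their number applies.\<close>

lemma orientation_change_steps:
  assumes "valid_gauged N l" "D \<subseteq> arcs N" "valid_gauged (reverse_arcs D N) l"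
  shows "step\<^sup>*\<^sup>* (N, l) (reverse_arcs D N, l)"
  using assms
proof (induction "card D" arbitrary: N D rule: less_induct)
  case less
  interpret reversal N l D using less.prems by unfold_locales
  show ?case
  proof (cases "D = {}")
    case True
    then show ?thesis by (simp add: reverse_arcs_empty)
  next
    case False
    obtain C \<zeta> where C: "C \<noteq> {}" "C \<subseteq> D" "elementary (N, l) \<zeta> (reverse_arcs C N, l)" "valid_gauged (reverse_arcs C N) l"
      by (rule elementary_part[OF False])
    have eq: "reverse_arcs (D - C) (reverse_arcs C N) = reverse_arcs D N"
      by (rule reverse_arcs_reverse_arcs[OF drawn(1) D C(2)])
    have "card (D - C) < card D" using C(1,2) finite_D by (intro psubset_card_mono) auto
    moreover have "D - C \<subseteq> arcs (reverse_arcs C N)" using D by (auto simp: reverse_arcs_def)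
    ultimately have "step\<^sup>*\<^sup>* (reverse_arcs C N, l) (reverse_arcs D N, l)"
      using less.hyps[of "D - C" "reverse_arcs C N"] C(4) less.prems(3) unfolding eq by blast
    moreover have "step (N, l) (reverse_arcs C N, l)" using C(3) by (auto simp: step_def)
    ultimately show ?thesis by (rule converse_rtranclp_into_rtranclp[rotated])
  qed
qed

section \<open>Decomposing a change of position into moves of single vertices\<close>

lemma affine_changes_sign:
  assumes "\<And>s. det2 l (v s) = (1 - s) * a + s * b" "a \<noteq> 0" "det2 l (v t) = 0"
  shows "changes_sign_at (\<lambda>s. turn l (v s)) t"
proof -
  have ab: "b \<noteq> a" using assms by (auto simp: algebra_simps)
  have eq: "det2 l (v s) = (s - t) * (b - a)" for s
    using assms(1)[of s] assms(1)[of t] assms(3) by (simp add: algebra_simps)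
  have lr: "\<forall>\<^sub>F s in at_left t. s < t" "\<forall>\<^sub>F s in at_right t. s > t"
    by (simp_all add: eventually_at_filter)
  define \<sigma> :: int where "\<sigma> = (if b > a then -1 else 1)"
  have "turn l (v s) = \<sigma>" if "s < t" for s
    using that ab unfolding turn_det2 eq \<sigma>_def
    by (auto simp: zero_less_mult_iff mult_less_0_iff)
  then have "\<forall>\<^sub>F s in at_left t. turn l (v s) = \<sigma>" using lr(1) by (rule eventually_mono[rotated])
  moreover have "turn l (v s) = - \<sigma>" if "s > t" for s
    using that ab unfolding turn_det2 eq \<sigma>_def
    by (auto simp: zero_less_mult_iff mult_less_0_iff)
  then have "\<forall>\<^sub>F s in at_right t. turn l (v s) = - \<sigma>" using lr(2) by (rule eventually_mono[rotated])
  moreover have "\<sigma> \<noteq> 0" by (simp add: \<sigma>_def)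
  ultimately show ?thesis unfolding changes_sign_at_def by blast
qed

text \<open>A segment whose ends move by less than \<open>\<delta>\<close> stays within
  \<open>\<delta>\<close> of its old position, so half the distance of two disjoint segments is a
  safe bound.\<close>

lemma disjoint_segments_stable:
  fixes x :: "'a \<Rightarrow> complex"
  assumes "seg (x a, x b) \<inter> seg (x c, x d) = {}"
  shows "\<forall>\<^sub>F \<delta> in at_right 0. \<forall>y. (\<forall>v. dist (y v) (x v) < \<delta>) \<longrightarrow> seg (y a, y b) \<inter> seg (y c, y d) = {}"
proof -
  have cl: "compact (seg (x a, x b))" "closed (seg (x c, x d))" by (simp_all add: seg_def)
  obtain \<rho> where \<rho>: "\<rho> > 0" "\<And>z w. z \<in> seg (x a, x b) \<Longrightarrow> w \<in> seg (x c, x d) \<Longrightarrow> \<rho> \<le> dist z w"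
    using separate_compact_closed[OF cl assms] by blast
  have near: "\<exists>w\<in>seg (x p, x q). dist z w < \<delta>"
    if y: "\<forall>v. dist (y v) (x v) < \<delta>" and z: "z \<in> seg (y p, y q)" for y \<delta> z p q
  proof -
    obtain u where u: "0 \<le> u" "u \<le> 1" "z = (1 - u) *\<^sub>R y p + u *\<^sub>R y q"
      using z by (auto simp: seg_def closed_segment_def)
    have d: "norm (y p - x p) < \<delta>" "norm (y q - x q) < \<delta>" using y by (simp_all add: dist_norm)
    have "norm ((1 - u) *\<^sub>R (y p - x p) + u *\<^sub>R (y q - x q)) \<le> (1 - u) * norm (y p - x p) + u * norm (y q - x q)"
      by (rule norm_triangle_le) (use u in simp)
    also have "\<dots> < \<delta>" by (rule convex_bound_lt[OF d]) (use u in auto)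
    finally have "dist z ((1 - u) *\<^sub>R x p + u *\<^sub>R x q) < \<delta>"
      unfolding u(3) dist_norm by (simp add: algebra_simps)
    moreover have "(1 - u) *\<^sub>R x p + u *\<^sub>R x q \<in> seg (x p, x q)"
      using u by (auto simp: seg_def closed_segment_def)
    ultimately show ?thesis by blast
  qed
  have "\<forall>\<^sub>F \<delta> in at_right (0::real). \<delta> < \<rho> / 2"
    using \<rho>(1) eventually_at_right_less[of 0] by (auto simp: eventually_at_right_field intro!: exI[of _ "\<rho> / 2"])
  then show ?thesis
  proof eventually_elim
    case (elim \<delta>)
    show ?case
    proof (intro allI impI equals0I)
      fix y z assume y: "\<forall>v. dist (y v) (x v) < \<delta>" and z: "z \<in> seg (y a, y b) \<inter> seg (y c, y d)"
      obtain w1 w2 where w: "w1 \<in> seg (x a, x b)" "dist z w1 < \<delta>" "w2 \<in> seg (x c, x d)" "dist z w2 < \<delta>"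
        using near[OF y, of z a b] near[OF y, of z c d] z by blast
      have "dist w1 w2 \<le> dist z w1 + dist z w2" by (metis dist_commute dist_triangle)
      then show False using \<rho>(2)[OF w(1,3)] w(2,4) elim by linarith
    qed
  qed
qed

text \<open>A further common point would make both segments leave \<open>v\<close> in the same
  direction, and the end of the shorter one would lie on the other.\<close>

lemma segments_from_common_end:
  fixes v :: complex
  assumes "a \<notin> closed_segment v b" "b \<notin> closed_segment v a"
  shows "closed_segment v a \<inter> closed_segment v b \<subseteq> {v}"
proof
  fix z assume "z \<in> closed_segment v a \<inter> closed_segment v b"
  then obtain s t where s: "0 \<le> s" "s \<le> 1" "z = (1 - s) *\<^sub>R v + s *\<^sub>R a"
    and t: "0 \<le> t" "t \<le> 1" "z = (1 - t) *\<^sub>R v + t *\<^sub>R b" by (auto simp: closed_segment_def)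
  have eq: "s *\<^sub>R (a - v) = t *\<^sub>R (b - v)" using s(3) t(3) by (simp add: algebra_simps)
  have in_seg: "c \<in> closed_segment v d" if "p *\<^sub>R (c - v) = q *\<^sub>R (d - v)" "0 \<le> q" "q \<le> p" "0 < p" for c d p q
  proof -
    have "c - v = (q / p) *\<^sub>R (d - v)"
      using arg_cong[OF that(1), of "\<lambda>w. (1 / p) *\<^sub>R w"] that(4) by simp
    then have "c = (1 - q / p) *\<^sub>R v + (q / p) *\<^sub>R d" by (simp add: algebra_simps)
    moreover have "0 \<le> q / p" "q / p \<le> 1" using that by simp_all
    ultimately show ?thesis by (auto simp: closed_segment_def)
  qed
  show "z \<in> {v}"
  proof (rule ccontr)
    assume "z \<notin> {v}"
    then have "s \<noteq> 0" "t \<noteq> 0" using s(3) t(3) by auto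
    then show False
      using in_seg[OF eq] in_seg[OF eq[symmetric]] s t assms by (cases "t \<le> s") auto
  qed
qed

locale positions =
  fixes N :: "'v network" and l :: complex
  assumes valid: "valid_gauged N l"
begin

abbreviation placed :: "('v vertex \<Rightarrow> complex) \<Rightarrow> 'v network" where
  "placed y \<equiv> N\<lparr>pos := y\<rparr>"

abbreviation h :: "complex \<Rightarrow> real" where "h z \<equiv> det2 z l"

definition fixed :: "('v vertex \<Rightarrow> complex) \<Rightarrow> bool" where
  "fixed y \<longleftrightarrow> (\<forall>v. v \<notin> Internal ` internals N \<longrightarrow> y v = pos N v)"

lemma plabic: "plabic_network N" and gauge: "gauge_direction N l"
  using valid by (simp_all add: valid_gauged_def)

lemma drawn: "drawn_network N" using plabic_drawn[OF plabic] .

lemma finite_internals: "finite (internals N)" using plabic by (simp add: plabic_network_def)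

lemma placed_simps [simp]:
  "center (placed y) = center N" "radius (placed y) = radius N" "bdcount (placed y) = bdcount N"
  "internals (placed y) = internals N" "white (placed y) = white N" "arcs (placed y) = arcs N"
  "weight (placed y) = weight N" "pos (placed y) = y"
  "vertices (placed y) = vertices N" "disc (placed y) = disc N"
  "in_arcs (placed y) = in_arcs N" "out_arcs (placed y) = out_arcs N"
  "valency (placed y) = valency N" "perfect_orientation (placed y) = perfect_orientation N"
  "sources (placed y) = sources N"
  by (simp_all add: vertices_def disc_def in_arcs_def[abs_def] out_arcs_def[abs_def] valency_def[abs_def]
      perfect_orientation_def sources_def)

lemma fixed_boundary: "fixed y \<Longrightarrow> y (Boundary j) = bpos N j"
  by (auto simp: fixed_def)

lemma placed_drawn: "plane_drawing (placed y) \<Longrightarrow> drawn_network (placed y)"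
  using drawn by (simp add: drawn_network_def)

text \<open>Apart from planarity, validity is a finite list of inequalities between horizontal
  coordinates \<open>h\<close>, so it can be achieved by avoiding finitely many values.\<close>

lemma valid_placed:
  assumes "fixed y"
  shows "valid_gauged (placed y) l \<longleftrightarrow> plane_drawing (placed y) \<and>
    (\<forall>e\<in>arcs N. h (y (fst e)) \<noteq> h (y (snd e))) \<and>
    (\<forall>u\<in>internals N. \<forall>j\<in>{1..bdcount N}. h (y (Internal u)) \<noteq> h (bpos N j))" (is "?L \<longleftrightarrow> ?R")
proof
  assume L: ?L
  then have g: "gauge_direction (placed y) l" and pd: "plane_drawing (placed y)"
    by (simp_all add: valid_gauged_def plabic_network_def)
  have "h (y (fst e)) \<noteq> h (y (snd e))" if "e \<in> arcs N" for e
    using edge_vec_ne[OF g, of e] that by (simp add: edge_vec_def det2_linear)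
  moreover have "h (y (Internal u)) \<noteq> h (bpos N j)" if "u \<in> internals N" "j \<in> {1..bdcount N}" for u j
    using vertex_det2_ne[OF placed_drawn[OF pd] g, of j "Internal u"] that fixed_boundary[OF assms] by simp
  ultimately show ?R using pd by blast
next
  assume R: ?R
  have "plabic_network (placed y)" using plabic R by (simp add: plabic_network_def)
  moreover have "turn (edge_vec (placed y) e) l \<noteq> 0" if "e \<in> arcs N" for e
    using R that by (auto simp: edge_vec_def det2_linear turn_det2)
  moreover have "y (Internal u) \<notin> ray (bpos N j) l" if "u \<in> internals N" "j \<in> {1..bdcount N}" for u j
  proof
    assume "y (Internal u) \<in> ray (bpos N j) l"
    then have "h (y (Internal u)) = h (bpos N j)" by (auto simp: ray_def det2_linear)
    then show False using R that by blast
  qed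
  ultimately show ?L
    using gauge by (simp add: valid_gauged_def gauge_direction_def fixed_boundary[OF assms])
qed

definition near :: "('v vertex \<Rightarrow> complex) \<Rightarrow> real \<Rightarrow> ('v vertex \<Rightarrow> complex) \<Rightarrow> bool" where
  "near x \<delta> y \<longleftrightarrow> fixed y \<and> (\<forall>u\<in>internals N. dist (y (Internal u)) (x (Internal u)) < \<delta>)"

lemma near_dist:
  assumes "fixed x" "near x \<delta> y" "\<delta> > 0" shows "dist (y v) (x v) < \<delta>"
  using assms by (cases "v \<in> Internal ` internals N") (auto simp: near_def fixed_def)

text \<open>Planarity reduced to disjointness of pairs of segments, points included, which is stable
  under small motions. For adjacent edges no condition of their own is needed: if neither contains
  the far end of the other, they meet only in the common end.\<close>

lemma plane_drawing_placedI:
  assumes fx: "fixed y"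
    and disc: "\<And>u. u \<in> internals N \<Longrightarrow> y (Internal u) \<in> disc N"
    and inj: "\<And>v w. v \<in> vertices N \<Longrightarrow> w \<in> vertices N \<Longrightarrow> v \<noteq> w \<Longrightarrow> y v \<noteq> y w"
    and vertex: "\<And>v e. v \<in> vertices N \<Longrightarrow> e \<in> arcs N \<Longrightarrow> v \<notin> ends e \<Longrightarrow> (\<exists>f\<in>arcs N. v \<in> ends f) \<Longrightarrow>
      y v \<notin> closed_segment (y (fst e)) (y (snd e))"
    and edge: "\<And>e f. e \<in> arcs N \<Longrightarrow> f \<in> arcs N \<Longrightarrow> ends e \<inter> ends f = {} \<Longrightarrow>
      closed_segment (y (fst e)) (y (snd e)) \<inter> closed_segment (y (fst f)) (y (snd f)) = {}"
  shows "plane_drawing (placed y)"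
proof -
  let ?s = "\<lambda>e. closed_segment (y (fst e)) (y (snd e))"
  have meet: "?s e \<inter> ?s f \<subseteq> y ` (ends e \<inter> ends f)" if e: "e \<in> arcs N" and f: "f \<in> arcs N" and ne: "e \<noteq> f" for e f
  proof (cases "ends e \<inter> ends f = {}")
    case True
    then show ?thesis using edge[OF e f] by blast
  next
    case False
    then obtain v where v: "v \<in> ends e" "v \<in> ends f" by blast
    have other: "\<exists>a. ends g = {v, a} \<and> a \<noteq> v \<and> ?s g = closed_segment (y v) (y a) \<and> a \<in> vertices N"
      if "g \<in> arcs N" "v \<in> ends g" for g
      using that arc_vertices[OF drawn that(1)] by (cases g) (force simp: ends_def closed_segment_commute)
    obtain a where a: "ends e = {v, a}" "a \<noteq> v" "?s e = closed_segment (y v) (y a)" "a \<in> vertices N" using other[OF e v(1)] by blast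
    obtain b where b: "ends f = {v, b}" "b \<noteq> v" "?s f = closed_segment (y v) (y b)" "b \<in> vertices N" using other[OF f v(2)] by blast
    have "a \<noteq> b" using arc_eqI[OF drawn e f] ne a(1) b(1) by metis
    then have "y a \<notin> ?s f" "y b \<notin> ?s e"
      using vertex[OF a(4) f] vertex[OF b(4) e] e f a b by blast+
    then have "?s e \<inter> ?s f \<subseteq> {y v}" unfolding a(3) b(3) by (rule segments_from_common_end)
    then show ?thesis using v by blast
  qed
  have pN: "plane_drawing N" using plabic by (simp add: plabic_network_def)
  have "clockwise_boundary (placed y) = clockwise_boundary N"
    by (simp add: clockwise_boundary_def fixed_boundary[OF fx])
  moreover have "inj_on y (vertices N)" using inj by (meson inj_onI)
  ultimately show ?thesis
    using pN disc meet by (simp add: plane_drawing_def edge_seg_def)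
qed

lemma plane_drawing_stable:
  assumes fx: "fixed x" and pd: "plane_drawing (placed x)"
  shows "\<exists>\<delta>>0. \<forall>y. near x \<delta> y \<longrightarrow> plane_drawing (placed y)"
proof -
  note dx = placed_drawn[OF pd]
  define P where "P a b c d \<delta> \<longleftrightarrow> (\<forall>y. (\<forall>v. dist (y v) (x v) < \<delta>) \<longrightarrow>
    closed_segment (y a) (y b) \<inter> closed_segment (y c) (y d) = {})" for a b c d :: "'v vertex" and \<delta>
  have P: "\<forall>\<^sub>F \<delta> in at_right 0. P a b c d \<delta>" if "closed_segment (x a) (x b) \<inter> closed_segment (x c) (x d) = {}" for a b c d
    using disjoint_segments_stable[of x a b c d] that unfolding seg_def P_def by simp
  have xmeet: "closed_segment (x (fst e)) (x (snd e)) \<inter> closed_segment (x (fst f)) (x (snd f)) \<subseteq> x ` (ends e \<inter> ends f)"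
    if "e \<in> arcs N" "f \<in> arcs N" "e \<noteq> f" for e f
    using edges_meet[OF dx, of e f] that by (simp add: edge_seg_def)
  have fV: "finite (vertices N)" and fA: "finite (arcs N)" using finite_vertices[OF drawn] finite_arcs[OF drawn] .
  have disc: "\<forall>\<^sub>F \<delta> in at_right 0. \<forall>u\<in>internals N. ball (x (Internal u)) \<delta> \<subseteq> disc N"
  proof (rule eventually_ball_finite[OF finite_internals], intro ballI)
    fix u assume "u \<in> internals N"
    then have "x (Internal u) \<in> disc N" using pd by (simp add: plane_drawing_def)
    moreover have "open (disc N)" by (simp add: disc_def)
    ultimately obtain \<epsilon> where "\<epsilon> > 0" "ball (x (Internal u)) \<epsilon> \<subseteq> disc N" using openE by blast
    then show "\<forall>\<^sub>F \<delta> in at_right 0. ball (x (Internal u)) \<delta> \<subseteq> disc N"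
      unfolding eventually_at_right_field by (intro exI[of _ \<epsilon>]) (auto simp: subset_iff)
  qed
  \<comment> \<open>A point is written as a degenerate segment, so \<open>P\<close> also covers
    distinctness of vertices and, below, vertices off edges.\<close>
  have inj: "\<forall>\<^sub>F \<delta> in at_right 0. \<forall>v\<in>vertices N. \<forall>w\<in>vertices N. v \<noteq> w \<longrightarrow> P v v w w \<delta>"
  proof (intro eventually_ball_finite[OF fV] ballI)
    fix v w assume "v \<in> vertices N" "w \<in> vertices N"
    then show "\<forall>\<^sub>F \<delta> in at_right 0. v \<noteq> w \<longrightarrow> P v v w w \<delta>"
      using P[of v v w w] pos_eq_iff[OF dx, of v w] by (cases "v = w") simp_all
  qed
  have vertex: "\<forall>\<^sub>F \<delta> in at_right 0. \<forall>v\<in>vertices N. \<forall>e\<in>arcs N.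
      v \<notin> ends e \<and> (\<exists>f\<in>arcs N. v \<in> ends f) \<longrightarrow> P v v (fst e) (snd e) \<delta>"
  proof (intro eventually_ball_finite[OF fV] eventually_ball_finite[OF fA] ballI)
    fix v e assume v: "v \<in> vertices N" and e: "e \<in> arcs N"
    show "\<forall>\<^sub>F \<delta> in at_right 0. v \<notin> ends e \<and> (\<exists>f\<in>arcs N. v \<in> ends f) \<longrightarrow> P v v (fst e) (snd e) \<delta>"
    proof (cases "v \<notin> ends e \<and> (\<exists>f\<in>arcs N. v \<in> ends f)")
      case True
      then obtain f where f: "f \<in> arcs N" "v \<in> ends f" and ve: "v \<notin> ends e" by blast
      have "x v \<notin> closed_segment (x (fst e)) (x (snd e))"
      proof
        assume xe: "x v \<in> closed_segment (x (fst e)) (x (snd e))"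
        have "x v \<in> closed_segment (x (fst f)) (x (snd f))" using f(2) by (auto simp: ends_def)
        then have "x v \<in> x ` (ends f \<inter> ends e)" using xmeet[OF f(1) e] f(2) ve xe by blast
        then obtain w where w: "w \<in> ends e" "x v = x w" by blast
        then have "w \<in> vertices N" using arc_vertices[OF drawn e] by (auto simp: ends_def)
        then show False using pos_eq_iff[OF dx, of v w] v w ve by auto
      qed
      then show ?thesis using P[of v v "fst e" "snd e"] by (auto elim: eventually_mono)
    qed auto
  qed
  have edge: "\<forall>\<^sub>F \<delta> in at_right 0. \<forall>e\<in>arcs N. \<forall>f\<in>arcs N. ends e \<inter> ends f = {} \<longrightarrow> P (fst e) (snd e) (fst f) (snd f) \<delta>"
  proof (intro eventually_ball_finite[OF fA] ballI)
    fix e f assume e: "e \<in> arcs N" and f: "f \<in> arcs N"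
    show "\<forall>\<^sub>F \<delta> in at_right 0. ends e \<inter> ends f = {} \<longrightarrow> P (fst e) (snd e) (fst f) (snd f) \<delta>"
    proof (cases "ends e \<inter> ends f = {}")
      case True
      then have "e \<noteq> f" by (auto simp: ends_def)
      then have "closed_segment (x (fst e)) (x (snd e)) \<inter> closed_segment (x (fst f)) (x (snd f)) = {}"
        using xmeet[OF e f] True by auto
      then show ?thesis using P by (auto elim: eventually_mono)
    qed simp
  qed
  have "\<forall>\<^sub>F \<delta> in at_right (0::real). \<delta> > 0" by (simp add: eventually_at_filter)
  then have "\<forall>\<^sub>F \<delta> in at_right 0. \<delta> > 0 \<and> (\<forall>y. near x \<delta> y \<longrightarrow> plane_drawing (placed y))"
    using disc inj vertex edge
  proof eventually_elim
    case (elim \<delta>)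
    have "plane_drawing (placed y)" if y: "near x \<delta> y" for y
    proof (rule plane_drawing_placedI)
      have yd: "\<forall>v. dist (y v) (x v) < \<delta>" using near_dist[OF fx y elim(1)] by blast
      show "fixed y" using y by (simp add: near_def)
      show "y (Internal u) \<in> disc N" if "u \<in> internals N" for u
        using elim(2) that yd by (auto simp: subset_iff dist_commute)
      show "y v \<noteq> y w" if "v \<in> vertices N" "w \<in> vertices N" "v \<noteq> w" for v w
        using elim(3) that yd unfolding P_def by fastforce
      show "y v \<notin> closed_segment (y (fst e)) (y (snd e))"
        if "v \<in> vertices N" "e \<in> arcs N" "v \<notin> ends e" "\<exists>f\<in>arcs N. v \<in> ends f" for v e
      proof -
        have "P v v (fst e) (snd e) \<delta>" using elim(4) that by blast
        then show ?thesis using yd unfolding P_def by simp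
      qed
      show "closed_segment (y (fst e)) (y (snd e)) \<inter> closed_segment (y (fst f)) (y (snd f)) = {}"
        if "e \<in> arcs N" "f \<in> arcs N" "ends e \<inter> ends f = {}" for e f
      proof -
        have "P (fst e) (snd e) (fst f) (snd f) \<delta>" using elim(5) that by blast
        then show ?thesis using yd unfolding P_def by simp
      qed
    qed
    then show ?case using elim(1) by blast
  qed
  then show ?thesis using eventually_happens'[OF trivial_limit_at_right_real] by blast
qed

end

context positions
begin

lemma near_mono: "near x \<delta> y \<Longrightarrow> \<delta> \<le> \<delta>' \<Longrightarrow> near x \<delta>' y"
  unfolding near_def by (meson less_le_trans)

lemma near_fixed: "near x \<delta> y \<Longrightarrow> fixed y"
  by (simp add: near_def)

lemma near_update:
  assumes "near x \<delta> y" "u \<in> internals N" "dist z (x (Internal u)) < \<delta>"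
  shows "near x \<delta> (y(Internal u := z))"
  using assms by (auto simp: near_def fixed_def)

lemma move_placed: "move (placed y) u z = placed (y(Internal u := z))"
  by (simp add: move_def)

text \<open>The vertex moves along a segment, which stays in a ball of good positions. All
  horizontal coordinates are then affine in time and start nonzero, so alignments and ray crossings
  are genuine sign changes.\<close>

lemma single_move:
  assumes plane: "\<And>y. near x \<delta> y \<Longrightarrow> plane_drawing (placed y)"
    and y: "near x \<delta> y" and u: "u \<in> internals N" and z: "dist z (x (Internal u)) < \<delta>"
    and val: "valid_gauged (placed y) l" "valid_gauged (placed (y(Internal u := z))) l"
  shows "step (placed y, l) (placed (y(Internal u := z)), l)"
proof -
  define p where "p t = of_real (1 - t) * y (Internal u) + of_real t * z" for t :: real
  have mr: "det2 l (w * of_real r) = r * det2 l w" for w and r :: real by (simp add: det2_def algebra_simps)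
  have p01: "p 0 = y (Internal u)" "p 1 = z" by (simp_all add: p_def)
  have fy: "fixed y" and fz: "fixed (y(Internal u := z))" using near_fixed near_update y u z by blast+
  have pd: "plane_drawing (placed (y(Internal u := p t)))" if t: "t \<in> {0..1}" for t
  proof (rule plane, rule near_update[OF y u])
    have "y (Internal u) \<in> ball (x (Internal u)) \<delta>" "z \<in> ball (x (Internal u)) \<delta>"
      using y u z by (auto simp: near_def dist_commute)
    then have "(1 - t) *\<^sub>R y (Internal u) + t *\<^sub>R z \<in> ball (x (Internal u)) \<delta>"
      by (rule convexD[OF convex_ball]) (use t in auto)
    then show "dist (p t) (x (Internal u)) < \<delta>" by (simp add: p_def scaleR_conv_of_real dist_commute)
  qed
  have ne: "det2 l (edge_vec (placed y) e) \<noteq> 0" if "e \<in> arcs N" for e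
    using valid_placed[OF fy] val(1) that by (auto simp: edge_vec_def det2_linear det2_commute[of l])
  have nb: "det2 l (y (Internal u) - bpos N j) \<noteq> 0" if "j \<in> {1..bdcount N}" for j
  proof -
    have "h (y (Internal u)) \<noteq> h (bpos N j)" using valid_placed[OF fy] val(1) u that by blast
    then show ?thesis by (simp add: det2_linear det2_commute[of l])
  qed
  have "vertex_motion (placed y) l u p"
    unfolding vertex_motion_def move_placed
  proof (intro conjI ballI impI)
    show "continuous_on {0..1} p" unfolding p_def by (intro continuous_intros)
    fix t :: real assume "t \<in> {0..1}"
    show "plane_drawing (placed (y(Internal u := p t)))" using pd[OF \<open>t \<in> {0..1}\<close>] .
  next
    fix t e assume e: "e \<in> arcs (placed y)" and a: "Internal u \<in> ends e \<and> aligned (edge_vec (placed (y(Internal u := p t))) e) l"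
    show "changes_sign_at (\<lambda>s. turn l (edge_vec (placed (y(Internal u := p s))) e)) t"
    proof (rule affine_changes_sign)
      show "det2 l (edge_vec (placed (y(Internal u := p s))) e) =
          (1 - s) * det2 l (edge_vec (placed y) e) + s * det2 l (edge_vec (placed (y(Internal u := z))) e)" for s
        by (cases e) (auto simp: edge_vec_def p_def det2_linear algebra_simps mr)
      show "det2 l (edge_vec (placed y) e) \<noteq> 0" using ne e by simp
      show "det2 l (edge_vec (placed (y(Internal u := p t))) e) = 0"
        using a by (auto simp: aligned_def det2_linear)
    qed
  next
    fix t j assume j: "j \<in> sources (placed y)" and r: "p t \<in> ray (bpos (placed y) j) l"
    have b: "y (Boundary j) = bpos N j" using fixed_boundary[OF fy] .
    show "changes_sign_at (\<lambda>s. turn l (p s - bpos (placed y) j)) t"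
    proof (rule affine_changes_sign)
      show "det2 l (p s - bpos (placed y) j) =
          (1 - s) * det2 l (y (Internal u) - bpos N j) + s * det2 l (z - bpos N j)" for s
        by (simp add: b p_def det2_linear algebra_simps mr)
      show "det2 l (y (Internal u) - bpos N j) \<noteq> 0" using nb j by (auto simp: sources_def)
      show "det2 l (p t - bpos (placed y) j) = 0" using r by (auto simp: ray_def det2_linear)
    qed
  qed (use u p01 in simp_all)
  from elementary.vertex_move[OF val(1) this] show ?thesis
    using val(2) unfolding move_placed p01 step_def by blast
qed

text \<open>The intermediate placement where the vertices in \<open>S\<close> have already been
  moved from \<open>a\<close> to \<open>c\<close>.\<close>

definition mix :: "('v vertex \<Rightarrow> complex) \<Rightarrow> ('v vertex \<Rightarrow> complex) \<Rightarrow> 'v set \<Rightarrow> 'v vertex \<Rightarrow> complex" where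
  "mix a c S w = (if w \<in> Internal ` S then c w else a w)"

text \<open>An edge of an intermediate placement may join an old position to a new one. The last
  assumption prevents it from being vertical.\<close>

lemma successive_moves:
  assumes plane: "\<And>y. near x \<delta> y \<Longrightarrow> plane_drawing (placed y)"
    and near: "near x \<delta> a" "near x \<delta> c"
    and val: "valid_gauged (placed a) l" "valid_gauged (placed c) l"
    and ne: "\<And>u v. u \<in> internals N \<Longrightarrow> v \<in> internals N \<Longrightarrow> u \<noteq> v \<Longrightarrow> h (a (Internal u)) \<noteq> h (c (Internal v))"
  shows "step\<^sup>*\<^sup>* (placed a, l) (placed c, l)"
proof -
  have fa: "fixed a" and fc: "fixed c" using near near_fixed by blast+
  have nm: "near x \<delta> (mix a c S)" if "S \<subseteq> internals N" for S
    using near that by (auto simp: near_def fixed_def mix_def)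
  have va: "valid_gauged (placed (mix a c S)) l" if S: "S \<subseteq> internals N" for S
  proof (subst valid_placed[OF near_fixed[OF nm[OF S]]], intro conjI ballI)
    show "plane_drawing (placed (mix a c S))" using plane nm[OF S] .
    have bd: "h (mix a c S (Internal u)) \<noteq> h (bpos N j)" if "u \<in> internals N" "j \<in> {1..bdcount N}" for u j
      using val that valid_placed[OF fa] valid_placed[OF fc] by (auto simp: mix_def)
    then show "h (mix a c S (Internal u)) \<noteq> h (bpos N j)" if "u \<in> internals N" "j \<in> {1..bdcount N}" for u j
      using that by blast
    have mb: "mix a c S (Boundary j) = bpos N j" for j
      using fixed_boundary[OF fa] by (auto simp: mix_def)
    fix e assume e: "e \<in> arcs N"
    obtain v w where vw: "e = (v, w)" by (cases e)
    have V: "v \<in> vertices N" "w \<in> vertices N" "v \<noteq> w" using arc_vertices[OF drawn e] vw by auto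
    have ea: "h (a v) \<noteq> h (a w)" "h (c v) \<noteq> h (c w)"
      using val valid_placed[OF fa] valid_placed[OF fc] e vw by auto
    show "h (mix a c S (fst e)) \<noteq> h (mix a c S (snd e))"
    proof (cases v)
      case (Boundary i)
      then show ?thesis
        using bd mb V ea vw fixed_boundary[OF fa] by (cases w) (auto simp: mb dest: bd[symmetric])
    next
      case (Internal s)
      then show ?thesis
      proof (cases w)
        case (Boundary j)
        then show ?thesis using bd[of s j] V vw Internal by (simp add: mb)
      next
        case I: (Internal t)
        have "s \<in> internals N" "t \<in> internals N" "s \<noteq> t" using V Internal I by auto
        then show ?thesis using ea ne[of s t] ne[of t s] Internal I vw by (auto simp: mix_def)
      qed
    qed
  qed
  have reach: "step\<^sup>*\<^sup>* (placed a, l) (placed (mix a c S), l)" if "S \<subseteq> internals N" for S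
    using finite_subset[OF that finite_internals] that
  proof (induction S rule: finite_induct)
    case empty
    have "mix a c {} = a" by (simp add: mix_def fun_eq_iff)
    then show ?case by simp
  next
    case (insert u S)
    have upd: "mix a c (insert u S) = (mix a c S)(Internal u := c (Internal u))"
      by (auto simp: mix_def fun_eq_iff)
    have u: "u \<in> internals N" and S: "S \<subseteq> internals N" using insert.prems by auto
    have "step (placed (mix a c S), l) (placed (mix a c (insert u S)), l)"
      unfolding upd
    proof (rule single_move[OF plane nm[OF S] u])
      show "dist (c (Internal u)) (x (Internal u)) < \<delta>" using near(2) u by (simp add: near_def)
      show "valid_gauged (placed (mix a c S)) l" using va[OF S] .
      show "valid_gauged (placed ((mix a c S)(Internal u := c (Internal u)))) l"
        using va[OF insert.prems] unfolding upd .
    qed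
    then show ?case using insert.IH[OF S] by simp
  qed
  have "mix a c (internals N) = c"
    using fa fc by (auto simp: mix_def fun_eq_iff fixed_def)
  then show ?thesis using reach[of "internals N"] by simp
qed

text \<open>Small shifts of \<open>w\<close> in the direction \<open>\<i> * l\<close> give
  infinitely many horizontal coordinates.\<close>

lemma avoid_heights:
  assumes "finite B" "\<delta> > 0" shows "\<exists>z. dist z w < \<delta> \<and> h z \<notin> B"
proof -
  have l: "l \<noteq> 0" using gauge by (simp add: gauge_direction_def)
  define f where "f \<epsilon> = w + of_real \<epsilon> * (\<i> * l)" for \<epsilon> :: real
  have "det2 (\<i> * l) l = - (cmod l)\<^sup>2" unfolding cmod_power2 by (simp add: det2_def power2_eq_square)
  then have il: "det2 (\<i> * l) l \<noteq> 0" using l by simp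
  have "inj (\<lambda>\<epsilon>. h (f \<epsilon>))" by (rule injI) (use il in \<open>simp add: f_def det2_linear\<close>)
  moreover have "infinite {0<..<\<delta> / cmod l}" using assms(2) l by (simp add: infinite_Ioo)
  ultimately have "infinite ((\<lambda>\<epsilon>. h (f \<epsilon>)) ` {0<..<\<delta> / cmod l})"
    by (meson finite_imageD inj_on_subset subset_UNIV)
  then have "\<not> (\<lambda>\<epsilon>. h (f \<epsilon>)) ` {0<..<\<delta> / cmod l} \<subseteq> B" using assms(1) by (meson finite_subset)
  then obtain \<epsilon> where \<epsilon>: "\<epsilon> \<in> {0<..<\<delta> / cmod l}" "h (f \<epsilon>) \<notin> B" by blast
  have "dist (f \<epsilon>) w < \<delta>" using \<epsilon>(1) l by (simp add: f_def dist_norm norm_mult pos_less_divide_eq)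
  then show ?thesis using \<epsilon>(2) by blast
qed

lemma generic_placement:
  assumes fx: "fixed x" and B: "finite B" and \<delta>: "\<delta> > 0"
  shows "\<exists>q. near x \<delta> q \<and> (\<forall>u\<in>internals N. h (q (Internal u)) \<notin> B) \<and> inj_on (\<lambda>u. h (q (Internal u))) (internals N)"
proof -
  have "\<exists>q. near x \<delta> q \<and> (\<forall>u\<in>U. h (q (Internal u)) \<notin> B) \<and> inj_on (\<lambda>u. h (q (Internal u))) U"
    if "U \<subseteq> internals N" for U
    using finite_subset[OF that finite_internals] that
  proof (induction U rule: finite_induct)
    case empty
    have "near x \<delta> x" using fx \<delta> by (simp add: near_def)
    then show ?case by auto
  next
    case (insert u U)
    then obtain q where q: "near x \<delta> q" "\<forall>u\<in>U. h (q (Internal u)) \<notin> B" "inj_on (\<lambda>u. h (q (Internal u))) U"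
      by blast
    obtain z where z: "dist z (x (Internal u)) < \<delta>" "h z \<notin> B \<union> (\<lambda>u. h (q (Internal u))) ` U"
      using avoid_heights[of "B \<union> (\<lambda>u. h (q (Internal u))) ` U" \<delta>] B insert.hyps(1) \<delta> by blast
    have eq: "(q(Internal u := z)) (Internal v) = q (Internal v)" if "v \<in> U" for v
      using that insert.hyps(2) by auto
    have "inj_on (\<lambda>v. h ((q(Internal u := z)) (Internal v))) (insert u U)"
    proof (subst inj_on_insert, intro conjI)
      show "inj_on (\<lambda>v. h ((q(Internal u := z)) (Internal v))) U"
        using q(3) eq by (simp add: inj_on_def)
      show "h ((q(Internal u := z)) (Internal u)) \<notin> (\<lambda>v. h ((q(Internal u := z)) (Internal v))) ` (U - {u})"
        using z(2) by (auto simp: image_iff)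
    qed
    moreover have "near x \<delta> (q(Internal u := z))" using near_update[OF q(1)] z(1) insert.prems by blast
    moreover have "\<forall>v\<in>insert u U. h ((q(Internal u := z)) (Internal v)) \<notin> B" using q(2) z(2) by simp
    ultimately show ?case by blast
  qed
  then show ?thesis by blast
qed

lemma generic_valid:
  assumes "fixed q" "plane_drawing (placed q)"
    and "\<And>u j. u \<in> internals N \<Longrightarrow> j \<in> {1..bdcount N} \<Longrightarrow> h (q (Internal u)) \<noteq> h (bpos N j)"
    and "inj_on (\<lambda>u. h (q (Internal u))) (internals N)"
  shows "valid_gauged (placed q) l"
proof (subst valid_placed[OF assms(1)], intro conjI ballI)
  fix e assume e: "e \<in> arcs N"
  obtain v w where vw: "e = (v, w)" by (cases e)
  have V: "v \<in> vertices N" "w \<in> vertices N" "v \<noteq> w" using arc_vertices[OF drawn e] vw by auto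
  have ea: "h (pos N v) \<noteq> h (pos N w)" using edge_vec_ne[OF gauge e] vw by (simp add: edge_vec_def det2_linear)
  show "h (q (fst e)) \<noteq> h (q (snd e))"
  proof (cases v)
    case (Boundary i)
    then show ?thesis
    proof (cases w)
      case (Internal t)
      then show ?thesis using assms(3)[of t i] V vw Boundary by (simp add: fixed_boundary[OF assms(1)])
    qed (use ea vw Boundary in \<open>simp add: fixed_boundary[OF assms(1)]\<close>)
  next
    case (Internal s)
    then show ?thesis
    proof (cases w)
      case (Boundary j)
      then show ?thesis using assms(3)[of s j] V vw Internal by (simp add: fixed_boundary[OF assms(1)])
    next
      case I: (Internal t)
      then show ?thesis using inj_onD[OF assms(4), of s t] V vw Internal by auto
    qed
  qed
qed (use assms in auto)

text \<open>Moving the vertices from \<open>a\<close> to \<open>b\<close> one by one could make an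
  edge vertical on the way. A placement \<open>q\<close> whose horizontal coordinates avoid those of
  both \<open>a\<close> and \<open>b\<close> makes each half safe.\<close>

lemma local_steps:
  assumes fx: "fixed x" and \<delta>: "\<delta> > 0" and plane: "\<And>y. near x \<delta> y \<Longrightarrow> plane_drawing (placed y)"
    and near: "near x \<delta> a" "near x \<delta> b"
    and val: "valid_gauged (placed a) l" "valid_gauged (placed b) l"
  shows "step\<^sup>*\<^sup>* (placed a, l) (placed b, l)"
proof -
  define B where "B = (\<lambda>u. h (a (Internal u))) ` internals N \<union> (\<lambda>u. h (b (Internal u))) ` internals N \<union>
    (\<lambda>j. h (bpos N j)) ` {1..bdcount N}"
  have "finite B" using finite_internals by (simp add: B_def)
  then obtain q where q: "near x \<delta> q" "\<forall>u\<in>internals N. h (q (Internal u)) \<notin> B"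
    "inj_on (\<lambda>u. h (q (Internal u))) (internals N)"
    using generic_placement[OF fx _ \<delta>] by blast
  have avoid: "h (q (Internal u)) \<noteq> h (a (Internal v))" "h (q (Internal u)) \<noteq> h (b (Internal v))"
    if "u \<in> internals N" "v \<in> internals N" for u v
    using q(2) that unfolding B_def by blast+
  have vq: "valid_gauged (placed q) l"
  proof (rule generic_valid[OF near_fixed[OF q(1)] plane[OF q(1)] _ q(3)])
    show "h (q (Internal u)) \<noteq> h (bpos N j)" if "u \<in> internals N" "j \<in> {1..bdcount N}" for u j
      using q(2) that unfolding B_def by blast
  qed
  have "step\<^sup>*\<^sup>* (placed a, l) (placed q, l)"
  proof (rule successive_moves[OF plane near(1) q(1) val(1) vq])
    show "h (a (Internal u)) \<noteq> h (q (Internal v))" if "u \<in> internals N" "v \<in> internals N" for u v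
      using avoid(1)[OF that(2,1)] by simp
  qed
  moreover have "step\<^sup>*\<^sup>* (placed q, l) (placed b, l)"
    by (rule successive_moves[OF plane q(1) near(2) vq val(2) avoid(2)])
  ultimately show ?thesis by (rule rtranclp_trans)
qed

lemma valid_dense:
  assumes fx: "fixed x" and pd: "plane_drawing (placed x)" and \<delta>: "\<delta> > 0"
  obtains q where "near x \<delta> q" "valid_gauged (placed q) l"
proof -
  obtain \<delta>' where d: "\<delta>' > 0" "\<And>y. near x \<delta>' y \<Longrightarrow> plane_drawing (placed y)"
    using plane_drawing_stable[OF fx pd] by blast
  obtain q where q: "near x (min \<delta> \<delta>') q" "\<forall>u\<in>internals N. h (q (Internal u)) \<notin> (\<lambda>j. h (bpos N j)) ` {1..bdcount N}"
    "inj_on (\<lambda>u. h (q (Internal u))) (internals N)"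
    using generic_placement[OF fx, of "(\<lambda>j. h (bpos N j)) ` {1..bdcount N}" "min \<delta> \<delta>'"] \<delta> d(1) by auto
  have n: "near x \<delta> q" "near x \<delta>' q" using near_mono[OF q(1)] by simp_all
  have "valid_gauged (placed q) l"
    by (rule generic_valid[OF near_fixed[OF n(1)] d(2)[OF n(2)] _ q(3)]) (use q(2) in blast)
  then show thesis using that n(1) by blast
qed

text \<open>Bisection of the time interval. On short pieces all placements involved are close to one
  plane drawing and \<open>local_steps\<close> applies.\<close>

lemma continuous_change_steps:
  fixes p :: "real \<Rightarrow> 'v vertex \<Rightarrow> complex"
  assumes p0: "p 0 = pos N" and cont: "\<And>v. continuous_on {0..1} (\<lambda>t. p t v)"
    and fx: "\<And>t. t \<in> {0..1} \<Longrightarrow> fixed (p t)" and pd: "\<And>t. t \<in> {0..1} \<Longrightarrow> plane_drawing (placed (p t))"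
    and val: "valid_gauged (placed (p 1)) l"
  shows "step\<^sup>*\<^sup>* (N, l) (placed (p 1), l)"
proof -
  define P where "P s t \<longleftrightarrow> (0 \<le> s \<and> t \<le> 1 \<longrightarrow> (\<exists>\<eta>>0. \<forall>a b. near (p s) \<eta> a \<and> near (p t) \<eta> b \<and>
    valid_gauged (placed a) l \<and> valid_gauged (placed b) l \<longrightarrow> step\<^sup>*\<^sup>* (placed a, l) (placed b, l)))" for s t
  \<comment> \<open>The small \<open>\<eta>\<close> in \<open>P\<close> is needed because \<open>p s\<close> itself need not be in general position.\<close>
  have "P 0 1"
  proof (rule Bolzano)
    fix r s t assume rs: "P r s" and st: "P s t" and le: "r \<le> s" "s \<le> t"
    show "P r t"
      unfolding P_def
    proof (intro impI)
      assume rt: "0 \<le> r \<and> t \<le> 1"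
      then have s: "s \<in> {0..1}" using le by auto
      obtain \<eta>1 where 1: "\<eta>1 > 0" "\<And>a b. near (p r) \<eta>1 a \<Longrightarrow> near (p s) \<eta>1 b \<Longrightarrow> valid_gauged (placed a) l \<Longrightarrow>
          valid_gauged (placed b) l \<Longrightarrow> step\<^sup>*\<^sup>* (placed a, l) (placed b, l)"
        using rs rt s unfolding P_def by auto
      obtain \<eta>2 where 2: "\<eta>2 > 0" "\<And>a b. near (p s) \<eta>2 a \<Longrightarrow> near (p t) \<eta>2 b \<Longrightarrow> valid_gauged (placed a) l \<Longrightarrow>
          valid_gauged (placed b) l \<Longrightarrow> step\<^sup>*\<^sup>* (placed a, l) (placed b, l)"
        using st rt s unfolding P_def by auto
      \<comment> \<open>The pieces are glued at a valid placement near \<open>p s\<close>, which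
        exists by \<open>valid_dense\<close> within both tolerances.\<close>
      obtain q where q: "near (p s) (min \<eta>1 \<eta>2) q" "valid_gauged (placed q) l"
        by (rule valid_dense[OF fx[OF s] pd[OF s], of "min \<eta>1 \<eta>2"]) (use 1(1) 2(1) in auto)
      have qn: "near (p s) \<eta>1 q" "near (p s) \<eta>2 q" using near_mono[OF q(1)] by simp_all
      show "\<exists>\<eta>>0. \<forall>a b. near (p r) \<eta> a \<and> near (p t) \<eta> b \<and> valid_gauged (placed a) l \<and> valid_gauged (placed b) l \<longrightarrow>
          step\<^sup>*\<^sup>* (placed a, l) (placed b, l)"
      proof (intro exI[of _ "min \<eta>1 \<eta>2"] conjI allI impI; (elim conjE)?)
        fix a b assume ab: "near (p r) (min \<eta>1 \<eta>2) a" "near (p t) (min \<eta>1 \<eta>2) b"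
          "valid_gauged (placed a) l" "valid_gauged (placed b) l"
        have "near (p r) \<eta>1 a" "near (p t) \<eta>2 b" using near_mono ab by (meson min.cobounded1 min.cobounded2)+
        then show "step\<^sup>*\<^sup>* (placed a, l) (placed b, l)"
          using 1(2)[OF _ qn(1) ab(3) q(2)] 2(2)[OF qn(2) _ q(2) ab(4)] by (meson rtranclp_trans)
      qed (use 1(1) 2(1) in simp)
    qed
  next
    \<comment> \<open>Placements within \<open>\<delta> / 2\<close> of \<open>p s\<close> are within
      \<open>\<delta>\<close> of \<open>p x\<close> as soon as \<open>p s\<close> is within
      \<open>\<delta> / 2\<close> of it, which continuity grants for \<open>s\<close> close to
      \<open>x\<close>.\<close>
    fix x :: real assume "0 \<le> x" "x \<le> 1"
    then have x: "x \<in> {0..1}" by simp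
    obtain \<delta> where \<delta>: "\<delta> > 0" "\<And>y. near (p x) \<delta> y \<Longrightarrow> plane_drawing (placed y)"
      using plane_drawing_stable[OF fx[OF x] pd[OF x]] by blast
    have "\<forall>\<^sub>F s in at x within {0..1}. \<forall>u\<in>internals N. dist (p s (Internal u)) (p x (Internal u)) < \<delta> / 2"
    proof (intro eventually_ball_finite[OF finite_internals] ballI)
      fix u
      have "((\<lambda>t. p t (Internal u)) \<longlongrightarrow> p x (Internal u)) (at x within {0..1})"
        using cont[of "Internal u"] x by (simp add: continuous_on_def)
      then show "\<forall>\<^sub>F s in at x within {0..1}. dist (p s (Internal u)) (p x (Internal u)) < \<delta> / 2"
        by (rule tendstoD) (use \<delta>(1) in simp)
    qed
    then obtain d where d: "d > 0" "\<And>s u. s \<in> {0..1} \<Longrightarrow> s \<noteq> x \<Longrightarrow> dist s x < d \<Longrightarrow> u \<in> internals N \<Longrightarrow>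
        dist (p s (Internal u)) (p x (Internal u)) < \<delta> / 2"
      unfolding eventually_at by blast
    have near_x: "near (p x) \<delta> y" if y: "near (p s) (\<delta> / 2) y" and s: "s \<in> {0..1}" "dist s x < d" for s y
    proof -
      have "dist (y (Internal u)) (p x (Internal u)) < \<delta>" if u: "u \<in> internals N" for u
      proof -
        have "dist (p s (Internal u)) (p x (Internal u)) < \<delta> / 2"
          using d(2)[OF s(1) _ s(2) u] \<delta>(1) by (cases "s = x") auto
        moreover have "dist (y (Internal u)) (p s (Internal u)) < \<delta> / 2" using y u by (simp add: near_def)
        ultimately show ?thesis
          using dist_triangle[of "y (Internal u)" "p x (Internal u)" "p s (Internal u)"] by linarith
      qed
      then show ?thesis using y by (simp add: near_def)
    qed
    show "\<exists>d>0. \<forall>s t. s \<le> x \<and> x \<le> t \<and> t - s < d \<longrightarrow> P s t"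
    proof (intro exI[of _ d] conjI allI impI d(1); (elim conjE)?)
      fix s t assume st: "s \<le> x" "x \<le> t" "t - s < d"
      show "P s t"
        unfolding P_def
      proof (intro impI exI[of _ "\<delta> / 2"] conjI allI; (elim conjE)?)
        fix a b assume r: "0 \<le> s" "t \<le> 1" and n: "near (p s) (\<delta> / 2) a" "near (p t) (\<delta> / 2) b"
          and v: "valid_gauged (placed a) l" "valid_gauged (placed b) l"
        have "near (p x) \<delta> a" by (rule near_x[OF n(1)]) (use r st in \<open>auto simp: dist_real_def\<close>)
        moreover have "near (p x) \<delta> b" by (rule near_x[OF n(2)]) (use r st in \<open>auto simp: dist_real_def\<close>)
        ultimately show "step\<^sup>*\<^sup>* (placed a, l) (placed b, l)"
          using local_steps[OF fx[OF x] \<delta>] v by blast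
      qed (use \<delta>(1) in simp)
    qed
  qed simp
  then obtain \<eta> where \<eta>: "\<eta> > 0" "\<And>a b. near (p 0) \<eta> a \<Longrightarrow> near (p 1) \<eta> b \<Longrightarrow> valid_gauged (placed a) l \<Longrightarrow>
      valid_gauged (placed b) l \<Longrightarrow> step\<^sup>*\<^sup>* (placed a, l) (placed b, l)"
    unfolding P_def by auto
  have n: "near (p t) \<eta> (p t)" if "t \<in> {0..1}" for t using fx[OF that] \<eta>(1) by (simp add: near_def)
  then have "step\<^sup>*\<^sup>* (placed (p 0), l) (placed (p 1), l)"
    using \<eta>(2)[OF n[of 0] n[of 1]] val valid by (simp add: p0)
  then show ?thesis by (simp add: p0)
qed

end

section \<open>Gauge equivalence\<close>

lemma change_steps:
  assumes "change S T" shows "step\<^sup>*\<^sup>* S T"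
proof -
  obtain N l N' l' where ST: "S = (N, l)" "T = (N', l')" by fastforce
  have v: "valid_gauged N l" "valid_gauged N' l'"
    and c: "orientation_change N N' \<and> l' = l \<or> N' = N \<or> position_change N N' \<and> l' = l"
    using assms by (simp_all add: ST)
  from c consider (orientation) D where "D \<subseteq> arcs N" "N' = reverse_arcs D N" "l' = l" | (ray) "N' = N"
    | (position) p where "l' = l" "p 0 = pos N" "N' = N\<lparr>pos := p 1\<rparr>"
      "\<And>v. continuous_on {0..1} (\<lambda>t::real. p t v)"
      "\<And>t v. t \<in> {0..1} \<Longrightarrow> v \<notin> Internal ` internals N \<Longrightarrow> p t v = pos N v"
      "\<And>t. t \<in> {0..1} \<Longrightarrow> plane_drawing (N\<lparr>pos := p t\<rparr>)"
    unfolding orientation_change_def position_change_def by blast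
  then show ?thesis
  proof cases
    case orientation
    then show ?thesis using orientation_change_steps[of N l D] v ST by simp
  next
    case ray
    then have "step (N, l) (N, l')" using elementary.ray_rotation v unfolding step_def by blast
    then show ?thesis using ray ST by simp
  next
    case position
    interpret positions N l using v(1) by unfold_locales
    have "step\<^sup>*\<^sup>* (N, l) (N\<lparr>pos := p 1\<rparr>, l)"
      by (rule continuous_change_steps) (use position v(2) in \<open>auto simp: fixed_def\<close>)
    then show ?thesis using position ST by simp
  qed
qed

lemma steps_composed: "step\<^sup>*\<^sup>* S T \<Longrightarrow> \<exists>\<eta>. composed S \<eta> T"
  by (induction rule: rtranclp_induct) (auto simp: step_def intro: composed.intros)

lemma elementary_same_graph:
  assumes "elementary (N, l) \<zeta> (N', l')"
  shows "internals N' = internals N" "edges N' = edges N"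
proof -
  have rev: "edges (reverse_arcs D N) = edges N" if "D \<subseteq> arcs N" for D
  proof -
    have "ends ` (D\<inverse>) = ends ` D" by (force simp: ends_def image_iff)
    then show ?thesis using that by (auto simp: edges_def reverse_arcs_def image_Un)
  qed
  show "internals N' = internals N" "edges N' = edges N"
    using assms rev
    by (cases; auto simp: reverse_arcs_def move_def edges_def source_sink_path_def simple_cycle_def)+
qed

lemma elementary_gauge_transforms:
  assumes "elementary (N, l) \<zeta> (N', l')"
  shows "gauge_transforms N \<zeta> (geom_signature N l) (geom_signature N' l')"
  using assms
  by cases (simp_all add: path_reversal_gauge cycle_reversal_gauge ray_rotation_gauge vertex_move_gauge)

lemma gauge_transforms_zero: "gauge_transforms N (\<lambda>_. 0) \<epsilon> \<epsilon>"
  by (simp add: gauge_transforms_def)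

lemma cong_2_iff: "[x = y] (mod 2) \<longleftrightarrow> (even x \<longleftrightarrow> even y)" for x y :: int
  unfolding cong_def by presburger

lemma gauge_transforms_trans:
  assumes "gauge_transforms N \<eta> \<epsilon>1 \<epsilon>2" "gauge_transforms N \<zeta> \<epsilon>2 \<epsilon>3"
  shows "gauge_transforms N (\<lambda>u. (\<eta> u + \<zeta> u) mod 2) \<epsilon>1 \<epsilon>3"
proof -
  have "(a + c) mod 2 \<in> {0, 1}" for a c :: int by auto
  then show ?thesis using assms unfolding gauge_transforms_def cong_2_iff by auto
qed

text \<open>Modulo two a gauge transformation is its own inverse, so the same \<open>\<eta>\<close>
  works.\<close>

lemma gauge_transforms_sym:
  assumes "gauge_transforms N \<eta> \<epsilon> \<epsilon>'" shows "gauge_transforms N \<eta> \<epsilon>' \<epsilon>"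
  using assms unfolding gauge_transforms_def cong_2_iff by auto

lemma gauge_transforms_same_graph:
  "internals N' = internals N \<Longrightarrow> edges N' = edges N \<Longrightarrow> gauge_transforms N' = gauge_transforms N"
  by (simp add: gauge_transforms_def fun_eq_iff)

lemma composed_gauge_transforms:
  assumes "composed S \<eta> T"
  shows "internals (fst T) = internals (fst S) \<and> edges (fst T) = edges (fst S) \<and>
    gauge_transforms (fst S) \<eta> (geom_signature (fst S) (snd S)) (geom_signature (fst T) (snd T))"
  using assms
proof induction
  case (refl S)
  then show ?case by (simp add: gauge_transforms_zero)
next
  case (step S \<eta> T \<zeta> R)
  obtain N l N' l' where TR: "T = (N, l)" "R = (N', l')" by fastforce
  have e: "elementary (N, l) \<zeta> (N', l')" using step.hyps TR by simp
  have "gauge_transforms (fst S) \<zeta> (geom_signature N l) (geom_signature N' l')"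
    using elementary_gauge_transforms[OF e] step.IH gauge_transforms_same_graph[of N "fst S"] TR by simp
  then show ?case
    using step.IH elementary_same_graph[OF e] gauge_transforms_trans TR by auto
qed

theorem mainTheorem4:
  fixes N N' :: "'v network" and l l' :: complex
  assumes "valid_gauged N l" and "valid_gauged N' l'"
    and "same_point N N'"
    and "change\<^sup>*\<^sup>* (N, l) (N', l')"
  shows "(\<forall>\<epsilon> \<epsilon>'. is_geometric_signature N l \<epsilon> \<and> is_geometric_signature N' l' \<epsilon>' \<longrightarrow>
            gauge_equivalent N \<epsilon> \<epsilon>')
       \<and> (\<exists>\<eta>. composed (N, l) \<eta> (N', l') \<and>
            gauge_transforms N \<eta> (geom_signature N l) (geom_signature N' l'))
       \<and> (\<forall>M m M' m' \<zeta>. elementary (M :: 'v network, m) \<zeta> (M', m') \<longrightarrow>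
            gauge_transforms M \<zeta> (geom_signature M m) (geom_signature M' m'))"
proof -
  have "step\<^sup>*\<^sup>* (N, l) (N', l')"
    using assms(4)
  proof (induction rule: rtranclp_induct)
    case (step S T)
    show ?case by (rule rtranclp_trans[OF step.IH change_steps[OF step.hyps(2)]])
  qed simp
  then obtain \<eta> where c: "composed (N, l) \<eta> (N', l')" using steps_composed by blast
  note g = composed_gauge_transforms[OF c]
  have "gauge_equivalent N \<epsilon> \<epsilon>'" if \<epsilon>: "is_geometric_signature N l \<epsilon>" "is_geometric_signature N' l' \<epsilon>'" for \<epsilon> \<epsilon>'
  proof -
    obtain \<zeta> \<zeta>' where z: "gauge_transforms N \<zeta> (geom_signature N l) \<epsilon>" "gauge_transforms N' \<zeta>' (geom_signature N' l') \<epsilon>'"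
      using \<epsilon> unfolding is_geometric_signature_def gauge_equivalent_def by blast
    have "gauge_transforms N \<zeta>' (geom_signature N' l') \<epsilon>'" "gauge_transforms N \<eta> (geom_signature N l) (geom_signature N' l')"
      using z(2) gauge_transforms_same_graph[of N' N] g by simp_all
    \<comment> \<open>Back from \<open>\<epsilon>\<close> to the signature of \<open>N\<close>,
      along \<open>\<eta>\<close> to that of \<open>N'\<close>, and on to
      \<open>\<epsilon>'\<close>.\<close>
    from gauge_transforms_trans[OF gauge_transforms_trans[OF gauge_transforms_sym[OF z(1)] this(2)] this(1)]
    show ?thesis unfolding gauge_equivalent_def by blast
  qed
  then show ?thesis using c g elementary_gauge_transforms by auto
qed

end
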